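(* Let $p$ be an odd prime and let $\mathfrak R$ be a set of representatives of the orbits of $\mathfrak g=\mathrm{GL}(2,\mathbb F_p)$ acting on $\tilde{\mathfrak F}(\mathbb F_p)$. Then every nilpotent Chernikov $p$-group whose top is an elementary abelian $p$-group and whose bottom is $M^{(2)}$ (a direct sum of two quasi-cyclic $p$-groups) is isomorphic to $G(\rho)=G(\tilde{\mathfrak A}^\rho)$ for a uniquely determined $\rho\in\mathfrak R$.
   Context: A Chernikov $p$-group is an extension of a finite direct sum of quasi-cyclic $p$-groups (bottom) by a finite $p$-group (top). Fix generators $a_1,a_2$ of $\{a\in M^{(2)}:pa=0\}\cong\mathbb F_p^2$. For a pair $\mathbf A=(A_1,A_2)$ of $m\times m$ skew-symmetric matrices over $\mathbb F_p$, $A_k=(t^{(k)}_{ij})$, $G(\mathbf A)$ is the additively written group generated by $M^{(2)}$ and $\bar h_1,\dots,\bar h_m$ with relations $\bar h_i+a=a+\bar h_i$ ($a\in M^{(2)}$), $p\bar h_i=0$, $[\bar h_i,\bar h_j]=t^{(1)}_{ij}a_1+t^{(2)}_{ij}a_2$, where $[u,v]=u+v-u-v$. Direct sums of pairs are blockwise. For a pair $R=(R_1,R_2)$ of $r\times s$ matrices, $R^+=\left(\begin{pmatrix}0&R_i\\-R_i^\top&0\end{pmatrix}\right)_{i=1,2}$. Pairs: $R_f=(I_d,F(f))$ for $f\in\mathbb F_p[x]$ monic of degree $d$, $F(f)$ its companion matrix; $R_{\infty,d}=(F(x^d),I_d)$; $R_{-,d}=((I_{d-1}\mid0),(0\mid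 I_{d-1}))$ ($(d-1)\times d$ matrices). $\mathcal P$ is the set of irreducible homogeneous polynomials $g\in\mathbb F_p[x_1,x_2]$ that are unital ($g=x_2$ or leading coefficient in $x_1$ equal to $1$), $\tilde{\mathcal P}=\mathcal P\cup\{\varepsilon\}$. For $Q=(q_{ij})\in\mathfrak g$ and $g\in\mathcal P$, $Q*g$ is the unique $g'\in\mathcal P$ with $g(q_{11}x_1+q_{12}x_2,q_{21}x_1+q_{22}x_2)=\lambda g'$, $\lambda\ne0$; $Q*\varepsilon=\varepsilon$. $\tilde{\mathfrak F}(\mathbb F_p)$ is the set of finitely supported functions $\rho:\tilde{\mathcal P}\times\mathbb N\to\mathbb Z_{\ge0}$, with $\mathfrak g$-action $(\rho*Q)(g,d)=\rho(Q*g,d)$. $R(g,d)=R^+_{-,d}$ if $g=\varepsilon$, $R^+_{\infty,d}$ if $g=x_2$, $R^+_{g(x,1)^d}$ otherwise, and $\tilde{\mathfrak A}^\rho=\bigoplus_{(g,d)}R(g,d)^{\rho(g,d)}$. *)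

theory Defs
  imports "Berlekamp_Zassenhaus.Finite_Field"
    "HOL-Algebra.Coset" "HOL-Algebra.Generated_Groups"
    "HOL-Computational_Algebra.Polynomial"
begin

fun lower_central :: "('a, 'b) monoid_scheme \<Rightarrow> nat \<Rightarrow> 'a set" where
  "lower_central G 0 = carrier G"
| "lower_central G (Suc n) =
     generate G {x \<otimes>\<^bsub>G\<^esub> y \<otimes>\<^bsub>G\<^esub> inv\<^bsub>G\<^esub> x \<otimes>\<^bsub>G\<^esub> inv\<^bsub>G\<^esub> y
                 | x y. x \<in> lower_central G n \<and> y \<in> carrier G}"

definition nilpotent_group :: "('a, 'b) monoid_scheme \<Rightarrow> bool" where
  "nilpotent_group G \<longleftrightarrow> group G \<and> (\<exists>n. lower_central G n = {\<one>\<^bsub>G\<^esub>})"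

text \<open>The quasi-cyclic p-group Z(p^infinity), realised as the rationals in [0,1)
  with p-power denominator under addition modulo 1.\<close>
definition prufer :: "nat \<Rightarrow> rat set" where
  "prufer p = {q. 0 \<le> q \<and> q < 1 \<and> (\<exists>k::nat. q * of_nat (p ^ k) \<in> \<int>)}"

definition M2 :: "nat \<Rightarrow> (rat \<times> rat) monoid" where
  "M2 p = \<lparr> carrier = prufer p \<times> prufer p,
            monoid.mult = (\<lambda>(a, b) (c, d). (frac (a + c), frac (b + d))),
            one = (0, 0) \<rparr>"

text \<open>A (nilpotent or not) Chernikov p-group whose bottom is M^(2) and whose top is
  a finite elementary abelian p-group: an extension of (a group isomorphic to) M^(2)
  by a finite elementary abelian p-group.  (A normal divisible abelian subgroup of
  finite index in a Chernikov group is necessarily its bottom.)\<close>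
definition chernikov_M2_elem_top :: "('a, 'b) monoid_scheme \<Rightarrow> nat \<Rightarrow> bool" where
  "chernikov_M2_elem_top G p \<longleftrightarrow> group G \<and>
     (\<exists>N. N \<lhd> G \<and> G\<lparr>carrier := N\<rparr> \<cong> M2 p \<and>
          finite (carrier (G Mod N)) \<and> comm_group (G Mod N) \<and>
          (\<forall>X \<in> carrier (G Mod N). X [^]\<^bsub>G Mod N\<^esub> p = \<one>\<^bsub>G Mod N\<^esub>))"

text \<open>Generators h_i are indexed by an arbitrary finite index set I (for an m x m pair
  take I = {0..<m}); a pair of skew-symmetric matrices is a pair of functions I x I -> F_p.
  G(A) is realised by its normal form: elements (m, x) with m in M^(2) and x in F_p^I,
  with product (m,x)(m',y) = (m + m' + c(x,y), x + y), where
  c(x,y) = (1/2) x^T A_1 y a_1 + (1/2) x^T A_2 y a_2, a_1 = (1/p,0), a_2 = (0,1/p).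
  This is the group presented by M^(2), h_i with the relations of the paper:
  h_i central over M^(2), p h_i = 0, [h_i,h_j] = t1_ij a_1 + t2_ij a_2.\<close>

definition coc :: "'i set \<Rightarrow> ('i \<Rightarrow> 'i \<Rightarrow> 'p::prime_card mod_ring)
     \<Rightarrow> ('i \<Rightarrow> 'p mod_ring) \<Rightarrow> ('i \<Rightarrow> 'p mod_ring) \<Rightarrow> rat" where
  "coc I A x y = of_int (to_int_mod_ring (inverse 2 * (\<Sum>i\<in>I. \<Sum>j\<in>I. x i * A i j * y j)))
                   / of_nat CARD('p)"

definition GA :: "'i set \<Rightarrow> ('i \<Rightarrow> 'i \<Rightarrow> 'p::prime_card mod_ring)
     \<Rightarrow> ('i \<Rightarrow> 'i \<Rightarrow> 'p mod_ring) \<Rightarrow> ((rat \<times> rat) \<times> ('i \<Rightarrow> 'p mod_ring)) monoid" where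
  "GA I A1 A2 = \<lparr> carrier = {((u1, u2), x). u1 \<in> prufer CARD('p) \<and> u2 \<in> prufer CARD('p)
                                         \<and> (\<forall>i. i \<notin> I \<longrightarrow> x i = 0)},
       monoid.mult = (\<lambda>((u1, u2), x) ((v1, v2), y).
                 ((frac (u1 + v1 + coc I A1 x y), frac (u2 + v2 + coc I A2 x y)),
                  (\<lambda>i. x i + y i))),
       one = ((0, 0), (\<lambda>i. 0)) \<rparr>"

text \<open>A homogeneous polynomial g in F[x1,x2] of degree d is represented by the pair
  (d, g(x,1)); g(x1,x2) = sum_i (coeff (g(x,1)) i) x1^i x2^(d-i).\<close>
type_synonym 'k bform = "nat \<times> 'k poly"

definition bform_wf :: "'k::zero bform \<Rightarrow> bool" where
  "bform_wf g \<longleftrightarrow> degree (snd g) \<le> fst g"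

definition bform_mult :: "'k::comm_semiring_1 bform \<Rightarrow> 'k bform \<Rightarrow> 'k bform" where
  "bform_mult g h = (fst g + fst h, snd g * snd h)"

text \<open>Irreducible homogeneous polynomial: nonzero, non-constant and not a product of two
  non-units; units of F[x1,x2] are the nonzero constants and factors of a homogeneous
  polynomial are homogeneous, so non-units here are forms of positive degree.\<close>
definition bform_irreducible :: "'k::field bform \<Rightarrow> bool" where
  "bform_irreducible g \<longleftrightarrow> bform_wf g \<and> snd g \<noteq> 0 \<and> fst g \<ge> 1 \<and>
     \<not> (\<exists>h k. bform_wf h \<and> bform_wf k \<and> fst h \<ge> 1 \<and> fst k \<ge> 1 \<and> g = bform_mult h k)"

text \<open>Unital: g = x2, i.e. (1, 1), or the coefficient of x1^(deg g) equals 1.\<close>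
definition bform_unital :: "'k::field bform \<Rightarrow> bool" where
  "bform_unital g \<longleftrightarrow> g = (1, 1) \<or> coeff (snd g) (fst g) = 1"

definition Pset :: "'k::field bform set" where
  "Pset = {g. bform_irreducible g \<and> bform_unital g}"

type_synonym 'k mat2 = "'k \<times> 'k \<times> 'k \<times> 'k"

definition GL2 :: "'k::field mat2 set" where
  "GL2 = {(q11, q12, q21, q22). q11 * q22 - q12 * q21 \<noteq> 0}"

text \<open>g(q11 x1 + q12 x2, q21 x1 + q22 x2).\<close>
definition bform_subst :: "'k::field mat2 \<Rightarrow> 'k bform \<Rightarrow> 'k bform" where
  "bform_subst Q g = (case Q of (q11, q12, q21, q22) \<Rightarrow>
     (fst g, \<Sum>i\<le>fst g. smult (coeff (snd g) i) ([:q12, q11:] ^ i * [:q22, q21:] ^ (fst g - i))))"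

definition bform_smult :: "'k::field \<Rightarrow> 'k bform \<Rightarrow> 'k bform" where
  "bform_smult c g = (fst g, smult c (snd g))"

definition act_P :: "'k::field mat2 \<Rightarrow> 'k bform \<Rightarrow> 'k bform" where
  "act_P Q g = (THE g'. g' \<in> Pset \<and> (\<exists>c. c \<noteq> 0 \<and> bform_subst Q g = bform_smult c g'))"

text \<open>P~ = P u {epsilon} is represented by 'k bform option, None = epsilon.
  F~(F_p): finitely supported functions P~ x N -> Z>=0, with N = {1,2,...};
  they are extended by 0 outside P~ x N.\<close>
definition Ftilde :: "('k::field bform option \<Rightarrow> nat \<Rightarrow> nat) set" where
  "Ftilde = {\<rho>. finite {(g, d). \<rho> g d \<noteq> 0} \<and> (\<forall>g. \<rho> g 0 = 0) \<and>
                 (\<forall>g d. g \<notin> Pset \<longrightarrow> \<rho> (Some g) d = 0)}"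

definition act_F :: "('k::field bform option \<Rightarrow> nat \<Rightarrow> nat) \<Rightarrow> 'k mat2
     \<Rightarrow> ('k bform option \<Rightarrow> nat \<Rightarrow> nat)" where
  "act_F \<rho> Q = (\<lambda>og d. case og of None \<Rightarrow> \<rho> None d
                 | Some g \<Rightarrow> (if g \<in> Pset then \<rho> (Some (act_P Q g)) d else 0))"

definition same_orbit :: "('k::field bform option \<Rightarrow> nat \<Rightarrow> nat)
     \<Rightarrow> ('k bform option \<Rightarrow> nat \<Rightarrow> nat) \<Rightarrow> bool" where
  "same_orbit \<rho> \<sigma> \<longleftrightarrow> (\<exists>Q \<in> GL2. \<sigma> = act_F \<rho> Q)"

definition idm :: "nat \<Rightarrow> nat \<Rightarrow> 'k::field" where
  "idm i j = (if i = j then 1 else 0)"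

definition companion :: "'k::field poly \<Rightarrow> nat \<Rightarrow> nat \<Rightarrow> 'k" where
  "companion f i j = (if i = Suc j then 1
                      else if j = degree f - 1 then - coeff f i else 0)"

definition plus_mat :: "nat \<Rightarrow> (nat \<Rightarrow> nat \<Rightarrow> 'k::field) \<Rightarrow> nat \<Rightarrow> nat \<Rightarrow> 'k" where
  "plus_mat r B i j = (if i < r \<and> r \<le> j then B i (j - r)
                       else if r \<le> i \<and> j < r then - B j (i - r) else 0)"

definition Rrows :: "'k::field bform option \<Rightarrow> nat \<Rightarrow> nat" where
  "Rrows og d = (case og of None \<Rightarrow> d - 1
                 | Some g \<Rightarrow> if g = (1, 1) then d else d * fst g)"

definition Rsize :: "'k::field bform option \<Rightarrow> nat \<Rightarrow> nat" where
  "Rsize og d = (case og of None \<Rightarrow> 2 * d - 1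
                 | Some g \<Rightarrow> if g = (1, 1) then 2 * d else 2 * d * fst g)"

text \<open>The k-th component (k = 1, 2) of the underlying pair R:
  R_(-,d) for epsilon, R_(infinity,d) for x2, R_(g(x,1)^d) otherwise.\<close>
definition Rbase :: "nat \<Rightarrow> 'k::field bform option \<Rightarrow> nat \<Rightarrow> nat \<Rightarrow> nat \<Rightarrow> 'k" where
  "Rbase k og d = (case og of
       None \<Rightarrow> (if k = 1 then (\<lambda>i j. if j = i then 1 else 0)
                          else (\<lambda>i j. if j = i + 1 then 1 else 0))
     | Some g \<Rightarrow> (if g = (1, 1)
                  then (if k = 1 then companion (monom 1 d) else idm)
                  else (if k = 1 then idm else companion (snd g ^ d))))"

definition Rmat :: "nat \<Rightarrow> 'k::field bform option \<Rightarrow> nat \<Rightarrow> nat \<Rightarrow> nat \<Rightarrow> 'k" where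
  "Rmat k og d = plus_mat (Rrows og d) (Rbase k og d)"

text \<open>A~^rho = direct sum of R(g,d)^rho(g,d): block diagonal, with basis indexed by
  ((g,d), copy number c < rho(g,d), position i < size of R(g,d)).\<close>
definition Arho_index :: "('k::field bform option \<Rightarrow> nat \<Rightarrow> nat)
     \<Rightarrow> (('k bform option \<times> nat) \<times> nat \<times> nat) set" where
  "Arho_index \<rho> = {((g, d), c, i). c < \<rho> g d \<and> i < Rsize g d}"

definition Arho :: "nat \<Rightarrow> ('k::field bform option \<Rightarrow> nat \<Rightarrow> nat)
     \<Rightarrow> (('k bform option \<times> nat) \<times> nat \<times> nat) \<Rightarrow> (('k bform option \<times> nat) \<times> nat \<times> nat) \<Rightarrow> 'k" where
  "Arho k \<rho> = (\<lambda>((g, d), c, i) ((g', d'), c', j).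
      if (g, d, c) = (g', d', c') then Rmat k g d i j else 0)"

definition Grho :: "('p::prime_card mod_ring bform option \<Rightarrow> nat \<Rightarrow> nat)
     \<Rightarrow> ((rat \<times> rat) \<times> ((('p mod_ring bform option \<times> nat) \<times> nat \<times> nat) \<Rightarrow> 'p mod_ring)) monoid" where
  "Grho \<rho> = GA (Arho_index \<rho>) (Arho 1 \<rho>) (Arho 2 \<rho>)"

end

theory Submission
  imports Defs "HOL-Library.Function_Algebras" "HOL-Computational_Algebra.Formal_Power_Series" "HOL-Computational_Algebra.Polynomial_Factorial"
begin

text \<open>Nilpotency and divisibility of the bottom force it to be central.  The group G then has
  class two, and Baer's correction x y [y,x]^((p+1)/2) of the product turns it into an abelian
  group in which the bottom has a complement; so G is G(A), where A is the pair of alternating forms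
  given by the commutator.  An isomorphism between two such groups preserves the bottom and its
  p-torsion F_p^2, hence amounts to a congruence of the pairs up to GL(2).

  Pairs are brought to canonical form by splitting off, in this order, a shortest singular chain
  (a block for epsilon), a maximal chain at infinity (a block for x2), and a cyclic submodule of
  T = a^(-1) b (a block for g^d).  The multiplicities are recovered by counting the polynomial
  vectors v of bounded degree for which (x A - B) v is a constant vector times a power of a given
  form.  Substituting Q in the pencil transforms that form, and this makes the action of GL(2) on
  the multiplicities visible.\<close>

subsection \<open>Pairs of alternating forms\<close>

text \<open>A singular chain, a chain at infinity or a cyclic submodule pairs trivially with itself,
  so it can be split off only together with a dual partner. The partner comes from a linear
  alternative: if none exists, the functional that it should not annihilate is a combination of the
  equations that define it, and the coefficients of this combination assemble into vectors that give
  a shorter singular chain, a longer chain at infinity or a vector of larger exponent. Extremality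
  of the first half excludes this. All counts are powers of the field size. Their exponents are
  piecewise linear in one parameter, with a kink where the parameter equals the size d of a block,
  so second differences isolate single multiplicities. That a substitution moves the block of (g, d)
  to that of the transformed form is not shown by a base change. The transformed pair is classified
  afresh, and the counts identify the result; the same invariants thus serve both directions of the
  orbit statement. The prime 2 is excluded by the factor 1/2 in the cocycle, by the square root of
  commutators, and because skew-symmetric forms must be alternating.\<close>

lemma functional_in_span:
  fixes f :: "'s \<Rightarrow> 'u \<Rightarrow> 'k::field" and F :: "'u \<Rightarrow> 'k"
  assumes "finite S"
    and "\<And>u c v. u \<in> U \<Longrightarrow> v \<in> U \<Longrightarrow> sub u c v \<in> U"
    and "\<And>s u c v. s \<in> S \<Longrightarrow> u \<in> U \<Longrightarrow> v \<in> U \<Longrightarrow> f s (sub u c v) = f s u - c * f s v"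
    and "\<And>u c v. u \<in> U \<Longrightarrow> v \<in> U \<Longrightarrow> F (sub u c v) = F u - c * F v"
    and "\<And>u. u \<in> U \<Longrightarrow> (\<forall>s\<in>S. f s u = 0) \<Longrightarrow> F u = 0"
  shows "\<exists>c. \<forall>u\<in>U. F u = (\<Sum>s\<in>S. c s * f s u)"
  using assms
proof (induction S arbitrary: U rule: finite_induct)
  case empty
  then show ?case by simp
next
  case (insert t S)
  \<comment> \<open>Restricting to the kernel of \<open>f t\<close> removes one functional. The
    operation \<open>sub\<close>, which stands for u - c v, is kept abstract so that the lemma
    covers single vectors and families of vectors alike.\<close>
  define U' where "U' = {u\<in>U. f t u = 0}"
  have "\<exists>c. \<forall>u\<in>U'. F u = (\<Sum>s\<in>S. c s * f s u)"
    by (rule insert.IH) (use insert.prems in \<open>auto simp: U'_def\<close>)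
  then obtain c where c: "\<And>u. u \<in> U' \<Longrightarrow> F u = (\<Sum>s\<in>S. c s * f s u)" by blast
  show ?case
  proof (cases "\<exists>v\<in>U. f t v \<noteq> 0")
    case True
    then obtain v where v: "v \<in> U" "f t v \<noteq> 0" by blast
    \<comment> \<open>This value makes both sides agree at v, the one direction missing from the
      kernel of \<open>f t\<close>.\<close>
    define e where "e = (F v - (\<Sum>s\<in>S. c s * f s v)) / f t v"
    have "F u = (\<Sum>s\<in>insert t S. (c(t := e)) s * f s u)" if u: "u \<in> U" for u
    proof -
      define w where "w = sub u (f t u / f t v) v"
      have "w \<in> U'" using insert.prems v u by (auto simp: U'_def w_def)
      hence "F w = (\<Sum>s\<in>S. c s * f s w)" by (rule c)
      moreover have "F w = F u - f t u / f t v * F v"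
        unfolding w_def by (rule insert.prems(3)) (use u v in auto)
      moreover have "(\<Sum>s\<in>S. c s * f s w)
          = (\<Sum>s\<in>S. c s * f s u) - f t u / f t v * (\<Sum>s\<in>S. c s * f s v)"
      proof -
        have "(\<Sum>s\<in>S. c s * f s w) = (\<Sum>s\<in>S. c s * f s u - f t u / f t v * (c s * f s v))"
          by (intro sum.cong refl) (simp add: w_def insert.prems(2) u v right_diff_distrib)
        thus ?thesis by (simp add: sum_subtractf sum_distrib_left)
      qed
      ultimately have "F u = (\<Sum>s\<in>S. c s * f s u) + e * f t u"
        using v by (simp add: e_def field_simps)
      moreover have "(\<Sum>s\<in>S. (c(t := e)) s * f s u) = (\<Sum>s\<in>S. c s * f s u)"
        using insert.hyps by (intro sum.cong) auto
      ultimately show ?thesis using insert.hyps by simp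
    qed
    then show ?thesis by blast
  next
    case False
    hence "U' = U" by (auto simp: U'_def)
    have "F u = (\<Sum>s\<in>insert t S. (c(t := 0)) s * f s u)" if u: "u \<in> U" for u
    proof -
      have "(\<Sum>s\<in>S. (c(t := 0)) s * f s u) = (\<Sum>s\<in>S. c s * f s u)"
        using insert.hyps by (intro sum.cong) auto
      thus ?thesis using c[of u] u \<open>U' = U\<close> insert.hyps by simp
    qed
    then show ?thesis by blast
  qed
qed

locale alt_form = vector_space scale
  for scale :: "'k::{field_gcd,finite} \<Rightarrow> 'v::ab_group_add \<Rightarrow> 'v" +
  fixes f :: "'v \<Rightarrow> 'v \<Rightarrow> 'k"
  assumes add_left: "f (x + y) z = f x z + f y z"
    and scale_left: "f (scale c x) z = c * f x z"
    and alt: "f x x = 0"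
    and skew: "f x y = - f y x"
begin

lemma add_right: "f z (x + y) = f z x + f z y"
  using skew[of z "x + y"] skew[of z x] skew[of z y] by (simp add: add_left)

lemma scale_right: "f z (scale c x) = c * f z x"
  using skew[of z "scale c x"] skew[of z x] by (simp add: scale_left)

lemma zero_left [simp]: "f 0 z = 0" using scale_left[of 0 0 z] by simp
lemma zero_right [simp]: "f z 0 = 0" using skew[of z 0] by simp
lemma minus_left: "f (- x) z = - f x z" using add_left[of x "-x" z] by (simp add: eq_neg_iff_add_eq_0 add.commute)
lemma minus_right: "f z (- x) = - f z x" using skew[of z "-x"] skew[of z x] by (simp add: minus_left)
lemma diff_left: "f (x - y) z = f x z - f y z" using add_left[of x "-y" z] by (simp add: minus_left)
lemma diff_right: "f z (x - y) = f z x - f z y" using add_right[of z x "-y"] by (simp add: minus_right)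

lemma sum_left: "f (\<Sum>i\<in>I. g i) z = (\<Sum>i\<in>I. f (g i) z)"
  by (induction I rule: infinite_finite_induct) (auto simp: add_left)

lemma sum_right: "f z (\<Sum>i\<in>I. g i) = (\<Sum>i\<in>I. f z (g i))"
  by (induction I rule: infinite_finite_induct) (auto simp: add_right)

end

text \<open>The space is a finite subset V of a fixed type because the recursion in
  \<open>classification\<close> passes to subspaces while the forms stay the same.\<close>

locale two_forms = A: alt_form scale a + B: alt_form scale b
  for scale :: "'k::{field_gcd,finite} \<Rightarrow> 'v::ab_group_add \<Rightarrow> 'v" and a b +
  fixes V :: "'v set"
  assumes subspace_V: "A.subspace V" and finite_V: "finite V"
begin

lemma V_0: "0 \<in> V" using subspace_V by (rule A.subspace_0)
lemma V_add: "x \<in> V \<Longrightarrow> y \<in> V \<Longrightarrow> x + y \<in> V" using subspace_V by (rule A.subspace_add)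
lemma V_scale: "x \<in> V \<Longrightarrow> scale c x \<in> V" using subspace_V by (rule A.subspace_scale)
lemma V_diff: "x \<in> V \<Longrightarrow> y \<in> V \<Longrightarrow> x - y \<in> V" using subspace_V by (rule A.subspace_diff)
lemma V_sum: "(\<And>i. i \<in> I \<Longrightarrow> g i \<in> V) \<Longrightarrow> (\<Sum>i\<in>I. g i) \<in> V" using subspace_V by (rule A.subspace_sum)

text \<open>For the vector polynomial w(x) with coefficient w_i at x^(n-1-i), these relations say
  that all coefficients of (x a - b) w(x) vanish on V except the extreme ones, given by a (w 0) and
  - b (w (n - 1)).\<close>

definition chain :: "nat \<Rightarrow> (nat \<Rightarrow> 'v) \<Rightarrow> bool" where
  "chain n w \<longleftrightarrow> (\<forall>i<n. w i \<in> V) \<and> (\<forall>i. Suc i < n \<longrightarrow> (\<forall>y\<in>V. a (w (Suc i)) y = b (w i) y))"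

lemma chain_V: "chain n w \<Longrightarrow> i < n \<Longrightarrow> w i \<in> V" by (simp add: chain_def)
lemma chain_step: "chain n w \<Longrightarrow> Suc i < n \<Longrightarrow> y \<in> V \<Longrightarrow> a (w (Suc i)) y = b (w i) y" by (simp add: chain_def)

lemma chain_shift:
  assumes "chain n v" "chain m w" "Suc i < n" "Suc j < m"
  shows "a (v (Suc i)) (w j) = a (v i) (w (Suc j))"
proof -
  have "a (v (Suc i)) (w j) = b (v i) (w j)" using assms by (intro chain_step) (auto intro: chain_V)
  also have "\<dots> = - b (w j) (v i)" by (rule B.skew)
  also have "b (w j) (v i) = a (w (Suc j)) (v i)" using assms by (intro chain_step[symmetric]) (auto intro: chain_V)
  also have "- \<dots> = a (v i) (w (Suc j))" by (rule A.skew[symmetric])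
  finally show ?thesis .
qed

text \<open>\<open>chain_shift\<close> moves the two indices towards each other until they coincide,
  where \<open>a\<close> is alternating, or are adjacent, where \<open>a (w (Suc i)) (w i)\<close>
  equals \<open>b (w i) (w i)\<close>.\<close>

lemma chain_isotropic_a_le:
  assumes "chain n w" shows "i \<le> j \<Longrightarrow> j < n \<Longrightarrow> a (w i) (w j) = 0"
proof (induction "j - i" arbitrary: i j rule: less_induct)
  case less
  consider "j = i" | "j = Suc i" | j' where "j = Suc j'" "Suc i \<le> j'"
    using less.prems by (cases j) (auto simp: le_Suc_eq, metis not_less_eq_eq le_antisym)
  then show ?case
  proof cases
    case 1 then show ?thesis by (simp add: A.alt)
  next
    case 2
    hence "a (w j) (w i) = b (w i) (w i)" using less.prems assms by (auto intro!: chain_step intro: chain_V)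
    thus ?thesis using A.skew[of "w i" "w j"] by (simp add: B.alt)
  next
    case 3
    hence "a (w i) (w j) = a (w (Suc i)) (w j')"
      using chain_shift[OF assms assms, of i j'] less.prems by auto
    also have "\<dots> = 0" using 3 less.prems by (intro less.hyps) auto
    finally show ?thesis .
  qed
qed

lemma chain_isotropic_a:
  assumes "chain n w" "i < n" "j < n" shows "a (w i) (w j) = 0"
  using chain_isotropic_a_le[OF assms(1), of i j] chain_isotropic_a_le[OF assms(1), of j i] assms
    A.skew[of "w i" "w j"] by (cases "i \<le> j") auto

lemma chain_isotropic_b:
  assumes w: "chain n w" and ij: "i < n" "j < n" shows "b (w i) (w j) = 0"
proof -
  have *: "b (w i) (w j) = 0" if "Suc i < n" "j < n" for i j
    using chain_step[OF w that(1), of "w j"] chain_isotropic_a[OF w that] chain_V[OF w that(2)] by simp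
  consider "Suc i < n" | "Suc j < n" | "i = j" using ij by linarith
  thus ?thesis using *[of i j] *[of j i] ij B.skew[of "w i" "w j"] by cases (auto simp: B.alt)
qed

lemma functional_on_V:
  fixes F :: "'v \<Rightarrow> 'k"
  assumes "finite S" "\<And>x c y. x \<in> V \<Longrightarrow> y \<in> V \<Longrightarrow> F (x - scale c y) = F x - c * F y"
    "\<And>s x c y. s \<in> S \<Longrightarrow> x \<in> V \<Longrightarrow> y \<in> V \<Longrightarrow> f s (x - scale c y) = f s x - c * f s y"
    "\<And>x. x \<in> V \<Longrightarrow> (\<forall>s\<in>S. f s x = 0) \<Longrightarrow> F x = 0"
  shows "\<exists>c. \<forall>x\<in>V. F x = (\<Sum>s\<in>S. c s * f s x)"
  by (rule functional_in_span[where sub = "\<lambda>u c v. u - scale c v"])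
     (use assms in \<open>auto intro: V_diff V_scale\<close>)

text \<open>The unknowns w_0, ..., w_(n-1) satisfy the chain equations with indices in
  \<open>K\<close>; the equation with index 0 reads a (w 0) = 0. A functional vanishing on all
  solutions is a combination of the equations, and as each equation is tested against all y in V,
  the multipliers of the i-th one add up to a single vector \<open>Y i\<close>. Evaluation at
  families supported in one index gives the adjoint system, a chain with reversed indices.\<close>

lemma fredholm:
  fixes F :: "(nat \<Rightarrow> 'v) \<Rightarrow> 'k"
  assumes K: "K \<subseteq> {..<n}"
    and lin: "\<And>u c w. F (\<lambda>i. u i - scale c (w i)) = F u - c * F w"
    and van: "\<And>w. (\<And>i. i < n \<Longrightarrow> w i \<in> V) \<Longrightarrow>
       (\<And>i y. i \<in> K \<Longrightarrow> y \<in> V \<Longrightarrow> a (w i) y = (if i = 0 then 0 else b (w (i - 1)) y)) \<Longrightarrow> F w = 0"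
  obtains Y where "\<And>i. Y i \<in> V"
    "\<And>i x. i < n \<Longrightarrow> x \<in> V \<Longrightarrow> F (\<lambda>j. if j = i then x else 0) =
       (if i \<in> K then a x (Y i) else 0) - (if Suc i \<in> K then b x (Y (Suc i)) else 0)"
proof -
  define f :: "nat \<times> 'v \<Rightarrow> (nat \<Rightarrow> 'v) \<Rightarrow> 'k" where "f = (\<lambda>(i, y) w. a (w i) y - (if i = 0 then 0 else b (w (i - 1)) y))"
  have fK: "finite K" using K finite_subset by blast
  have "\<exists>c. \<forall>w\<in>{w. \<forall>i<n. w i \<in> V}. F w = (\<Sum>s\<in>K \<times> V. c s * f s w)"
  proof (rule functional_in_span[where sub = "\<lambda>u c v i. u i - scale c (v i)"])
    show "finite (K \<times> V)" using fK finite_V by simp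
    show "F u = 0" if "u \<in> {w. \<forall>i<n. w i \<in> V}" "\<forall>s\<in>K \<times> V. f s u = 0" for u
      using that by (intro van) (auto simp: f_def)
  qed (auto simp: f_def lin A.diff_left B.diff_left A.scale_left B.scale_left algebra_simps
        intro: V_diff V_scale)
  then obtain c where c: "\<And>w. (\<forall>i<n. w i \<in> V) \<Longrightarrow> F w = (\<Sum>s\<in>K \<times> V. c s * f s w)" by blast
  define Y where "Y i = (\<Sum>y\<in>V. scale (c (i, y)) y)" for i
  have Y: "Y i \<in> V" for i unfolding Y_def by (intro V_sum V_scale)
  have eq: "F w = (\<Sum>i\<in>K. a (w i) (Y i) - (if i = 0 then 0 else b (w (i - 1)) (Y i)))"
    if "\<forall>i<n. w i \<in> V" for w
  proof -
    have "F w = (\<Sum>i\<in>K. \<Sum>y\<in>V. c (i, y) * f (i, y) w)"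
      using c[OF that] by (simp add: sum.cartesian_product)
    also have "\<dots> = (\<Sum>i\<in>K. a (w i) (Y i) - (if i = 0 then 0 else b (w (i - 1)) (Y i)))"
      by (intro sum.cong refl)
         (auto simp: f_def Y_def A.sum_right B.sum_right A.scale_right B.scale_right
           right_diff_distrib sum_subtractf)
    finally show ?thesis .
  qed
  have "F (\<lambda>j. if j = i then x else 0) =
       (if i \<in> K then a x (Y i) else 0) - (if Suc i \<in> K then b x (Y (Suc i)) else 0)"
    if "i < n" "x \<in> V" for i x
  proof -
    have "F (\<lambda>j. if j = i then x else 0) = (\<Sum>l\<in>K. (if l = i then a x (Y l) else 0)
        - (if l = Suc i then b x (Y l) else 0))"
      using that V_0 by (subst eq) (auto intro!: sum.cong)
    also have "\<dots> = (if i \<in> K then a x (Y i) else 0) - (if Suc i \<in> K then b x (Y (Suc i)) else 0)"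
      using fK by (simp add: sum_subtractf)
    finally show ?thesis .
  qed
  with Y that show ?thesis by blast
qed

text \<open>Vectors u that span a direct summand of V, orthogonal to the common kernel of the
  functionals phi, on which the two forms have the Gram matrices C and D.\<close>

definition is_block :: "nat \<Rightarrow> (nat \<Rightarrow> nat \<Rightarrow> 'k) \<Rightarrow> (nat \<Rightarrow> nat \<Rightarrow> 'k) \<Rightarrow> (nat \<Rightarrow> 'v) \<Rightarrow> (nat \<Rightarrow> 'v \<Rightarrow> 'k) \<Rightarrow> bool" where
  "is_block n C D u \<phi> \<longleftrightarrow> (\<forall>i<n. u i \<in> V) \<and>
     (\<forall>i<n. \<forall>x y c. \<phi> i (x + y) = \<phi> i x + \<phi> i y \<and> \<phi> i (scale c x) = c * \<phi> i x) \<and>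
     (\<forall>i<n. \<forall>j<n. \<phi> i (u j) = (if i = j then 1 else 0)) \<and>
     (\<forall>j<n. \<forall>y\<in>V. a (u j) y = (\<Sum>i<n. C j i * \<phi> i y) \<and> b (u j) y = (\<Sum>i<n. D j i * \<phi> i y))"

lemma plus_mat_sum:
  fixes \<phi> :: "nat \<Rightarrow> 'k"
  shows "(\<Sum>i<r + s. plus_mat r R j i * \<phi> i) =
    (if j < r then (\<Sum>l<s. R j l * \<phi> (r + l)) else - (\<Sum>i<r. R i (j - r) * \<phi> i))"
proof -
  have "(\<Sum>i<r + s. plus_mat r R j i * \<phi> i)
      = (\<Sum>i<r. plus_mat r R j i * \<phi> i) + (\<Sum>l<s. plus_mat r R j (r + l) * \<phi> (r + l))"
    by (induction s) (auto simp: algebra_simps)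
  thus ?thesis by (auto simp: plus_mat_def sum_negf)
qed

text \<open>In a block of shape R^+ the two halves x and z pair only with each other. Hence a form
  on the x-half is expressed through the functionals dual to the z-half, and conversely with
  transpose and sign.\<close>

lemma block_intro:
  assumes "\<And>i. i < r \<Longrightarrow> x i \<in> V" "\<And>i. i < s \<Longrightarrow> z i \<in> V"
    and "\<And>i x y. i < r \<Longrightarrow> \<psi> i (x + y) = \<psi> i x + \<psi> i y" "\<And>i c x. i < r \<Longrightarrow> \<psi> i (scale c x) = c * \<psi> i x"
    and "\<And>i x y. i < s \<Longrightarrow> \<chi> i (x + y) = \<chi> i x + \<chi> i y" "\<And>i c x. i < s \<Longrightarrow> \<chi> i (scale c x) = c * \<chi> i x"
    and "\<And>i j. i < r \<Longrightarrow> j < r \<Longrightarrow> \<psi> i (x j) = (if i = j then 1 else 0)"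
    and "\<And>i j. i < s \<Longrightarrow> j < s \<Longrightarrow> \<chi> i (z j) = (if i = j then 1 else 0)"
    and "\<And>i j. i < r \<Longrightarrow> j < s \<Longrightarrow> \<psi> i (z j) = 0"
    and "\<And>i j. i < s \<Longrightarrow> j < r \<Longrightarrow> \<chi> i (x j) = 0"
    and "\<And>i y. i < r \<Longrightarrow> y \<in> V \<Longrightarrow> a (x i) y = (\<Sum>j<s. R1 i j * \<chi> j y)"
    and "\<And>i y. i < r \<Longrightarrow> y \<in> V \<Longrightarrow> b (x i) y = (\<Sum>j<s. R2 i j * \<chi> j y)"
    and "\<And>j y. j < s \<Longrightarrow> y \<in> V \<Longrightarrow> a (z j) y = - (\<Sum>i<r. R1 i j * \<psi> i y)"
    and "\<And>j y. j < s \<Longrightarrow> y \<in> V \<Longrightarrow> b (z j) y = - (\<Sum>i<r. R2 i j * \<psi> i y)"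
  shows "is_block (r + s) (plus_mat r R1) (plus_mat r R2) (\<lambda>i. if i < r then x i else z (i - r))
     (\<lambda>i. if i < r then \<psi> i else \<chi> (i - r))"
  unfolding is_block_def plus_mat_sum by (auto simp: assms)

end

section \<open>Blocks for epsilon: singular chains of minimal length\<close>

context two_forms
begin

text \<open>The extreme coefficients vanish as well, so the vector polynomial is a nonzero kernel
  element of the pencil x a - b on V. The least n is Kronecker's minimal index plus one.\<close>

definition singular_chain :: "nat \<Rightarrow> (nat \<Rightarrow> 'v) \<Rightarrow> bool" where
  "singular_chain n v \<longleftrightarrow> n \<ge> 1 \<and> chain n v \<and> v 0 \<noteq> 0 \<and> (\<forall>y\<in>V. a (v 0) y = 0) \<and> (\<forall>y\<in>V. b (v (n - 1)) y = 0)"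

text \<open>Otherwise, by scaling, a (w 0) (v k) vanishes for all chains w of length k, and the
  adjoint vectors of \<open>fredholm\<close> correct v to a singular chain of length k, against
  minimality.\<close>

lemma singular_dual_chain:
  assumes v: "singular_chain (Suc k) v" and min: "\<And>n u. singular_chain n u \<Longrightarrow> k < n" and k: "k > 0"
  shows "\<exists>w. chain k w \<and> a (w 0) (v k) = 1"
proof (rule ccontr)
  assume no: "\<not> ?thesis"
  from v have ch: "chain (Suc k) v" and v0: "v 0 \<noteq> 0" "\<And>y. y \<in> V \<Longrightarrow> a (v 0) y = 0"
    and vk: "\<And>y. y \<in> V \<Longrightarrow> b (v k) y = 0" by (auto simp: singular_chain_def)
  have vV: "v i \<in> V" if "i \<le> k" for i using ch that by (auto intro: chain_V)
  have "a (w 0) (v k) = 0" if w: "chain k w" for w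
  proof (rule ccontr)
    assume nz: "a (w 0) (v k) \<noteq> 0"
    define w' where "w' i = scale (inverse (a (w 0) (v k))) (w i)" for i
    have "chain k w'" using w by (auto simp: chain_def w'_def A.scale_left B.scale_left V_scale)
    moreover have "a (w' 0) (v k) = 1" using nz by (simp add: w'_def A.scale_left)
    ultimately show False using no by blast
  qed
  note van = this
  \<comment> \<open>Without the index 0 these are exactly the equations of a chain of length k;
    nothing is asked of a (w 0).\<close>
  have K: "{1..<k} \<subseteq> {..<k}" by auto
  obtain Y where Y: "\<And>i. Y i \<in> V"
    "\<And>i x. i < k \<Longrightarrow> x \<in> V \<Longrightarrow> a ((\<lambda>j. if j = i then x else 0) 0) (v k) =
       (if i \<in> {1..<k} then a x (Y i) else 0) - (if Suc i \<in> {1..<k} then b x (Y (Suc i)) else 0)"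
  proof (rule fredholm[OF K, of "\<lambda>w. a (w 0) (v k)"])
    show "a (w 0) (v k) = 0" if "\<And>i. i < k \<Longrightarrow> w i \<in> V"
      "\<And>i y. i \<in> {1..<k} \<Longrightarrow> y \<in> V \<Longrightarrow> a (w i) y = (if i = 0 then 0 else b (w (i - 1)) y)" for w
      by (rule van) (use that(1) that(2)[of "Suc _"] in \<open>auto simp: chain_def\<close>)
  qed (use that in \<open>auto simp: A.diff_left A.scale_left\<close>)
  \<comment> \<open>Reversing the indices turns the adjoint system into a chain. For k > 1 the
    equation with index 0 says that b (Y 1) = - a (v k) = - b (v (k - 1)), so the last vector of u
    is annihilated by b, while u 0 = v 0 stays nonzero.\<close>
  define u where "u i = v i + (if i = 0 then 0 else Y (k - i))" for i
  have uV: "u i \<in> V" if "i \<le> k" for i using that Y(1) vV by (auto simp: u_def intro: V_add V_0)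
  have step: "a (u (Suc i)) y = b (u i) y" if "Suc i < k" "y \<in> V" for i y
  proof -
    have "a y (Y (k - Suc i)) = (if i = 0 then 0 else b y (Y (k - i)))"
    proof -
      have "k - Suc i < k" "k - Suc i \<in> {1..<k}" "Suc (k - Suc i) = k - i"
        "k - i \<in> {1..<k} \<longleftrightarrow> i \<noteq> 0" using that by auto
      thus ?thesis using Y(2)[of "k - Suc i" y] that by (auto split: if_splits)
    qed
    hence "a (Y (k - Suc i)) y = (if i = 0 then 0 else b (Y (k - i)) y)"
      using A.skew[of y "Y (k - Suc i)"] B.skew[of y "Y (k - i)"] by (auto split: if_splits)
    thus ?thesis using chain_step[OF ch, of i y] that by (auto simp: u_def A.add_left B.add_left)
  qed
  have last: "b (u (k - 1)) y = 0" if "y \<in> V" for y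
  proof -
    have "a y (v k) = - (if 1 < k then b y (Y 1) else 0)" using Y(2)[of 0 y] k that by simp
    hence "a (v k) y = - (if 1 < k then b (Y 1) y else 0)"
      using A.skew[of y "v k"] B.skew[of y "Y 1"] by (auto split: if_splits)
    moreover have "a (v k) y = b (v (k - 1)) y"
      using chain_step[OF ch, of "k - 1" y] that k by simp
    ultimately show ?thesis using k by (cases "k = 1") (auto simp: u_def B.add_left)
  qed
  have "singular_chain k u"
    unfolding singular_chain_def chain_def
    using k uV step last v0 by (auto simp: u_def)
  from min[OF this] show False by simp
qed

lemma dual_functional:
  assumes "v \<noteq> 0"
  shows "\<exists>\<phi>::'v \<Rightarrow> 'k. (\<forall>x y c. \<phi> (x + y) = \<phi> x + \<phi> y \<and> \<phi> (scale c x) = c * \<phi> x) \<and> \<phi> v = 1"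
proof -
  have i: "A.independent {v}" using assms by simp
  define B where "B = A.extend_basis {v}"
  have B: "A.independent B" "A.span B = UNIV" "v \<in> B"
    using A.independent_extend_basis[OF i] A.span_extend_basis[OF i] A.extend_basis_superset[OF i]
    by (auto simp: B_def)
  show ?thesis
    using A.representation_add[OF B(1)] A.representation_scale[OF B(1)] A.representation_basis[OF B(1) B(3)] B(2)
    by (intro exI[of _ "\<lambda>x. A.representation B x v"]) auto
qed

text \<open>The k vectors of the dual chain w and the k + 1 vectors of v, in reversed order, belong
  to the rows and columns of R_(-,k+1): a (w i) (v l) is 1 if i + l = k and 0 otherwise.\<close>

lemma singular_block:
  assumes "singular_chain n0 v0"
  shows "\<exists>d u \<phi>. d \<ge> 1 \<and> is_block (Rsize (None :: 'k bform option) d) (Rmat 1 None d) (Rmat 2 None d) u \<phi>"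
proof -
  define n where "n = (LEAST n. \<exists>v. singular_chain n v)"
  have "\<exists>v. singular_chain n v" unfolding n_def by (rule LeastI[of _ n0]) (use assms in blast)
  then obtain v where v: "singular_chain n v" by blast
  have min: "n \<le> m" if "singular_chain m u" for m u
    unfolding n_def by (rule Least_le) (use that in blast)
  obtain k where n: "n = Suc k" using v by (cases n) (auto simp: singular_chain_def)
  have ch: "chain (Suc k) v" and v0: "v 0 \<noteq> 0" "\<And>y. y \<in> V \<Longrightarrow> a (v 0) y = 0"
    and vk: "\<And>y. y \<in> V \<Longrightarrow> b (v k) y = 0" using v by (auto simp: singular_chain_def n)
  have vV: "v i \<in> V" if "i \<le> k" for i using ch that by (auto intro: chain_V)
  obtain w where w: "chain k w" "k > 0 \<Longrightarrow> a (w 0) (v k) = 1"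
  proof (cases "k = 0")
    case True then show ?thesis using that[of v] by (auto simp: chain_def)
  next
    case False then show ?thesis using singular_dual_chain[OF v[unfolded n]] min that by (metis Suc_le_eq n not_gr0)
  qed
  obtain \<phi>0 where \<phi>0: "\<And>x y. \<phi>0 (x + y) = \<phi>0 x + \<phi>0 y" "\<And>c x. \<phi>0 (scale c x) = c * \<phi>0 x" "\<phi>0 (v 0) = 1"
    using dual_functional[OF v0(1)] by blast
  have av0: "a y (v 0) = 0" if "y \<in> V" for y using A.skew[of y "v 0"] v0(2)[OF that] by simp
  have bvk: "b y (v k) = 0" if "y \<in> V" for y using B.skew[of y "v k"] vk[OF that] by simp
  have bv: "b y (v i) = a y (v (Suc i))" if "i < k" "y \<in> V" for y i
    using chain_step[OF ch, of i y] that A.skew[of y "v (Suc i)"] B.skew[of y "v i"] by simp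
  \<comment> \<open>Shifting lowers the index of v to 0 while w still has room, and \<open>a\<close>
    annihilates v 0.\<close>
  have aw_low: "a (w i) (v l) = 0" if "i + l < k" for i l
    using that
  proof (induction l arbitrary: i)
    case 0
    then show ?case using av0 chain_V[OF w(1)] by simp
  next
    case (Suc l)
    then show ?case using chain_shift[OF w(1) ch, of i l] by simp
  qed
  have aw: "a (w i) (v l) = (if i + l = k then 1 else 0)" if "i < k" "l \<le> k" for i l
    using that
  proof (induction i arbitrary: l)
    case 0
    then show ?case using w(2) aw_low[of 0 l] by (cases "l = k") auto
  next
    case (Suc i)
    have "a (w (Suc i)) (v l) = b (w i) (v l)" using w(1) Suc.prems vV by (auto simp: chain_def)
    then show ?case using Suc bv[of l "w i"] bvk[of "w i"] chain_V[OF w(1), of i] by (cases "l = k") auto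
  qed
  \<comment> \<open>The functionals dual to v are a (w 0) followed by the b (w i). For k = 0 the
    block is one vector of the common radical, which the forms cannot detect, and any functional
    with value 1 on it serves.\<close>
  define \<chi> where "\<chi> j = (if j = 0 then if k = 0 then \<phi>0 else a (w 0) else b (w (j - 1)))" for j
  have "is_block (k + Suc k) (plus_mat k (Rbase 1 None (Suc k))) (plus_mat k (Rbase 2 None (Suc k)))
     (\<lambda>i. if i < k then w i else v (k - (i - k))) (\<lambda>i. if i < k then \<lambda>x. a x (v (k - i)) else \<chi> (i - k))"
  proof (rule block_intro[where z = "\<lambda>j. v (k - j)" and \<psi> = "\<lambda>i x. a x (v (k - i))"])
    show "w i \<in> V" if "i < k" for i using w that by (auto intro: chain_V)
    show "v (k - i) \<in> V" for i by (rule vV) simp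
    show "\<chi> i (x + y) = \<chi> i x + \<chi> i y" for i x y by (auto simp: \<chi>_def \<phi>0 A.add_right B.add_right)
    show "\<chi> i (scale c x) = c * \<chi> i x" for i c x by (auto simp: \<chi>_def \<phi>0 A.scale_right B.scale_right)
    show "a (w j) (v (k - i)) = (if i = j then 1 else 0)" if "i < k" "j < k" for i j
      using that by (subst aw) auto
    show "\<chi> i (v (k - j)) = (if i = j then 1 else 0)" if "i < Suc k" "j < Suc k" for i j
    proof (cases i)
      case 0
      then show ?thesis using that aw[of 0 "k - j"] by (auto simp: \<chi>_def \<phi>0)
    next
      case (Suc i')
      then show ?thesis
        using that bv[of "k - j" "w i'"] aw[of i' "Suc (k - j)"] bvk[of "w i'"] chain_V[OF w(1), of i']
        by (cases "j = 0") (auto simp: \<chi>_def)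
    qed
    show "a (v (k - j)) (v (k - i)) = 0" for i j
      by (rule chain_isotropic_a[OF ch]) auto
    show "\<chi> i (w j) = 0" if "i < Suc k" "j < k" for i j
      using that chain_isotropic_a[OF w(1)] chain_isotropic_b[OF w(1)] by (auto simp: \<chi>_def)
    show "a (w i) y = (\<Sum>j<Suc k. Rbase 1 None (Suc k) i j * \<chi> j y)" if "i < k" "y \<in> V" for i y
      using that chain_step[OF w(1), of "i - 1" y]
      by (cases i) (simp_all add: Rbase_def \<chi>_def if_distrib[of "\<lambda>c. c * _"] cong: if_cong)
    show "b (w i) y = (\<Sum>j<Suc k. Rbase 2 None (Suc k) i j * \<chi> j y)" if "i < k" "y \<in> V" for i y
      using that by (simp add: Rbase_def \<chi>_def if_distrib[of "\<lambda>c. c * _"] cong: if_cong)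
    show "a (v (k - j)) y = - (\<Sum>i<k. Rbase 1 None (Suc k) i j * a y (v (k - i)))"
      if "j < Suc k" "y \<in> V" for j y
      using that v0(2)[of y] A.skew[of y "v (k - j)"]
      by (cases "j = k") (auto simp: Rbase_def if_distrib[of "\<lambda>c. c * _"] cong: if_cong)
    show "b (v (k - j)) y = - (\<Sum>i<k. Rbase 2 None (Suc k) i j * a y (v (k - i)))"
      if "j < Suc k" "y \<in> V" for j y
    proof (cases j)
      case 0
      then show ?thesis using vk[of y] that by (simp add: Rbase_def)
    next
      case (Suc j')
      then show ?thesis using bv[of "k - j" y] that B.skew[of y "v (k - j)"]
        by (simp add: Rbase_def if_distrib[of "\<lambda>c. c * _"] Suc_diff_Suc cong: if_cong)
    qed
  qed (auto simp: A.add_left A.scale_left)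
  moreover have "Rsize (None :: 'k bform option) (Suc k) = k + Suc k" by (simp add: Rsize_def)
  moreover have "Rmat l (None :: 'k bform option) (Suc k) = plus_mat k (Rbase l None (Suc k))" for l
    by (simp add: Rmat_def Rrows_def)
  ultimately have "is_block (Rsize (None :: 'k bform option) (Suc k)) (Rmat 1 None (Suc k)) (Rmat 2 None (Suc k))
     (\<lambda>i. if i < k then w i else v (k - (i - k))) (\<lambda>i. if i < k then \<lambda>x. a x (v (k - i)) else \<chi> (i - k))"
    by (simp only:)
  thus ?thesis by (intro exI[of _ "Suc k"] exI conjI) auto
qed

section \<open>Blocks for x2: maximal chains starting in the radical of the first form\<close>

definition radical_chain :: "nat \<Rightarrow> (nat \<Rightarrow> 'v) \<Rightarrow> bool" where
  "radical_chain n v \<longleftrightarrow> n \<ge> 1 \<and> chain n v \<and> v 0 \<noteq> 0 \<and> (\<forall>y\<in>V. a (v 0) y = 0)"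

text \<open>If v l = v m with l < m, then v minus its own shift by m - l is a singular chain of
  length m. So the vectors of a radical chain are distinct.\<close>

lemma radical_chain_bounded:
  assumes ns: "\<And>n v. \<not> singular_chain n v" and v: "radical_chain n v"
  shows "n \<le> card V"
proof -
  have ch: "chain n v" and v0: "v 0 \<noteq> 0" "\<And>y. y \<in> V \<Longrightarrow> a (v 0) y = 0" using v by (auto simp: radical_chain_def)
  have "False" if lm: "l < m" "m < n" "v l = v m" for l m
  proof -
    define u where "u j = v j - (if j < m - l then 0 else v (j - (m - l)))" for j
    have "u j \<in> V" if "j < m" for j
      using that lm chain_V[OF ch, of j] chain_V[OF ch, of "j - (m - l)"] by (auto simp: u_def intro!: V_diff V_0)
    moreover have "a (u (Suc j)) y = b (u j) y" if "Suc j < m" "y \<in> V" for j y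
    proof -
      have "a (v (Suc j)) y = b (v j) y" using that lm by (intro chain_step[OF ch]) auto
      moreover have "a (if Suc j < m - l then 0 else v (Suc j - (m - l))) y
          = b (if j < m - l then 0 else v (j - (m - l))) y"
      proof (cases "m - l \<le> j")
        case True
        then show ?thesis using chain_step[OF ch, of "j - (m - l)" y] that lm by (simp add: Suc_diff_le)
      next
        case False
        then show ?thesis using v0(2)[of y] that by (auto simp: not_le)
      qed
      ultimately show ?thesis by (simp add: u_def A.diff_left B.diff_left)
    qed
    moreover have "b (u (m - 1)) y = 0" if "y \<in> V" for y
    proof -
      have c1: "b (v (m - 1)) y = a (v m) y" using chain_step[OF ch, of "m - 1" y] that lm by simp
      moreover have c2: "b (if m - 1 < m - l then 0 else v (m - 1 - (m - l))) y = a (v l) y"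
      proof (cases l)
        case 0
        then show ?thesis using v0(2)[of y] that lm by simp
      next
        case (Suc l')
        then have "m - 1 - (m - l) = l'" "\<not> m - 1 < m - l" using lm by auto
        then show ?thesis using chain_step[OF ch, of l' y] that lm Suc by simp
      qed
      moreover have c3: "b (u (m - 1)) y = b (v (m - 1)) y - b (if m - 1 < m - l then 0 else v (m - 1 - (m - l))) y"
        by (simp only: u_def B.diff_left)
      ultimately show ?thesis by (simp only: c1 c2 c3 lm(3) diff_self)
    qed
    ultimately have "singular_chain m u"
      using lm v0 by (auto simp: singular_chain_def chain_def u_def)
    thus False using ns by blast
  qed
  hence "inj_on v {..<n}" by (intro linorder_inj_onI) auto
  hence "card {..<n} \<le> card V" using chain_V[OF ch] by (intro card_inj_on_le[of v]) (auto simp: finite_V)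
  thus ?thesis by simp
qed

text \<open>Each shift trades a step of v against a step of u, so the pairing matrix is triangular
  and Toeplitz: an entry depends on i - m only and is 0 once v has been pushed below its radical
  start.\<close>

lemma radical_chain_pairing:
  assumes v: "chain d v" "\<And>y. y \<in> V \<Longrightarrow> a (v 0) y = 0"
    and u: "chain d u" "\<And>y. y \<in> V \<Longrightarrow> a (u 0) y = 0"
    and "i < d" "m < d"
  shows "b (v i) (u (d - 1 - m)) = (if m \<le> i then b (v (i - m)) (u (d - 1)) else 0)"
  using assms(5,6)
proof (induction m arbitrary: i)
  case 0
  then show ?case by simp
next
  case (Suc m)
  define l where "l = d - 1 - Suc m"
  have l: "Suc l = d - 1 - m" "Suc l < d" using Suc.prems by (auto simp: l_def)
  have iV: "v i \<in> V" "u l \<in> V" "u (Suc l) \<in> V" using v u l Suc.prems by (auto intro: chain_V)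
  have *: "b (v i) (u l) = a (v i) (u (Suc l))"
    using B.skew[of "v i" "u l"] A.skew[of "v i" "u (Suc l)"] chain_step[OF u(1) l(2) iV(1)] by simp
  show ?case
  proof (cases i)
    case 0
    then show ?thesis using * v(2) iV by (simp add: l_def)
  next
    case (Suc i')
    have "a (v i) (u (Suc l)) = b (v i') (u (Suc l))"
      using chain_step[OF v(1), of i' "u (Suc l)"] iV Suc Suc.prems by simp
    then show ?thesis using * Suc.IH[of i'] Suc Suc.prems l by (simp add: l_def)
  qed
qed

lemma infinity_block:
  assumes ns: "\<And>n v. \<not> singular_chain n v"
    and r: "r \<in> V" "r \<noteq> 0" "\<And>y. y \<in> V \<Longrightarrow> a r y = 0"
  shows "\<exists>d u \<phi>. d \<ge> 1 \<and> is_block (Rsize (Some (1, 1) :: 'k bform option) d) (Rmat 1 (Some (1, 1)) d) (Rmat 2 (Some (1, 1)) d) u \<phi>"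
proof -
  have "radical_chain 1 (\<lambda>_. r)" using r by (auto simp: radical_chain_def chain_def)
  hence "\<exists>n. (\<exists>v. radical_chain n v) \<and> (\<forall>m. (\<exists>v. radical_chain m v) \<longrightarrow> m \<le> n)"
    using radical_chain_bounded[OF ns] by (intro ex_has_greatest_nat[of "\<lambda>n. \<exists>v. radical_chain n v" 1 "\<lambda>n. n" "Suc (card V)"]) (auto simp: less_Suc_eq_le)
  then obtain d v where v: "radical_chain d v" and max: "\<And>m u. radical_chain m u \<Longrightarrow> m \<le> d" by blast
  have d: "d \<ge> 1" and ch: "chain d v" and v0: "v 0 \<noteq> 0" "\<And>y. y \<in> V \<Longrightarrow> a (v 0) y = 0"
    using v by (auto simp: radical_chain_def)
  \<comment> \<open>If this pairing vanished for every chain u of length d that starts in the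
    radical of \<open>a\<close>, then v 0 followed by the adjoint vectors Y (d - 1), ..., Y 0 would
    be a radical chain of length d + 1.\<close>
  have "\<exists>u. chain d u \<and> (\<forall>y\<in>V. a (u 0) y = 0) \<and> b (u (d - 1)) (v 0) \<noteq> 0"
  proof (rule ccontr)
    assume no: "\<not> ?thesis"
    have K: "{0..<d} \<subseteq> {..<d}" by auto
    obtain Y where Y: "\<And>i. Y i \<in> V"
      "\<And>i x. i < d \<Longrightarrow> x \<in> V \<Longrightarrow> b ((\<lambda>j. if j = i then x else 0) (d - 1)) (v 0) =
         (if i \<in> {0..<d} then a x (Y i) else 0) - (if Suc i \<in> {0..<d} then b x (Y (Suc i)) else 0)"
    proof (rule fredholm[OF K, of "\<lambda>w. b (w (d - 1)) (v 0)"])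
      show "b (w (d - 1)) (v 0) = 0" if w: "\<And>i. i < d \<Longrightarrow> w i \<in> V"
        "\<And>i y. i \<in> {0..<d} \<Longrightarrow> y \<in> V \<Longrightarrow> a (w i) y = (if i = 0 then 0 else b (w (i - 1)) y)" for w
      proof -
        have "chain d w" using w(1) w(2)[of "Suc _"] by (auto simp: chain_def)
        moreover have "\<forall>y\<in>V. a (w 0) y = 0" using w(2)[of 0] d by auto
        ultimately show ?thesis using no by blast
      qed
    qed (use that in \<open>auto simp: B.diff_left B.scale_left\<close>)
    define c where "c j = (if j = 0 then v 0 else Y (d - j))" for j
    have "a (c (Suc j)) y = b (c j) y" if "Suc j < Suc d" "y \<in> V" for j y
    proof -
      have "a y (Y (d - Suc j)) = b y (c j)"
      proof (cases "j = 0")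
        case True
        thus ?thesis using Y(2)[of "d - 1" y] that by (simp add: c_def)
      next
        case False
        define l where "l = d - Suc j"
        have "Suc l = d - j" "Suc l < d" "l \<noteq> d - 1" "d - 1 \<noteq> l" using that False by (auto simp: l_def)
        thus ?thesis using Y(2)[of l y] that False unfolding l_def[symmetric] by (simp add: c_def)
      qed
      thus ?thesis using A.skew[of y "Y (d - Suc j)"] B.skew[of y "c j"] by (simp add: c_def)
    qed
    hence "radical_chain (Suc d) c" using v0 Y(1) chain_V[OF ch, of 0] d
      by (auto simp: radical_chain_def chain_def c_def)
    from max[OF this] show False by simp
  qed
  then obtain u where u: "chain d u" "\<And>y. y \<in> V \<Longrightarrow> a (u 0) y = 0" "b (u (d - 1)) (v 0) \<noteq> 0" by blast
  \<comment> \<open>A triangular Toeplitz matrix is a truncated power series. Convolving u with the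
    coefficients of the inverse series makes the pairing matrix the identity; the constant term is
    invertible by the choice of u.\<close>
  define S where "S = Abs_fps (\<lambda>n. b (v n) (u (d - 1)))"
  define c where "c = fps_nth (inverse S)"
  have S: "inverse S * S = 1" using u(3) B.skew[of "v 0" "u (d - 1)"] by (intro inverse_mult_eq_1) (simp add: S_def)
  define u' where "u' j = (\<Sum>m\<le>j. scale (c m) (u (j - m)))" for j
  have ch': "chain d u'"
  proof -
    \<comment> \<open>The summand m = Suc j contains u 0, which \<open>a\<close> annihilates; the
      other summands step down along u.\<close>
    have "a (u' (Suc j)) y = b (u' j) y" if "Suc j < d" "y \<in> V" for j y
    proof -
      have "a (u' (Suc j)) y = (\<Sum>m\<le>j. c m * a (u (Suc (j - m))) y)"
        using u(2) that by (simp add: u'_def A.add_left A.sum_left A.scale_left Suc_diff_le cong: sum.cong_simp)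
      also have "\<dots> = b (u' j) y"
        unfolding u'_def B.sum_left B.scale_left using that chain_step[OF u(1)] by (intro sum.cong) auto
      finally show ?thesis .
    qed
    moreover have "u' j \<in> V" if "j < d" for j
      unfolding u'_def using that by (intro V_sum V_scale chain_V[OF u(1)]) auto
    ultimately show ?thesis by (auto simp: chain_def)
  qed
  have u'0: "a (u' 0) y = 0" if "y \<in> V" for y using u(2)[OF that] by (simp add: u'_def A.scale_left)
  have norm: "b (v i) (u' (d - 1)) = (if i = 0 then 1 else 0)" if "i < d" for i
  proof -
    have "b (v i) (u' (d - 1)) = (\<Sum>m\<le>d - 1. c m * b (v i) (u (d - 1 - m)))"
      by (simp add: u'_def B.sum_right B.scale_right)
    also have "\<dots> = (\<Sum>m\<le>d - 1. if m \<le> i then c m * b (v (i - m)) (u (d - 1)) else 0)"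
      using radical_chain_pairing[OF ch v0(2) u(1,2) that] d by (intro sum.cong) auto
    also have "\<dots> = (\<Sum>m\<in>{0..i}. c m * b (v (i - m)) (u (d - 1)))"
      using that by (intro sum.mono_neutral_cong_right) auto
    also have "\<dots> = fps_nth (inverse S * S) i" by (simp add: fps_mult_nth c_def S_def)
    finally show ?thesis using S by simp
  qed
  have pair: "b (v i) (u' (d - 1 - m)) = (if i = m then 1 else 0)" if "i < d" "m < d" for i m
    using radical_chain_pairing[OF ch v0(2) ch' u'0 that] norm[of "i - m"] that by auto
  have "is_block (d + d) (plus_mat d (Rbase 1 (Some (1, 1)) d)) (plus_mat d (Rbase 2 (Some (1, 1)) d))
     (\<lambda>i. if i < d then v i else u' (d - 1 - (i - d))) (\<lambda>i. if i < d then \<lambda>x. b x (u' (d - 1 - i)) else b (v (i - d)))"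
  proof (rule block_intro[where z = "\<lambda>j. u' (d - 1 - j)" and \<psi> = "\<lambda>i x. b x (u' (d - 1 - i))" and \<chi> = "\<lambda>i. b (v i)"])
    show "v i \<in> V" "u' (d - 1 - i) \<in> V" if "i < d" for i using that chain_V[OF ch] chain_V[OF ch'] by auto
    show "b (v j) (u' (d - 1 - i)) = (if i = j then 1 else 0)" if "i < d" "j < d" for i j
      using pair[OF that(2,1)] by auto
    show "b (v i) (u' (d - 1 - j)) = (if i = j then 1 else 0)" if "i < d" "j < d" for i j
      using pair[OF that] by auto
    show "b (u' (d - 1 - j)) (u' (d - 1 - i)) = 0" if "i < d" "j < d" for i j
      using that by (intro chain_isotropic_b[OF ch']) auto
    show "b (v i) (v j) = 0" if "i < d" "j < d" for i j
      using that by (intro chain_isotropic_b[OF ch]) auto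
    show "a (v i) y = (\<Sum>j<d. Rbase 1 (Some (1, 1)) d i j * b (v j) y)" if "i < d" "y \<in> V" for i y
      using that v0(2)[of y] chain_step[OF ch, of "i - 1" y]
      by (cases i) (simp_all add: Rbase_def companion_def degree_monom_eq if_distrib[of "\<lambda>c. c * _"] cong: if_cong)
    show "b (v i) y = (\<Sum>j<d. Rbase 2 (Some (1, 1)) d i j * b (v j) y)" if "i < d" "y \<in> V" for i y
      using that by (simp add: Rbase_def idm_def if_distrib[of "\<lambda>c. c * _"] cong: if_cong)
    show "a (u' (d - 1 - j)) y = - (\<Sum>i<d. Rbase 1 (Some (1, 1)) d i j * b y (u' (d - 1 - i)))"
      if "j < d" "y \<in> V" for j y
    proof -
      have "(\<Sum>i<d. Rbase 1 (Some (1, 1)) d i j * b y (u' (d - 1 - i)))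
          = (\<Sum>i<d. if i = Suc j then b y (u' (d - 1 - i)) else 0)"
        by (intro sum.cong) (auto simp: Rbase_def companion_def degree_monom_eq)
      also have "\<dots> = (if Suc j < d then b y (u' (d - 1 - Suc j)) else 0)" by simp
      finally show ?thesis
        using u'0[of y] chain_step[OF ch', of "d - 1 - Suc j" y] that B.skew[of y "u' (d - 1 - Suc j)"]
        by (cases "Suc j < d") (auto simp: Suc_diff_Suc not_less_eq less_Suc_eq_le)
    qed
    show "b (u' (d - 1 - j)) y = - (\<Sum>i<d. Rbase 2 (Some (1, 1)) d i j * b y (u' (d - 1 - i)))"
      if "j < d" "y \<in> V" for j y
      using that B.skew[of y "u' (d - 1 - j)"]
      by (simp add: Rbase_def idm_def if_distrib[of "\<lambda>c. c * _"] cong: if_cong)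
  qed (auto simp: B.add_left B.scale_left B.add_right B.scale_right)
  moreover have "Rsize (Some (1, 1) :: 'k bform option) d = d + d" by (simp add: Rsize_def)
  moreover have "Rmat l (Some (1, 1) :: 'k bform option) d = plus_mat d (Rbase l (Some (1, 1)) d)" for l
    by (simp add: Rmat_def Rrows_def)
  ultimately have "is_block (Rsize (Some (1, 1) :: 'k bform option) d) (Rmat 1 (Some (1, 1)) d) (Rmat 2 (Some (1, 1)) d)
     (\<lambda>i. if i < d then v i else u' (d - 1 - (i - d))) (\<lambda>i. if i < d then \<lambda>x. b x (u' (d - 1 - i)) else b (v (i - d)))"
    by (simp only:)
  thus ?thesis using d by (intro exI[of _ d] exI conjI) auto
qed

end

text \<open>The form has the same degree as its dehomogenisation, so x2 cannot divide it; in any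
  product of two forms both factors keep their full degree and already factor g.\<close>

lemma irreducible_monic_in_Pset:
  fixes g :: "'k::field poly"
  assumes "irreducible g" "lead_coeff g = 1"
  shows "(degree g, g) \<in> Pset"
proof -
  have g: "g \<noteq> 0" "degree g \<ge> 1"
    using assms by (auto simp: irreducible_def is_unit_iff_degree not_less_eq_eq)
  have False if "bform_wf h" "bform_wf k" "fst h \<ge> 1" "fst k \<ge> 1" "(degree g, g) = bform_mult h k" for h k
  proof -
    from that(5) have e: "degree g = fst h + fst k" "g = snd h * snd k" by (auto simp: bform_mult_def)
    hence nz: "snd h \<noteq> 0" "snd k \<noteq> 0" using g by auto
    have "degree (snd h) \<ge> 1" "degree (snd k) \<ge> 1"
      using that(1-4) e degree_mult_eq[OF nz] by (auto simp: bform_wf_def)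
    thus False using irreducibleD[OF assms(1) e(2)] nz by (auto simp: is_unit_iff_degree)
  qed
  hence "\<not> (\<exists>h k. bform_wf h \<and> bform_wf k \<and> fst h \<ge> 1 \<and> fst k \<ge> 1 \<and> (degree g, g) = bform_mult h k)"
    by blast
  thus ?thesis using g assms(2)
    by (simp add: Pset_def bform_irreducible_def bform_unital_def bform_wf_def)
qed

subsection \<open>Cyclic submodules of an endomorphism\<close>

locale linear_endo = vector_space scale
  for scale :: "'k::{field_gcd,finite} \<Rightarrow> 'v::ab_group_add \<Rightarrow> 'v" +
  fixes V :: "'v set" and T :: "'v \<Rightarrow> 'v"
  assumes subspace_V: "subspace V"
    and T_V: "x \<in> V \<Longrightarrow> T x \<in> V"
    and T_add: "x \<in> V \<Longrightarrow> y \<in> V \<Longrightarrow> T (x + y) = T x + T y"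
    and T_scale: "x \<in> V \<Longrightarrow> T (scale c x) = scale c (T x)"
begin

definition papp :: "'k poly \<Rightarrow> 'v \<Rightarrow> 'v" where
  "papp p x = (\<Sum>i\<le>degree p. scale (coeff p i) ((T ^^ i) x))"

lemma T_pow_V: "x \<in> V \<Longrightarrow> (T ^^ i) x \<in> V" by (induction i) (auto intro: T_V)

lemma T_zero: "T 0 = 0" using T_scale[of 0 0] subspace_0[OF subspace_V] by simp

lemma T_sum: "(\<And>i. i \<in> I \<Longrightarrow> g i \<in> V) \<Longrightarrow> T (\<Sum>i\<in>I. g i) = (\<Sum>i\<in>I. T (g i))"
  by (induction I rule: infinite_finite_induct) (auto simp: T_zero T_add subspace_sum[OF subspace_V])

lemma papp_eq: "degree p < n \<Longrightarrow> papp p x = (\<Sum>i<n. scale (coeff p i) ((T ^^ i) x))"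
  unfolding papp_def by (intro sum.mono_neutral_left) (auto simp: coeff_eq_0 not_le)

lemma papp_V: "x \<in> V \<Longrightarrow> papp p x \<in> V"
  unfolding papp_def by (intro subspace_sum[OF subspace_V] subspace_scale[OF subspace_V] T_pow_V)

lemma papp_0 [simp]: "papp 0 x = 0" by (simp add: papp_def)
lemma papp_1 [simp]: "papp 1 x = x" by (simp add: papp_def)

lemma papp_add: "papp (p + q) x = papp p x + papp q x"
proof -
  define n where "n = Suc (max (degree p) (degree q))"
  have "degree p < n" "degree q < n" "degree (p + q) < n"
    using degree_add_le_max[of p q] by (auto simp: n_def)
  thus ?thesis by (simp add: papp_eq scale_left_distrib sum.distrib)
qed

lemma papp_smult: "papp (smult c p) x = scale c (papp p x)"
proof -
  have "degree p < Suc (degree p)" "degree (smult c p) < Suc (degree p)" by (auto simp: le_less_trans[OF degree_smult_le])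
  thus ?thesis by (simp only: papp_eq) (simp add: scale_sum_right scale_right_distrib)
qed

lemma papp_minus: "papp (- p) x = - papp p x" using papp_smult[of "-1" p x] by simp
lemma papp_diff: "papp (p - q) x = papp p x - papp q x" using papp_add[of p "- q" x] by (simp add: papp_minus)

lemma papp_sum: "papp (\<Sum>i\<in>I. g i) x = (\<Sum>i\<in>I. papp (g i) x)"
  by (induction I rule: infinite_finite_induct) (auto simp: papp_add)

lemma papp_shift: "x \<in> V \<Longrightarrow> papp (pCons 0 p) x = T (papp p x)"
proof -
  assume x: "x \<in> V"
  have "papp (pCons 0 p) x = (\<Sum>i<Suc (Suc (degree p)). scale (coeff (pCons 0 p) i) ((T ^^ i) x))"
    by (rule papp_eq) (auto simp: degree_pCons_eq_if)
  also have "\<dots> = (\<Sum>i<Suc (degree p). T (scale (coeff p i) ((T ^^ i) x)))"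
    using x by (subst sum.lessThan_Suc_shift) (auto simp: T_scale T_pow_V)
  also have "\<dots> = T (papp p x)"
    unfolding papp_eq[OF lessI] by (intro T_sum[symmetric] subspace_scale[OF subspace_V] T_pow_V x)
  finally show ?thesis .
qed

lemma papp_zero_right [simp]: "papp p 0 = 0"
proof -
  have "(T ^^ i) 0 = 0" for i by (induction i) (auto simp: T_zero)
  thus ?thesis by (simp add: papp_def)
qed

lemma papp_mult: "x \<in> V \<Longrightarrow> papp (p * q) x = papp p (papp q x)"
proof (induction p rule: pCons_induct)
  case 0
  then show ?case by simp
next
  case (pCons c p)
  have c: "papp (pCons c p) y = scale c y + T (papp p y)" if "y \<in> V" for y
  proof -
    have "pCons c p = smult c 1 + pCons 0 p" by (simp add: one_pCons)
    thus ?thesis using that by (simp only: papp_add papp_smult papp_1 papp_shift)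
  qed
  have "papp (pCons c p * q) x = scale c (papp q x) + T (papp (p * q) x)"
    using pCons.prems by (simp add: mult_pCons_left papp_add papp_smult papp_shift)
  thus ?case using pCons by (simp add: c papp_V)
qed

lemma T_pow_add: "x \<in> V \<Longrightarrow> y \<in> V \<Longrightarrow> (T ^^ i) (x + y) = (T ^^ i) x + (T ^^ i) y"
  by (induction i) (auto simp: T_add T_pow_V)

lemma T_pow_scale: "x \<in> V \<Longrightarrow> (T ^^ i) (scale c x) = scale c ((T ^^ i) x)"
  by (induction i) (auto simp: T_scale T_pow_V)

lemma papp_vec_add: "x \<in> V \<Longrightarrow> y \<in> V \<Longrightarrow> papp p (x + y) = papp p x + papp p y"
  by (simp add: papp_def T_pow_add scale_right_distrib sum.distrib)

lemma papp_vec_scale: "x \<in> V \<Longrightarrow> papp p (scale c x) = scale c (papp p x)"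
  by (simp add: papp_def T_pow_scale scale_sum_right mult.commute)

lemma papp_vec_diff: "x \<in> V \<Longrightarrow> y \<in> V \<Longrightarrow> papp p (x - scale c y) = papp p x - scale c (papp p y)"
  using papp_vec_add[of x "scale (-c) y" p] papp_vec_scale[of y p "-c"] subspace_scale[OF subspace_V, of y "-c"]
  by simp

lemma papp_monom: "papp (monom 1 j) x = (T ^^ j) x"
proof -
  have "papp (monom 1 j) x = (\<Sum>i<Suc j. scale (coeff (monom 1 j) i) ((T ^^ i) x))"
    by (rule papp_eq) (simp add: degree_monom_eq)
  also have "\<dots> = (\<Sum>i<Suc j. if i = j then (T ^^ i) x else 0)" by (intro sum.cong) auto
  finally show ?thesis by simp
qed

text \<open>A polynomial of least degree that kills some nonzero vector u is irreducible: for a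
  proper factorisation q r, either r kills u or q kills the nonzero vector r(T) u. Some annihilator
  x^j - x^i exists because the iterates of w repeat in the finite set V.\<close>

lemma minimal_annihilator:
  assumes "finite V" "w \<in> V" "w \<noteq> 0"
  obtains g u where "irreducible g" "lead_coeff g = 1" "u \<in> V" "u \<noteq> 0" "papp g u = 0"
proof -
  define P where "P n \<longleftrightarrow> (\<exists>p u. p \<noteq> 0 \<and> degree p = n \<and> u \<in> V \<and> u \<noteq> 0 \<and> papp p u = 0)" for n
  have "\<not> inj_on (\<lambda>i. (T ^^ i) w) {..card V}"
  proof
    assume "inj_on (\<lambda>i. (T ^^ i) w) {..card V}"
    hence "card {..card V} \<le> card V" using assms by (intro card_inj_on_le) (auto simp: T_pow_V)
    thus False by simp
  qed
  then obtain i j where ij: "i < j" "(T ^^ i) w = (T ^^ j) w" by (auto simp: inj_on_def) (metis linorder_neqE_nat)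
  have "coeff (monom 1 j - monom (1::'k) i) j = 1" using ij by simp
  hence "monom 1 j - monom (1::'k) i \<noteq> 0" by (metis coeff_0 zero_neq_one)
  moreover have "papp (monom 1 j - monom 1 i) w = 0" using ij by (simp add: papp_diff papp_monom)
  ultimately have "\<exists>n. P n" using assms unfolding P_def by blast
  hence P: "P (LEAST n. P n)" by (rule LeastI_ex)
  then obtain p u where p: "p \<noteq> 0" "degree p = (LEAST n. P n)" "u \<in> V" "u \<noteq> 0" "papp p u = 0" unfolding P_def by blast
  have min: "degree p \<le> degree q" if "q \<noteq> 0" "x \<in> V" "x \<noteq> 0" "papp q x = 0" for q x
    unfolding p(2) by (rule Least_le) (use that in \<open>auto simp: P_def\<close>)
  define g where "g = smult (inverse (lead_coeff p)) p"
  have g: "g \<noteq> 0" "lead_coeff g = 1" "papp g u = 0" "degree g = degree p" using p(1,5) by (auto simp: g_def papp_smult)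
  have "irreducible g"
  proof (rule irreducibleI)
    show "g \<noteq> 0" by fact
    show "\<not> g dvd 1"
    proof
      assume "g dvd 1"
      hence "degree g = 0" using g by (simp add: is_unit_iff_degree)
      hence "g = 1" using g(2) by (simp add: monic_degree_0)
      thus False using g p by simp
    qed
    show "q dvd 1 \<or> r dvd 1" if qr: "g = q * r" for q r
    proof (rule ccontr)
      assume no: "\<not> ?thesis"
      have nz: "q \<noteq> 0" "r \<noteq> 0" using qr g by auto
      hence "degree q > 0" "degree r > 0" using no by (auto simp: is_unit_iff_degree)
      hence lt: "degree q < degree p" "degree r < degree p" using qr g(4) degree_mult_eq[OF nz] by auto
      have "papp q (papp r u) = 0" using g p qr by (simp add: papp_mult[symmetric])
      thus False using min[OF nz(1), of "papp r u"] min[OF nz(2), of u] lt p papp_V[of u r] by auto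
    qed
  qed
  thus ?thesis using that g p by blast
qed

end

lemma dvd_prime_power_cases:
  fixes g t :: "'k::field_gcd poly"
  assumes "irreducible g" "t dvd g ^ d" "d > 0"
  shows "t dvd g ^ (d - 1) \<or> g ^ d dvd t"
proof -
  have "prime_elem g" using assms(1) by (rule irreducible_imp_prime_elem_gcd)
  hence p: "prime (normalize g)" by (simp add: prime_def)
  have "t dvd normalize g ^ d" using assms(2) by (metis normalize_power dvd_normalize_iff)
  then obtain m where m: "m \<le> d" "normalize t = normalize g ^ m"
    by (rule divides_primepow[OF p]) (auto simp: normalize_power)
  hence "normalize t = normalize (g ^ m)" by (simp add: normalize_power)
  hence t: "t dvd g ^ m" "g ^ m dvd t" by (auto dest: associatedD1 associatedD2)
  show ?thesis
  proof (cases "m = d")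
    case True
    thus ?thesis using t by simp
  next
    case False
    hence "g ^ m dvd g ^ (d - 1)" using m by (intro le_imp_power_dvd) auto
    thus ?thesis using t dvd_trans by blast
  qed
qed

section \<open>Blocks for powers of irreducible polynomials, with nondegenerate first form\<close>

context two_forms
begin

text \<open>The vectors T^i x form a chain, so cyclic submodules are isotropic and a summand needs
  two of them. The modules generated by x and y, both killed by g^d with d the largest exponent, are
  put in duality by \<open>a\<close>, for which T is self-adjoint.\<close>

lemma regular_block:
  assumes nd: "\<And>x. x \<in> V \<Longrightarrow> (\<And>y. y \<in> V \<Longrightarrow> a x y = 0) \<Longrightarrow> x = 0"
    and w: "w \<in> V" "w \<noteq> 0"
  shows "\<exists>g d u \<phi>. g \<in> Pset \<and> d \<ge> 1 \<and> is_block (Rsize (Some (g :: 'k bform)) d) (Rmat 1 (Some g) d) (Rmat 2 (Some g) d) u \<phi>"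
proof -
  have nd': "x = z" if "x \<in> V" "z \<in> V" "\<And>y. y \<in> V \<Longrightarrow> a x y = a z y" for x z
    using nd[of "x - z"] that by (auto simp: A.diff_left V_diff)
  \<comment> \<open>The vector representing b x through the nondegenerate form \<open>a\<close> will
    be T x.\<close>
  have "\<exists>z\<in>V. \<forall>y\<in>V. a z y = b x y" for x
  proof -
    have "\<exists>c. \<forall>y\<in>V. b x y = (\<Sum>s\<in>V. c s * a s y)"
    proof (rule functional_on_V)
      show "b x y = 0" if "y \<in> V" "\<forall>s\<in>V. a s y = 0" for y
        using nd[of y] that A.skew[of y] by auto
    qed (auto simp: finite_V A.diff_right B.diff_right A.scale_right B.scale_right)
    then obtain c where c: "\<And>y. y \<in> V \<Longrightarrow> b x y = (\<Sum>s\<in>V. c s * a s y)" by blast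
    show ?thesis
      by (intro bexI[of _ "\<Sum>s\<in>V. scale (c s) s"]) (auto simp: c A.sum_left A.scale_left intro: V_sum V_scale)
  qed
  then obtain T where T: "\<And>x. T x \<in> V" "\<And>x y. y \<in> V \<Longrightarrow> a (T x) y = b x y" by metis
  interpret linear_endo scale V T
  proof
    show "A.subspace V" by (rule subspace_V)
    show "T (x + y) = T x + T y" for x y by (rule nd') (auto simp: T V_add A.add_left B.add_left)
    show "T (scale c x) = scale c (T x)" for c x by (rule nd') (auto simp: T V_scale A.scale_left B.scale_left)
  qed (rule T)
  have sa1: "a (T x) y = a x (T y)" if "x \<in> V" "y \<in> V" for x y
    using that T(2)[of y x] T(2)[of x y] B.skew[of x y] A.skew[of x "T y"] by simp
  have saT: "a ((T ^^ i) x) y = a x ((T ^^ i) y)" if "x \<in> V" "y \<in> V" for i x y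
  proof -
    have "\<forall>x\<in>V. \<forall>y\<in>V. a ((T ^^ i) x) y = a x ((T ^^ i) y)"
      by (induction i) (simp_all add: sa1 T_pow_V T funpow_swap1)
    thus ?thesis using that by blast
  qed
  have sa: "a (papp p x) y = a x (papp p y)" if "x \<in> V" "y \<in> V" for p x y
    using that by (simp add: papp_def A.sum_left A.sum_right A.scale_left A.scale_right saT)
  have iso: "a (papp p x) (papp q x) = 0" if x: "x \<in> V" for p q x
  proof -
    have "a ((T ^^ i) x) ((T ^^ j) x) = 0" for i j
    proof (rule chain_isotropic_a[where n = "Suc (max i j)" and w = "\<lambda>i. (T ^^ i) x"])
      show "chain (Suc (max i j)) (\<lambda>i. (T ^^ i) x)" using x by (auto simp: chain_def T T_pow_V)
    qed auto
    thus ?thesis by (simp add: papp_def A.sum_left A.sum_right A.scale_left A.scale_right)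
  qed
  obtain g u where g: "irreducible g" "lead_coeff g = 1" and u: "u \<in> V" "u \<noteq> 0" "papp g u = 0"
    using minimal_annihilator[OF finite_V w] by blast
  define P where "P d \<longleftrightarrow> d \<ge> 1 \<and> (\<exists>x\<in>V. papp (g ^ d) x = 0 \<and> papp (g ^ (d - 1)) x \<noteq> 0)" for d
  have vanish: "papp (g ^ n) x = 0" if "papp (g ^ d) x = 0" "d \<le> n" "x \<in> V" for n d x
    using papp_mult[OF that(3), of "g ^ (n - d)" "g ^ d"] that by (simp add: power_add[symmetric])
  have P_le: "d \<le> card V" if Pd: "P d" for d
  proof -
    obtain x where x: "x \<in> V" "papp (g ^ d) x = 0" "papp (g ^ (d - 1)) x \<noteq> 0" using Pd by (auto simp: P_def)
    have "inj_on (\<lambda>i. papp (g ^ i) x) {..<d}"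
    proof (rule linorder_inj_onI)
      fix i j assume ij: "i < j" "i \<in> {..<d}" "j \<in> {..<d}"
      have "papp (g ^ (d - 1 - i)) (papp (g ^ i) x) = papp (g ^ (d - 1)) x"
        "papp (g ^ (d - 1 - i)) (papp (g ^ j) x) = 0"
        using ij vanish[OF x(2), of "d - 1 - i + j"] x(1) by (auto simp: papp_mult[symmetric] power_add[symmetric])
      thus "papp (g ^ i) x \<noteq> papp (g ^ j) x" using x(3) by metis
    qed auto
    hence "card {..<d} \<le> card V" using x finite_V by (intro card_inj_on_le) (auto simp: papp_V)
    thus ?thesis by simp
  qed
  have "P 1" using u by (auto simp: P_def)
  hence "\<exists>d. P d \<and> (\<forall>m. P m \<longrightarrow> m \<le> d)"
    using P_le by (intro ex_has_greatest_nat[of P 1 "\<lambda>n. n" "Suc (card V)"]) (auto simp: less_Suc_eq_le)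
  then obtain d where d: "P d" and max: "\<And>m. P m \<Longrightarrow> m \<le> d" by blast
  obtain x where x: "x \<in> V" "papp (g ^ d) x = 0" "papp (g ^ (d - 1)) x \<noteq> 0" and d1: "d \<ge> 1" using d by (auto simp: P_def)
  \<comment> \<open>Otherwise g^(d-1)(T) x is orthogonal to the kernel of the self-adjoint map
    g^d(T) and hence lies in its image. A preimage is killed by g^(d+1) but not by g^d, against the
    choice of d.\<close>
  have "\<exists>y\<in>V. papp (g ^ d) y = 0 \<and> a (papp (g ^ (d - 1)) x) y \<noteq> 0"
  proof (rule ccontr)
    assume no: "\<not> ?thesis"
    have "\<exists>c. \<forall>z\<in>V. a (papp (g ^ (d - 1)) x) z = (\<Sum>s\<in>V. c s * a s (papp (g ^ d) z))"
    proof (rule functional_on_V)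
      show "a (papp (g ^ (d - 1)) x) z = 0" if "z \<in> V" "\<forall>s\<in>V. a s (papp (g ^ d) z) = 0" for z
        using nd[of "papp (g ^ d) z"] that A.skew[of "papp (g ^ d) z"] no by (auto simp: papp_V)
    qed (auto simp: finite_V papp_vec_diff A.diff_right A.scale_right)
    then obtain c where c: "\<And>z. z \<in> V \<Longrightarrow> a (papp (g ^ (d - 1)) x) z = (\<Sum>s\<in>V. c s * a s (papp (g ^ d) z))" by blast
    define w where "w = (\<Sum>s\<in>V. scale (c s) s)"
    have w: "w \<in> V" unfolding w_def by (intro V_sum V_scale)
    have "a (papp (g ^ (d - 1)) x) z = a (papp (g ^ d) w) z" if "z \<in> V" for z
      using c[OF that] sa[OF w that] by (simp add: w_def A.sum_left A.scale_left)
    hence e: "papp (g ^ (d - 1)) x = papp (g ^ d) w" using x w by (intro nd') (auto simp: papp_V)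
    have "papp (g ^ Suc d) w = papp g (papp (g ^ (d - 1)) x)" by (simp only: e power_Suc papp_mult[OF w])
    also have "\<dots> = papp (g ^ d) x" using papp_mult[OF x(1), of g "g ^ (d - 1)"] d1 by (simp add: power_eq_if)
    finally have "P (Suc d)" using w e x by (auto simp: P_def)
    from max[OF this] show False by simp
  qed
  then obtain y where y: "y \<in> V" "papp (g ^ d) y = 0" "a (papp (g ^ (d - 1)) x) y \<noteq> 0" by blast
  define f where "f = g ^ d"
  define D where "D = degree f"
  have g0: "g \<noteq> 0" "degree g \<ge> 1" using g by (auto simp: irreducible_def is_unit_iff_degree not_less_eq_eq)
  have "lead_coeff f = 1" unfolding f_def lead_coeff_power g(2) by simp
  hence f: "f \<noteq> 0" "lead_coeff f = 1" "D = d * degree g" using g0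
    by (auto simp: f_def D_def degree_power_eq mult.commute)
  have D1: "D \<ge> 1" using f d1 g0 by (simp add: Suc_le_eq)
  have fx: "papp f x = 0" "papp f y = 0" using x y by (auto simp: f_def)
  define z where "z j = (T ^^ j) y" for j
  have zV: "z j \<in> V" for j using y by (simp add: z_def T_pow_V)
  \<comment> \<open>Such a q pairs trivially with the whole module of y, and so does t = gcd q f. If
    t were a proper divisor of f = g^d, it would divide g^(d-1), and g^(d-1)(T) x would be
    orthogonal to y.\<close>
  have key: "f dvd q" if q: "\<And>j. j < D \<Longrightarrow> a (papp q x) (z j) = 0" for q
  proof -
    have qJ: "a (papp q x) (papp r y) = 0" for r
    proof -
      have "papp r y = papp (r mod f) y"
        using papp_add[of "r div f * f" "r mod f" y] papp_mult[OF y(1), of "r div f" f] fx by simp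
      moreover have "degree (r mod f) < D" using degree_mod_less[of f r] f D1 by (auto simp: D_def)
      hence "papp (r mod f) y = (\<Sum>i<D. scale (coeff (r mod f) i) (z i))" by (simp add: papp_eq z_def)
      ultimately show ?thesis using q by (simp add: A.sum_right A.scale_right)
    qed
    define t where "t = gcd q f"
    have tJ: "a (papp t x) (papp r y) = 0" for r
    proof -
      obtain s s' where "s * q + s' * f = t" unfolding t_def by (metis bezout_coefficients prod.collapse)
      hence "papp t x = papp s (papp q x)"
        using papp_add[of "s * q" "s' * f" x] papp_mult[OF x(1)] fx by simp
      hence "a (papp t x) (papp r y) = a (papp q x) (papp s (papp r y))" using x y by (simp add: sa papp_V)
      also have "\<dots> = a (papp q x) (papp (s * r) y)" using y by (simp add: papp_mult)
      finally show ?thesis by (simp add: qJ)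
    qed
    have "\<not> t dvd g ^ (d - 1)"
    proof
      assume "t dvd g ^ (d - 1)"
      then obtain s where s: "g ^ (d - 1) = s * t" by (metis dvdE mult.commute)
      have "a (papp (g ^ (d - 1)) x) y = a (papp t x) (papp s y)"
        unfolding s papp_mult[OF x(1)] using x y by (simp add: sa papp_V)
      thus False using tJ y by simp
    qed
    hence "f dvd t" using dvd_prime_power_cases[OF g(1), of t d] d1 by (auto simp: t_def f_def)
    thus ?thesis by (auto simp: t_def intro: dvd_trans)
  qed
  have small: "q = 0" if "f dvd q" "degree q < D" for q
    using that dvd_imp_degree_le[of f q] by (auto simp: D_def)
  define pol where "pol c = (\<Sum>i<D. monom (c i) i)" for c :: "nat \<Rightarrow> 'k"
  have coeff_pol: "coeff (pol c) n = (if n < D then c n else 0)" for c n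
    by (simp add: pol_def coeff_sum)
  have deg_pol: "degree (pol c) < D" for c using D1 by (intro degree_lessI) (auto simp: coeff_pol)
  \<comment> \<open>\<open>L\<close> sends D coefficients to D values and is injective by
    \<open>key\<close>. Over a finite field it is therefore onto, which yields the basis of the
    module of x dual to z 0, ..., z (D - 1).\<close>
  define L where "L c = restrict (\<lambda>j. a (papp (pol c) x) (z j)) {..<D}" for c
  have "inj_on L ({..<D} \<rightarrow>\<^sub>E UNIV)"
  proof (rule inj_onI)
    fix c c' assume c: "c \<in> {..<D} \<rightarrow>\<^sub>E (UNIV::'k set)" "c' \<in> {..<D} \<rightarrow>\<^sub>E (UNIV::'k set)" "L c = L c'"
    have "f dvd pol c - pol c'"
    proof (rule key)
      show "a (papp (pol c - pol c') x) (z j) = 0" if "j < D" for j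
        using fun_cong[OF c(3), of j] that by (simp add: L_def papp_diff A.diff_left)
    qed
    hence "pol c - pol c' = 0" by (rule small) (rule degree_diff_less[OF deg_pol deg_pol])
    hence "pol c = pol c'" by simp
    hence "c n = c' n" if "n < D" for n using coeff_pol[of c n] coeff_pol[of c' n] that by simp
    thus "c = c'" by (intro PiE_ext[OF c(1,2)]) simp
  qed
  hence surj: "L ` ({..<D} \<rightarrow>\<^sub>E UNIV) = ({..<D} \<rightarrow>\<^sub>E UNIV)"
  proof (rule endo_inj_surj[rotated 2])
    show "finite ({..<D} \<rightarrow>\<^sub>E (UNIV :: 'k set))" by (rule finite_PiE) auto
    have "L c \<in> ({..<D} \<rightarrow>\<^sub>E UNIV)" for c unfolding L_def restrict_PiE_iff by simp
    thus "L ` ({..<D} \<rightarrow>\<^sub>E UNIV) \<subseteq> ({..<D} \<rightarrow>\<^sub>E UNIV)" by blast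
  qed
  have "\<exists>q. \<forall>j<D. a (papp q x) (z j) = (if i = j then 1 else 0)" for i
  proof -
    have "restrict (\<lambda>j. if i = j then 1 else 0) {..<D} \<in> L ` ({..<D} \<rightarrow>\<^sub>E UNIV)" unfolding surj by auto
    then obtain c where c: "restrict (\<lambda>j. if i = j then 1 else 0) {..<D} = L c" by blast
    show ?thesis
    proof (intro exI allI impI)
      fix j assume "j < D"
      thus "a (papp (pol c) x) (z j) = (if i = j then 1 else 0)" using fun_cong[OF c, of j] by (simp add: L_def)
    qed
  qed
  then obtain q where q: "\<And>i j. j < D \<Longrightarrow> a (papp (q i) x) (z j) = (if i = j then 1 else 0)" by metis
  define xx where "xx i = papp (q i) x" for i
  have xV: "xx i \<in> V" for i using x by (simp add: xx_def papp_V)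
  have zD: "z D = - (\<Sum>l<D. scale (coeff f l) (z l))"
  proof -
    have "papp f y = (\<Sum>l<Suc D. scale (coeff f l) (z l))" unfolding z_def by (rule papp_eq) (simp add: D_def)
    hence "(\<Sum>l<D. scale (coeff f l) (z l)) + z D = 0" using fx f by (simp add: D_def)
    thus ?thesis by (simp add: eq_neg_iff_add_eq_0 add.commute)
  qed
  have Txz: "a (T (xx i)) (z j) = companion f i j" if "i < D" "j < D" for i j
  proof -
    have "a (T (xx i)) (z j) = a (xx i) (z (Suc j))" using xV zV by (simp add: sa1 z_def)
    also have "\<dots> = companion f i j"
    proof (cases "Suc j < D")
      case True
      then show ?thesis using q[of "Suc j" i] by (auto simp: xx_def companion_def D_def)
    next
      case False
      hence "Suc j = D" using that by simp
      have "a (xx i) (z (Suc j)) = - (\<Sum>l<D. coeff f l * a (xx i) (z l))"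
        unfolding \<open>Suc j = D\<close> zD by (simp add: A.minus_right A.sum_right A.scale_right)
      also have "(\<Sum>l<D. coeff f l * a (xx i) (z l)) = (\<Sum>l<D. if i = l then coeff f l else 0)"
        by (intro sum.cong) (auto simp: xx_def q)
      finally show ?thesis using that \<open>Suc j = D\<close> by (auto simp: companion_def D_def[symmetric])
    qed
    finally show ?thesis .
  qed
  \<comment> \<open>By \<open>key\<close>, a vector of the module of x is determined by its products
    with the z j, so the matrix of T can be read off from \<open>Txz\<close>.\<close>
  have Tx: "T (xx i) = (\<Sum>j<D. scale (companion f i j) (xx j))" if "i < D" for i
  proof -
    define e where "e = pCons 0 (q i) - (\<Sum>j<D. smult (companion f i j) (q j))"
    have e: "papp e x = T (xx i) - (\<Sum>j<D. scale (companion f i j) (xx j))"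
      using x by (simp add: e_def papp_diff papp_shift papp_sum papp_smult xx_def)
    have "f dvd e"
    proof (rule key)
      fix j assume j: "j < D"
      have "(\<Sum>l<D. companion f i l * a (xx l) (z j)) = (\<Sum>l<D. if l = j then companion f i l else 0)"
        using j by (intro sum.cong) (auto simp: xx_def q)
      thus "a (papp e x) (z j) = 0" using j Txz[OF that j] by (simp add: e A.diff_left A.sum_left A.scale_left)
    qed
    then obtain s where "e = s * f" by (metis dvdE mult.commute)
    hence "papp e x = 0" using x fx by (simp add: papp_mult)
    thus ?thesis using e by simp
  qed
  define G where "G = (degree g, g)"
  have G: "G \<in> Pset" "G \<noteq> (1, 1)" using irreducible_monic_in_Pset[OF g] g0 by (auto simp: G_def)
  have "is_block (D + D) (plus_mat D (Rbase 1 (Some G) d)) (plus_mat D (Rbase 2 (Some G) d))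
     (\<lambda>i. if i < D then xx i else z (i - D)) (\<lambda>i. if i < D then \<lambda>v. a v (z i) else a (xx (i - D)))"
  proof (rule block_intro[where \<psi> = "\<lambda>i v. a v (z i)" and \<chi> = "\<lambda>i. a (xx i)"])
    show "a (xx j) (z i) = (if i = j then 1 else 0)" if "i < D" "j < D" for i j
      using q[of i j] that by (auto simp: xx_def)
    show "a (xx i) (z j) = (if i = j then 1 else 0)" if "i < D" "j < D" for i j
      using q[of j i] that by (auto simp: xx_def)
    show "a (z j) (z i) = 0" if "i < D" "j < D" for i j
      using iso[OF y(1), of "monom 1 j" "monom 1 i"] by (simp add: papp_monom z_def)
    show "a (xx i) (xx j) = 0" if "i < D" "j < D" for i j
      using iso[OF x(1)] by (simp add: xx_def)
    show "a (xx i) y = (\<Sum>j<D. Rbase 1 (Some G) d i j * a (xx j) y)" if "i < D" "y \<in> V" for i y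
      using that G by (simp add: Rbase_def idm_def if_distrib[of "\<lambda>c. c * _"] cong: if_cong)
    show "b (xx i) y = (\<Sum>j<D. Rbase 2 (Some G) d i j * a (xx j) y)" if "i < D" "y \<in> V" for i y
      using Tx[OF that(1)] T(2)[OF that(2), of "xx i"] G
      by (simp add: Rbase_def A.sum_left A.scale_left) (simp add: f_def G_def)
    show "a (z j) y = - (\<Sum>i<D. Rbase 1 (Some G) d i j * a y (z i))" if "j < D" "y \<in> V" for j y
      using that G A.skew[of y "z j"] by (simp add: Rbase_def idm_def if_distrib[of "\<lambda>c. c * _"] cong: if_cong)
    show "b (z j) y = - (\<Sum>i<D. Rbase 2 (Some G) d i j * a y (z i))" if "j < D" "y \<in> V" for j y
    proof -
      have "b (z j) y = a (z (Suc j)) y" using T(2)[OF that(2), of "z j"] by (simp add: z_def)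
      also have "\<dots> = (\<Sum>i<D. companion f i j * a (z i) y)"
      proof (cases "Suc j < D")
        case True
        hence "(\<Sum>i<D. companion f i j * a (z i) y) = (\<Sum>i<D. if i = Suc j then a (z i) y else 0)"
          by (intro sum.cong) (auto simp: companion_def D_def)
        thus ?thesis using True by simp
      next
        case False
        hence j: "Suc j = D" using that by simp
        hence "(\<Sum>i<D. companion f i j * a (z i) y) = (\<Sum>i<D. - coeff f i * a (z i) y)"
          by (intro sum.cong) (auto simp: companion_def D_def[symmetric])
        thus ?thesis unfolding j zD by (simp add: A.minus_left A.sum_left A.scale_left sum_negf)
      qed
      also have "\<dots> = - (\<Sum>i<D. companion f i j * a y (z i))"
        unfolding sum_negf[symmetric] by (intro sum.cong refl) (simp add: A.skew[of y])
      finally show ?thesis using G by (simp add: Rbase_def) (simp add: f_def G_def)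
    qed
  qed (auto simp: xV zV A.add_left A.scale_left A.add_right A.scale_right)
  moreover have "Rsize (Some G) d = D + D" using G f by (simp add: Rsize_def) (simp add: G_def)
  moreover have "Rmat l (Some G) d = plus_mat D (Rbase l (Some G) d)" for l
    using G f by (simp add: Rmat_def Rrows_def) (simp add: G_def)
  ultimately have "is_block (Rsize (Some G) d) (Rmat 1 (Some G) d) (Rmat 2 (Some G) d)
     (\<lambda>i. if i < D then xx i else z (i - D)) (\<lambda>i. if i < D then \<lambda>v. a v (z i) else a (xx (i - D)))"
    by (simp only:)
  thus ?thesis using G d1 by (intro exI[of _ G] exI[of _ d] exI conjI) auto
qed

end

subsection \<open>Canonical form of a pair\<close>

lemma x2_in_Pset: "(1, 1) \<in> (Pset :: 'k::field bform set)"
  by (auto simp: Pset_def bform_irreducible_def bform_unital_def bform_wf_def bform_mult_def)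

lemma Rsize_pos: "d \<ge> 1 \<Longrightarrow> (\<And>g. og = Some g \<Longrightarrow> g \<in> Pset) \<Longrightarrow> Rsize og d > 0"
  by (auto simp: Rsize_def Pset_def bform_irreducible_def split: option.splits)

text \<open>The order of the cases matters: the length of chains at infinity is bounded only in the
  absence of singular chains, and T exists once \<open>a\<close> is nondegenerate.\<close>

lemma (in two_forms) find_block:
  assumes w: "w \<in> V" "w \<noteq> 0"
  obtains og :: "'k bform option" and d u \<phi> where "d \<ge> 1" "\<And>g. og = Some g \<Longrightarrow> g \<in> Pset"
    "is_block (Rsize og d) (Rmat 1 og d) (Rmat 2 og d) u \<phi>"
proof (cases "\<exists>n v. singular_chain n v")
  case True
  then show ?thesis using singular_block that[of _ None] by (metis option.distinct(1))
next
  case ns: False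
  show ?thesis
  proof (cases "\<exists>r\<in>V. r \<noteq> 0 \<and> (\<forall>y\<in>V. a r y = 0)")
    case True
    then show ?thesis using infinity_block ns that[of _ "Some (1, 1)"] x2_in_Pset by (metis option.inject)
  next
    case False
    then have "\<exists>g d u \<phi>. g \<in> Pset \<and> d \<ge> 1 \<and> is_block (Rsize (Some (g :: 'k bform)) d) (Rmat 1 (Some g) d) (Rmat 2 (Some g) d) u \<phi>"
      using w by (intro regular_block) auto
    then show ?thesis using that[of _ "Some _"] by (metis option.inject)
  qed
qed

lemma finite_Arho_index:
  fixes \<rho> :: "'k::field bform option \<Rightarrow> nat \<Rightarrow> nat"
  assumes "\<rho> \<in> Ftilde" shows "finite (Arho_index \<rho>)"
proof -
  have "Arho_index \<rho> \<subseteq> (SIGMA (g, d):{(g, d). \<rho> g d \<noteq> 0}. {..<\<rho> g d} \<times> {..<Rsize g d})"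
    by (auto simp: Arho_index_def)
  moreover have "finite (SIGMA (g, d):{(g, d). \<rho> g d \<noteq> 0}. {..<\<rho> g d} \<times> {..<Rsize g d})"
    using assms by (intro finite_SigmaI) (auto simp: Ftilde_def)
  ultimately show ?thesis by (rule finite_subset)
qed

definition Arho_basis :: "('k::field \<Rightarrow> 'v::ab_group_add \<Rightarrow> 'v) \<Rightarrow> ('v \<Rightarrow> 'v \<Rightarrow> 'k) \<Rightarrow> ('v \<Rightarrow> 'v \<Rightarrow> 'k)
    \<Rightarrow> 'v set \<Rightarrow> ('k bform option \<Rightarrow> nat \<Rightarrow> nat) \<Rightarrow> (('k bform option \<times> nat) \<times> nat \<times> nat \<Rightarrow> 'v) \<Rightarrow> bool" where
  "Arho_basis scale a b V \<rho> w \<longleftrightarrow> (\<forall>s\<in>Arho_index \<rho>. w s \<in> V) \<and>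
    (\<forall>s\<in>Arho_index \<rho>. \<forall>t\<in>Arho_index \<rho>. a (w s) (w t) = Arho 1 \<rho> s t \<and> b (w s) (w t) = Arho 2 \<rho> s t) \<and>
    (\<forall>x\<in>V. \<exists>c. x = (\<Sum>s\<in>Arho_index \<rho>. scale (c s) (w s))) \<and>
    (\<forall>c. (\<Sum>s\<in>Arho_index \<rho>. scale (c s) (w s)) = 0 \<longrightarrow> (\<forall>s\<in>Arho_index \<rho>. c s = 0))"

text \<open>Both forms of a block vector with y are combinations of the dual functionals at y. Their
  common kernel W is therefore a linear complement of the block and orthogonal to it, and the
  recursion continues with W.\<close>

theorem classification:
  fixes scale :: "'k::{field_gcd,finite} \<Rightarrow> 'v::ab_group_add \<Rightarrow> 'v"
  assumes "two_forms scale a b V"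
  shows "\<exists>\<rho>\<in>Ftilde. \<exists>w. Arho_basis scale a b V \<rho> w"
  using assms
proof (induction "card V" arbitrary: V rule: less_induct)
  case less
  interpret two_forms scale a b V by (rule less.prems)
  show ?case
  proof (cases "V = {0}")
    case True
    have "(\<lambda>_ _. 0) \<in> (Ftilde :: ('k bform option \<Rightarrow> nat \<Rightarrow> nat) set)" by (auto simp: Ftilde_def)
    moreover have "Arho_index (\<lambda>_ _. 0) = ({} :: (('k bform option \<times> nat) \<times> nat \<times> nat) set)"
      by (auto simp: Arho_index_def)
    ultimately show ?thesis using True by (intro bexI[of _ "\<lambda>_ _. 0"] exI[of _ "\<lambda>_. 0"]) (auto simp: Arho_basis_def)
  next
    case False
    then obtain x0 where "x0 \<in> V" "x0 \<noteq> 0" using V_0 by blast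
    then obtain og :: "'k bform option" and d u \<phi> where d: "d \<ge> 1" and og: "\<And>g. og = Some g \<Longrightarrow> g \<in> Pset"
      and blk: "is_block (Rsize og d) (Rmat 1 og d) (Rmat 2 og d) u \<phi>" using find_block by metis
    define n where "n = Rsize og d"
    have n: "n > 0" unfolding n_def using Rsize_pos d og by blast
    have uV: "u i \<in> V" if "i < n" for i using blk that by (auto simp: is_block_def n_def)
    have \<phi>: "\<phi> i (x + y) = \<phi> i x + \<phi> i y" "\<phi> i (scale c x) = c * \<phi> i x" if "i < n" for i x y c
      using blk that by (auto simp: is_block_def n_def)
    have \<phi>u: "\<phi> i (u j) = (if i = j then 1 else 0)" if "i < n" "j < n" for i j
      using blk that by (auto simp: is_block_def n_def)
    have au: "a (u j) y = (\<Sum>i<n. Rmat 1 og d j i * \<phi> i y)" "b (u j) y = (\<Sum>i<n. Rmat 2 og d j i * \<phi> i y)"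
      if "j < n" "y \<in> V" for j y using blk that by (auto simp: is_block_def n_def)
    have \<phi>0: "\<phi> i 0 = 0" if "i < n" for i using \<phi>(2)[OF that, of 0 0] by simp
    have \<phi>_sum: "\<phi> i (\<Sum>j\<in>J. g j) = (\<Sum>j\<in>J. \<phi> i (g j))" if "i < n" for i J and g :: "'j \<Rightarrow> 'v"
      by (induction J rule: infinite_finite_induct) (auto simp: \<phi> \<phi>0 that)
    define W where "W = {x\<in>V. \<forall>i<n. \<phi> i x = 0}"
    have WV: "W \<subseteq> V" by (auto simp: W_def)
    have "A.subspace W" by (rule A.subspaceI) (auto simp: W_def V_0 V_add V_scale \<phi> \<phi>0)
    hence W: "two_forms scale a b W" using finite_subset[OF WV finite_V] by unfold_locales
    have "u 0 \<notin> W" using \<phi>u[OF n n] n by (auto simp: W_def)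
    hence "card W < card V" using WV uV[OF n] finite_V by (intro psubset_card_mono) auto
    from less.hyps[OF this W] obtain \<rho>' :: "'k bform option \<Rightarrow> nat \<Rightarrow> nat" and w' where
      \<rho>': "\<rho>' \<in> Ftilde" and basis': "Arho_basis scale a b W \<rho>' w'" by blast
    note basis' = basis'[unfolded Arho_basis_def]
    note w'W = basis'[THEN conjunct1, rule_format]
    note gram = basis'[THEN conjunct2, THEN conjunct1, rule_format]
    note span' = basis'[THEN conjunct2, THEN conjunct2, THEN conjunct1, rule_format]
    note indep' = basis'[THEN conjunct2, THEN conjunct2, THEN conjunct2, rule_format]
    \<comment> \<open>Copies of a block are numbered from 0, so the number of copies already present
      is the label of the new one.\<close>
    define c0 where "c0 = \<rho>' og d"
    define \<rho> where "\<rho> = \<rho>'(og := (\<rho>' og)(d := Suc c0))"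
    have \<rho>_eq: "\<rho> g e = (if (g, e) = (og, d) then Suc c0 else \<rho>' g e)" for g e by (auto simp: \<rho>_def)
    define key where "key i = ((og, d), c0, i)" for i :: nat
    define I' where "I' = Arho_index \<rho>'"
    define B where "B = key ` {..<n}"
    have \<rho>: "\<rho> \<in> Ftilde"
    proof -
      have "{(g, e). \<rho> g e \<noteq> 0} \<subseteq> insert (og, d) {(g, e). \<rho>' g e \<noteq> 0}" by (auto simp: \<rho>_eq)
      hence "finite {(g, e). \<rho> g e \<noteq> 0}" using \<rho>' by (auto simp: Ftilde_def intro: finite_subset)
      thus ?thesis using \<rho>' d og by (auto simp: Ftilde_def \<rho>_eq)
    qed
    have idx: "Arho_index \<rho> = I' \<union> B"
      by (auto simp: Arho_index_def I'_def B_def key_def n_def \<rho>_eq c0_def less_Suc_eq split: if_splits)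
    have disj: "I' \<inter> B = {}" by (auto simp: Arho_index_def I'_def B_def key_def c0_def)
    have fin: "finite I'" "finite B" using finite_Arho_index[OF \<rho>'] by (auto simp: I'_def B_def)
    have inj: "inj_on key {..<n}" by (auto simp: inj_on_def key_def)
    define w where "w s = (if s \<in> I' then w' s else u (snd (snd s)))" for s
    have w_I: "w s = w' s" if "s \<in> I'" for s using that by (simp add: w_def)
    have w_B: "w (key i) = u i" if "i < n" for i
      using that disj by (auto simp: w_def B_def) (simp add: key_def)
    have sumB: "(\<Sum>s\<in>B. scale (c s) (w s)) = (\<Sum>i<n. scale (c (key i)) (u i))" for c
      unfolding B_def by (subst sum.reindex[OF inj]) (auto intro!: sum.cong simp: w_B)
    have split: "(\<Sum>s\<in>Arho_index \<rho>. scale (c s) (w s))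
        = (\<Sum>s\<in>I'. scale (c s) (w' s)) + (\<Sum>i<n. scale (c (key i)) (u i))" for c
      unfolding idx by (subst sum.union_disjoint[OF fin disj]) (simp add: sumB w_I cong: sum.cong)
    have uW: "a (u i) y = 0 \<and> b (u i) y = 0" if "i < n" "y \<in> W" for i y
      using au[of i y] that by (auto simp: W_def)
    have Wu: "a y (u i) = 0 \<and> b y (u i) = 0" if "i < n" "y \<in> W" for i y
      using uW[OF that] A.skew[of y "u i"] B.skew[of y "u i"] by auto
    have uu: "a (u i) (u j) = Rmat 1 og d i j \<and> b (u i) (u j) = Rmat 2 og d i j" if "i < n" "j < n" for i j
    proof -
      have "(\<Sum>l<n. C i l * \<phi> l (u j)) = (\<Sum>l<n. if l = j then C i l else 0)" for C :: "nat \<Rightarrow> nat \<Rightarrow> 'k"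
        using that by (intro sum.cong) (auto simp: \<phi>u)
      thus ?thesis using au[OF that(1) uV[OF that(2)]] that by simp
    qed
    have B_I: "Arho k \<rho> (key i) s = 0 \<and> Arho k \<rho> s (key i) = 0" if "s \<in> I'" for s i k
      using that by (auto simp: Arho_def key_def I'_def Arho_index_def c0_def)
    have Arho_eq: "Arho k \<rho> = Arho k \<rho>'" for k by (simp add: Arho_def)
    have gram_w: "a (w s) (w t) = Arho 1 \<rho> s t \<and> b (w s) (w t) = Arho 2 \<rho> s t"
      if st: "s \<in> I' \<union> B" "t \<in> I' \<union> B" for s t
    proof -
      consider "s \<in> I'" "t \<in> I'" | i where "t \<in> I'" "s = key i" "i < n"
        | i where "s \<in> I'" "t = key i" "i < n" | i j where "s = key i" "i < n" "t = key j" "j < n"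
        using st by (auto simp: B_def)
      thus ?thesis
      proof cases
        case 1
        then show ?thesis using gram[of s t] by (simp add: w_I Arho_eq) (simp add: I'_def)
      next
        case 2
        then show ?thesis using uW[of i "w' t"] w'W[of t] B_I[of t] by (simp add: w_I w_B) (simp add: I'_def)
      next
        case 3
        then show ?thesis using Wu[of i "w' s"] w'W[of s] B_I[of s] by (simp add: w_I w_B) (simp add: I'_def)
      next
        case 4
        then show ?thesis using uu[of i j] by (simp add: w_B) (simp add: Arho_def key_def)
      qed
    qed
    have wV: "w s \<in> V" if "s \<in> I' \<union> B" for s
      using that w'W[of s] WV uV by (auto simp: B_def w_B w_I) (auto simp: I'_def)
    have span: "\<exists>c. x = (\<Sum>s\<in>Arho_index \<rho>. scale (c s) (w s))" if x: "x \<in> V" for x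
    proof -
      define y where "y = x - (\<Sum>i<n. scale (\<phi> i x) (u i))"
      have xy: "x = y + (\<Sum>i<n. scale (\<phi> i x) (u i))" by (simp add: y_def)
      have "\<phi> i y = 0" if i: "i < n" for i
      proof -
        have "\<phi> i x = \<phi> i y + (\<Sum>j<n. \<phi> j x * \<phi> i (u j))"
          using i by (subst xy) (simp add: \<phi> \<phi>_sum)
        also have "(\<Sum>j<n. \<phi> j x * \<phi> i (u j)) = (\<Sum>j<n. if j = i then \<phi> j x else 0)"
          using i by (intro sum.cong) (auto simp: \<phi>u)
        finally show ?thesis using i by simp
      qed
      moreover have "y \<in> V" unfolding y_def using x by (intro V_diff V_sum V_scale uV) auto
      ultimately have "y \<in> W" by (simp add: W_def)
      then obtain c where c: "y = (\<Sum>s\<in>I'. scale (c s) (w' s))" using span' unfolding I'_def by blast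
      define c' where "c' s = (if s \<in> I' then c s else \<phi> (snd (snd s)) x)" for s
      have "c' (key i) = \<phi> i x" if "i < n" for i using disj that by (auto simp: c'_def B_def) (simp add: key_def)
      moreover have "c' s = c s" if "s \<in> I'" for s using that by (simp add: c'_def)
      ultimately have "x = (\<Sum>s\<in>Arho_index \<rho>. scale (c' s) (w s))"
        unfolding split by (subst xy) (simp add: c cong: sum.cong_simp)
      thus ?thesis by blast
    qed
    have indep: "c s = 0" if 0: "(\<Sum>s\<in>Arho_index \<rho>. scale (c s) (w s)) = 0" and s: "s \<in> I' \<union> B" for c s
    proof -
      define y where "y = (\<Sum>s\<in>I'. scale (c s) (w' s))"
      have eq: "y + (\<Sum>i<n. scale (c (key i)) (u i)) = 0" using 0 unfolding split y_def .
      have y\<phi>: "\<phi> i y = 0" if "i < n" for i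
        using w'W that unfolding y_def by (auto simp: \<phi>_sum \<phi> W_def I'_def intro!: sum.neutral)
      have cB: "c (key i) = 0" if i: "i < n" for i
      proof -
        have "0 = \<phi> i (y + (\<Sum>i<n. scale (c (key i)) (u i)))" using \<phi>0[OF i] by (simp add: eq)
        also have "\<dots> = (\<Sum>j<n. c (key j) * \<phi> i (u j))" using i by (simp add: \<phi> \<phi>_sum y\<phi>)
        also have "\<dots> = (\<Sum>j<n. if j = i then c (key j) else 0)"
          using i by (intro sum.cong) (auto simp: \<phi>u)
        finally show ?thesis using i by simp
      qed
      hence "y = 0" using eq by simp
      thus ?thesis using s indep'[of c s] cB by (auto simp: y_def I'_def B_def)
    qed
    show ?thesis
    proof (intro bexI[OF _ \<rho>] exI[of _ w])
      show "Arho_basis scale a b V \<rho> w"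
        unfolding Arho_basis_def using wV gram_w span indep by (intro conjI ballI allI impI) (auto simp: idx)
    qed
  qed
qed

section \<open>Pairs of matrices and their congruence\<close>

definition funs_on :: "'i set \<Rightarrow> ('i \<Rightarrow> 'k::zero) set" where
  "funs_on I = {x. \<forall>i. i \<notin> I \<longrightarrow> x i = 0}"

definition bil :: "'i set \<Rightarrow> ('i \<Rightarrow> 'i \<Rightarrow> 'k::field) \<Rightarrow> ('i \<Rightarrow> 'k) \<Rightarrow> ('i \<Rightarrow> 'k) \<Rightarrow> 'k" where
  "bil I A x y = (\<Sum>i\<in>I. \<Sum>j\<in>I. x i * A i j * y j)"

definition skew_on :: "'i set \<Rightarrow> ('i \<Rightarrow> 'i \<Rightarrow> 'k::field) \<Rightarrow> bool" where
  "skew_on I A \<longleftrightarrow> (\<forall>i\<in>I. \<forall>j\<in>I. A i j = - A j i)"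

text \<open>M^T A M = C and M^T B M = D with M invertible. The inverse M' is part of the data, since
  the index sets may have different types and no square matrix is available.\<close>

definition congruence_matrices :: "'i set \<Rightarrow> ('i \<Rightarrow> 'i \<Rightarrow> 'k::field) \<Rightarrow> ('i \<Rightarrow> 'i \<Rightarrow> 'k)
    \<Rightarrow> 'j set \<Rightarrow> ('j \<Rightarrow> 'j \<Rightarrow> 'k) \<Rightarrow> ('j \<Rightarrow> 'j \<Rightarrow> 'k) \<Rightarrow> ('i \<Rightarrow> 'j \<Rightarrow> 'k) \<Rightarrow> ('j \<Rightarrow> 'i \<Rightarrow> 'k) \<Rightarrow> bool" where
  "congruence_matrices I A B J C D M M' \<longleftrightarrow>
     (\<forall>s\<in>J. \<forall>t\<in>J. (\<Sum>i\<in>I. \<Sum>j\<in>I. M i s * A i j * M j t) = C s t) \<and>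
     (\<forall>s\<in>J. \<forall>t\<in>J. (\<Sum>i\<in>I. \<Sum>j\<in>I. M i s * B i j * M j t) = D s t) \<and>
     (\<forall>i\<in>I. \<forall>i'\<in>I. (\<Sum>s\<in>J. M i s * M' s i') = (if i = i' then 1 else 0)) \<and>
     (\<forall>s\<in>J. \<forall>s'\<in>J. (\<Sum>i\<in>I. M' s i * M i s') = (if s = s' then 1 else 0))"

lemma congruence_matricesD:
  assumes "congruence_matrices I A B J C D M M'"
  shows "\<And>s t. s \<in> J \<Longrightarrow> t \<in> J \<Longrightarrow> (\<Sum>i\<in>I. \<Sum>j\<in>I. M i s * A i j * M j t) = C s t"
    "\<And>s t. s \<in> J \<Longrightarrow> t \<in> J \<Longrightarrow> (\<Sum>i\<in>I. \<Sum>j\<in>I. M i s * B i j * M j t) = D s t"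
    "\<And>i i'. i \<in> I \<Longrightarrow> i' \<in> I \<Longrightarrow> (\<Sum>s\<in>J. M i s * M' s i') = (if i = i' then 1 else 0)"
    "\<And>s s'. s \<in> J \<Longrightarrow> s' \<in> J \<Longrightarrow> (\<Sum>i\<in>I. M' s i * M i s') = (if s = s' then 1 else 0)"
  using assms by (simp_all add: congruence_matrices_def)

definition congruent_pairs :: "'i set \<Rightarrow> ('i \<Rightarrow> 'i \<Rightarrow> 'k::field) \<Rightarrow> ('i \<Rightarrow> 'i \<Rightarrow> 'k)
    \<Rightarrow> 'j set \<Rightarrow> ('j \<Rightarrow> 'j \<Rightarrow> 'k) \<Rightarrow> ('j \<Rightarrow> 'j \<Rightarrow> 'k) \<Rightarrow> bool" where
  "congruent_pairs I A B J C D \<longleftrightarrow> (\<exists>M M'. congruence_matrices I A B J C D M M')"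

text \<open>M has the basis vectors as columns, and M' holds the coordinates of the unit vectors.
  One product is the identity by this choice, the other one by independence.\<close>

lemma congruent_pairs_of_basis:
  assumes fin: "finite I" "finite J"
    and gram: "\<forall>s\<in>J. \<forall>t\<in>J. bil I A (w s) (w t) = C s t \<and> bil I B (w s) (w t) = D s t"
    and span: "\<forall>x\<in>funs_on I. \<exists>c. \<forall>i\<in>I. x i = (\<Sum>s\<in>J. c s * w s i)"
    and indep0: "\<forall>c. (\<forall>i\<in>I. (\<Sum>s\<in>J. c s * w s i) = 0) \<longrightarrow> (\<forall>s\<in>J. c s = 0)"
  shows "congruent_pairs I A B J C D"
proof -
  have indep: "c s = 0" if "\<And>i. i \<in> I \<Longrightarrow> (\<Sum>s\<in>J. c s * w s i) = 0" "s \<in> J" for c s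
    using indep0 that by blast
  have "\<exists>c. \<forall>i\<in>I. (if i = i' then 1 else 0) = (\<Sum>s\<in>J. c s * w s i)" if "i' \<in> I" for i'
    using span[rule_format, of "\<lambda>i. if i = i' then 1 else 0"] that by (auto simp: funs_on_def)
  then obtain N where N: "\<And>i i'. i \<in> I \<Longrightarrow> i' \<in> I \<Longrightarrow> (if i = i' then 1 else 0) = (\<Sum>s\<in>J. N i' s * w s i)"
    by metis
  have "(\<Sum>i\<in>I. N i s * w s' i) = (if s = s' then 1 else 0)" if s: "s \<in> J" "s' \<in> J" for s s'
  proof -
    have "(\<Sum>i\<in>I. N i s * w s' i) - (if s = s' then 1 else 0) = 0"
    proof (rule indep[where c = "\<lambda>s. (\<Sum>i\<in>I. N i s * w s' i) - (if s = s' then 1 else 0)"])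
      fix i0 assume i0: "i0 \<in> I"
      have "(\<Sum>s\<in>J. ((\<Sum>i\<in>I. N i s * w s' i) - (if s = s' then 1 else 0)) * w s i0)
          = (\<Sum>s\<in>J. (\<Sum>i\<in>I. N i s * w s' i) * w s i0) - (\<Sum>s\<in>J. if s = s' then w s i0 else 0)"
        by (auto simp: left_diff_distrib sum_subtractf[symmetric] intro!: sum.cong)
      also have "(\<Sum>s\<in>J. (\<Sum>i\<in>I. N i s * w s' i) * w s i0) = (\<Sum>i\<in>I. w s' i * (\<Sum>s\<in>J. N i s * w s i0))"
        by (simp add: sum_distrib_left sum_distrib_right sum.swap[of _ J I] mult_ac)
      also have "\<dots> = (\<Sum>i\<in>I. if i = i0 then w s' i else 0)"
        using N i0 by (intro sum.cong) (auto simp: N[symmetric])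
      finally show "(\<Sum>s\<in>J. ((\<Sum>i\<in>I. N i s * w s' i) - (if s = s' then 1 else 0)) * w s i0) = 0"
        using fin i0 s by simp
    qed (rule s)
    thus ?thesis by simp
  qed
  thus ?thesis unfolding congruent_pairs_def congruence_matrices_def
    using gram N by (intro exI[of _ "\<lambda>i s. w s i"] exI[of _ "\<lambda>s i. N i s"])
      (auto simp: bil_def mult.commute[of "w _ _" "N _ _"])
qed

lemma sum_fun_apply: "(\<Sum>s\<in>J. f s) i = (\<Sum>s\<in>J. f s i)"
  by (induction J rule: infinite_finite_induct) auto

lemma finite_funs_on: "finite I \<Longrightarrow> finite (funs_on I :: ('i \<Rightarrow> 'k::{zero,finite}) set)"
  using finite_set_of_finite_funs[of I "UNIV :: 'k set" 0] by (simp add: funs_on_def)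

text \<open>Skew-symmetry alone gives 2 bil x x = 0, so the characteristic must differ from 2 for
  the form to be alternating.\<close>

lemma alt_form_bil:
  fixes A :: "'i \<Rightarrow> 'i \<Rightarrow> 'k::{field_gcd,finite}"
  assumes "skew_on I A" "(2::'k) \<noteq> 0"
  shows "alt_form (\<lambda>c x i. c * x i) (bil I A)"
proof
  have skew: "bil I A x y = - bil I A y x" for x y
  proof -
    have "bil I A x y = (\<Sum>i\<in>I. \<Sum>j\<in>I. - (y j * A j i * x i))"
      unfolding bil_def
    proof (intro sum.cong refl)
      fix i j assume "i \<in> I" "j \<in> I"
      hence A: "A i j = - A j i" using assms(1) unfolding skew_on_def by blast
      show "x i * A i j * y j = - (y j * A j i * x i)" by (subst A) (simp add: mult_ac)
    qed
    also have "\<dots> = - bil I A y x"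
      unfolding bil_def by (subst sum.swap) (simp add: sum_negf)
    finally show ?thesis .
  qed
  show "bil I A x y = - bil I A y x" for x y by (rule skew)
  have "2 * bil I A x x = 0" for x using skew[of x x] by simp
  thus "bil I A x x = 0" for x using assms(2) by simp
qed (auto simp: bil_def fun_eq_iff algebra_simps sum.distrib sum_distrib_left)

lemma congruent_pairs_of_Arho_basis:
  fixes A B :: "'i \<Rightarrow> 'i \<Rightarrow> 'k::field"
  assumes "finite I" and \<rho>: "\<rho> \<in> Ftilde"
    and basis: "Arho_basis (\<lambda>c x i. c * x i) (bil I A) (bil I B) (funs_on I) \<rho> w"
  shows "congruent_pairs I A B (Arho_index \<rho>) (Arho 1 \<rho>) (Arho 2 \<rho>)"
proof -
  note basis = basis[unfolded Arho_basis_def]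
  note w = basis[THEN conjunct1]
  note gram = basis[THEN conjunct2, THEN conjunct1]
  note span = basis[THEN conjunct2, THEN conjunct2, THEN conjunct1]
  note indep = basis[THEN conjunct2, THEN conjunct2, THEN conjunct2]
  have span': "\<forall>x\<in>funs_on I. \<exists>c. \<forall>i\<in>I. x i = (\<Sum>s\<in>Arho_index \<rho>. c s * w s i)"
  proof
    fix x :: "'i \<Rightarrow> 'k" assume x: "x \<in> funs_on I"
    obtain c where "x = (\<Sum>s\<in>Arho_index \<rho>. (\<lambda>i. c s * w s i))" using span x by blast
    hence "\<forall>i. x i = (\<Sum>s\<in>Arho_index \<rho>. c s * w s i)" by (simp add: sum_fun_apply)
    thus "\<exists>c. \<forall>i\<in>I. x i = (\<Sum>s\<in>Arho_index \<rho>. c s * w s i)" by blast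
  qed
  have indep': "\<forall>c. (\<forall>i\<in>I. (\<Sum>s\<in>Arho_index \<rho>. c s * w s i) = 0) \<longrightarrow> (\<forall>s\<in>Arho_index \<rho>. c s = 0)"
  proof (intro allI impI)
    fix c assume 0: "\<forall>i\<in>I. (\<Sum>s\<in>Arho_index \<rho>. c s * w s i) = 0"
    have "(\<Sum>s\<in>Arho_index \<rho>. (\<lambda>i. c s * w s i)) = 0"
    proof (rule ext)
      show "(\<Sum>s\<in>Arho_index \<rho>. (\<lambda>i. c s * w s i)) i = 0 i" for i
        using 0 w by (cases "i \<in> I") (auto simp: sum_fun_apply funs_on_def intro!: sum.neutral)
    qed
    thus "\<forall>s\<in>Arho_index \<rho>. c s = 0" using indep by blast
  qed
  show ?thesis
    by (rule congruent_pairs_of_basis[OF assms(1) finite_Arho_index[OF \<rho>] gram span' indep'])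
qed

theorem pair_classification:
  fixes A B :: "'i \<Rightarrow> 'i \<Rightarrow> 'k::{field_gcd,finite}"
  assumes "finite I" "skew_on I A" "skew_on I B" "(2::'k) \<noteq> 0"
  shows "\<exists>\<rho>\<in>Ftilde. congruent_pairs I A B (Arho_index \<rho>) (Arho 1 \<rho>) (Arho 2 \<rho>)"
proof -
  have forms: "two_forms (\<lambda>c x i. c * x i) (bil I A) (bil I B) (funs_on I)"
  proof (intro two_forms.intro two_forms_axioms.intro)
    show "alt_form (\<lambda>c x i. c * x i) (bil I A)" "alt_form (\<lambda>c x i. c * x i) (bil I B)"
      using assms by (auto intro: alt_form_bil)
    then interpret alt_form "\<lambda>c x i. c * x i" "bil I A" by simp
    show "subspace (funs_on I)" by (rule subspaceI) (auto simp: funs_on_def)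
    show "finite (funs_on I :: ('i \<Rightarrow> 'k) set)" using assms(1) by (rule finite_funs_on)
  qed
  show ?thesis
    by (rule bexE[OF classification[OF forms]], erule exE, rule bexI)
       (rule congruent_pairs_of_Arho_basis[OF assms(1)])
qed

subsection \<open>Polynomial solutions of a pencil\<close>

text \<open>This is x1 A - x2 B at x1 = x and x2 = 1.\<close>

definition pencil :: "('i \<Rightarrow> 'j \<Rightarrow> 'k::field) \<Rightarrow> ('i \<Rightarrow> 'j \<Rightarrow> 'k) \<Rightarrow> 'i \<Rightarrow> 'j \<Rightarrow> 'k poly" where
  "pencil A B i j = [:- B i j, A i j:]"

text \<open>In homogeneous terms v consists of forms of degree k and h is a form of degree k + 1;
  thus h = 1 stands for x2^(k+1), and h = 0 gives the kernel of the pencil. Allowing an arbitrary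
  constant in each row makes the count invariant under base change.\<close>

definition psol :: "'i set \<Rightarrow> 'j set \<Rightarrow> ('i \<Rightarrow> 'j \<Rightarrow> 'k::field poly) \<Rightarrow> nat \<Rightarrow> 'k poly \<Rightarrow> ('j \<Rightarrow> 'k poly) set" where
  "psol I J L k h = {v\<in>funs_on J. (\<forall>j. degree (v j) \<le> k) \<and> (\<forall>i\<in>I. \<exists>c. (\<Sum>j\<in>J. L i j * v j) = smult c h)}"

lemma psolI:
  assumes "\<And>j. j \<notin> J \<Longrightarrow> v j = 0" "\<And>j. j \<in> J \<Longrightarrow> degree (v j) \<le> k"
    "\<And>i. i \<in> I \<Longrightarrow> \<exists>c. (\<Sum>j\<in>J. L i j * v j) = smult c h"
  shows "v \<in> psol I J L k h"
proof -
  have "degree (v j) \<le> k" for j using assms(1,2) by (cases "j \<in> J") auto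
  thus ?thesis using assms by (auto simp: psol_def funs_on_def)
qed

lemma psolD:
  assumes "v \<in> psol I J L k h"
  shows "\<And>j. j \<notin> J \<Longrightarrow> v j = 0" "\<And>j. degree (v j) \<le> k"
    "\<And>i. i \<in> I \<Longrightarrow> \<exists>c. (\<Sum>j\<in>J. L i j * v j) = smult c h"
  using assms by (auto simp: psol_def funs_on_def)

lemma psol_cong:
  assumes "\<And>i j. i \<in> I \<Longrightarrow> j \<in> J \<Longrightarrow> L i j = L' i j"
  shows "psol I J L k h = psol I J L' k h"
proof -
  have "(\<Sum>j\<in>J. L i j * v j) = (\<Sum>j\<in>J. L' i j * v j)" if "i \<in> I" for i v
    using assms that by (intro sum.cong) auto
  thus ?thesis by (auto simp: psol_def)
qed

lemma psol_uminus: "psol I J (\<lambda>i j. - L i j) k h = psol I J L k h"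
proof -
  have "(\<exists>c. (\<Sum>j\<in>J. - L i j * v j) = smult c h) \<longleftrightarrow> (\<exists>c. (\<Sum>j\<in>J. L i j * v j) = smult c h)" for i v
  proof -
    have e: "(\<Sum>j\<in>J. - L i j * v j) = - (\<Sum>j\<in>J. L i j * v j)" by (simp add: sum_negf)
    have 1: "\<exists>c. S = smult c h" if "- S = smult c h" for S c
      using that[symmetric] by (intro exI[of _ "- c"]) simp
    have 2: "\<exists>c. - S = smult c h" if "S = smult c h" for S c
      using that by (intro exI[of _ "- c"]) simp
    show ?thesis unfolding e by (rule iffI, erule exE, erule 1, erule exE, erule 2)
  qed
  thus ?thesis by (simp add: psol_def)
qed

lemma psol_zero: "(\<lambda>_. 0) \<in> psol I J L k h"
  by (rule psolI) (auto intro: exI[of _ 0])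

lemma psol_trivial:
  assumes "\<And>v j. v \<in> psol I J L k h \<Longrightarrow> j \<in> J \<Longrightarrow> v j = 0"
  shows "card (psol I J L k h) = 1"
proof -
  have "v = (\<lambda>_. 0)" if "v \<in> psol I J L k h" for v
  proof
    show "v j = 0" for j using assms[OF that] psolD(1)[OF that] by (cases "j \<in> J") auto
  qed
  hence "psol I J L k h = {\<lambda>_. 0}" using psol_zero by fastforce
  thus ?thesis by simp
qed

text \<open>Every row has its own constant c, so the blocks share nothing but h and their solutions
  combine freely.\<close>

lemma psol_split:
  fixes L :: "'i \<Rightarrow> 'j \<Rightarrow> 'k::field poly"
  assumes fin: "finite J1" "finite J2" and disj: "J1 \<inter> J2 = {}"
    and z: "\<And>i j. i \<in> I1 \<Longrightarrow> j \<in> J2 \<Longrightarrow> L i j = 0" "\<And>i j. i \<in> I2 \<Longrightarrow> j \<in> J1 \<Longrightarrow> L i j = 0"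
  shows "card (psol (I1 \<union> I2) (J1 \<union> J2) L k h) = card (psol I1 J1 L k h) * card (psol I2 J2 L k h)"
proof -
  define F where "F = (\<lambda>(u :: 'j \<Rightarrow> 'k poly, w). \<lambda>j. if j \<in> J1 then u j else w j)"
  have s1: "(\<Sum>j\<in>J1 \<union> J2. L i j * v j) = (\<Sum>j\<in>J1. L i j * v j)" if "i \<in> I1" for i v
    using that z(1) by (subst sum.union_disjoint[OF fin disj]) auto
  have s2: "(\<Sum>j\<in>J1 \<union> J2. L i j * v j) = (\<Sum>j\<in>J2. L i j * v j)" if "i \<in> I2" for i v
    using that z(2) by (subst sum.union_disjoint[OF fin disj]) auto
  have c1: "(\<Sum>j\<in>J1. L i j * (if j \<in> J1 then u j else w j)) = (\<Sum>j\<in>J1. L i j * u j)" for i u w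
    by (intro sum.cong) auto
  have c2: "(\<Sum>j\<in>J2. L i j * (if j \<in> J1 then u j else w j)) = (\<Sum>j\<in>J2. L i j * w j)" for i u w
    using disj by (intro sum.cong) auto
  have c3: "(\<Sum>j\<in>J2. L i j * (if j \<in> J2 then u j else w j)) = (\<Sum>j\<in>J2. L i j * u j)" for i u w
    by (intro sum.cong) auto
  have "bij_betw F (psol I1 J1 L k h \<times> psol I2 J2 L k h) (psol (I1 \<union> I2) (J1 \<union> J2) L k h)"
  proof (rule bij_betw_byWitness[where f' = "\<lambda>v. (\<lambda>j. if j \<in> J1 then v j else 0, \<lambda>j. if j \<in> J2 then v j else 0)"])
    show "F ` (psol I1 J1 L k h \<times> psol I2 J2 L k h) \<subseteq> psol (I1 \<union> I2) (J1 \<union> J2) L k h"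
    proof clarify
      fix u w assume u: "u \<in> psol I1 J1 L k h" and w: "w \<in> psol I2 J2 L k h"
      show "F (u, w) \<in> psol (I1 \<union> I2) (J1 \<union> J2) L k h"
      proof (rule psolI)
        show "\<exists>c. (\<Sum>j\<in>J1 \<union> J2. L i j * F (u, w) j) = smult c h" if "i \<in> I1 \<union> I2" for i
          using that psolD(3)[OF u, of i] psolD(3)[OF w, of i] by (auto simp: F_def s1 s2 c1 c2)
      qed (use psolD(1,2)[OF u] psolD(1,2)[OF w] in \<open>auto simp: F_def\<close>)
    qed
    show "(\<lambda>v. (\<lambda>j. if j \<in> J1 then v j else 0, \<lambda>j. if j \<in> J2 then v j else 0)) ` psol (I1 \<union> I2) (J1 \<union> J2) L k h
        \<subseteq> psol I1 J1 L k h \<times> psol I2 J2 L k h"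
    proof (clarify, intro conjI SigmaI)
      fix v assume v: "v \<in> psol (I1 \<union> I2) (J1 \<union> J2) L k h"
      show "(\<lambda>j. if j \<in> J1 then v j else 0) \<in> psol I1 J1 L k h"
      proof (rule psolI)
        show "\<exists>c. (\<Sum>j\<in>J1. L i j * (if j \<in> J1 then v j else 0)) = smult c h" if "i \<in> I1" for i
          using psolD(3)[OF v, of i] s1[OF that, of v] that by (simp add: c1)
      qed (use psolD(2)[OF v] in auto)
      show "(\<lambda>j. if j \<in> J2 then v j else 0) \<in> psol I2 J2 L k h"
      proof (rule psolI)
        show "\<exists>c. (\<Sum>j\<in>J2. L i j * (if j \<in> J2 then v j else 0)) = smult c h" if "i \<in> I2" for i
          using psolD(3)[OF v, of i] s2[OF that, of v] that by (simp add: c3)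
      qed (use psolD(2)[OF v] in auto)
    qed
    show "\<forall>x\<in>psol I1 J1 L k h \<times> psol I2 J2 L k h.
        (\<lambda>j. if j \<in> J1 then F x j else 0, \<lambda>j. if j \<in> J2 then F x j else 0) = x"
      using disj by (auto simp: F_def fun_eq_iff dest: psolD(1))
    show "\<forall>v\<in>psol (I1 \<union> I2) (J1 \<union> J2) L k h. F (\<lambda>j. if j \<in> J1 then v j else 0, \<lambda>j. if j \<in> J2 then v j else 0) = v"
      by (auto simp: F_def fun_eq_iff dest: psolD(1))
  qed
  from bij_betw_same_card[OF this] show ?thesis by (simp add: card_cartesian_product)
qed

lemma psol_reindex:
  fixes L :: "'s \<Rightarrow> 't \<Rightarrow> 'k::field poly" and f :: "'i \<Rightarrow> 's" and g :: "'j \<Rightarrow> 't"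
  assumes inj: "inj_on g J"
  shows "card (psol (f ` I) (g ` J) L k h) = card (psol I J (\<lambda>i j. L (f i) (g j)) k h)"
proof -
  define F where "F v = (\<lambda>j. if j \<in> J then v (g j) else 0)" for v :: "'t \<Rightarrow> 'k poly"
  define F' where "F' v = (\<lambda>s. if s \<in> g ` J then v (inv_into J g s) else 0)" for v :: "'j \<Rightarrow> 'k poly"
  have s: "(\<Sum>j\<in>g ` J. L i j * v j) = (\<Sum>j\<in>J. L i (g j) * v (g j))" for i v
    by (subst sum.reindex[OF inj]) simp
  have "bij_betw F (psol (f ` I) (g ` J) L k h) (psol I J (\<lambda>i j. L (f i) (g j)) k h)"
  proof (rule bij_betw_byWitness[where f' = F'])
    show "F ` psol (f ` I) (g ` J) L k h \<subseteq> psol I J (\<lambda>i j. L (f i) (g j)) k h"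
    proof clarify
      fix v assume v: "v \<in> psol (f ` I) (g ` J) L k h"
      have c: "(\<Sum>j\<in>J. L i (g j) * F v j) = (\<Sum>j\<in>J. L i (g j) * v (g j))" for i
        by (intro sum.cong) (auto simp: F_def)
      show "F v \<in> psol I J (\<lambda>i j. L (f i) (g j)) k h"
      proof (rule psolI)
        show "\<exists>c. (\<Sum>j\<in>J. L (f i) (g j) * F v j) = smult c h" if "i \<in> I" for i
          using psolD(3)[OF v, of "f i"] that unfolding c s by blast
      qed (use psolD(2)[OF v] in \<open>auto simp: F_def\<close>)
    qed
    show "F' ` psol I J (\<lambda>i j. L (f i) (g j)) k h \<subseteq> psol (f ` I) (g ` J) L k h"
    proof clarify
      fix v assume v: "v \<in> psol I J (\<lambda>i j. L (f i) (g j)) k h"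
      have c: "(\<Sum>j\<in>J. L i (g j) * F' v (g j)) = (\<Sum>j\<in>J. L i (g j) * v j)" for i
        using inj by (intro sum.cong) (auto simp: F'_def)
      show "F' v \<in> psol (f ` I) (g ` J) L k h"
      proof (rule psolI)
        show "\<exists>c. (\<Sum>j\<in>g ` J. L i j * F' v j) = smult c h" if "i \<in> f ` I" for i
          using psolD(3)[OF v] that unfolding s c by blast
      qed (use psolD(2)[OF v] in \<open>auto simp: F'_def\<close>)
    qed
    show "\<forall>v\<in>psol (f ` I) (g ` J) L k h. F' (F v) = v"
    proof (intro ballI ext)
      fix v s assume v: "v \<in> psol (f ` I) (g ` J) L k h"
      show "F' (F v) s = v s"
        using psolD(1)[OF v, of s] by (auto simp: F_def F'_def f_inv_into_f inv_into_into)
    qed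
    show "\<forall>v\<in>psol I J (\<lambda>i j. L (f i) (g j)) k h. F (F' v) = v"
      using inj by (auto simp: F_def F'_def fun_eq_iff dest: psolD(1))
  qed
  thus ?thesis by (rule bij_betw_same_card)
qed

lemma psol_Union:
  assumes "finite S" "\<And>b. b \<in> S \<Longrightarrow> finite (N b)"
    and "\<And>b b'. b \<in> S \<Longrightarrow> b' \<in> S \<Longrightarrow> b \<noteq> b' \<Longrightarrow> N b \<inter> N b' = {}"
    and "\<And>b b' i j. b \<in> S \<Longrightarrow> b' \<in> S \<Longrightarrow> b \<noteq> b' \<Longrightarrow> i \<in> N b \<Longrightarrow> j \<in> N b' \<Longrightarrow> L i j = 0"
  shows "card (psol (\<Union>b\<in>S. N b) (\<Union>b\<in>S. N b) L k h) = (\<Prod>b\<in>S. card (psol (N b) (N b) L k h))"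
  using assms
proof (induction S rule: finite_induct)
  case empty
  show ?case using psol_trivial[of "{}" "{}" L k h] by simp
next
  case (insert b S)
  have ne: "b' \<noteq> b" if "b' \<in> S" for b' using insert.hyps that by auto
  have "card (psol (N b \<union> (\<Union>b\<in>S. N b)) (N b \<union> (\<Union>b\<in>S. N b)) L k h)
      = card (psol (N b) (N b) L k h) * card (psol (\<Union>b\<in>S. N b) (\<Union>b\<in>S. N b) L k h)"
  proof (rule psol_split)
    show "finite (N b)" "finite (\<Union>b\<in>S. N b)" using insert.hyps insert.prems(1) by auto
    show "N b \<inter> (\<Union>b\<in>S. N b) = {}" using insert.prems(2) ne by blast
    show "L i j = 0" if "i \<in> N b" "j \<in> (\<Union>b\<in>S. N b)" for i j
      using that insert.prems(3)[of b] ne by blast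
    show "L i j = 0" if "i \<in> (\<Union>b\<in>S. N b)" "j \<in> N b" for i j
      using that insert.prems(3)[of _ b] ne by blast
  qed
  also have "card (psol (\<Union>b\<in>S. N b) (\<Union>b\<in>S. N b) L k h) = (\<Prod>b\<in>S. card (psol (N b) (N b) L k h))"
  proof (rule insert.IH)
    show "finite (N b)" if "b \<in> S" for b using that insert.prems(1) by simp
    show "N b \<inter> N b' = {}" if "b \<in> S" "b' \<in> S" "b \<noteq> b'" for b b'
      using that by (intro insert.prems(2)) auto
    show "L i j = 0" if "b \<in> S" "b' \<in> S" "b \<noteq> b'" "i \<in> N b" "j \<in> N b'" for b b' i j
      using that insert.prems(3)[of b b' i j] by simp
  qed
  finally show ?case using insert.hyps by simp
qed

lemma sum_pCons2: "(\<Sum>i\<in>I. [:f i, g i:]) = [:\<Sum>i\<in>I. f i, \<Sum>i\<in>I. g i:]"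
  by (induction I rule: infinite_finite_induct) auto

text \<open>Constant invertible matrices preserve the degree bound as well as the space of constant
  vectors times h.\<close>

lemma psol_congruent:
  fixes A B :: "'i \<Rightarrow> 'i \<Rightarrow> 'k::field" and C D :: "'j \<Rightarrow> 'j \<Rightarrow> 'k"
  assumes "congruent_pairs I A B J C D" and fin: "finite I" "finite J"
  shows "card (psol J J (pencil C D) k h) = card (psol I I (pencil A B) k h)"
proof -
  obtain M M' where M: "congruence_matrices I A B J C D M M'"
    using assms(1) unfolding congruent_pairs_def by blast
  note C = congruence_matricesD(1)[OF M] and D = congruence_matricesD(2)[OF M]
    and MM' = congruence_matricesD(3)[OF M] and M'M = congruence_matricesD(4)[OF M]
  define P where "P i s = [:M i s:]" for i s
  define P' where "P' s i = [:M' s i:]" for s i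
  have sum0: "(\<Sum>i\<in>K. [:f i:]) = [:\<Sum>i\<in>K. f i:]" for K :: "'x set" and f :: "'x \<Rightarrow> 'k"
    by (induction K rule: infinite_finite_induct) auto
  have PP': "(\<Sum>s\<in>J. P i s * P' s i') = (if i = i' then 1 else 0)" if "i \<in> I" "i' \<in> I" for i i'
    using MM'[OF that] by (simp add: P_def P'_def sum0 one_pCons mult.commute split: if_splits)
  have P'P: "(\<Sum>i\<in>I. P' s i * P i s') = (if s = s' then 1 else 0)" if "s \<in> J" "s' \<in> J" for s s'
    using M'M[OF that] by (simp add: P_def P'_def sum0 one_pCons mult.commute split: if_splits)
  have pen: "pencil C D s t = (\<Sum>i\<in>I. \<Sum>j\<in>I. P i s * pencil A B i j * P j t)" if "s \<in> J" "t \<in> J" for s t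
  proof -
    have "P i s * pencil A B i j * P j t = [:- (M i s * B i j * M j t), M i s * A i j * M j t:]" for i j
      by (simp add: P_def pencil_def mult_ac)
    hence "(\<Sum>i\<in>I. \<Sum>j\<in>I. P i s * pencil A B i j * P j t)
       = [:- (\<Sum>i\<in>I. \<Sum>j\<in>I. M i s * B i j * M j t), \<Sum>i\<in>I. \<Sum>j\<in>I. M i s * A i j * M j t:]"
      by (simp add: sum_pCons2 sum_negf)
    thus ?thesis using C[OF that] D[OF that] by (simp add: pencil_def)
  qed
  define F where "F v = (\<lambda>i. if i \<in> I then \<Sum>s\<in>J. P i s * v s else 0)" for v
  define F' where "F' u = (\<lambda>s. if s \<in> J then \<Sum>i\<in>I. P' s i * u i else 0)" for u
  have row: "(\<Sum>t\<in>J. pencil C D s t * v t) = (\<Sum>i\<in>I. P i s * (\<Sum>j\<in>I. pencil A B i j * F v j))"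
    if "s \<in> J" for s v
  proof -
    have "(\<Sum>t\<in>J. pencil C D s t * v t) = (\<Sum>t\<in>J. \<Sum>i\<in>I. \<Sum>j\<in>I. P i s * pencil A B i j * P j t * v t)"
      using that by (intro sum.cong) (auto simp: pen sum_distrib_right)
    also have "\<dots> = (\<Sum>i\<in>I. \<Sum>t\<in>J. \<Sum>j\<in>I. P i s * pencil A B i j * P j t * v t)"
      by (rule sum.swap)
    also have "\<dots> = (\<Sum>i\<in>I. \<Sum>j\<in>I. \<Sum>t\<in>J. P i s * pencil A B i j * P j t * v t)"
      by (intro sum.cong refl sum.swap)
    also have "\<dots> = (\<Sum>i\<in>I. P i s * (\<Sum>j\<in>I. pencil A B i j * F v j))"
      by (intro sum.cong refl) (simp add: F_def sum_distrib_left mult_ac cong: sum.cong)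
    finally show ?thesis .
  qed
  have degP: "degree (P i s * p) \<le> degree p" "degree (P' s i * p) \<le> degree p" for i s p
    by (simp_all add: P_def P'_def degree_smult_le)
  have F'F: "F' (F v) = v" if v: "\<And>s. s \<notin> J \<Longrightarrow> v s = 0" for v
  proof
    fix s
    show "F' (F v) s = v s"
    proof (cases "s \<in> J")
      case True
      have "F' (F v) s = (\<Sum>i\<in>I. \<Sum>t\<in>J. P' s i * P i t * v t)"
        using True by (simp add: F'_def F_def sum_distrib_left mult.assoc)
      also have "\<dots> = (\<Sum>t\<in>J. (\<Sum>i\<in>I. P' s i * P i t) * v t)"
        by (subst sum.swap) (simp add: sum_distrib_right)
      also have "\<dots> = (\<Sum>t\<in>J. if s = t then v t else 0)"
        using True by (intro sum.cong) (auto simp: P'P)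
      finally show ?thesis using True fin by simp
    qed (simp add: F'_def v)
  qed
  have FF': "F (F' u) = u" if u: "\<And>i. i \<notin> I \<Longrightarrow> u i = 0" for u
  proof
    fix i
    show "F (F' u) i = u i"
    proof (cases "i \<in> I")
      case True
      have "F (F' u) i = (\<Sum>s\<in>J. \<Sum>j\<in>I. P i s * P' s j * u j)"
        using True by (simp add: F'_def F_def sum_distrib_left mult.assoc)
      also have "\<dots> = (\<Sum>j\<in>I. (\<Sum>s\<in>J. P i s * P' s j) * u j)"
        by (subst sum.swap) (simp add: sum_distrib_right)
      also have "\<dots> = (\<Sum>j\<in>I. if i = j then u j else 0)"
        using True by (intro sum.cong) (auto simp: PP')
      finally show ?thesis using True fin by simp
    qed (simp add: F_def u)
  qed
  have "bij_betw F (psol J J (pencil C D) k h) (psol I I (pencil A B) k h)"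
  proof (rule bij_betw_byWitness[where f' = F'])
    show "F ` psol J J (pencil C D) k h \<subseteq> psol I I (pencil A B) k h"
    proof clarify
      fix v assume v: "v \<in> psol J J (pencil C D) k h"
      then obtain c where c: "\<And>s. s \<in> J \<Longrightarrow> (\<Sum>t\<in>J. pencil C D s t * v t) = smult (c s) h"
        using psolD(3)[OF v] by metis
      show "F v \<in> psol I I (pencil A B) k h"
      proof (rule psolI)
        show "degree (F v j) \<le> k" for j
          using fin psolD(2)[OF v] by (auto simp: F_def intro!: degree_sum_le order.trans[OF degP(1)])
        show "\<exists>c. (\<Sum>j\<in>I. pencil A B i0 j * F v j) = smult c h" if i0: "i0 \<in> I" for i0
        proof -
          define r where "r i = (\<Sum>j\<in>I. pencil A B i j * F v j)" for i
          have "(\<Sum>s\<in>J. P' s i0 * smult (c s) h) = (\<Sum>s\<in>J. \<Sum>i\<in>I. P i s * P' s i0 * r i)"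
          proof (rule sum.cong[OF refl])
            fix s assume s: "s \<in> J"
            have "smult (c s) h = (\<Sum>i\<in>I. P i s * r i)" by (simp add: c[OF s, symmetric] row[OF s] r_def)
            thus "P' s i0 * smult (c s) h = (\<Sum>i\<in>I. P i s * P' s i0 * r i)"
              by (simp add: sum_distrib_left mult_ac)
          qed
          also have "\<dots> = (\<Sum>i\<in>I. (\<Sum>s\<in>J. P i s * P' s i0) * r i)"
            by (subst sum.swap) (simp add: sum_distrib_right)
          also have "\<dots> = (\<Sum>i\<in>I. if i = i0 then r i else 0)"
            using i0 by (intro sum.cong) (auto simp: PP')
          finally have "r i0 = (\<Sum>s\<in>J. smult (M' s i0 * c s) h)" using i0 fin by (simp add: P'_def mult.commute)
          also have "\<dots> = smult (\<Sum>s\<in>J. M' s i0 * c s) h" by (simp add: smult_sum)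
          finally show ?thesis by (auto simp: r_def)
        qed
      qed (auto simp: F_def)
    qed
    show "F' ` psol I I (pencil A B) k h \<subseteq> psol J J (pencil C D) k h"
    proof clarify
      fix u assume u: "u \<in> psol I I (pencil A B) k h"
      then obtain c where c: "\<And>i. i \<in> I \<Longrightarrow> (\<Sum>j\<in>I. pencil A B i j * u j) = smult (c i) h"
        using psolD(3)[OF u] by metis
      show "F' u \<in> psol J J (pencil C D) k h"
      proof (rule psolI)
        show "degree (F' u j) \<le> k" for j
          using fin psolD(2)[OF u] by (auto simp: F'_def intro!: degree_sum_le order.trans[OF degP(2)])
        show "\<exists>c. (\<Sum>j\<in>J. pencil C D s j * F' u j) = smult c h" if s: "s \<in> J" for s
        proof -
          have "(\<Sum>j\<in>J. pencil C D s j * F' u j) = (\<Sum>i\<in>I. P i s * smult (c i) h)"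
            using FF'[of u] psolD(1)[OF u] by (simp add: row[OF s] c cong: sum.cong)
          also have "\<dots> = smult (\<Sum>i\<in>I. M i s * c i) h" by (simp add: P_def smult_sum mult.commute)
          finally show ?thesis by blast
        qed
      qed (auto simp: F'_def)
    qed
    show "\<forall>v\<in>psol J J (pencil C D) k h. F' (F v) = v"
    proof
      fix v assume v: "v \<in> psol J J (pencil C D) k h"
      show "F' (F v) = v" by (rule F'F) (rule psolD(1)[OF v])
    qed
    show "\<forall>u\<in>psol I I (pencil A B) k h. F (F' u) = u"
    proof
      fix u assume u: "u \<in> psol I I (pencil A B) k h"
      show "F (F' u) = u" by (rule FF') (rule psolD(1)[OF u])
    qed
  qed
  thus ?thesis by (rule bij_betw_same_card)
qed

text \<open>The pencil of R^+ is antidiagonal, so rows of one half meet only columns of the other.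
  The sign of the transposed block is absorbed by the constants.\<close>

lemma psol_plus_mat:
  "card (psol {..<r + s} {..<r + s} (pencil (plus_mat r R1) (plus_mat r R2)) k h)
   = card (psol {..<r} {..<s} (pencil R1 R2) k h) * card (psol {..<s} {..<r} (\<lambda>i j. pencil R1 R2 j i) k h)"
proof -
  define L where "L = pencil (plus_mat r R1) (plus_mat r R2)"
  have img: "(\<lambda>i. r + i) ` {..<s} = {r..<r + s}"
    using image_add_atLeastLessThan[of r 0 s] by (simp add: lessThan_atLeast0 add.commute)
  have set: "(\<lambda>i. i) ` {..<r} \<union> (\<lambda>i. r + i) ` {..<s} = {..<r + s}" "(\<lambda>i. r + i) ` {..<s} \<union> (\<lambda>i. i) ` {..<r} = {..<r + s}"
    unfolding img by auto
  have "card (psol {..<r + s} {..<r + s} L k h)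
      = card (psol ((\<lambda>i. i) ` {..<r} \<union> (\<lambda>i. r + i) ` {..<s}) ((\<lambda>i. r + i) ` {..<s} \<union> (\<lambda>i. i) ` {..<r}) L k h)"
    by (simp only: set)
  also have "\<dots> = card (psol ((\<lambda>i. i) ` {..<r}) ((\<lambda>i. r + i) ` {..<s}) L k h) * card (psol ((\<lambda>i. r + i) ` {..<s}) ((\<lambda>i. i) ` {..<r}) L k h)"
    by (rule psol_split) (auto simp: L_def pencil_def plus_mat_def)
  also have "card (psol ((\<lambda>i. i) ` {..<r}) ((\<lambda>i. r + i) ` {..<s}) L k h) = card (psol {..<r} {..<s} (\<lambda>i j. L i (r + j)) k h)"
    by (rule psol_reindex) (auto simp: inj_on_def)
  also have "psol {..<r} {..<s} (\<lambda>i j. L i (r + j)) k h = psol {..<r} {..<s} (pencil R1 R2) k h"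
    by (rule psol_cong) (auto simp: L_def pencil_def plus_mat_def)
  also have "card (psol ((\<lambda>i. r + i) ` {..<s}) ((\<lambda>i. i) ` {..<r}) L k h) = card (psol {..<s} {..<r} (\<lambda>i j. L (r + i) j) k h)"
    by (rule psol_reindex) (auto simp: inj_on_def)
  also have "psol {..<s} {..<r} (\<lambda>i j. L (r + i) j) k h = psol {..<s} {..<r} (\<lambda>i j. - pencil R1 R2 j i) k h"
    by (rule psol_cong) (auto simp: L_def pencil_def plus_mat_def)
  finally show ?thesis by (simp add: L_def psol_uminus)
qed

lemma psol_Arho:
  assumes \<rho>: "\<rho> \<in> Ftilde"
  shows "card (psol (Arho_index \<rho>) (Arho_index \<rho>) (pencil (Arho 1 \<rho>) (Arho 2 \<rho>)) k h)
    = (\<Prod>(og, d)\<in>{(og, d). \<rho> og d \<noteq> 0}.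
        card (psol {..<Rsize og d} {..<Rsize og d} (pencil (Rmat 1 og d) (Rmat 2 og d)) k h) ^ \<rho> og d)"
proof -
  define supp where "supp = {(og, d). \<rho> og d \<noteq> 0}"
  define S where "S = (SIGMA (og, d):supp. {..<\<rho> og d})"
  define key where "key b i = (fst b, snd b, i)" for b :: "('a bform option \<times> nat) \<times> nat" and i :: nat
  define n where "n b = Rsize (fst (fst b)) (snd (fst b))" for b :: "('a bform option \<times> nat) \<times> nat"
  define N where "N b = key b ` {..<n b}" for b
  define L where "L = pencil (Arho 1 \<rho>) (Arho 2 \<rho>)"
  have fs: "finite supp" using \<rho> by (simp add: supp_def Ftilde_def)
  hence fS: "finite S" by (auto simp: S_def)
  have Arho: "Arho l \<rho> (x, c, i) (x', c', j) = (if x = x' \<and> c = c' then Rmat l (fst x) (snd x) i j else 0)"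
    for l x c i x' c' j by (cases x; cases x') (simp add: Arho_def)
  have idx: "Arho_index \<rho> = (\<Union>b\<in>S. N b)"
  proof
    show "Arho_index \<rho> \<subseteq> (\<Union>b\<in>S. N b)"
    proof
      fix s assume s: "s \<in> Arho_index \<rho>"
      obtain og d c i where e: "s = ((og, d), c, i)" by (cases s) auto
      have "((og, d), c) \<in> S" using s by (simp add: e Arho_index_def S_def supp_def)
      moreover have "s \<in> N ((og, d), c)" using s by (simp add: e Arho_index_def N_def key_def n_def)
      ultimately show "s \<in> (\<Union>b\<in>S. N b)" by blast
    qed
    show "(\<Union>b\<in>S. N b) \<subseteq> Arho_index \<rho>"
      by (auto simp: Arho_index_def S_def N_def key_def n_def)
  qed
  have "card (psol (Arho_index \<rho>) (Arho_index \<rho>) L k h) = (\<Prod>b\<in>S. card (psol (N b) (N b) L k h))"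
    unfolding idx
  proof (rule psol_Union[OF fS])
    show "N b \<inter> N b' = {}" if "b \<noteq> b'" for b b' using that by (auto simp: N_def key_def prod_eq_iff)
    show "L i j = 0" if "b \<noteq> b'" "i \<in> N b" "j \<in> N b'" for b b' i j
      using that by (auto simp: N_def key_def L_def pencil_def Arho prod_eq_iff)
  qed (simp add: N_def)
  also have "\<dots> = (\<Prod>b\<in>S. card (psol {..<n b} {..<n b} (pencil (Rmat 1 (fst (fst b)) (snd (fst b))) (Rmat 2 (fst (fst b)) (snd (fst b)))) k h))"
  proof (rule prod.cong[OF refl])
    fix b assume "b \<in> S"
    have "card (psol (N b) (N b) L k h) = card (psol {..<n b} {..<n b} (\<lambda>i j. L (key b i) (key b j)) k h)"
      unfolding N_def by (rule psol_reindex) (simp add: inj_on_def key_def)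
    moreover have "(\<lambda>i j. L (key b i) (key b j)) = pencil (Rmat 1 (fst (fst b)) (snd (fst b))) (Rmat 2 (fst (fst b)) (snd (fst b)))"
      by (simp add: fun_eq_iff L_def key_def pencil_def Arho)
    ultimately show "card (psol (N b) (N b) L k h) = card (psol {..<n b} {..<n b}
      (pencil (Rmat 1 (fst (fst b)) (snd (fst b))) (Rmat 2 (fst (fst b)) (snd (fst b)))) k h)" by simp
  qed
  also have "\<dots> = (\<Prod>x\<in>supp. \<Prod>c\<in>{..<\<rho> (fst x) (snd x)}. card (psol {..<Rsize (fst x) (snd x)} {..<Rsize (fst x) (snd x)}
      (pencil (Rmat 1 (fst x) (snd x)) (Rmat 2 (fst x) (snd x))) k h))"
    unfolding S_def case_prod_unfold using fs by (subst prod.Sigma) (simp_all add: case_prod_unfold n_def)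
  also have "\<dots> = (\<Prod>(og, d)\<in>supp.
        card (psol {..<Rsize og d} {..<Rsize og d} (pencil (Rmat 1 og d) (Rmat 2 og d)) k h) ^ \<rho> og d)"
    by (simp add: case_prod_unfold)
  finally show ?thesis by (simp add: L_def supp_def)
qed

section \<open>Polynomials of bounded degree\<close>

definition polys_below :: "nat \<Rightarrow> 'k::zero poly set" where
  "polys_below n = {p. \<forall>i\<ge>n. coeff p i = 0}"

text \<open>Coefficients rather than degrees define the set because \<open>degree 0 = 0\<close>: for
  n = 0 the condition \<open>degree p < n\<close> would lose the zero polynomial.\<close>

lemma polys_below_iff: "p \<in> polys_below n \<longleftrightarrow> p = 0 \<or> degree p < n"
proof
  assume p: "p \<in> polys_below n"
  show "p = 0 \<or> degree p < n"
  proof (rule ccontr)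
    assume "\<not> ?thesis"
    hence "p \<noteq> 0" "n \<le> degree p" by auto
    hence "coeff p (degree p) = 0" using p unfolding polys_below_def by blast
    thus False using \<open>p \<noteq> 0\<close> by simp
  qed
qed (auto simp: polys_below_def coeff_eq_0)

lemma card_polys_below: "card (polys_below n :: 'k::{zero,finite} poly set) = CARD('k) ^ n"
proof (induction n)
  case 0
  have "polys_below 0 = {0 :: 'k poly}" by (auto simp: polys_below_iff)
  thus ?case by simp
next
  case (Suc n)
  have "polys_below (Suc n) = (\<lambda>(c :: 'k, p). pCons c p) ` (UNIV \<times> polys_below n)"
  proof
    show "polys_below (Suc n) \<subseteq> (\<lambda>(c :: 'k, p). pCons c p) ` (UNIV \<times> polys_below n)"
    proof
      fix p :: "'k poly" assume p: "p \<in> polys_below (Suc n)"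
      obtain c p' where e: "p = pCons c p'" by (cases p) auto
      have "coeff p' i = 0" if "i \<ge> n" for i
      proof -
        have "coeff p (Suc i) = 0" using p that unfolding polys_below_def by simp
        thus ?thesis by (simp add: e)
      qed
      hence "p' \<in> polys_below n" by (simp add: polys_below_def)
      thus "p \<in> (\<lambda>(c :: 'k, p). pCons c p) ` (UNIV \<times> polys_below n)" unfolding e by force
    qed
    show "(\<lambda>(c :: 'k, p). pCons c p) ` (UNIV \<times> polys_below n) \<subseteq> polys_below (Suc n)"
      by (auto simp: polys_below_def coeff_pCons split: nat.splits)
  qed
  moreover have "inj_on (\<lambda>(c :: 'k, p). pCons c p) (UNIV \<times> polys_below n)" by (auto simp: inj_on_def)
  ultimately show ?case using Suc by (simp add: card_image card_cartesian_product)
qed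

text \<open>A step of Horner's scheme; it turns recurrences with \<open>pCons\<close> into
  statements about shifts.\<close>

lemma shift_Suc: "poly_shift n p = pCons (coeff p n) (poly_shift (Suc n) p)"
  by (rule poly_eqI) (simp add: coeff_poly_shift coeff_pCons split: nat.splits)

lemma shift_high: "p \<in> polys_below n \<Longrightarrow> poly_shift n p = 0"
  by (rule poly_eqI) (simp add: coeff_poly_shift polys_below_def)

lemma shift_monic: "lead_coeff f = 1 \<Longrightarrow> poly_shift (degree f) f = 1"
  by (rule poly_eqI) (simp add: coeff_poly_shift coeff_eq_0)

lemma cutoff_shift: "(p :: 'k::field poly) = poly_cutoff n p + monom 1 n * poly_shift n p"
  by (rule poly_eqI) (simp add: coeff_poly_cutoff coeff_monom_mult coeff_poly_shift)

lemma polys_below_mult: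
  fixes p q :: "'k::field poly"
  assumes "p \<in> polys_below a" "q \<in> polys_below b" "a + b \<le> Suc N" shows "p * q \<in> polys_below N"
proof (cases "p = 0 \<or> q = 0")
  case False
  thus ?thesis using assms by (auto simp: polys_below_iff degree_mult_eq)
qed (auto simp: polys_below_def)

lemma polys_below_diff: "p \<in> polys_below n \<Longrightarrow> q \<in> polys_below n \<Longrightarrow> p - q \<in> polys_below (n :: nat)"
  for p q :: "'k::field poly"
  by (simp add: polys_below_def)

lemma polys_below_smult: "p \<in> polys_below n \<Longrightarrow> smult c p \<in> polys_below n"
  for p :: "'k::field poly"
  by (simp add: polys_below_def)

lemma polys_below_add: "p \<in> polys_below n \<Longrightarrow> q \<in> polys_below n \<Longrightarrow> p + q \<in> polys_below (n :: nat)"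
  for p q :: "'k::field poly"
  by (simp add: polys_below_def)

lemma polys_below_sum: "(\<And>i. i \<in> I \<Longrightarrow> g i \<in> polys_below n) \<Longrightarrow> (\<Sum>i\<in>I. g i) \<in> polys_below n"
  for g :: "'i \<Rightarrow> 'k::field poly"
  by (simp add: polys_below_def coeff_sum)

lemma dvd_small_imp_smult:
  fixes f :: "'k::field poly"
  assumes "f dvd E" "E \<in> polys_below (Suc (degree f))" "f \<noteq> 0"
  shows "\<exists>c. E = smult c f"
proof -
  obtain s where s: "E = f * s" using assms(1) by (elim dvdE)
  have "degree s = 0"
  proof (cases "s = 0")
    case False
    thus ?thesis using assms(2,3) degree_mult_eq[of f s] by (auto simp: s polys_below_iff)
  qed simp
  then obtain c where "s = [:c:]" by (rule degree_eq_zeroE)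
  thus ?thesis using s by auto
qed

lemma large_smult_eq_0:
  fixes h :: "'k::field poly"
  assumes "degree v \<le> k" "degree h = Suc k" "v = smult c h" shows "v = 0"
  using assms by (cases "c = 0") auto

lemma shifted_const_eq_0:
  fixes h :: "'k::field poly"
  assumes "degree h = 0" "pCons 0 v = smult c h" shows "v = 0"
proof -
  have "degree (pCons 0 v) = 0" unfolding assms(2) using assms(1) degree_smult_le[of c h] by simp
  thus ?thesis by (auto split: if_splits)
qed

subsection \<open>Kronecker blocks\<close>

text \<open>\<open>pCons 0\<close> is multiplication by x, so each row is a step of a recurrence
  along the components of v.\<close>

lemma psol_singular_row:
  fixes v :: "nat \<Rightarrow> 'k::field poly"
  assumes "i < m"
  shows "(\<Sum>j<Suc m. pencil (Rbase 1 None d) (Rbase 2 None d) i j * v j) = pCons 0 (v i) - v (Suc i)"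
proof -
  have "(\<Sum>j<Suc m. pencil (Rbase 1 None d) (Rbase 2 None d) i j * v j)
     = (\<Sum>j<Suc m. (if j = i then pCons 0 (v j) else 0) + (if j = Suc i then - v j else 0))"
    by (intro sum.cong) (auto simp: pencil_def Rbase_def)
  also have "\<dots> = (\<Sum>j<Suc m. if j = i then pCons 0 (v j) else 0) + (\<Sum>j<Suc m. if j = Suc i then - v j else 0)"
    by (rule sum.distrib)
  also have "\<dots> = pCons 0 (v i) - v (Suc i)" using assms by (subst sum.delta, simp)+ simp
  finally show ?thesis .
qed

text \<open>The recurrence lets one component determine the others. Which one depends on h: it runs
  upwards from index 0 if h is 0 or has degree k + 1, and downwards from index m for h = 1, where x
  can be divided off.\<close>

lemma psol_singular_bij:
  fixes \<Psi> :: "'k::field poly \<Rightarrow> nat \<Rightarrow> 'k poly" and m k h d l0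
  defines "X \<equiv> psol {..<m} {..<Suc m} (pencil (Rbase 1 None d) (Rbase 2 None d)) k h"
  assumes l0: "l0 \<le> m"
    and 1: "\<And>v. (\<And>i. i \<le> m \<Longrightarrow> degree (v i) \<le> k) \<Longrightarrow> (\<And>i. i < m \<Longrightarrow> \<exists>c. pCons 0 (v i) - v (Suc i) = smult c h) \<Longrightarrow>
        v l0 \<in> polys_below N \<and> (\<forall>i\<le>m. \<Psi> (v l0) i = v i)"
    and 2: "\<And>p i. p \<in> polys_below N \<Longrightarrow> i \<le> m \<Longrightarrow> degree (\<Psi> p i) \<le> k"
    and 3: "\<And>p i. p \<in> polys_below N \<Longrightarrow> i < m \<Longrightarrow> \<exists>c. pCons 0 (\<Psi> p i) - \<Psi> p (Suc i) = smult c h"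
    and 4: "\<And>p. p \<in> polys_below N \<Longrightarrow> \<Psi> p l0 = p"
  shows "card X = card (polys_below N :: 'k poly set)"
proof -
  define \<Psi>' where "\<Psi>' p = (\<lambda>i. if i \<le> m then \<Psi> p i else 0)" for p
  have Xv: "v l0 \<in> polys_below N \<and> (\<forall>i\<le>m. \<Psi> (v l0) i = v i)" if v: "v \<in> X" for v
  proof (rule 1)
    show "degree (v i) \<le> k" for i using psolD(2)[OF v[unfolded X_def]] .
    show "\<exists>c. pCons 0 (v i) - v (Suc i) = smult c h" if "i < m" for i
      using psolD(3)[OF v[unfolded X_def], of i] that unfolding psol_singular_row[OF that] by simp
  qed
  have "bij_betw (\<lambda>v. v l0) X (polys_below N)"
  proof (rule bij_betw_byWitness[where f' = \<Psi>'])
    show "\<forall>v\<in>X. \<Psi>' (v l0) = v"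
    proof (intro ballI ext)
      fix v i assume v: "v \<in> X"
      show "\<Psi>' (v l0) i = v i"
        using Xv[OF v] psolD(1)[OF v[unfolded X_def], of i] by (auto simp: \<Psi>'_def)
    qed
    show "\<forall>p\<in>polys_below N. \<Psi>' p l0 = p" using 4 l0 by (simp add: \<Psi>'_def)
    show "(\<lambda>v. v l0) ` X \<subseteq> polys_below N" using Xv by blast
    show "\<Psi>' ` polys_below N \<subseteq> X"
    proof clarify
      fix p :: "'k poly" assume p: "p \<in> polys_below N"
      show "\<Psi>' p \<in> X" unfolding X_def
      proof (rule psolI)
        show "\<Psi>' p j = 0" if "j \<notin> {..<Suc m}" for j using that by (simp add: \<Psi>'_def)
        show "degree (\<Psi>' p j) \<le> k" if "j \<in> {..<Suc m}" for j using that 2[OF p] by (simp add: \<Psi>'_def)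
        show "\<exists>c. (\<Sum>j<Suc m. pencil (Rbase 1 None d) (Rbase 2 None d) i j * \<Psi>' p j) = smult c h" if "i \<in> {..<m}" for i
        proof -
          have im: "i < m" using that by simp
          show ?thesis unfolding psol_singular_row[OF im] using 3[OF p im] im by (simp add: \<Psi>'_def)
        qed
      qed
    qed
  qed
  thus ?thesis by (rule bij_betw_same_card)
qed

text \<open>Solutions are v i = x^i (v 0). The bound on v m leaves k + 1 - m free coefficients in v
  0, and none if m exceeds k, as the truncated subtraction says.\<close>

lemma psol_singular_homogeneous:
  "card (psol {..<m} {..<Suc m} (pencil (Rbase 1 None d) (Rbase 2 None d)) k (0 :: 'k::{field,finite} poly)) = CARD('k) ^ (k + 1 - m)"
  unfolding card_polys_below[symmetric]
proof (rule psol_singular_bij[where \<Psi> = "\<lambda>p i. monom 1 i * p" and ?l0.0 = 0])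
  fix v :: "nat \<Rightarrow> 'k poly"
  assume deg: "\<And>i. i \<le> m \<Longrightarrow> degree (v i) \<le> k" and row: "\<And>i. i < m \<Longrightarrow> \<exists>c. pCons 0 (v i) - v (Suc i) = smult c 0"
  have eq: "monom 1 i * v 0 = v i" if "i \<le> m" for i
    using that
  proof (induction i)
    case (Suc i)
    have "v (Suc i) = pCons 0 (v i)" using row[of i] Suc.prems by simp
    also have "\<dots> = monom 1 (Suc i) * v 0" using Suc by (simp add: monom_Suc)
    finally show ?case by simp
  qed simp
  have "v 0 = 0 \<or> degree (v 0) + m \<le> k"
    using eq[of m] deg[of m] by (cases "v 0 = 0") (auto simp: degree_mult_eq degree_monom_eq monom_eq_0_iff dest: sym)
  thus "v 0 \<in> polys_below (k + 1 - m) \<and> (\<forall>i\<le>m. monom 1 i * v 0 = v i)" using eq by (auto simp: polys_below_iff)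
next
  fix p :: "'k poly" and i assume "p \<in> polys_below (k + 1 - m)" "i \<le> m"
  thus "degree (monom 1 i * p) \<le> k"
    by (cases "p = 0") (auto simp: polys_below_iff degree_mult_eq degree_monom_eq monom_eq_0_iff)
qed (auto simp: monom_Suc)

lemma degree_mod_below:
  fixes h :: "'k::{field_gcd} poly"
  assumes "h \<noteq> 0" shows "p mod h \<in> polys_below (degree h)"
  using degree_mod_less[OF assms, of p] by (auto simp: polys_below_iff)

lemma mod_below_eq:
  fixes h :: "'k::{field_gcd} poly"
  assumes "h \<noteq> 0" "p \<in> polys_below (degree h)" shows "p mod h = p"
  using assms by (auto simp: polys_below_iff mod_poly_less)

text \<open>Modulo h the rows read v (i + 1) = x (v i), and the bound k makes every component a
  reduced residue. Hence v 0 is arbitrary and determines the rest.\<close>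

lemma psol_singular_proper:
  fixes h :: "'k::{field_gcd,finite} poly"
  assumes h: "degree h = Suc k"
  shows "card (psol {..<m} {..<Suc m} (pencil (Rbase 1 None d) (Rbase 2 None d)) k h) = CARD('k) ^ (k + 1)"
  unfolding card_polys_below[symmetric]
proof (rule psol_singular_bij[where \<Psi> = "\<lambda>p i. (monom 1 i * p) mod h" and ?l0.0 = 0])
  have h0: "h \<noteq> 0" using h by auto
  have small: "p mod h = p" if "degree p \<le> k" for p
    using that h h0 by (intro mod_below_eq) (auto simp: polys_below_iff)
  fix v :: "nat \<Rightarrow> 'k poly"
  assume deg: "\<And>i. i \<le> m \<Longrightarrow> degree (v i) \<le> k" and row: "\<And>i. i < m \<Longrightarrow> \<exists>c. pCons 0 (v i) - v (Suc i) = smult c h"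
  have eq: "(monom 1 i * v 0) mod h = v i" if "i \<le> m" for i
    using that
  proof (induction i)
    case 0
    show ?case using small[OF deg[of 0]] by simp
  next
    case (Suc i)
    obtain c where c: "pCons 0 (v i) - v (Suc i) = smult c h" using row[of i] Suc.prems by auto
    have "(monom 1 (Suc i) * v 0) mod h = ([:0, 1:] * (monom 1 i * v 0)) mod h" by (simp add: monom_Suc)
    also have "\<dots> = ([:0, 1:] * v i) mod h" using Suc by (metis mod_mult_right_eq Suc_leD)
    also have "[:0, 1:] * v i = v (Suc i) + smult c 1 * h" using c by (simp add: algebra_simps)
    also have "(v (Suc i) + smult c 1 * h) mod h = v (Suc i) mod h" by (rule mod_mult_self1)
    finally show ?case using small[OF deg[OF Suc.prems]] by simp
  qed
  thus "v 0 \<in> polys_below (k + 1) \<and> (\<forall>i\<le>m. (monom 1 i * v 0) mod h = v i)"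
    using deg[of 0] by (auto simp: polys_below_iff)
next
  have h0: "h \<noteq> 0" using h by auto
  fix p :: "'k poly" and i
  show "degree ((monom 1 i * p) mod h) \<le> k"
    using degree_mod_below[OF h0, of "monom 1 i * p"] h by (auto simp: polys_below_iff)
  assume i: "i < m"
  let ?E = "pCons 0 ((monom 1 i * p) mod h) - (monom 1 (Suc i) * p) mod h"
  have "(monom 1 (Suc i) * p) mod h = ([:0, 1:] * ((monom 1 i * p) mod h)) mod h"
    by (subst mod_mult_right_eq) (simp add: monom_Suc)
  hence B: "(monom 1 (Suc i) * p) mod h = pCons 0 ((monom 1 i * p) mod h) mod h" by simp
  have "h dvd ?E" by (simp only: B dvd_minus_mod)
  moreover have "?E \<in> polys_below (Suc (degree h))"
    using degree_mod_below[OF h0, of "monom 1 i * p"] degree_mod_below[OF h0, of "monom 1 (Suc i) * p"]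
    by (intro polys_below_diff) (auto simp: polys_below_iff degree_pCons_eq_if)
  ultimately show "\<exists>c. ?E = smult c h" using h0 by (rule dvd_small_imp_smult)
next
  have h0: "h \<noteq> 0" using h by auto
  fix p :: "'k poly" assume "p \<in> polys_below (k + 1)"
  hence "p mod h = p" using h0 h by (intro mod_below_eq) simp_all
  thus "(monom 1 0 * p) mod h = p" by (simp add: monom_0 one_pCons[symmetric])
qed simp

text \<open>For h = 1 a row fixes v (i + 1) up to its constant term, so v i arises from v (i + 1) by
  dropping that term and dividing by x. Hence v m is arbitrary.\<close>

lemma psol_singular_x2:
  "card (psol {..<m} {..<Suc m} (pencil (Rbase 1 None d) (Rbase 2 None d)) k (1 :: 'k::{field,finite} poly)) = CARD('k) ^ (k + 1)"
  unfolding card_polys_below[symmetric]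
proof (rule psol_singular_bij[where \<Psi> = "\<lambda>p i. poly_shift (m - i) p" and ?l0.0 = m])
  fix v :: "nat \<Rightarrow> 'k poly"
  assume deg: "\<And>i. i \<le> m \<Longrightarrow> degree (v i) \<le> k" and row: "\<And>i. i < m \<Longrightarrow> \<exists>c. pCons 0 (v i) - v (Suc i) = smult c 1"
  have "poly_shift n (v m) = v (m - n)" if "n \<le> m" for n
    using that
  proof (induction n)
    case (Suc n)
    define i where "i = m - Suc n"
    have i: "Suc i = m - n" "i < m" using Suc.prems by (auto simp: i_def)
    obtain c where c: "pCons 0 (v i) - v (Suc i) = smult c 1" using row[OF i(2)] by blast
    have "v (Suc i) = pCons 0 (v i) - smult c 1" by (simp only: c[symmetric]) simp
    hence "v (Suc i) = pCons (- c) (v i)" by (simp add: one_pCons)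
    moreover have "v (Suc i) = pCons (coeff (v m) n) (poly_shift (Suc n) (v m))"
      using Suc i by (simp add: shift_Suc[symmetric])
    ultimately show ?case by (simp add: i_def)
  qed simp
  from this[of "m - _"] have "poly_shift (m - i) (v m) = v i" if "i \<le> m" for i using that by simp
  thus "v m \<in> polys_below (k + 1) \<and> (\<forall>i\<le>m. poly_shift (m - i) (v m) = v i)"
    using deg[of m] by (auto simp: polys_below_iff)
next
  fix p :: "'k poly" and i assume p: "p \<in> polys_below (k + 1)"
  hence "poly_shift (m - i) p \<in> polys_below (k + 1)" by (auto simp: polys_below_def coeff_poly_shift)
  thus "degree (poly_shift (m - i) p) \<le> k" by (auto simp: polys_below_iff)
  assume im: "i < m"
  have "poly_shift (m - Suc i) p = pCons (coeff p (m - Suc i)) (poly_shift (m - i) p)"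
    using shift_Suc[of "m - Suc i" p] by (simp only: Suc_diff_Suc[OF im])
  hence "pCons 0 (poly_shift (m - i) p) - poly_shift (m - Suc i) p = smult (- coeff p (m - Suc i)) 1"
    by (simp add: one_pCons)
  thus "\<exists>c. pCons 0 (poly_shift (m - i) p) - poly_shift (m - Suc i) p = smult c 1" by blast
qed auto

lemma psol_singular_transpose_row:
  fixes v :: "nat \<Rightarrow> 'k::field poly"
  assumes "i < Suc m"
  shows "(\<Sum>j<m. pencil (Rbase 1 None d) (Rbase 2 None d) j i * v j)
    = (if i < m then pCons 0 (v i) else 0) - (if i = 0 then 0 else v (i - 1))"
proof -
  have "(\<Sum>j<m. pencil (Rbase 1 None d) (Rbase 2 None d) j i * v j)
     = (\<Sum>j<m. (if j = i then pCons 0 (v j) else 0) + (if j = i - 1 then (if i = 0 then 0 else - v j) else 0))"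
    by (intro sum.cong) (auto simp: pencil_def Rbase_def)
  also have "\<dots> = (\<Sum>j<m. if j = i then pCons 0 (v j) else 0)
      + (\<Sum>j<m. if j = i - 1 then (if i = 0 then 0 else - v j) else 0)"
    by (rule sum.distrib)
  also have "\<dots> = (if i < m then pCons 0 (v i) else 0) - (if i = 0 then 0 else v (i - 1))"
    using assms by (subst sum.delta, simp)+ auto
  finally show ?thesis .
qed

text \<open>With one row more than columns, both ends of the recurrence involve a single component:
  the first row is x (v 0) = c h and the last one - v (m - 1) = c h. Constant h forces v 0 = 0, and
  degree k + 1 forces v (m - 1) = 0; the zeros propagate from there.\<close>

lemma psol_singular_transpose:
  fixes h :: "'k::field poly"
  assumes h: "degree h = 0 \<or> degree h = Suc k"
  shows "card (psol {..<Suc m} {..<m} (\<lambda>i j. pencil (Rbase 1 None d) (Rbase 2 None d) j i) k h) = 1"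
proof (rule psol_trivial)
  fix v j assume v: "v \<in> psol {..<Suc m} {..<m} (\<lambda>i j. pencil (Rbase 1 None d) (Rbase 2 None d) j i) k h" and "j \<in> {..<m}"
  have row: "\<exists>c. (if i < m then pCons 0 (v i) else 0) - (if i = 0 then 0 else v (i - 1)) = smult c h" if "i < Suc m" for i
    using psolD(3)[OF v, of i] that unfolding psol_singular_transpose_row[OF that] by simp
  have "v j = 0" if "j < m" for j
  proof (cases "degree h = 0")
    case True
    show ?thesis using that
    proof (induction j)
      case 0
      obtain c where "pCons 0 (v 0) = smult c h" using row[of 0] 0 by auto
      thus ?case by (rule shifted_const_eq_0[OF True])
    next
      case (Suc j)
      obtain c where "pCons 0 (v (Suc j)) = smult c h" using row[of "Suc j"] Suc by auto
      thus ?case by (rule shifted_const_eq_0[OF True])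
    qed
  next
    case False
    hence d: "degree h = Suc k" using h by simp
    have "v (m - Suc n) = 0" if "n < m" for n
      using that
    proof (induction n)
      case 0
      obtain c where c: "- v (m - 1) = smult c h" using row[of m] 0 by auto
      have "- v (m - 1) = 0" using psolD(2)[OF v, of "m - 1"] by (intro large_smult_eq_0[OF _ d c]) simp
      thus ?case by simp
    next
      case (Suc n)
      have e: "m - Suc n < Suc m" "m - Suc n < m" "m - Suc n \<noteq> 0" "m - Suc n - 1 = m - Suc (Suc n)" using Suc.prems by auto
      obtain c where c: "- v (m - Suc (Suc n)) = smult c h" using row[OF e(1)] Suc e by auto
      have "- v (m - Suc (Suc n)) = 0" using psolD(2)[OF v, of "m - Suc (Suc n)"]
        by (intro large_smult_eq_0[OF _ d c]) simp
      thus ?case by simp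
    qed
    from this[of "m - Suc j"] show ?thesis using that by simp
  qed
  thus "v j = 0" using \<open>j \<in> {..<m}\<close> by simp
qed

subsection \<open>Regular blocks\<close>

text \<open>If v i has the highest degree n among the components, then x (v i) contributes to
  x^(n+1) in row i, where neither the constant entries nor the constant h can cancel it.
  \<open>F\<close> is arbitrary so that companion matrices and their transposes are both
  covered.\<close>

lemma psol_companion_const:
  fixes F :: "nat \<Rightarrow> nat \<Rightarrow> 'k::field"
  assumes h: "degree h = 0"
  shows "card (psol {..<D} {..<D} (\<lambda>i j. [:- F i j, if i = j then 1 else 0:]) k h) = 1"
proof (rule psol_trivial)
  fix v j0 assume v: "v \<in> psol {..<D} {..<D} (\<lambda>i j. [:- F i j, if i = j then 1 else 0:]) k h" and j0: "j0 \<in> {..<D}"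
  show "v j0 = 0"
  proof (rule ccontr)
    assume nz: "v j0 \<noteq> 0"
    have "\<exists>i. (i < D \<and> v i \<noteq> 0) \<and> (\<forall>j. j < D \<and> v j \<noteq> 0 \<longrightarrow> degree (v j) \<le> degree (v i))"
      using nz j0 psolD(2)[OF v]
      by (intro ex_has_greatest_nat[of "\<lambda>i. i < D \<and> v i \<noteq> 0" j0 "\<lambda>i. degree (v i)" "Suc k"]) (auto simp: less_Suc_eq_le)
    then obtain i where i: "i < D" "v i \<noteq> 0" and max: "\<And>j. j < D \<Longrightarrow> v j \<noteq> 0 \<Longrightarrow> degree (v j) \<le> degree (v i)" by blast
    obtain c where c: "(\<Sum>j<D. [:- F i j, if i = j then 1 else 0:] * v j) = smult c h"
      using psolD(3)[OF v, of i] i by auto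
    define n where "n = degree (v i)"
    have z: "coeff (v j) (Suc n) = 0" if "j < D" for j
      using max[OF that] by (cases "v j = 0") (auto simp: n_def intro: coeff_eq_0)
    have "coeff ([:- F i j, if i = j then 1 else 0:] * v j) (Suc n) = (if j = i then coeff (v j) n else 0)" if "j < D" for j
      using z[OF that] by simp
    hence "coeff (\<Sum>j<D. [:- F i j, if i = j then 1 else 0:] * v j) (Suc n) = (\<Sum>j<D. if j = i then coeff (v j) n else 0)"
      unfolding coeff_sum by (intro sum.cong) auto
    also have "\<dots> = lead_coeff (v i)" using i by (simp add: n_def)
    finally have "lead_coeff (v i) = c * coeff h (Suc n)" unfolding c by simp
    also have "\<dots> = 0" using h by (simp add: coeff_eq_0)
    finally show False using i by simp
  qed
qed

context
  fixes f h :: "'k::{field_gcd,finite} poly" and D k :: nat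
  assumes f: "lead_coeff f = 1" "degree f = D" "D > 0" and h: "degree h = Suc k"
begin

lemma f0: "f \<noteq> 0" using f by auto
lemma h0: "h \<noteq> 0" using h by auto

lemma companion_row:
  assumes "i < D"
  shows "(\<Sum>j<D. pencil idm (companion f) i j * v j)
    = pCons 0 (v i) - (if i = 0 then 0 else v (i - 1)) + smult (coeff f i) (v (D - 1))"
proof -
  have "(\<Sum>j<D. pencil idm (companion f) i j * v j)
     = (\<Sum>j<D. ((if j = i then pCons 0 (v j) else 0) + (if j = i - 1 then (if i = 0 then 0 else - v j) else 0))
          + (if j = D - 1 then smult (coeff f i) (v j) else 0))"
    using assms f by (intro sum.cong refl) (auto simp: pencil_def idm_def companion_def)
  also have "\<dots> = (\<Sum>j<D. if j = i then pCons 0 (v j) else 0)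
      + (\<Sum>j<D. if j = i - 1 then (if i = 0 then 0 else - v j) else 0)
      + (\<Sum>j<D. if j = D - 1 then smult (coeff f i) (v j) else 0)"
    by (simp only: sum.distrib)
  also have "\<dots> = pCons 0 (v i) - (if i = 0 then 0 else v (i - 1)) + smult (coeff f i) (v (D - 1))"
    using assms by (subst sum.delta, simp)+ auto
  finally show ?thesis .
qed

lemma companion_transpose_row:
  assumes "i < D"
  shows "(\<Sum>j<D. pencil idm (companion f) j i * v j)
    = pCons 0 (v i) + (if Suc i < D then - v (Suc i) else \<Sum>j<D. smult (coeff f j) (v j))"
proof -
  have "(\<Sum>j<D. pencil idm (companion f) j i * v j)
     = (\<Sum>j<D. (if j = i then pCons 0 (v j) else 0) + (if Suc i < D then (if j = Suc i then - v j else 0) else smult (coeff f j) (v j)))"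
    using assms f by (intro sum.cong refl) (auto simp: pencil_def idm_def companion_def)
  also have "\<dots> = (\<Sum>j<D. if j = i then pCons 0 (v j) else 0)
     + (if Suc i < D then (\<Sum>j<D. if j = Suc i then - v j else 0) else (\<Sum>j<D. smult (coeff f j) (v j)))"
    by (simp add: sum.distrib)
  also have "\<dots> = pCons 0 (v i) + (if Suc i < D then - v (Suc i) else \<Sum>j<D. smult (coeff f j) (v j))"
    using assms by (subst sum.delta, simp)+ auto
  finally show ?thesis .
qed

text \<open>In f v = E h the degrees give D + degree v = degree E + k + 1, so the bound k on v and
  the bound D on E are equivalent.\<close>

lemma degree_cofactor:
  assumes "f * v = E * h" "E \<in> polys_below D" shows "degree v \<le> k"
proof (cases "v = 0")
  case False
  hence E: "E \<noteq> 0" using assms(1) f0 by auto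
  hence "D + degree v = degree E + Suc k"
    using assms(1) False f0 h0 h f by (metis degree_mult_eq)
  moreover have "degree E < D" using assms(2) E by (simp add: polys_below_iff)
  ultimately show ?thesis by simp
qed simp

lemma cofactor_below:
  assumes "f * v = E * h" "degree v \<le> k" shows "E \<in> polys_below D"
proof (cases "E = 0")
  case False
  hence v: "v \<noteq> 0" using assms(1) h0 by auto
  hence "D + degree v = degree E + Suc k"
    using assms(1) False f0 h0 h f by (metis degree_mult_eq)
  thus ?thesis using assms(2) by (simp add: polys_below_iff)
qed (simp add: polys_below_def)

lemma row_of_cofactor:
  assumes "f * R = E * h" "f dvd E" "E \<in> polys_below (Suc D)" shows "\<exists>c. R = smult c h"
proof -
  obtain c where "E = smult c f" using dvd_small_imp_smult[OF assms(2) _ f0] assms(3) f by auto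
  hence "f * R = f * smult c h" using assms(1) by (simp add: mult.commute)
  thus ?thesis using f0 mult_left_cancel by blast
qed

text \<open>Let C have the constants of the rows as coefficients. Multiplying row i by x^i and
  adding telescopes to f (v (D - 1)) = C h, so C determines v, and divisibility of C h by f is the
  only condition on C.\<close>

lemma card_psol_companion:
  "card (psol {..<D} {..<D} (pencil idm (companion f)) k h) = card {C \<in> polys_below D. f dvd C * h}"
proof -
  \<comment> \<open>This solves the rows downwards from v (D - 1) = C h / f; the shifts collect the
    coefficients of f and C met so far.\<close>
  define \<Psi> where "\<Psi> C = (\<lambda>i. if i < D then (C * h div f) * poly_shift (Suc i) f - poly_shift (Suc i) C * h else 0)" for C
  have topf: "poly_shift D f = 1" using shift_monic[OF f(1)] f by simp
  have sol: "f * v (D - 1) = C * h \<and> \<Psi> C = v \<and> C \<in> polys_below D"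
    if v: "v \<in> psol {..<D} {..<D} (pencil idm (companion f)) k h" and C: "C = f * v (D - 1) div h" for v C
  proof -
    define W where "W = v (D - 1)"
    have "\<exists>c. (\<Sum>j<D. pencil idm (companion f) i j * v j) = smult c h" if "i < D" for i
      using psolD(3)[OF v, of i] that by simp
    then obtain c where c: "\<And>i. i < D \<Longrightarrow> (\<Sum>j<D. pencil idm (companion f) i j * v j) = smult (c i) h" by metis
    define C' where "C' = (\<Sum>i<D. monom (c i) i)"
    have C'_coeff: "coeff C' i = c i" if "i < D" for i using that by (simp add: C'_def coeff_sum)
    have C': "C' \<in> polys_below D" by (auto simp: C'_def polys_below_def coeff_sum)
    have eq: "v (D - Suc n) = W * poly_shift (D - n) f - poly_shift (D - n) C' * h" if "n < D" for n
      using that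
    proof (induction n)
      case 0
      show ?case using topf shift_high[OF C'] by (simp add: W_def)
    next
      case (Suc n)
      define i where "i = D - Suc n"
      have i: "i < D" "i \<noteq> 0" "D - n = Suc i" "D - Suc (Suc n) = i - 1" using Suc.prems by (auto simp: i_def)
      have "pCons 0 (v i) - v (i - 1) + smult (coeff f i) W = smult (c i) h"
        using c[OF i(1)] i(2) unfolding companion_row[OF i(1)] by (simp add: W_def)
      hence "v (i - 1) = pCons 0 (v i) + smult (coeff f i) W - smult (c i) h" by (simp add: algebra_simps)
      also have "v i = W * poly_shift (Suc i) f - poly_shift (Suc i) C' * h" using Suc i by (simp add: i_def)
      also have "pCons 0 (W * poly_shift (Suc i) f - poly_shift (Suc i) C' * h) + smult (coeff f i) W - smult (c i) h
          = W * pCons (coeff f i) (poly_shift (Suc i) f) - pCons (coeff C' i) (poly_shift (Suc i) C') * h"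
        using i by (simp add: C'_coeff algebra_simps)
      finally show ?case using i by (simp add: shift_Suc[symmetric] i_def[symmetric])
    qed
    have veq: "v i = W * poly_shift (Suc i) f - poly_shift (Suc i) C' * h" if "i < D" for i
      using eq[of "D - Suc i"] that by (simp add: Suc_diff_Suc)
    have "pCons 0 (v 0) + smult (coeff f 0) W = smult (c 0) h"
      using c[OF f(3)] unfolding companion_row[OF f(3)] by (simp add: W_def)
    moreover have "pCons 0 (v 0) + smult (coeff f 0) W - smult (c 0) h
        = W * pCons (coeff f 0) (poly_shift (Suc 0) f) - pCons (coeff C' 0) (poly_shift (Suc 0) C') * h"
      using veq[OF f(3)] f(3) by (simp add: C'_coeff algebra_simps)
    ultimately have WC: "W * f = C' * h" by (simp add: shift_Suc[symmetric])
    hence CC': "C = C'" unfolding C W_def[symmetric] using h0 by (simp add: mult.commute)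
    have "C' * h div f = W" using WC f0 by (metis nonzero_mult_div_cancel_right)
    hence "\<Psi> C = v" using veq psolD(1)[OF v] by (auto simp: \<Psi>_def CC' fun_eq_iff)
    thus ?thesis using WC C' by (simp add: CC' W_def mult.commute)
  qed
  have "bij_betw (\<lambda>v. f * v (D - 1) div h) (psol {..<D} {..<D} (pencil idm (companion f)) k h) {C \<in> polys_below D. f dvd C * h}"
  proof (rule bij_betw_byWitness[where f' = \<Psi>])
    show "\<forall>v\<in>psol {..<D} {..<D} (pencil idm (companion f)) k h. \<Psi> (f * v (D - 1) div h) = v" using sol by simp
    show "(\<lambda>v. f * v (D - 1) div h) ` psol {..<D} {..<D} (pencil idm (companion f)) k h \<subseteq> {C \<in> polys_below D. f dvd C * h}"
    proof clarify
      fix v assume v: "v \<in> psol {..<D} {..<D} (pencil idm (companion f)) k h"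
      show "f * v (D - 1) div h \<in> polys_below D \<and> f dvd f * v (D - 1) div h * h"
        using sol[OF v refl] by (metis dvd_triv_left)
    qed
    have WC: "f * (C * h div f) = C * h" if "f dvd C * h" for C using that by simp
    have "\<Psi> C (D - 1) = C * h div f" if "C \<in> polys_below D" for C
      using f topf shift_high[OF that] by (simp add: \<Psi>_def)
    thus "\<forall>C\<in>{C \<in> polys_below D. f dvd C * h}. f * \<Psi> C (D - 1) div h = C"
      using WC h0 by simp
    show "\<Psi> ` {C \<in> polys_below D. f dvd C * h} \<subseteq> psol {..<D} {..<D} (pencil idm (companion f)) k h"
    proof clarify
      fix C assume C: "C \<in> polys_below D" and dvd: "f dvd C * h"
      define W where "W = C * h div f"
      have W: "f * W = C * h" using dvd by (simp add: W_def)
      have \<Psi>: "\<Psi> C i = W * poly_shift (Suc i) f - poly_shift (Suc i) C * h" if "i < D" for i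
        using that by (simp add: \<Psi>_def W_def)
      show "\<Psi> C \<in> psol {..<D} {..<D} (pencil idm (companion f)) k h"
      proof (rule psolI)
        show "\<Psi> C j = 0" if "j \<notin> {..<D}" for j using that by (simp add: \<Psi>_def)
        fix i assume "i \<in> {..<D}"
        hence i: "i < D" by simp
        define n where "n = Suc i"
        \<comment> \<open>The product of the two high parts cancels in E. This keeps its degree
          below D, although each of the two terms may exceed it.\<close>
        define E where "E = C * poly_shift n f - poly_shift n C * f"
        have "f * \<Psi> C i = (f * W) * poly_shift n f - poly_shift n C * f * h"
          unfolding \<Psi>[OF i] n_def[symmetric] by (simp add: algebra_simps)
        also have "\<dots> = E * h" unfolding W by (simp add: E_def algebra_simps)
        finally have E1: "f * \<Psi> C i = E * h" .
        have "E = poly_cutoff n C * poly_shift n f - poly_shift n C * poly_cutoff n f"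
        proof -
          have aux: "E = a * q - s * b" if "C = a + u * s" "f = b + u * q" "q = poly_shift n f" "s = poly_shift n C" for a b q s u
            unfolding E_def that(3,4)[symmetric] unfolding that(1,2) by (simp add: algebra_simps)
          show ?thesis by (rule aux[OF cutoff_shift cutoff_shift refl refl])
        qed
        moreover have "poly_cutoff n C * poly_shift n f \<in> polys_below D" "poly_shift n C * poly_cutoff n f \<in> polys_below D"
        proof -
          have "poly_cutoff n C \<in> polys_below n" "poly_cutoff n f \<in> polys_below n"
            by (auto simp: polys_below_def coeff_poly_cutoff)
          moreover have "poly_shift n C \<in> polys_below (D - n)" using C by (auto simp: polys_below_def coeff_poly_shift)
          moreover have "poly_shift n f \<in> polys_below (Suc D - n)"
            using f(2) by (auto simp: polys_below_def coeff_poly_shift intro: coeff_eq_0)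
          ultimately show "poly_cutoff n C * poly_shift n f \<in> polys_below D" "poly_shift n C * poly_cutoff n f \<in> polys_below D"
            using i by (auto simp: n_def intro: polys_below_mult)
        qed
        ultimately have "E \<in> polys_below D" by (auto intro: polys_below_diff)
        thus "degree (\<Psi> C i) \<le> k" by (rule degree_cofactor[OF E1])
        have top: "\<Psi> C (D - 1) = W" using f topf shift_high[OF C] by (simp add: \<Psi>)
        have step: "pCons 0 (W * poly_shift (Suc i) f - poly_shift (Suc i) C * h) + smult (coeff f i) W - smult (coeff C i) h
          = W * poly_shift i f - poly_shift i C * h"
          unfolding shift_Suc[of i] by (simp add: algebra_simps)
        have prev: "(if i = 0 then 0 else \<Psi> C (i - 1)) = W * poly_shift i f - poly_shift i C * h"
        proof (cases i)
          case 0
          thus ?thesis using W by (simp add: mult.commute)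
        next
          case (Suc i')
          thus ?thesis using i by (simp add: \<Psi>)
        qed
        have "(\<Sum>j<D. pencil idm (companion f) i j * \<Psi> C j) = smult (coeff C i) h"
          unfolding companion_row[OF i] prev top step[symmetric] \<Psi>[OF i] by simp
        thus "\<exists>c. (\<Sum>j<D. pencil idm (companion f) i j * \<Psi> C j) = smult c h" by blast
      qed
    qed
  qed
  thus ?thesis by (rule bij_betw_same_card)
qed

lemma monic_expand: "f * u = pCons 0 (monom 1 (D - 1) * u) + (\<Sum>j<D. smult (coeff f j) (monom 1 j * u))"
proof -
  have "f * u = (\<Sum>j\<le>D. monom (coeff f j) j) * u" using poly_as_sum_of_monoms[of f] f by simp
  also have "\<dots> = (\<Sum>j<D. monom (coeff f j) j * u) + monom 1 D * u"
    using f by (simp add: lessThan_Suc_atMost[symmetric] distrib_right sum_distrib_right)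
  also have "monom 1 D * u = pCons 0 (monom 1 (D - 1) * u)"
    using f(3) monom_Suc[of "1::'k" "D - 1"] by simp
  also have "(\<Sum>j<D. monom (coeff f j) j * u) = (\<Sum>j<D. smult (coeff f j) (monom 1 j * u))"
    by (intro sum.cong refl) (metis mult.right_neutral mult_smult_left smult_monom)
  finally show ?thesis by (simp add: add.commute)
qed

text \<open>The rows give v i = x^i (v 0) modulo h. With f (v 0) = C h this becomes f (v i) = E h,
  where E is x^i C modulo f and the degree bound on v i forces E to be reduced. So C again
  parametrises the solutions.\<close>

lemma card_psol_companion_transpose:
  "card (psol {..<D} {..<D} (\<lambda>i j. pencil idm (companion f) j i) k h) = card {C \<in> polys_below D. f dvd C * h}"
proof -
  define L where "L = (\<lambda>i j. pencil idm (companion f) j i)"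
  define E where "E C i = (monom 1 i * C) mod f" for C i
  define \<Psi> where "\<Psi> C = (\<lambda>i. if i < D then E C i * h div f else 0)" for C
  have E_below: "E C i \<in> polys_below D" for C i using degree_mod_below[OF f0] f by (simp add: E_def)
  have E_below': "E C i \<in> polys_below (Suc D)" for C i using E_below[of C i] by (simp add: polys_below_def)
  have E_div: "E C i = monom 1 i * C - (monom 1 i * C div f) * f" for C i
    by (simp add: E_def minus_div_mult_eq_mod)
  have sol: "f * v 0 = C * h \<and> \<Psi> C = v \<and> C \<in> polys_below D"
    if v: "v \<in> psol {..<D} {..<D} L k h" and C: "C = f * v 0 div h" for v C
  proof -
    have row: "\<exists>c. (\<Sum>j<D. L i j * v j) = smult c h" if "i < D" for i
      using psolD(3)[OF v, of i] that by simp
    have "\<exists>s. v i = monom 1 i * v 0 - s * h" if "i < D" for i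
      using that
    proof (induction i)
      case 0
      show ?case by (intro exI[of _ 0]) simp
    next
      case (Suc i)
      then obtain s where s: "v i = monom 1 i * v 0 - s * h" by auto
      obtain c where "pCons 0 (v i) - v (Suc i) = smult c h"
        using row[of i] companion_transpose_row[of i v] Suc.prems unfolding L_def by auto
      hence "v (Suc i) = pCons 0 (v i) - smult c h" by (simp only: diff_eq_eq eq_diff_eq add.commute)
      also have "\<dots> = monom 1 (Suc i) * v 0 - ([:0, 1:] * s + [:c:]) * h"
        unfolding s by (simp add: monom_Suc algebra_simps)
      finally show ?case by blast
    qed
    then obtain s where s: "\<And>i. i < D \<Longrightarrow> v i = monom 1 i * v 0 - s i * h" by metis
    have last: "D - 1 < D" "\<not> Suc (D - 1) < D" using f by auto
    obtain c where "pCons 0 (v (D - 1)) + (\<Sum>j<D. smult (coeff f j) (v j)) = smult c h"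
      using row[OF last(1)] companion_transpose_row[OF last(1), of v] last(2) unfolding L_def by auto
    moreover have "pCons 0 (v (D - 1)) + (\<Sum>j<D. smult (coeff f j) (v j))
        = f * v 0 - (pCons 0 (s (D - 1)) + (\<Sum>j<D. smult (coeff f j) (s j))) * h"
    proof -
      have "(\<Sum>j<D. smult (coeff f j) (v j)) = (\<Sum>j<D. smult (coeff f j) (monom 1 j * v 0) - smult (coeff f j) (s j) * h)"
      proof (rule sum.cong[OF refl])
        fix j assume "j \<in> {..<D}"
        hence vj: "v j = monom 1 j * v 0 - s j * h" using s by blast
        show "smult (coeff f j) (v j) = smult (coeff f j) (monom 1 j * v 0) - smult (coeff f j) (s j) * h"
          unfolding arg_cong[OF vj, of "smult (coeff f j)"] by (simp add: smult_diff_right)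
      qed
      hence sm: "(\<Sum>j<D. smult (coeff f j) (v j)) = (\<Sum>j<D. smult (coeff f j) (monom 1 j * v 0)) - (\<Sum>j<D. smult (coeff f j) (s j)) * h"
        by (simp add: sum_subtractf sum_distrib_right)
      have "pCons 0 (v (D - 1)) = pCons 0 (monom 1 (D - 1) * v 0) - pCons 0 (s (D - 1)) * h"
        unfolding arg_cong[OF s[OF last(1)], of "pCons 0"] by simp
      thus ?thesis unfolding sm monic_expand[of "v 0"] by (simp only: distrib_right) simp
    qed
    ultimately have "f * v 0 = (pCons 0 (s (D - 1)) + (\<Sum>j<D. smult (coeff f j) (s j)) + [:c:]) * h"
      by (simp add: algebra_simps)
    hence fv: "f * v 0 = C * h" unfolding C by (metis dvd_triv_right dvd_div_mult_self)
    have CD: "C \<in> polys_below D" by (rule cofactor_below[OF fv psolD(2)[OF v]])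
    have "\<Psi> C i = v i" for i
    proof (cases "i < D")
      case True
      have "f * v i = monom 1 i * (f * v 0) - f * s i * h" unfolding arg_cong[OF s[OF True], of "(*) f"] by (simp add: algebra_simps)
      also have "\<dots> = (monom 1 i * C - s i * f) * h" unfolding fv by (simp add: algebra_simps)
      finally have *: "f * v i = (monom 1 i * C - s i * f) * h" .
      have "monom 1 i * C - s i * f \<in> polys_below D" by (rule cofactor_below[OF * psolD(2)[OF v]])
      hence "(monom 1 i * C - s i * f) mod f = monom 1 i * C - s i * f" using f f0 by (intro mod_below_eq) simp_all
      moreover have "(monom 1 i * C - s i * f) mod f = E C i"
        using mod_mult_self1[of "monom 1 i * C" "- s i" f] by (simp add: E_def)
      ultimately have "f * v i = E C i * h" using * by simp
      thus ?thesis using True f0 by (simp add: \<Psi>_def) (metis nonzero_mult_div_cancel_left)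
    qed (use psolD(1)[OF v] in \<open>simp add: \<Psi>_def\<close>)
    thus ?thesis using fv CD by auto
  qed
  have "bij_betw (\<lambda>v. f * v 0 div h) (psol {..<D} {..<D} L k h) {C \<in> polys_below D. f dvd C * h}"
  proof (rule bij_betw_byWitness[where f' = \<Psi>])
    show "\<forall>v\<in>psol {..<D} {..<D} L k h. \<Psi> (f * v 0 div h) = v" using sol by simp
    show "(\<lambda>v. f * v 0 div h) ` psol {..<D} {..<D} L k h \<subseteq> {C \<in> polys_below D. f dvd C * h}"
    proof clarify
      fix v assume v: "v \<in> psol {..<D} {..<D} L k h"
      show "f * v 0 div h \<in> polys_below D \<and> f dvd f * v 0 div h * h"
        using sol[OF v refl] by (metis dvd_triv_left)
    qed
    have \<Psi>: "f * \<Psi> C i = E C i * h" if "f dvd C * h" "i < D" for C i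
    proof -
      have "f dvd monom 1 i * (C * h)" using that(1) by (rule dvd_mult)
      moreover have "E C i * h = monom 1 i * (C * h) - f * ((monom 1 i * C div f) * h)"
        unfolding E_div by (simp add: algebra_simps)
      ultimately have "f dvd E C i * h" by simp
      thus ?thesis using that by (simp add: \<Psi>_def)
    qed
    show "\<forall>C\<in>{C \<in> polys_below D. f dvd C * h}. f * \<Psi> C 0 div h = C"
    proof clarify
      fix C assume C: "C \<in> polys_below D" "f dvd C * h"
      have "E C 0 = C" using C(1) f f0 mod_below_eq[of f C] by (simp add: E_def monom_0 one_pCons[symmetric])
      thus "f * \<Psi> C 0 div h = C" using \<Psi>[OF C(2) f(3)] h0 by simp
    qed
    show "\<Psi> ` {C \<in> polys_below D. f dvd C * h} \<subseteq> psol {..<D} {..<D} L k h"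
    proof clarify
      fix C assume C: "C \<in> polys_below D" and dvd: "f dvd C * h"
      show "\<Psi> C \<in> psol {..<D} {..<D} L k h"
      proof (rule psolI)
        show "\<Psi> C j = 0" if "j \<notin> {..<D}" for j using that by (simp add: \<Psi>_def)
        show "degree (\<Psi> C j) \<le> k" if "j \<in> {..<D}" for j
          using that by (intro degree_cofactor[OF \<Psi>[OF dvd] E_below]) simp
        fix i assume "i \<in> {..<D}"
        hence i: "i < D" by simp
        show "\<exists>c. (\<Sum>j<D. L i j * \<Psi> C j) = smult c h"
        proof (cases "Suc i < D")
          case True
          have row: "(\<Sum>j<D. L i j * \<Psi> C j) = pCons 0 (\<Psi> C i) - \<Psi> C (Suc i)"
            unfolding L_def companion_transpose_row[OF i] using True by simp
          have "f * (pCons 0 (\<Psi> C i) - \<Psi> C (Suc i)) = pCons 0 (f * \<Psi> C i) - f * \<Psi> C (Suc i)"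
            by (simp add: algebra_simps)
          also have "\<dots> = (pCons 0 (E C i) - E C (Suc i)) * h"
            using \<Psi>[OF dvd i] \<Psi>[OF dvd True] by (simp add: algebra_simps)
          finally have R: "f * (pCons 0 (\<Psi> C i) - \<Psi> C (Suc i)) = (pCons 0 (E C i) - E C (Suc i)) * h" .
          have "pCons 0 (E C i) - E C (Suc i) = f * ((monom 1 (Suc i) * C div f) - pCons 0 (monom 1 i * C div f))"
            unfolding E_div by (simp add: monom_Suc algebra_simps)
          hence "f dvd pCons 0 (E C i) - E C (Suc i)" by simp
          moreover have "pCons 0 (E C i) - E C (Suc i) \<in> polys_below (Suc D)"
            using E_below[of C i] E_below'[of C "Suc i"]
            by (intro polys_below_diff) (auto simp: polys_below_iff degree_pCons_eq_if)
          ultimately show ?thesis unfolding row by (rule row_of_cofactor[OF R])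
        next
          case False
          hence iD: "i = D - 1" using i by simp
          define R where "R = pCons 0 (\<Psi> C i) + (\<Sum>j<D. smult (coeff f j) (\<Psi> C j))"
          define E' where "E' = pCons 0 (E C i) + (\<Sum>j<D. smult (coeff f j) (E C j))"
          have row: "(\<Sum>j<D. L i j * \<Psi> C j) = R"
            unfolding L_def companion_transpose_row[OF i] R_def using False by simp
          have "f * R = pCons 0 (f * \<Psi> C i) + (\<Sum>j<D. smult (coeff f j) (f * \<Psi> C j))"
            by (simp add: R_def algebra_simps sum_distrib_left)
          also have "(\<Sum>j<D. smult (coeff f j) (f * \<Psi> C j)) = (\<Sum>j<D. smult (coeff f j) (E C j * h))"
            by (intro sum.cong refl) (simp add: \<Psi>[OF dvd])
          also have "pCons 0 (f * \<Psi> C i) + \<dots> = E' * h"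
            using \<Psi>[OF dvd i] by (simp add: E'_def algebra_simps sum_distrib_left sum_distrib_right)
          finally have R: "f * R = E' * h" .
          have "(\<Sum>j<D. smult (coeff f j) (E C j)) = (\<Sum>j<D. smult (coeff f j) (monom 1 j * C) - f * smult (coeff f j) (monom 1 j * C div f))"
            unfolding E_div by (intro sum.cong refl) (simp add: smult_diff_right mult.commute)
          hence sm: "(\<Sum>j<D. smult (coeff f j) (E C j)) = (\<Sum>j<D. smult (coeff f j) (monom 1 j * C)) - f * (\<Sum>j<D. smult (coeff f j) (monom 1 j * C div f))"
            by (simp only: sum_subtractf sum_distrib_left)
          have pc: "pCons 0 (E C (D - 1)) = pCons 0 (monom 1 (D - 1) * C) - f * pCons 0 (monom 1 (D - 1) * C div f)"
            unfolding E_div by (simp add: mult.commute)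
          have gen: "(a - x) + (b - y) = (a + b) - (x + y)" for a b x y :: "'k poly" by (simp add: algebra_simps)
          have "E' = f * C - f * (pCons 0 (monom 1 (D - 1) * C div f) + (\<Sum>j<D. smult (coeff f j) (monom 1 j * C div f)))"
            unfolding E'_def iD pc sm monic_expand[of C] distrib_left by (rule gen)
          hence "f dvd E'" by simp
          moreover have "E' \<in> polys_below (Suc D)"
            unfolding E'_def using E_below[of C i]
            by (intro polys_below_add polys_below_sum polys_below_smult E_below') (auto simp: polys_below_iff degree_pCons_eq_if)
          ultimately show ?thesis unfolding row by (rule row_of_cofactor[OF R])
        qed
      qed
    qed
  qed
  thus ?thesis unfolding L_def by (rule bij_betw_same_card)
qed

end

section \<open>Counting the polynomials C\<close>

lemma irreducible_monic_coprime:
  fixes g g' :: "'k::field_gcd poly"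
  assumes "irreducible g" "irreducible g'" "lead_coeff g = 1" "lead_coeff g' = 1" "g \<noteq> g'"
  shows "coprime g g'"
proof -
  have "\<not> g dvd g'"
  proof
    assume "g dvd g'"
    then obtain s where s: "g' = g * s" by (elim dvdE)
    hence "is_unit s" using irreducibleD[OF assms(2) s] assms(1) by (auto simp: irreducible_def)
    then obtain c where c: "s = [:c:]" using is_unit_polyE by blast
    hence "lead_coeff g' = lead_coeff g * c" using s by simp
    hence "c = 1" using assms by simp
    thus False using s c assms(5) by (simp add: one_pCons[symmetric])
  qed
  thus ?thesis using assms(1) irreducible_imp_prime_elem_gcd prime_elem_imp_coprime by blast
qed

text \<open>g^d divides C g^j exactly when g^(d - min d j) divides C, which leaves degree g * min d
  j free coefficients.\<close>

lemma card_power_multiples: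
  fixes g :: "'k::{field_gcd,finite} poly"
  assumes g: "g \<noteq> 0"
  shows "card {C \<in> polys_below (d * degree g). g ^ d dvd C * g ^ j} = CARD('k) ^ (degree g * min d j)"
proof -
  define m where "m = min d j"
  have gp: "g ^ n \<noteq> 0" for n using g by simp
  have dvd: "g ^ d dvd C * g ^ j \<longleftrightarrow> g ^ (d - m) dvd C" for C
  proof (cases "d \<le> j")
    case True
    thus ?thesis by (simp add: m_def min_def dvd_mult le_imp_power_dvd)
  next
    case False
    hence "g ^ d = g ^ (d - m) * g ^ j" by (simp add: m_def min_def power_add[symmetric])
    thus ?thesis using g by simp
  qed
  have deg: "(g ^ (d - m) * p \<in> polys_below (d * degree g)) = (p \<in> polys_below (degree g * m))" for p
  proof -
    have "m \<le> d" by (simp add: m_def)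
    then obtain l where "d = m + l" using le_Suc_ex by blast
    thus ?thesis using gp[of "d - m"] g
      by (cases "p = 0") (auto simp: polys_below_iff degree_mult_eq degree_power_eq algebra_simps)
  qed
  have "{C \<in> polys_below (d * degree g). g ^ d dvd C * g ^ j} = (\<lambda>p. g ^ (d - m) * p) ` polys_below (degree g * m)"
    unfolding dvd by (auto simp: deg elim!: dvdE)
  moreover have "inj_on (\<lambda>p. g ^ (d - m) * p) (polys_below (degree g * m))" using gp by (auto simp: inj_on_def)
  ultimately show ?thesis by (simp add: card_image card_polys_below m_def)
qed

lemma card_coprime_multiples:
  fixes f h :: "'k::{field_gcd,finite} poly"
  assumes "coprime f h" "f \<noteq> 0"
  shows "card {C \<in> polys_below (degree f). f dvd C * h} = 1"
proof -
  have "C = 0" if "C \<in> polys_below (degree f)" "f dvd C * h" for C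
  proof -
    have "f dvd C" using that(2) assms(1) by (simp add: coprime_dvd_mult_left_iff)
    thus ?thesis using that(1) dvd_imp_degree_le[of f C] by (cases "C = 0") (auto simp: polys_below_iff)
  qed
  hence "{C \<in> polys_below (degree f). f dvd C * h} = {0}" by (auto simp: polys_below_def)
  thus ?thesis by simp
qed

subsection \<open>Blocks at infinity\<close>

lemma infinity_row:
  fixes v :: "nat \<Rightarrow> 'k::field poly"
  assumes "i < d"
  shows "(\<Sum>j<d. pencil (companion (monom 1 d)) idm i j * v j) = (if i = 0 then 0 else pCons 0 (v (i - 1))) - v i"
proof -
  have "(\<Sum>j<d. pencil (companion (monom 1 d)) idm i j * v j)
     = (\<Sum>j<d. (if j = i then - v j else 0) + (if j = i - 1 then (if i = 0 then 0 else pCons 0 (v j)) else 0))"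
    using assms by (intro sum.cong refl) (auto simp: pencil_def idm_def companion_def degree_monom_eq)
  also have "\<dots> = (\<Sum>j<d. if j = i then - v j else 0) + (\<Sum>j<d. if j = i - 1 then (if i = 0 then 0 else pCons 0 (v j)) else 0)"
    by (rule sum.distrib)
  also have "\<dots> = (if i = 0 then 0 else pCons 0 (v (i - 1))) - v i"
    using assms by (subst sum.delta, simp)+ auto
  finally show ?thesis .
qed

text \<open>Reversing the order of the basis transposes a nilpotent Jordan block.\<close>

lemma psol_infinity_transpose:
  "card (psol {..<d} {..<d} (\<lambda>i j. pencil (companion (monom 1 d)) idm j i) k h)
   = card (psol {..<d} {..<d} (pencil (companion (monom 1 d)) idm) k (h :: 'k::field poly))"
proof -
  let ?L = "pencil (companion (monom (1::'k) d)) idm"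
  let ?r = "\<lambda>i. d - 1 - i"
  have img: "?r ` {..<d} = {..<d}"
  proof
    show "{..<d} \<subseteq> ?r ` {..<d}"
    proof
      fix i assume "i \<in> {..<d}"
      thus "i \<in> ?r ` {..<d}" by (intro image_eqI[of _ _ "?r i"]) auto
    qed
  qed auto
  have "card (psol (?r ` {..<d}) (?r ` {..<d}) (\<lambda>i j. ?L j i) k h) = card (psol {..<d} {..<d} (\<lambda>i j. ?L (?r j) (?r i)) k h)"
    by (rule psol_reindex) (auto simp: inj_on_def)
  also have "psol {..<d} {..<d} (\<lambda>i j. ?L (?r j) (?r i)) k h = psol {..<d} {..<d} ?L k h"
  proof (rule psol_cong)
    fix i j assume "i \<in> {..<d}" "j \<in> {..<d}"
    hence "(d - 1 - j = d - 1 - i) = (i = j)" "(d - 1 - j = Suc (d - 1 - i)) = (i = Suc j)"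
      "d \<noteq> d - 1 - j" "d \<noteq> i" by auto
    thus "?L (?r j) (?r i) = ?L i j" by (simp add: pencil_def idm_def companion_def degree_monom_eq)
  qed
  finally show ?thesis unfolding img .
qed

text \<open>Row 0 is - v 0 = c h, which forces v 0 = 0 since c h is 0 or of degree above k. After
  that, row 1 has the same form, and so on.\<close>

lemma psol_infinity_trivial:
  fixes h :: "'k::field poly"
  assumes h: "h = 0 \<or> degree h = Suc k"
  shows "card (psol {..<d} {..<d} (pencil (companion (monom 1 d)) idm) k h) = 1"
proof (rule psol_trivial)
  fix v j assume v: "v \<in> psol {..<d} {..<d} (pencil (companion (monom 1 d)) idm) k h" and "j \<in> {..<d}"
  have row: "\<exists>c. (if i = 0 then 0 else pCons 0 (v (i - 1))) - v i = smult c h" if "i < d" for i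
    using psolD(3)[OF v, of i] that unfolding infinity_row[OF that] by simp
  have z: "v i = 0" if c: "- v i = smult c h" for i c
  proof (cases "h = 0")
    case False
    hence "degree h = Suc k" using h by simp
    hence "- v i = 0" using psolD(2)[OF v, of i] by (intro large_smult_eq_0[OF _ _ c]) simp_all
    thus ?thesis by simp
  qed (use c in simp)
  have "v j = 0" if "j < d" for j
    using that
  proof (induction j)
    case 0
    thus ?case using row[of 0] z by auto
  next
    case (Suc j)
    thus ?case using row[of "Suc j"] z[of "Suc j"] by auto
  qed
  thus "v j = 0" using \<open>j \<in> {..<d}\<close> by simp
qed

text \<open>All components are shifts of v (d - 1), and row 0 makes v 0 constant. So v (d - 1) has
  degree below d besides the bound k, and is otherwise arbitrary.\<close>

lemma psol_infinity_x2:
  assumes d: "d > 0"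
  shows "card (psol {..<d} {..<d} (pencil (companion (monom 1 d)) idm) k (1 :: 'k::{field,finite} poly)) = CARD('k) ^ min d (k + 1)"
  unfolding card_polys_below[symmetric]
proof -
  let ?X = "psol {..<d} {..<d} (pencil (companion (monom 1 d)) idm) k (1 :: 'k poly)"
  let ?N = "min d (k + 1)"
  define \<Psi> where "\<Psi> p = (\<lambda>i. if i < d then poly_shift (d - 1 - i) p else 0)" for p :: "'k poly"
  have sol: "v (d - 1) \<in> polys_below ?N \<and> \<Psi> (v (d - 1)) = v" if v: "v \<in> ?X" for v
  proof -
    have row: "\<exists>c. (if i = 0 then 0 else pCons 0 (v (i - 1))) - v i = smult c 1" if "i < d" for i
      using psolD(3)[OF v, of i] that unfolding infinity_row[OF that] by simp
    have sh: "poly_shift n (v (d - 1)) = v (d - 1 - n)" if "n < d" for n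
      using that
    proof (induction n)
      case (Suc n)
      define i where "i = d - 1 - n"
      have i: "i < d" "i \<noteq> 0" "d - 1 - Suc n = i - 1" using Suc.prems by (auto simp: i_def)
      obtain c where c: "pCons 0 (v (i - 1)) - v i = smult c 1" using row[OF i(1)] i(2) by auto
      have "v i = pCons 0 (v (i - 1)) - smult c 1" by (simp only: c[symmetric]) simp
      hence "v i = pCons (- c) (v (i - 1))" by (simp add: one_pCons)
      moreover have "v i = pCons (coeff (v (d - 1)) n) (poly_shift (Suc n) (v (d - 1)))"
        using Suc by (simp add: shift_Suc[symmetric] i_def)
      ultimately show ?case using i by simp
    qed simp
    obtain c where c: "- v 0 = smult c 1" using row[OF d] by auto
    have "v 0 = - smult c 1" by (simp only: c[symmetric]) simp
    hence v0: "coeff (v 0) n = 0" if "n \<noteq> 0" for n using that by (simp add: coeff_eq_0)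
    have "coeff (v (d - 1)) n = 0" if "n \<ge> d" for n
    proof -
      have "coeff (v (d - 1)) n = coeff (poly_shift (d - 1) (v (d - 1))) (n - (d - 1))"
        using that d by (simp add: coeff_poly_shift)
      thus ?thesis using sh[of "d - 1"] v0 d that by simp
    qed
    moreover have "coeff (v (d - 1)) n = 0" if "n > k" for n
      using psolD(2)[OF v, of "d - 1"] that by (intro coeff_eq_0) simp
    ultimately have "v (d - 1) \<in> polys_below ?N" by (auto simp: polys_below_def min_def split: if_splits)
    moreover have "\<Psi> (v (d - 1)) i = v i" for i
      using sh[of "d - 1 - i"] psolD(1)[OF v, of i] by (simp add: \<Psi>_def)
    ultimately show ?thesis by auto
  qed
  have "bij_betw (\<lambda>v. v (d - 1)) ?X (polys_below ?N)"
  proof (rule bij_betw_byWitness[where f' = \<Psi>])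
    show "\<forall>v\<in>?X. \<Psi> (v (d - 1)) = v" "(\<lambda>v. v (d - 1)) ` ?X \<subseteq> polys_below ?N" using sol by auto
    show "\<forall>p\<in>polys_below ?N. \<Psi> p (d - 1) = p" using d by (simp add: \<Psi>_def)
    show "\<Psi> ` polys_below ?N \<subseteq> ?X"
    proof clarify
      fix p :: "'k poly" assume p: "p \<in> polys_below ?N"
      show "\<Psi> p \<in> ?X"
      proof (rule psolI)
        show "\<Psi> p j = 0" if "j \<notin> {..<d}" for j using that by (simp add: \<Psi>_def)
        have below: "\<Psi> p j \<in> polys_below (k + 1)" for j using p by (auto simp: \<Psi>_def polys_below_def coeff_poly_shift)
        show "degree (\<Psi> p j) \<le> k" for j using below[of j] by (auto simp: polys_below_iff)
        fix i assume "i \<in> {..<d}"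
        hence i: "i < d" by simp
        show "\<exists>c. (\<Sum>j<d. pencil (companion (monom 1 d)) idm i j * \<Psi> p j) = smult c 1"
        proof (cases i)
          case 0
          have "p \<in> polys_below d" using p by (simp add: polys_below_def)
          hence "poly_shift d p = 0" by (rule shift_high)
          hence "- \<Psi> p 0 = smult (- coeff p (d - 1)) 1"
            using shift_Suc[of "d - 1" p] d by (simp add: \<Psi>_def one_pCons)
          thus ?thesis unfolding infinity_row[OF i] using 0 by auto
        next
          case (Suc i')
          have e: "d - 1 - i' = Suc (d - 1 - i)" using i Suc by simp
          have "pCons 0 (\<Psi> p i') - \<Psi> p i = smult (- coeff p (d - 1 - i)) 1"
            using shift_Suc[of "d - 1 - i" p] i Suc e by (simp add: \<Psi>_def one_pCons)
          thus ?thesis unfolding infinity_row[OF i] using Suc by auto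
        qed
      qed
    qed
  qed
  thus "card ?X = card (polys_below ?N :: 'k poly set)" by (rule bij_betw_same_card)
qed

subsection \<open>Invariants of the canonical pairs\<close>

text \<open>A unital form other than x2 has leading coefficient 1 in x1, so setting x2 = 1 keeps its
  degree, and a factorisation of the polynomial would lift to one of the form.\<close>

lemma Pset_cases:
  fixes g :: "'k::field bform"
  assumes "g \<in> Pset" "g \<noteq> (1, 1)"
  shows "irreducible (snd g)" "lead_coeff (snd g) = 1" "degree (snd g) = fst g" "fst g \<ge> 1"
proof -
  have g: "bform_wf g" "fst g \<ge> 1" "coeff (snd g) (fst g) = 1" and irr:
    "\<And>h k. bform_wf h \<Longrightarrow> bform_wf k \<Longrightarrow> fst h \<ge> 1 \<Longrightarrow> fst k \<ge> 1 \<Longrightarrow> g \<noteq> bform_mult h k"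
    using assms unfolding Pset_def bform_irreducible_def bform_unital_def by blast+
  show deg: "degree (snd g) = fst g"
    using g(1,3) le_degree[of "snd g" "fst g"] by (simp add: bform_wf_def)
  show "fst g \<ge> 1" "lead_coeff (snd g) = 1" using g deg by simp_all
  show "irreducible (snd g)"
  proof (rule irreducibleI)
    show nz: "snd g \<noteq> 0" using g(3) by auto
    show "\<not> snd g dvd 1" using nz deg g(2) by (simp add: is_unit_iff_degree)
    show "a dvd 1 \<or> b dvd 1" if ab: "snd g = a * b" for a b
    proof (rule ccontr)
      assume no: "\<not> ?thesis"
      have nz': "a \<noteq> 0" "b \<noteq> 0" using nz ab by auto
      hence "degree a \<ge> 1" "degree b \<ge> 1" using no by (auto simp: is_unit_iff_degree)
      moreover have "g = bform_mult (degree a, a) (degree b, b)"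
        using ab deg degree_mult_eq[OF nz'] by (simp add: bform_mult_def prod_eq_iff)
      ultimately show False using irr[of "(degree a, a)" "(degree b, b)"] by (simp add: bform_wf_def)
    qed
  qed
qed

definition block_count :: "'k::field bform option \<Rightarrow> nat \<Rightarrow> nat \<Rightarrow> 'k poly \<Rightarrow> nat" where
  "block_count og d k h = card (psol {..<Rsize og d} {..<Rsize og d} (pencil (Rmat 1 og d) (Rmat 2 og d)) k h)"

text \<open>The transposed half of the block contributes the factor 1, so the count is that of
  R_(-,d) with m = d - 1 rows.\<close>

lemma block_count_None:
  assumes "d \<ge> 1"
  shows "block_count (None :: 'k::{field_gcd,finite} bform option) d k 0 = CARD('k) ^ (k + 2 - d)"
    and "h = 1 \<or> degree h = Suc k \<Longrightarrow> block_count (None :: 'k bform option) d k h = CARD('k) ^ (k + 1)"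
proof -
  obtain m where m: "d = Suc m" using assms by (cases d) auto
  have size: "Rsize (None :: 'k bform option) d = m + Suc m" by (simp add: Rsize_def m)
  have mat: "Rmat l (None :: 'k bform option) d = plus_mat m (Rbase l None d)" for l
    by (simp add: Rmat_def Rrows_def m)
  have c: "block_count (None :: 'k bform option) d k h
     = card (psol {..<m} {..<Suc m} (pencil (Rbase 1 None d) (Rbase 2 None d)) k h)
       * card (psol {..<Suc m} {..<m} (\<lambda>i j. pencil (Rbase 1 None d) (Rbase 2 None d) j i) k h)" for h
    unfolding block_count_def size mat by (rule psol_plus_mat)
  show "block_count (None :: 'k bform option) d k 0 = CARD('k) ^ (k + 2 - d)"
    unfolding c psol_singular_homogeneous by (subst psol_singular_transpose) (simp_all add: m)
  assume h: "h = 1 \<or> degree h = Suc k"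
  hence "card (psol {..<m} {..<Suc m} (pencil (Rbase 1 None d) (Rbase 2 None d)) k h) = CARD('k) ^ (k + 1)"
    using psol_singular_x2 psol_singular_proper by metis
  thus "block_count (None :: 'k bform option) d k h = CARD('k) ^ (k + 1)"
    unfolding c using h by (subst psol_singular_transpose) auto
qed

lemma block_count_x2:
  assumes "d \<ge> 1"
  shows "h = 0 \<or> degree h = Suc k \<Longrightarrow> block_count (Some (1, 1) :: 'k::{field_gcd,finite} bform option) d k h = 1"
    and "block_count (Some (1, 1) :: 'k bform option) d k 1 = CARD('k) ^ (2 * min d (k + 1))"
proof -
  have size: "Rsize (Some (1, 1) :: 'k bform option) d = d + d" by (simp add: Rsize_def)
  have mat: "Rmat 1 (Some (1, 1) :: 'k bform option) d = plus_mat d (companion (monom 1 d))"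
    "Rmat 2 (Some (1, 1) :: 'k bform option) d = plus_mat d idm"
    by (simp_all add: Rmat_def Rrows_def Rbase_def)
  have c: "block_count (Some (1, 1) :: 'k bform option) d k h
     = (card (psol {..<d} {..<d} (pencil (companion (monom 1 d)) idm) k h))\<^sup>2" for h
    unfolding block_count_def size mat psol_plus_mat psol_infinity_transpose by (simp add: power2_eq_square)
  show "h = 0 \<or> degree h = Suc k \<Longrightarrow> block_count (Some (1, 1) :: 'k bform option) d k h = 1"
    unfolding c using psol_infinity_trivial by (metis power_one)
  show "block_count (Some (1, 1) :: 'k bform option) d k 1 = CARD('k) ^ (2 * min d (k + 1))"
    unfolding c using psol_infinity_x2[of d k, where 'k = 'k] assms by (simp add: power_mult[symmetric] mult.commute)
qed

lemma block_count_regular: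
  fixes g :: "'k::{field_gcd,finite} bform"
  assumes g: "g \<in> Pset" "g \<noteq> (1, 1)" and d: "d \<ge> 1"
  shows "degree h = 0 \<Longrightarrow> block_count (Some g) d k h = 1"
    and "degree h = Suc k \<Longrightarrow> block_count (Some g) d k h = (card {C \<in> polys_below (d * fst g). snd g ^ d dvd C * h})\<^sup>2"
proof -
  define f where "f = snd g ^ d"
  define D where "D = d * fst g"
  note P = Pset_cases[OF g]
  have f: "lead_coeff f = 1" "degree f = D" "D > 0"
  proof -
    show "lead_coeff f = 1" unfolding f_def lead_coeff_power P(2) by simp
    show "degree f = D" using P by (simp add: f_def D_def degree_power_eq irreducible_def)
    show "D > 0" using P(4) d by (simp add: D_def)
  qed
  have size: "Rsize (Some g) d = D + D" using g(2) by (simp add: Rsize_def D_def)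
  have mat: "Rmat 1 (Some g) d = plus_mat D idm" "Rmat 2 (Some g) d = plus_mat D (companion f)"
    using g(2) by (simp_all add: Rmat_def Rrows_def Rbase_def D_def f_def)
  have c: "block_count (Some g) d k h = card (psol {..<D} {..<D} (pencil idm (companion f)) k h)
      * card (psol {..<D} {..<D} (\<lambda>i j. pencil idm (companion f) j i) k h)" for h
    unfolding block_count_def size mat by (rule psol_plus_mat)
  show "block_count (Some g) d k h = 1" if h: "degree h = 0"
  proof -
    have p1: "pencil idm (companion f) = (\<lambda>i j. [:- companion f i j, if i = j then 1 else 0:])"
      and p2: "(\<lambda>i j. pencil idm (companion f) j i) = (\<lambda>i j. [:- companion f j i, if i = j then 1 else 0:])"
      by (auto simp: fun_eq_iff pencil_def idm_def)
    show ?thesis unfolding c unfolding p2 unfolding p1 psol_companion_const[OF h] by simp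
  qed
  show "block_count (Some g) d k h = (card {C \<in> polys_below (d * fst g). snd g ^ d dvd C * h})\<^sup>2" if h: "degree h = Suc k"
    unfolding c card_psol_companion[OF f h] card_psol_companion_transpose[OF f h]
    by (simp add: power2_eq_square f_def D_def)
qed

lemma block_count_Some_zero:
  fixes g :: "'k::{field_gcd,finite} bform"
  assumes "g \<in> Pset" "d \<ge> 1"
  shows "block_count (Some g) d k 0 = 1"
  using block_count_regular(1)[OF assms(1) _ assms(2), of 0 k] block_count_x2(1)[OF assms(2), of "0 :: 'k poly" k]
  by (cases "g = (1, 1)") auto

lemma degree_Pset_power:
  fixes g :: "'k::field bform"
  assumes "g \<in> Pset" "j \<ge> 1"
  shows "if g = (1, 1) then snd g ^ j = 1 \<and> fst g = 1 else degree (snd g ^ j) = Suc (j * fst g - 1)"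
proof (cases "g = (1, 1)")
  case False
  note P = Pset_cases[OF assms(1) False]
  have "degree (snd g ^ j) = j * fst g" using P by (simp add: degree_power_eq irreducible_def)
  thus ?thesis using False P(4) assms(2) by simp
qed simp

lemma block_count_None_power:
  fixes g :: "'k::{field_gcd,finite} bform"
  assumes g: "g \<in> Pset" and j: "j \<ge> 1" and d: "d \<ge> 1"
  shows "block_count None d (j * fst g - 1) (snd g ^ j) = CARD('k) ^ (j * fst g)"
proof -
  have "fst g \<ge> 1" using g by (simp add: Pset_def bform_irreducible_def)
  hence "j * fst g - 1 + 1 = j * fst g" using j by simp
  thus ?thesis using block_count_None(2)[OF d, of "snd g ^ j" "j * fst g - 1"] degree_Pset_power[OF g j]
    by (auto split: if_splits)
qed

text \<open>With h = g^j read as a form of degree k + 1, blocks of a different form contribute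
  trivially, by coprimality or because one of the two forms is x2. The factor 2 in the exponent
  comes from the two halves of R^+.\<close>

lemma block_count_Some_power:
  fixes g g' :: "'k::{field_gcd,finite} bform"
  assumes g: "g \<in> Pset" and g': "g' \<in> Pset" and j: "j \<ge> 1" and d: "d \<ge> 1"
  shows "block_count (Some g') d (j * fst g - 1) (snd g ^ j) = CARD('k) ^ (if g' = g then 2 * fst g * min d j else 0)"
proof (cases "g = (1, 1)")
  case gi: True
  show ?thesis
  proof (cases "g' = (1, 1)")
    case True
    thus ?thesis using gi block_count_x2(2)[OF d, of "j - 1", where 'k = 'k] j by simp
  next
    case False
    thus ?thesis using gi block_count_regular(1)[OF g' False d, of 1] by simp
  qed
next
  case gr: False
  note P = Pset_cases[OF g gr]
  have deg: "degree (snd g ^ j) = Suc (j * fst g - 1)" using degree_Pset_power[OF g j] gr by simp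
  show ?thesis
  proof (cases "g' = (1, 1)")
    case True
    thus ?thesis using gr block_count_x2(1)[OF d, of "snd g ^ j" "j * fst g - 1"] deg by auto
  next
    case False
    note P' = Pset_cases[OF g' False]
    show ?thesis
    proof (cases "g' = g")
      case True
      have "card {C \<in> polys_below (d * fst g). snd g ^ d dvd C * snd g ^ j} = CARD('k) ^ (fst g * min d j)"
        using card_power_multiples[of "snd g" d j] P by (simp add: irreducible_def)
      thus ?thesis unfolding block_count_regular(2)[OF g' False d deg] using True
        by (simp add: power_mult[symmetric] mult_ac)
    next
      case ne: False
      have "snd g' \<noteq> snd g" using ne P(3) P'(3) by (auto simp: prod_eq_iff)
      hence "coprime (snd g') (snd g)" using P P' by (intro irreducible_monic_coprime)
      hence cop: "coprime (snd g' ^ d) (snd g ^ j)" by simp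
      have nz: "snd g' ^ d \<noteq> 0" using P' by (simp add: irreducible_def)
      have "degree (snd g' ^ d) = d * fst g'" using P' by (simp add: degree_power_eq irreducible_def)
      thus ?thesis unfolding block_count_regular(2)[OF g' False d deg]
        using card_coprime_multiples[OF cop nz] ne by simp
    qed
  qed
qed

section \<open>Multiplicities from second differences of the counts\<close>

definition pair_count :: "('k::field bform option \<Rightarrow> nat \<Rightarrow> nat) \<Rightarrow> nat \<Rightarrow> 'k poly \<Rightarrow> nat" where
  "pair_count \<rho> k h = card (psol (Arho_index \<rho>) (Arho_index \<rho>) (pencil (Arho 1 \<rho>) (Arho 2 \<rho>)) k h)"

definition weight_sum :: "('k::field bform option \<Rightarrow> nat \<Rightarrow> nat) \<Rightarrow> ('k bform option \<Rightarrow> nat \<Rightarrow> nat) \<Rightarrow> nat" where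
  "weight_sum \<rho> w = (\<Sum>(og, d)\<in>{(og, d). \<rho> og d \<noteq> 0}. \<rho> og d * w og d)"

lemma Ftilde_supp:
  assumes "\<rho> \<in> Ftilde" "\<rho> og d \<noteq> 0" shows "d \<ge> 1" "\<And>g. og = Some g \<Longrightarrow> g \<in> Pset"
proof -
  have F: "\<forall>og. \<rho> og 0 = 0" "\<forall>g d. g \<notin> Pset \<longrightarrow> \<rho> (Some g) d = 0" using assms(1) by (simp_all add: Ftilde_def)
  show "d \<ge> 1" using F(1) assms(2) by (cases d) auto
  show "g \<in> Pset" if "og = Some g" for g
  proof (rule ccontr)
    assume "g \<notin> Pset"
    thus False using F(2)[rule_format, of g d] assms(2) that by simp
  qed
qed

lemma pair_count_power:
  fixes \<rho> :: "'k::{field_gcd,finite} bform option \<Rightarrow> nat \<Rightarrow> nat"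
  assumes \<rho>: "\<rho> \<in> Ftilde"
    and w: "\<And>og d. d \<ge> 1 \<Longrightarrow> (\<And>g. og = Some g \<Longrightarrow> g \<in> Pset) \<Longrightarrow> block_count og d k h = CARD('k) ^ w og d"
  shows "pair_count \<rho> k h = CARD('k) ^ weight_sum \<rho> w"
proof -
  have "pair_count \<rho> k h = (\<Prod>(og, d)\<in>{(og, d). \<rho> og d \<noteq> 0}. block_count og d k h ^ \<rho> og d)"
    unfolding pair_count_def psol_Arho[OF \<rho>] block_count_def ..
  also have "\<dots> = (\<Prod>(og, d)\<in>{(og, d). \<rho> og d \<noteq> 0}. CARD('k) ^ (\<rho> og d * w og d))"
  proof (rule prod.cong[OF refl])
    fix x assume "x \<in> {(og, d). \<rho> og d \<noteq> 0}"
    then obtain og d where x: "x = (og, d)" "\<rho> og d \<noteq> 0" by auto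
    have "block_count og d k h = CARD('k) ^ w og d" using Ftilde_supp[OF \<rho> x(2)] by (rule w)
    thus "(case x of (og, d) \<Rightarrow> block_count og d k h ^ \<rho> og d) = (case x of (og, d) \<Rightarrow> CARD('k) ^ (\<rho> og d * w og d))"
      by (simp add: x power_mult[symmetric] mult.commute)
  qed
  also have "\<dots> = CARD('k) ^ weight_sum \<rho> w"
    by (simp add: weight_sum_def power_sum case_prod_unfold)
  finally show ?thesis .
qed

text \<open>Intended for w1, w2 and w3 taken at a parameter raised by one, lowered by one and
  unchanged: the second difference of a piecewise linear weight is nonzero only at its kink.\<close>

lemma weight_sum_second_difference:
  assumes \<rho>: "\<rho> \<in> Ftilde"
    and w: "\<And>og d. \<rho> og d \<noteq> 0 \<Longrightarrow> int (w1 og d) + int (w2 og d) - 2 * int (w3 og d) = (if og = og0 \<and> d = d0 then c else 0)"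
  shows "int (weight_sum \<rho> w1) + int (weight_sum \<rho> w2) - 2 * int (weight_sum \<rho> w3) = c * int (\<rho> og0 d0)"
proof -
  let ?S = "{(og, d). \<rho> og d \<noteq> 0}"
  have fin: "finite ?S" using \<rho> by (simp add: Ftilde_def)
  have "int (weight_sum \<rho> w1) + int (weight_sum \<rho> w2) - 2 * int (weight_sum \<rho> w3)
     = (\<Sum>(og, d)\<in>?S. int (\<rho> og d) * (int (w1 og d) + int (w2 og d) - 2 * int (w3 og d)))"
    unfolding weight_sum_def of_nat_sum sum_distrib_left sum.distrib[symmetric] sum_subtractf[symmetric]
    by (intro sum.cong refl) (auto simp: algebra_simps)
  also have "\<dots> = (\<Sum>x\<in>?S. if x = (og0, d0) then c * int (\<rho> og0 d0) else 0)"
    by (intro sum.cong refl) (auto simp: w split: if_splits)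
  also have "\<dots> = c * int (\<rho> og0 d0)" using fin by (cases "\<rho> og0 d0 = 0") auto
  finally show ?thesis .
qed

text \<open>The parameter n stands for k + 2, which puts the kink of the truncated difference at n =
  d.\<close>

definition hom_weight :: "nat \<Rightarrow> 'k bform option \<Rightarrow> nat \<Rightarrow> nat" where
  "hom_weight n og d = (case og of None \<Rightarrow> n - d | Some _ \<Rightarrow> 0)"

text \<open>The weight of epsilon is linear in j and thus disappears in second differences; the
  weight of g has its kink at j = d.\<close>

definition form_weight :: "'k bform \<Rightarrow> nat \<Rightarrow> 'k bform option \<Rightarrow> nat \<Rightarrow> nat" where
  "form_weight g j og d = (case og of None \<Rightarrow> j * fst g | Some g' \<Rightarrow> if g' = g then 2 * fst g * min d j else 0)"

lemma pair_count_zero: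
  fixes \<rho> :: "'k::{field_gcd,finite} bform option \<Rightarrow> nat \<Rightarrow> nat"
  assumes "\<rho> \<in> Ftilde"
  shows "pair_count \<rho> k 0 = CARD('k) ^ weight_sum \<rho> (hom_weight (k + 2))"
  using assms
proof (rule pair_count_power)
  fix og :: "'k bform option" and d :: nat
  assume "d \<ge> 1" and "\<And>g. og = Some g \<Longrightarrow> g \<in> Pset"
  thus "block_count og d k 0 = CARD('k) ^ hom_weight (k + 2) og d"
    using block_count_None(1)[of d k, where 'k = 'k] block_count_Some_zero[of _ d k]
    by (cases og) (auto simp: hom_weight_def)
qed

lemma pair_count_form:
  fixes \<rho> :: "'k::{field_gcd,finite} bform option \<Rightarrow> nat \<Rightarrow> nat"
  assumes "\<rho> \<in> Ftilde" "g \<in> Pset" "j \<ge> 1"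
  shows "pair_count \<rho> (j * fst g - 1) (snd g ^ j) = CARD('k) ^ weight_sum \<rho> (form_weight g j)"
  using assms(1)
proof (rule pair_count_power)
  fix og :: "'k bform option" and d :: nat
  assume "d \<ge> 1" and "\<And>g. og = Some g \<Longrightarrow> g \<in> Pset"
  thus "block_count og d (j * fst g - 1) (snd g ^ j) = CARD('k) ^ form_weight g j og d"
    using block_count_None_power[OF assms(2,3)] block_count_Some_power[OF assms(2) _ assms(3)]
    by (cases og) (auto simp: form_weight_def)
qed

lemma weight_sum_trivial: "(\<And>og d. \<rho> og d \<noteq> 0 \<Longrightarrow> w og d = 0) \<Longrightarrow> weight_sum \<rho> w = 0"
  unfolding weight_sum_def by (rule sum.neutral) auto

text \<open>Two forms g and g' of equal degree are compared because a substitution changes the form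
  to which a multiplicity belongs.\<close>

theorem multiplicities_eq:
  fixes \<rho> \<sigma> :: "'k::{field_gcd,finite} bform option \<Rightarrow> nat \<Rightarrow> nat"
  assumes \<rho>: "\<rho> \<in> Ftilde" and \<sigma>: "\<sigma> \<in> Ftilde"
  shows "(\<And>k. pair_count \<rho> k 0 = pair_count \<sigma> k 0) \<Longrightarrow> \<rho> None d = \<sigma> None d"
    and "g \<in> Pset \<Longrightarrow> g' \<in> Pset \<Longrightarrow> fst g = fst g' \<Longrightarrow>
      (\<And>j. j \<ge> 1 \<Longrightarrow> pair_count \<rho> (j * fst g - 1) (snd g ^ j) = pair_count \<sigma> (j * fst g - 1) (snd g' ^ j)) \<Longrightarrow>
      \<rho> (Some g) d = \<sigma> (Some g') d"
proof -
  have q: "CARD('k) > 1" using card_mono[of UNIV "{0, 1 :: 'k}"] by simp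
  have d0: "\<rho> og 0 = 0" "\<sigma> og 0 = 0" for og using \<rho> \<sigma> by (simp_all add: Ftilde_def)
  show "\<rho> None d = \<sigma> None d" if eq: "\<And>k. pair_count \<rho> k 0 = pair_count \<sigma> k 0"
  proof (cases "d = 0")
    case False
    have W: "weight_sum \<rho> (hom_weight n) = weight_sum \<sigma> (hom_weight n)" for n
    proof (cases "n \<ge> 2")
      case True
      then obtain k where "n = k + 2" using le_Suc_ex by (metis add.commute)
      thus ?thesis using eq[of k] pair_count_zero[OF \<rho>, of k] pair_count_zero[OF \<sigma>, of k] q by simp
    next
      case False
      \<comment> \<open>The counts reach only n = k + 2. Below that the weight vanishes by itself,
        since d \<ge> 1 on the support.\<close>
      have "weight_sum \<tau> (hom_weight n) = 0" if "\<tau> \<in> Ftilde" for \<tau> :: "'k bform option \<Rightarrow> nat \<Rightarrow> nat"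
      proof (rule weight_sum_trivial)
        fix og d assume "\<tau> og d \<noteq> 0"
        thus "hom_weight n og d = 0" using Ftilde_supp(1)[OF that, of og d] False by (cases og) (auto simp: hom_weight_def)
      qed
      thus ?thesis using \<rho> \<sigma> by simp
    qed
    have "int (weight_sum \<tau> (hom_weight (d + 1))) + int (weight_sum \<tau> (hom_weight (d - 1))) - 2 * int (weight_sum \<tau> (hom_weight d))
        = 1 * int (\<tau> None d)" if "\<tau> \<in> Ftilde" for \<tau> :: "'k bform option \<Rightarrow> nat \<Rightarrow> nat"
    proof (rule weight_sum_second_difference[OF that])
      fix og d' assume "\<tau> og d' \<noteq> 0"
      thus "int (hom_weight (d + 1) og d') + int (hom_weight (d - 1) og d') - 2 * int (hom_weight d og d')
          = (if og = None \<and> d' = d then 1 else 0)"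
        using False by (cases og) (auto simp: hom_weight_def)
    qed
    from this[OF \<rho>] this[OF \<sigma>] show ?thesis unfolding W by simp
  qed (simp add: d0)
  show "\<rho> (Some g) d = \<sigma> (Some g') d"
    if g: "g \<in> Pset" and g': "g' \<in> Pset" and e: "fst g = fst g'"
      and eq: "\<And>j. j \<ge> 1 \<Longrightarrow> pair_count \<rho> (j * fst g - 1) (snd g ^ j) = pair_count \<sigma> (j * fst g - 1) (snd g' ^ j)"
  proof (cases "d = 0")
    case False
    have W: "weight_sum \<rho> (form_weight g j) = weight_sum \<sigma> (form_weight g' j)" for j
    proof (cases "j \<ge> 1")
      case True
      thus ?thesis using eq[OF True] pair_count_form[OF \<rho> g True] pair_count_form[OF \<sigma> g' True] q e by simp
    next
      case False
      hence "weight_sum \<tau> (form_weight u j) = 0" for \<tau> and u :: "'k bform"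
        by (intro weight_sum_trivial) (auto simp: form_weight_def split: option.splits)
      thus ?thesis by simp
    qed
    have "fst g \<ge> 1" using g by (simp add: Pset_def bform_irreducible_def)
    have X: "int (weight_sum \<tau> (form_weight u (d + 1))) + int (weight_sum \<tau> (form_weight u (d - 1))) - 2 * int (weight_sum \<tau> (form_weight u d))
        = - 2 * int (fst u) * int (\<tau> (Some u) d)" if "\<tau> \<in> Ftilde" for \<tau> :: "'k bform option \<Rightarrow> nat \<Rightarrow> nat" and u
    proof (rule weight_sum_second_difference[OF that])
      fix og d' assume "\<tau> og d' \<noteq> 0"
      obtain d1 where d1: "d = Suc d1" using False by (cases d) auto
      have "int (min d' (d + 1)) + int (min d' (d - 1)) - 2 * int (min d' d) = (if d' = d then - 1 else 0)"
        using d1 by (auto simp: min_def)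
      hence m: "2 * int (fst u) * (int (min d' (d + 1)) + int (min d' (d - 1)) - 2 * int (min d' d))
          = (if d' = d then - 2 * int (fst u) else 0)" by simp
      show "int (form_weight u (d + 1) og d') + int (form_weight u (d - 1) og d') - 2 * int (form_weight u d og d')
          = (if og = Some u \<and> d' = d then - 2 * int (fst u) else 0)"
      proof (cases og)
        case None
        thus ?thesis by (simp add: form_weight_def d1 algebra_simps)
      next
        case (Some v)
        have fw: "int (form_weight u j og d') = (if v = u then 2 * int (fst u) * int (min d' j) else 0)" for j
          by (simp add: form_weight_def Some)
        have gen: "2 * F * A + 2 * F * B - 2 * (2 * F * C) = 2 * F * (A + B - 2 * C)" for F A B C :: int
          by (simp add: algebra_simps)
        show ?thesis
        proof (cases "v = u")
          case True
          show ?thesis unfolding fw if_P[OF True] gen m by (simp add: Some True)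
        qed (simp add: form_weight_def Some)
      qed
    qed
    have "- 2 * int (fst g) * int (\<rho> (Some g) d) = - 2 * int (fst g') * int (\<sigma> (Some g') d)"
      using X[OF \<rho>, of g] X[OF \<sigma>, of g'] unfolding W by simp
    thus ?thesis using e \<open>fst g \<ge> 1\<close> by simp
  qed (simp add: d0)
qed

subsection \<open>Linear substitutions in binary forms\<close>

text \<open>The form of degree n with dehomogenisation f, evaluated at (u, v). The degree is a
  separate argument because f does not determine it; raising it by one multiplies the value by v, as
  in \<open>homsub_Suc\<close>.\<close>

definition homsub :: "'k::field poly \<Rightarrow> 'k poly \<Rightarrow> nat \<Rightarrow> 'k poly \<Rightarrow> 'k poly" where
  "homsub u v n f = (\<Sum>i\<le>n. smult (coeff f i) (u ^ i * v ^ (n - i)))"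

lemma homsub_0 [simp]: "homsub u v n 0 = 0" by (simp add: homsub_def)

lemma homsub_add: "homsub u v n (f + g) = homsub u v n f + homsub u v n g"
  by (simp add: homsub_def smult_add_left sum.distrib)

lemma homsub_smult: "homsub u v n (smult c f) = smult c (homsub u v n f)"
  by (simp add: homsub_def smult_sum2)

lemma homsub_sum: "homsub u v n (\<Sum>j\<in>J. f j) = (\<Sum>j\<in>J. homsub u v n (f j))"
  by (induction J rule: infinite_finite_induct) (auto simp: homsub_add)

lemma homsub_shift: "homsub u v (Suc n) (pCons 0 f) = u * homsub u v n f"
  unfolding homsub_def sum.atMost_Suc_shift by (simp add: sum_distrib_left mult.assoc)

lemma homsub_Suc: "degree f \<le> n \<Longrightarrow> homsub u v (Suc n) f = v * homsub u v n f"
  by (simp add: homsub_def coeff_eq_0 sum_distrib_left Suc_diff_le mult_ac cong: sum.cong_simp)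

lemma homsub_add_deg: "degree f \<le> n \<Longrightarrow> homsub u v (m + n) f = v ^ m * homsub u v n f"
proof (induction m)
  case (Suc m)
  have "degree f \<le> m + n" using Suc.prems by simp
  thus ?case using homsub_Suc[of f "m + n" u v] Suc by (simp add: mult.assoc)
qed simp

lemma homsub_const: "homsub u v n [:a:] = smult a (v ^ n)"
  using homsub_add_deg[of "[:a:]" 0 u v n] by (simp add: homsub_def)

lemma homsub_pCons: "homsub u v (Suc n) (pCons a f) = smult a (v ^ Suc n) + u * homsub u v n f"
proof -
  have "pCons a f = [:a:] + pCons 0 f" by simp
  hence "homsub u v (Suc n) (pCons a f) = homsub u v (Suc n) [:a:] + homsub u v (Suc n) (pCons 0 f)"
    by (metis homsub_add)
  thus ?thesis by (simp only: homsub_const homsub_shift)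
qed

lemma homsub_mult:
  assumes "degree f \<le> m" "degree g \<le> n"
  shows "homsub u v (m + n) (f * g) = homsub u v m f * homsub u v n g"
  using assms(1)
proof (induction m arbitrary: f)
  case 0
  then obtain c where "f = [:c:]" by (metis degree_eq_zeroE le_zero_eq)
  thus ?case by (simp add: homsub_smult homsub_const)
next
  case (Suc m)
  obtain a f' where f: "f = pCons a f'" by (cases f) auto
  have f': "degree f' \<le> m" using Suc.prems by (auto simp: f split: if_splits)
  have "homsub u v (Suc m + n) (f * g) = homsub u v (Suc m + n) (smult a g) + homsub u v (Suc (m + n)) (pCons 0 (f' * g))"
    unfolding f mult_pCons_left homsub_add by simp
  also have "homsub u v (Suc m + n) (smult a g) = smult a (v ^ Suc m * homsub u v n g)"
    unfolding homsub_smult homsub_add_deg[OF assms(2)] ..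
  also have "homsub u v (Suc (m + n)) (pCons 0 (f' * g)) = u * (homsub u v m f' * homsub u v n g)"
    unfolding homsub_shift Suc.IH[OF f'] ..
  also have "smult a (v ^ Suc m * homsub u v n g) + \<dots> = homsub u v (Suc m) f * homsub u v n g"
    unfolding f homsub_pCons by (simp add: algebra_simps)
  finally show ?case .
qed

lemma homsub_power:
  assumes "degree f \<le> m"
  shows "homsub u v (i * m) (f ^ i) = homsub u v m f ^ i"
proof (induction i)
  case 0
  show ?case by (simp add: homsub_def)
next
  case (Suc i)
  have "degree (f ^ i) \<le> degree f * i" by (rule degree_power_le)
  also have "\<dots> \<le> m * i" by (rule mult_le_mono1[OF assms])
  finally have "degree (f ^ i) \<le> i * m" by (simp add: mult.commute)
  thus ?case using homsub_mult[OF assms, of "f ^ i" "i * m" u v] Suc by simp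
qed

lemma degree_homsub:
  assumes "degree u \<le> 1" "degree v \<le> 1"
  shows "degree (homsub u v n f) \<le> n"
  unfolding homsub_def
proof (rule degree_sum_le)
  fix i assume "i \<in> {..n}"
  have "degree (u ^ i) \<le> i" "degree (v ^ (n - i)) \<le> n - i"
    using degree_power_le[of u i] degree_power_le[of v "n - i"] assms
    by (metis mult.commute mult_le_mono1 nat_mult_1 order_trans)+
  hence "degree (u ^ i * v ^ (n - i)) \<le> n" using degree_mult_le[of "u ^ i" "v ^ (n - i)"] \<open>i \<in> {..n}\<close> by simp
  thus "degree (smult (coeff f i) (u ^ i * v ^ (n - i))) \<le> n" using degree_smult_le order_trans by blast
qed simp

lemma homsub_linear: "homsub u v 1 [:b, a:] = smult b v + smult a u"
  by (simp add: homsub_def)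

text \<open>Linear substitutions compose. Together with \<open>homsub_id\<close> this makes
  substitutions by invertible matrices reversible.\<close>

lemma homsub_comp:
  assumes "degree u \<le> 1" "degree v \<le> 1"
  shows "homsub u' v' n (homsub u v n f) = homsub (homsub u' v' 1 u) (homsub u' v' 1 v) n f"
proof -
  have "homsub u' v' n (homsub u v n f) = (\<Sum>i\<le>n. smult (coeff f i) (homsub u' v' n (u ^ i * v ^ (n - i))))"
    unfolding homsub_def[of u v] homsub_sum homsub_smult ..
  also have "\<dots> = (\<Sum>i\<le>n. smult (coeff f i) (homsub u' v' 1 u ^ i * homsub u' v' 1 v ^ (n - i)))"
  proof (intro sum.cong refl)
    fix i assume i: "i \<in> {..n}"
    have "degree (u ^ i) \<le> i" "degree (v ^ (n - i)) \<le> n - i"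
      using degree_power_le[of u i] degree_power_le[of v "n - i"] assms
      by (metis mult.commute mult_le_mono1 nat_mult_1 order_trans)+
    hence "homsub u' v' (i + (n - i)) (u ^ i * v ^ (n - i)) = homsub u' v' i (u ^ i) * homsub u' v' (n - i) (v ^ (n - i))"
      by (rule homsub_mult)
    also have "\<dots> = homsub u' v' 1 u ^ i * homsub u' v' 1 v ^ (n - i)"
      using homsub_power[OF assms(1), of u' v' i] homsub_power[OF assms(2), of u' v' "n - i"] by simp
    finally show "smult (coeff f i) (homsub u' v' n (u ^ i * v ^ (n - i)))
        = smult (coeff f i) (homsub u' v' 1 u ^ i * homsub u' v' 1 v ^ (n - i))" using i by simp
  qed
  finally show ?thesis unfolding homsub_def[of "homsub u' v' 1 u"] .
qed

lemma homsub_id: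
  assumes "degree f \<le> n" shows "homsub [:0, 1:] 1 n f = f"
proof -
  have "homsub [:0, 1:] 1 n f = (\<Sum>i\<le>n. monom (coeff f i) i)" by (simp add: homsub_def monom_altdef)
  also have "\<dots> = f" using poly_as_sum_of_monoms'[OF assms] .
  finally show ?thesis .
qed

fun subst_poly :: "'k::field mat2 \<Rightarrow> nat \<Rightarrow> 'k poly \<Rightarrow> 'k poly" where
  "subst_poly (q11, q12, q21, q22) n f = homsub [:q12, q11:] [:q22, q21:] n f"

fun inv_mat2 :: "'k::field mat2 \<Rightarrow> 'k mat2" where
  "inv_mat2 (a, b, c, d) = (d / (a * d - b * c), - b / (a * d - b * c), - c / (a * d - b * c), a / (a * d - b * c))"

lemma bform_subst_eq: "bform_subst Q g = (fst g, subst_poly Q (fst g) (snd g))"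
  by (cases Q) (simp add: bform_subst_def homsub_def)

lemma inv_mat2_GL2: "Q \<in> GL2 \<Longrightarrow> inv_mat2 Q \<in> GL2"
proof (cases Q)
  case (fields a b c d)
  assume "Q \<in> GL2"
  hence D: "a * d - b * c \<noteq> 0" by (simp add: fields GL2_def)
  have "d / (a * d - b * c) * (a / (a * d - b * c)) - - b / (a * d - b * c) * (- c / (a * d - b * c)) = 1 / (a * d - b * c)"
    using D by (simp add: divide_simps)
  hence "d / (a * d - b * c) * (a / (a * d - b * c)) - - b / (a * d - b * c) * (- c / (a * d - b * c)) \<noteq> 0" using D by simp
  thus ?thesis unfolding fields inv_mat2.simps GL2_def mem_Collect_eq prod.case .
qed

lemma inv_mat2_inv: "Q \<in> GL2 \<Longrightarrow> inv_mat2 (inv_mat2 Q) = Q"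
proof (cases Q)
  case (fields a b c d)
  assume "Q \<in> GL2"
  hence D: "a * d - b * c \<noteq> 0" by (simp add: fields GL2_def)
  have e: "d / (a * d - b * c) * (a / (a * d - b * c)) - - b / (a * d - b * c) * (- c / (a * d - b * c)) = 1 / (a * d - b * c)"
    using D by (simp add: divide_simps)
  show ?thesis unfolding fields inv_mat2.simps e using D by simp
qed

lemma subst_poly_inv:
  assumes Q: "Q \<in> GL2" and f: "degree f \<le> n"
  shows "subst_poly (inv_mat2 Q) n (subst_poly Q n f) = f"
proof (cases Q)
  case (fields a b c d)
  define D where "D = a * d - b * c"
  have D: "D \<noteq> 0" using Q by (simp add: fields GL2_def D_def)
  have "a * d / D - b * c / D = 1" "d * a / D - c * b / D = 1" using D by (simp_all add: D_def diff_divide_distrib[symmetric] mult.commute)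
  hence "homsub [:- b / D, d / D:] [:a / D, - c / D:] 1 [:b, a:] = [:0, 1:]"
    "homsub [:- b / D, d / D:] [:a / D, - c / D:] 1 [:d, c:] = 1"
    unfolding homsub_linear using D by (simp_all add: one_pCons mult.commute)
  thus ?thesis using f by (simp add: fields D_def[symmetric] homsub_comp homsub_id)
qed

lemma degree_subst_poly: "degree (subst_poly Q n f) \<le> n"
  by (cases Q) (auto intro: degree_homsub)

lemma subst_poly_smult: "subst_poly Q n (smult c f) = smult c (subst_poly Q n f)"
  by (cases Q) (simp add: homsub_smult)

lemma subst_poly_0 [simp]: "subst_poly Q n 0 = 0"
  by (cases Q) simp

lemma subst_poly_mult: "degree f \<le> m \<Longrightarrow> degree g \<le> n \<Longrightarrow> subst_poly Q (m + n) (f * g) = subst_poly Q m f * subst_poly Q n g"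
  by (cases Q) (simp add: homsub_mult)

lemma subst_poly_power: "degree f \<le> m \<Longrightarrow> subst_poly Q (i * m) (f ^ i) = subst_poly Q m f ^ i"
  by (cases Q) (simp add: homsub_power)

lemma subst_poly_sum: "subst_poly Q n (\<Sum>j\<in>J. f j) = (\<Sum>j\<in>J. subst_poly Q n (f j))"
  by (cases Q) (simp add: homsub_sum)

lemma subst_poly_eq_0: "Q \<in> GL2 \<Longrightarrow> degree f \<le> n \<Longrightarrow> subst_poly Q n f = 0 \<longleftrightarrow> f = 0"
  using subst_poly_inv[of Q f n] by auto

text \<open>The pencil x1 A - x2 B after the substitution Q is x1 A' - x2 B' for the following A', B'.\<close>

fun trans1 :: "'k::field mat2 \<Rightarrow> ('i \<Rightarrow> 'j \<Rightarrow> 'k) \<Rightarrow> ('i \<Rightarrow> 'j \<Rightarrow> 'k) \<Rightarrow> 'i \<Rightarrow> 'j \<Rightarrow> 'k" where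
  "trans1 (q11, q12, q21, q22) A B = (\<lambda>i j. q11 * A i j - q21 * B i j)"

fun trans2 :: "'k::field mat2 \<Rightarrow> ('i \<Rightarrow> 'j \<Rightarrow> 'k) \<Rightarrow> ('i \<Rightarrow> 'j \<Rightarrow> 'k) \<Rightarrow> 'i \<Rightarrow> 'j \<Rightarrow> 'k" where
  "trans2 (q11, q12, q21, q22) A B = (\<lambda>i j. q22 * B i j - q12 * A i j)"

text \<open>Sorting (q11 x + q12) A - (q21 x + q22) B by powers of x explains the signs in
  \<open>trans1\<close> and \<open>trans2\<close>.\<close>

lemma subst_pencil: "subst_poly Q 1 (pencil A B i j) = pencil (trans1 Q A B) (trans2 Q A B) i j"
  by (cases Q) (simp add: pencil_def homsub_linear[unfolded One_nat_def] algebra_simps)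

lemma trans_inv:
  assumes "Q \<in> GL2"
  shows "pencil (trans1 (inv_mat2 Q) (trans1 Q A B) (trans2 Q A B)) (trans2 (inv_mat2 Q) (trans1 Q A B) (trans2 Q A B)) i j = pencil A B i j"
  unfolding subst_pencil[symmetric] using assms by (rule subst_poly_inv) (simp add: pencil_def)

text \<open>The components of v are substituted as forms of degree k and h as a form of degree k +
  1. Multiplicativity then carries each row over with the same constant.\<close>

lemma psol_subst:
  assumes v: "v \<in> psol I J (pencil A B) k h"
  shows "(\<lambda>j. subst_poly Q k (v j)) \<in> psol I J (pencil (trans1 Q A B) (trans2 Q A B)) k (subst_poly Q (Suc k) h)"
proof (rule psolI)
  show "subst_poly Q k (v j) = 0" if "j \<notin> J" for j using psolD(1)[OF v that] by simp
  show "degree (subst_poly Q k (v j)) \<le> k" for j by (rule degree_subst_poly)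
  fix i assume "i \<in> I"
  then obtain c where c: "(\<Sum>j\<in>J. pencil A B i j * v j) = smult c h" using psolD(3)[OF v] by blast
  have "(\<Sum>j\<in>J. pencil (trans1 Q A B) (trans2 Q A B) i j * subst_poly Q k (v j))
      = (\<Sum>j\<in>J. subst_poly Q (1 + k) (pencil A B i j * v j))"
  proof (rule sum.cong[OF refl])
    fix j
    have "degree (pencil A B i j) \<le> 1" by (simp add: pencil_def)
    thus "pencil (trans1 Q A B) (trans2 Q A B) i j * subst_poly Q k (v j) = subst_poly Q (1 + k) (pencil A B i j * v j)"
      unfolding subst_pencil[symmetric] using psolD(2)[OF v, of j] by (rule subst_poly_mult[symmetric])
  qed
  also have "\<dots> = smult c (subst_poly Q (Suc k) h)" unfolding subst_poly_sum[symmetric] c by (simp add: subst_poly_smult)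
  finally show "\<exists>c. (\<Sum>j\<in>J. pencil (trans1 Q A B) (trans2 Q A B) i j * subst_poly Q k (v j)) = smult c (subst_poly Q (Suc k) h)"
    by blast
qed

lemma card_psol_subst:
  assumes Q: "Q \<in> GL2" and h: "degree h \<le> Suc k"
  shows "card (psol I J (pencil (trans1 Q A B) (trans2 Q A B)) k (subst_poly Q (Suc k) h)) = card (psol I J (pencil A B) k h)"
proof -
  let ?X = "psol I J (pencil A B) k h"
  let ?Y = "psol I J (pencil (trans1 Q A B) (trans2 Q A B)) k (subst_poly Q (Suc k) h)"
  let ?P = "inv_mat2 Q"
  have P: "?P \<in> GL2" "inv_mat2 ?P = Q" using Q by (simp_all add: inv_mat2_GL2 inv_mat2_inv)
  have inv: "(\<lambda>j. subst_poly ?P k (w j)) \<in> ?X" if "w \<in> ?Y" for w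
  proof -
    have "(\<lambda>j. subst_poly ?P k (w j)) \<in> psol I J (pencil (trans1 ?P (trans1 Q A B) (trans2 Q A B)) (trans2 ?P (trans1 Q A B) (trans2 Q A B)))
       k (subst_poly ?P (Suc k) (subst_poly Q (Suc k) h))" using that by (rule psol_subst)
    also have "\<dots> = psol I J (pencil A B) k (subst_poly ?P (Suc k) (subst_poly Q (Suc k) h))"
      by (rule psol_cong) (rule trans_inv[OF Q])
    finally show ?thesis using subst_poly_inv[OF Q h] by simp
  qed
  have "bij_betw (\<lambda>v j. subst_poly Q k (v j)) ?X ?Y"
  proof (rule bij_betw_byWitness[where f' = "\<lambda>w j. subst_poly ?P k (w j)"])
    show "\<forall>v\<in>?X. (\<lambda>j. subst_poly ?P k (subst_poly Q k (v j))) = v"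
      using subst_poly_inv[OF Q] psolD(2) by fastforce
    show "\<forall>w\<in>?Y. (\<lambda>j. subst_poly Q k (subst_poly ?P k (w j))) = w"
    proof
      fix w assume w: "w \<in> ?Y"
      show "(\<lambda>j. subst_poly Q k (subst_poly ?P k (w j))) = w"
        using subst_poly_inv[OF P(1) psolD(2)[OF w]] unfolding P(2) by auto
    qed
    show "(\<lambda>v j. subst_poly Q k (v j)) ` ?X \<subseteq> ?Y" using psol_subst by blast
    show "(\<lambda>w j. subst_poly ?P k (w j)) ` ?Y \<subseteq> ?X" using inv by blast
  qed
  thus ?thesis by (rule bij_betw_same_card[symmetric])
qed

lemma psol_smult: "c \<noteq> 0 \<Longrightarrow> psol I J L k (smult c h) = psol I J L k h"
proof -
  assume c: "c \<noteq> 0"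
  have "(\<exists>e. S = smult e (smult c h)) \<longleftrightarrow> (\<exists>e. S = smult e h)" for S
  proof
    assume "\<exists>e. S = smult e h"
    then obtain e where "S = smult e h" by blast
    thus "\<exists>e. S = smult e (smult c h)" using c by (intro exI[of _ "e / c"]) simp
  qed auto
  thus ?thesis by (simp add: psol_def)
qed

subsection \<open>The action on unital irreducible forms\<close>

text \<open>If the coefficient of x1^n vanishes, then x2 divides the form, and irreducibility leaves
  only multiples of x2; otherwise the form is divided by that coefficient.\<close>

lemma bform_irreducible_normalize:
  fixes w :: "'k::field bform"
  assumes w: "bform_irreducible w"
  shows "\<exists>c g. c \<noteq> 0 \<and> g \<in> Pset \<and> w = bform_smult c g"
proof -
  obtain n p where e: "w = (n, p)" by (cases w)
  have wf: "degree p \<le> n" "p \<noteq> 0" "n \<ge> 1"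
    using w unfolding bform_irreducible_def bform_wf_def e by simp_all
  have irr: "w \<noteq> bform_mult h k" if "bform_wf h" "bform_wf k" "fst h \<ge> 1" "fst k \<ge> 1" for h k
    using w that unfolding bform_irreducible_def by blast
  show ?thesis
  proof (cases "coeff p n = 0")
    case False
    define c where "c = coeff p n"
    define g where "g = (n, smult (inverse c) p)"
    have c: "c \<noteq> 0" using False by (simp add: c_def)
    have wg: "w = bform_smult c g" using c by (simp add: e g_def bform_smult_def)
    have "g \<noteq> bform_mult h k" if hk: "bform_wf h" "bform_wf k" "fst h \<ge> 1" "fst k \<ge> 1" for h k
    proof
      assume "g = bform_mult h k"
      hence "w = bform_mult (bform_smult c h) k" using wg by (simp add: bform_mult_def bform_smult_def)
      thus False using irr[of "bform_smult c h" k] hk c by (auto simp: bform_wf_def bform_smult_def)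
    qed
    hence "\<not> (\<exists>h k. bform_wf h \<and> bform_wf k \<and> fst h \<ge> 1 \<and> fst k \<ge> 1 \<and> g = bform_mult h k)" by blast
    moreover have "bform_wf g" "snd g \<noteq> 0" "fst g \<ge> 1" using wf c by (auto simp: g_def bform_wf_def)
    ultimately have "bform_irreducible g" unfolding bform_irreducible_def by blast
    moreover have "bform_unital g" using c by (simp add: bform_unital_def g_def c_def)
    ultimately have "g \<in> Pset" by (simp add: Pset_def)
    thus ?thesis using c wg by blast
  next
    case True
    have lt: "degree p < n"
      using True wf by (metis le_neq_implies_less leading_coeff_0_iff)
    have "n = 1"
    proof (rule ccontr)
      assume "n \<noteq> 1"
      hence "w \<noteq> bform_mult (1, 1) (n - 1, p)" using wf lt by (intro irr) (auto simp: bform_wf_def)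
      thus False using wf by (simp add: e bform_mult_def)
    qed
    then obtain c where "p = [:c:]" using lt by (metis degree_eq_zeroE less_one)
    hence "w = bform_smult c (1, 1)" "c \<noteq> 0" using \<open>n = 1\<close> wf by (auto simp: e bform_smult_def)
    thus ?thesis using x2_in_Pset by blast
  qed
qed

lemma Pset_scalar_unique:
  assumes g: "g \<in> Pset" "g' \<in> Pset" and c: "c \<noteq> 0" "c' \<noteq> 0" and e: "bform_smult c g = bform_smult c' g'"
  shows "g = g'"
proof -
  have f: "fst g = fst g'" "smult c (snd g) = smult c' (snd g')" using e by (simp_all add: bform_smult_def)
  have u: "g = (1, 1) \<or> coeff (snd g) (fst g) = 1" "g' = (1, 1) \<or> coeff (snd g') (fst g') = 1"
    using g by (auto simp: Pset_def bform_unital_def)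
  have k: "c * coeff (snd g) (fst g) = c' * coeff (snd g') (fst g')" using f(1) arg_cong[OF f(2), of "\<lambda>p. coeff p (fst g)"] by simp
  show ?thesis
  proof (cases "g = (1, 1)")
    case True
    hence "coeff (snd g') (fst g') = 0" using k c by simp
    thus ?thesis using u(2) True by simp
  next
    case False
    hence 1: "coeff (snd g) (fst g) = 1" using u(1) by simp
    hence "g' \<noteq> (1, 1)" using k c by auto
    hence "coeff (snd g') (fst g') = 1" using u(2) by simp
    hence "c = c'" using k 1 by simp
    have "snd g = smult (inverse c) (smult c (snd g))" using c by simp
    also have "\<dots> = snd g'" unfolding f(2) unfolding \<open>c = c'\<close> using c by simp
    finally show ?thesis using f by (simp add: prod_eq_iff)
  qed
qed

lemma bform_irreducible_subst:
  assumes Q: "Q \<in> GL2" and g: "bform_irreducible g"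
  shows "bform_irreducible (bform_subst Q g)"
proof -
  have wf: "degree (snd g) \<le> fst g" "snd g \<noteq> 0" "fst g \<ge> 1"
    using g unfolding bform_irreducible_def bform_wf_def by simp_all
  have irr: "g \<noteq> bform_mult h k" if "bform_wf h" "bform_wf k" "fst h \<ge> 1" "fst k \<ge> 1" for h k
    using g that unfolding bform_irreducible_def by blast
  have "bform_subst Q g \<noteq> bform_mult h k" if hk: "bform_wf h" "bform_wf k" "fst h \<ge> 1" "fst k \<ge> 1" for h k
  proof
    assume "bform_subst Q g = bform_mult h k"
    hence "fst g = fst h + fst k \<and> subst_poly Q (fst g) (snd g) = snd h * snd k"
      unfolding bform_subst_eq bform_mult_def prod.inject .
    note e = this[THEN conjunct1] this[THEN conjunct2]
    have "snd g = subst_poly (inv_mat2 Q) (fst h + fst k) (snd h * snd k)"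
      using subst_poly_inv[OF Q wf(1)] e by simp
    also have "\<dots> = subst_poly (inv_mat2 Q) (fst h) (snd h) * subst_poly (inv_mat2 Q) (fst k) (snd k)"
      using hk by (intro subst_poly_mult) (auto simp: bform_wf_def)
    finally have "g = bform_mult (fst h, subst_poly (inv_mat2 Q) (fst h) (snd h)) (fst k, subst_poly (inv_mat2 Q) (fst k) (snd k))"
      using e(1) by (simp add: bform_mult_def prod_eq_iff)
    thus False using irr[of "(fst h, subst_poly (inv_mat2 Q) (fst h) (snd h))" "(fst k, subst_poly (inv_mat2 Q) (fst k) (snd k))"] hk
      by (simp add: bform_wf_def degree_subst_poly)
  qed
  hence "\<not> (\<exists>h k. bform_wf h \<and> bform_wf k \<and> fst h \<ge> 1 \<and> fst k \<ge> 1 \<and> bform_subst Q g = bform_mult h k)" by blast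
  thus ?thesis using wf subst_poly_eq_0[OF Q wf(1)]
    by (simp add: bform_irreducible_def bform_subst_eq bform_wf_def degree_subst_poly)
qed

lemma act_P_unique:
  assumes "g' \<in> Pset" "c \<noteq> 0" "bform_subst Q g = bform_smult c g'"
  shows "act_P Q g = g'"
  unfolding act_P_def
proof (rule the_equality)
  show "g' \<in> Pset \<and> (\<exists>c. c \<noteq> 0 \<and> bform_subst Q g = bform_smult c g')" using assms by blast
  fix g'' assume "g'' \<in> Pset \<and> (\<exists>c. c \<noteq> 0 \<and> bform_subst Q g = bform_smult c g'')"
  thus "g'' = g'" using Pset_scalar_unique assms by metis
qed

lemma act_P_in_Pset:
  assumes Q: "Q \<in> GL2" and g: "g \<in> Pset"
  obtains c where "c \<noteq> 0" "act_P Q g \<in> Pset" "fst (act_P Q g) = fst g"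
    "subst_poly Q (fst g) (snd g) = smult c (snd (act_P Q g))"
proof -
  obtain c g' where c: "c \<noteq> 0" "g' \<in> Pset" "bform_subst Q g = bform_smult c g'"
  proof -
    have "bform_irreducible g" using g by (simp add: Pset_def)
    from bform_irreducible_normalize[OF bform_irreducible_subst[OF Q this]] show ?thesis using that by blast
  qed
  have eq: "act_P Q g = g'" using act_P_unique[OF c(2,1,3)] .
  have "fst g = fst g' \<and> subst_poly Q (fst g) (snd g) = smult c (snd g')"
    using c(3) unfolding bform_subst_eq bform_smult_def prod.inject .
  note f = this[THEN conjunct1] this[THEN conjunct2]
  show ?thesis by (rule that[OF c(1), unfolded eq, OF c(2) f(1)[symmetric] f(2)])
qed

text \<open>A preimage is obtained by substituting the inverse matrix and normalising.\<close>

lemma act_P_surj: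
  assumes Q: "Q \<in> GL2" and g: "g \<in> Pset"
  obtains g0 where "g0 \<in> Pset" "act_P Q g0 = g"
proof -
  have wf: "degree (snd g) \<le> fst g" using g by (simp add: Pset_def bform_irreducible_def bform_wf_def)
  have P: "inv_mat2 Q \<in> GL2" "inv_mat2 (inv_mat2 Q) = Q" using Q by (simp_all add: inv_mat2_GL2 inv_mat2_inv)
  define g0 where "g0 = act_P (inv_mat2 Q) g"
  obtain c where c: "c \<noteq> 0" "g0 \<in> Pset" "fst g0 = fst g"
    "subst_poly (inv_mat2 Q) (fst g) (snd g) = smult c (snd g0)"
    using act_P_in_Pset[OF P(1) g] unfolding g0_def by blast
  have "snd g = smult c (subst_poly Q (fst g) (snd g0))"
    using subst_poly_inv[OF P(1) wf] unfolding P(2) c(4) subst_poly_smult by simp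
  hence "subst_poly Q (fst g) (snd g0) = smult (inverse c) (snd g)" using c(1) by simp
  hence "bform_subst Q g0 = bform_smult (inverse c) g" by (simp add: bform_subst_eq bform_smult_def c(3))
  hence "act_P Q g0 = g" using act_P_unique[of g "inverse c" Q g0] g c(1) by simp
  thus ?thesis using that c(2) by blast
qed

lemma Ftilde_zero:
  assumes "\<rho> \<in> Ftilde" "g \<notin> Pset" shows "\<rho> (Some g) d = 0"
proof -
  have "\<forall>g d. g \<notin> Pset \<longrightarrow> \<rho> (Some g) d = 0"
    using assms(1) unfolding Ftilde_def mem_Collect_eq by (elim conjE)
  thus ?thesis using assms(2) by (elim allE impE)
qed

text \<open>As g runs through the unital irreducible forms, so does \<open>act_P Q g\<close>; hence
  every value of the function is still visible after the action.\<close>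

lemma act_F_inj:
  fixes \<rho> \<sigma> :: "'k::field bform option \<Rightarrow> nat \<Rightarrow> nat"
  assumes Q: "Q \<in> GL2" and F: "\<rho> \<in> Ftilde" "\<sigma> \<in> Ftilde" and e: "act_F \<rho> Q = act_F \<sigma> Q"
  shows "\<rho> = \<sigma>"
proof (intro ext)
  fix og d
  have eq: "act_F \<rho> Q x d = act_F \<sigma> Q x d" for x using e by simp
  show "\<rho> og d = \<sigma> og d"
  proof (cases og)
    case None
    thus ?thesis using eq[of None] by (simp add: act_F_def)
  next
    case (Some g)
    show ?thesis
    proof (cases "g \<in> Pset")
      case True
      then obtain g0 where "g0 \<in> Pset" "act_P Q g0 = g" using act_P_surj[OF Q] by blast
      thus ?thesis using eq[of "Some g0"] Some by (simp add: act_F_def)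
    next
      case False
      thus ?thesis using Ftilde_zero[OF F(1)] Ftilde_zero[OF F(2)] Some by simp
    qed
  qed
qed

lemma act_F_id:
  fixes \<rho> :: "'k::field bform option \<Rightarrow> nat \<Rightarrow> nat"
  assumes "\<rho> \<in> Ftilde" shows "act_F \<rho> (1, 0, 0, 1) = \<rho>"
proof (intro ext)
  fix og d
  have "act_P (1, 0, 0, 1) g = g" if g: "g \<in> Pset" for g :: "'k bform"
  proof (rule act_P_unique[OF g])
    have "degree (snd g) \<le> fst g" using g by (simp add: Pset_def bform_irreducible_def bform_wf_def)
    hence "homsub [:0, 1:] 1 (fst g) (snd g) = snd g" by (rule homsub_id)
    thus "bform_subst (1, 0, 0, 1) g = bform_smult 1 g" by (simp add: bform_subst_eq bform_smult_def one_pCons)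
  qed simp
  moreover have "\<rho> (Some g) d = 0" if "g \<notin> Pset" for g using Ftilde_zero[OF assms that] .
  ultimately show "act_F \<rho> (1, 0, 0, 1) og d = \<rho> og d" by (cases og) (auto simp: act_F_def)
qed

text \<open>The count of \<rho> at h equals that of \<sigma> at the substituted h. For h = 0 nothing
  changes, and for h = g^j the substituted form is a nonzero multiple of the j-th power of
  \<open>act_P Q g\<close>, so the multiplicities of \<rho> at g are those of \<sigma> at
  \<open>act_P Q g\<close>.\<close>

theorem congruent_Arho_imp_act_F:
  fixes \<rho> \<sigma> :: "'k::{field_gcd,finite} bform option \<Rightarrow> nat \<Rightarrow> nat"
  assumes \<rho>: "\<rho> \<in> Ftilde" and \<sigma>: "\<sigma> \<in> Ftilde" and Q: "Q \<in> GL2"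
    and congr: "congruent_pairs (Arho_index \<rho>) (trans1 Q (Arho 1 \<rho>) (Arho 2 \<rho>)) (trans2 Q (Arho 1 \<rho>) (Arho 2 \<rho>))
      (Arho_index \<sigma>) (Arho 1 \<sigma>) (Arho 2 \<sigma>)"
  shows "\<rho> = act_F \<sigma> Q"
proof -
  have pc: "pair_count \<sigma> k (subst_poly Q (Suc k) h) = pair_count \<rho> k h" if "degree h \<le> Suc k" for k h
    unfolding pair_count_def card_psol_subst[OF Q that, symmetric]
    by (rule psol_congruent[OF congr finite_Arho_index[OF \<rho>] finite_Arho_index[OF \<sigma>]])
  have N: "\<rho> None d = \<sigma> None d" for d
    using pc[of 0] by (intro multiplicities_eq(1)[OF \<rho> \<sigma>]) simp
  have S: "\<rho> (Some g) d = \<sigma> (Some (act_P Q g)) d" if g: "g \<in> Pset" for g d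
  proof -
    obtain c where c: "c \<noteq> 0" "act_P Q g \<in> Pset" "fst (act_P Q g) = fst g"
      "subst_poly Q (fst g) (snd g) = smult c (snd (act_P Q g))" using act_P_in_Pset[OF Q g] by blast
    have wf: "degree (snd g) \<le> fst g" "fst g \<ge> 1" using g by (auto simp: Pset_def bform_irreducible_def bform_wf_def)
    show ?thesis
    proof (rule multiplicities_eq(2)[OF \<rho> \<sigma> g c(2) c(3)[symmetric]])
      fix j :: nat assume j: "j \<ge> 1"
      have k: "Suc (j * fst g - 1) = j * fst g" using j wf(2) by simp
      have "degree (snd g ^ j) \<le> degree (snd g) * j" by (rule degree_power_le)
      also have "\<dots> \<le> fst g * j" by (rule mult_le_mono1[OF wf(1)])
      finally have "degree (snd g ^ j) \<le> j * fst g" by (simp add: mult.commute)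
      hence "pair_count \<rho> (j * fst g - 1) (snd g ^ j) = pair_count \<sigma> (j * fst g - 1) (subst_poly Q (j * fst g) (snd g ^ j))"
        using pc[of "snd g ^ j" "j * fst g - 1"] unfolding k by simp
      also have "subst_poly Q (j * fst g) (snd g ^ j) = smult (c ^ j) (snd (act_P Q g) ^ j)"
        unfolding subst_poly_power[OF wf(1)] c(4) by (simp add: smult_power)
      also have "pair_count \<sigma> (j * fst g - 1) \<dots> = pair_count \<sigma> (j * fst g - 1) (snd (act_P Q g) ^ j)"
        unfolding pair_count_def using c(1) by (subst psol_smult) simp_all
      finally show "pair_count \<rho> (j * fst g - 1) (snd g ^ j) = pair_count \<sigma> (j * fst g - 1) (snd (act_P Q g) ^ j)" .
    qed
  qed
  have Z: "\<rho> (Some g) d = 0" if "g \<notin> Pset" for g d using Ftilde_zero[OF \<rho> that] .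
  show ?thesis
  proof (intro ext)
    fix og d
    show "\<rho> og d = act_F \<sigma> Q og d" using N S Z by (cases og) (auto simp: act_F_def)
  qed
qed

subsection \<open>Additive maps over the prime field\<close>

text \<open>Every element of the prime field is a sum of ones, so additive maps are linear. This is
  how group homomorphisms become matrices.\<close>

lemma additive_mod_ring:
  fixes g :: "'p::prime_card mod_ring \<Rightarrow> 'p mod_ring"
  assumes add: "\<And>c d. g (c + d) = g c + g d"
  shows "g c = c * g 1"
proof -
  have g0: "g 0 = 0" using add[of 0 0] by (metis add.right_neutral add_left_cancel)
  have n: "g (of_nat n) = of_nat n * g 1" for n
    by (induction n) (simp_all add: g0 add algebra_simps)
  have "c = of_nat (nat (to_int_mod_ring c))"
  proof -
    have "to_int_mod_ring c \<ge> 0" using range_to_int_mod_ring[where 'a = 'p] by (metis atLeastLessThan_iff rangeI)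
    thus ?thesis by (simp add: of_nat_of_int_mod_ring)
  qed
  thus ?thesis using n by metis
qed

definition unit_fun :: "'i \<Rightarrow> 'i \<Rightarrow> 'k::zero_neq_one" where
  "unit_fun i = (\<lambda>k. if k = i then 1 else 0)"

lemma unit_fun_in: "i \<in> I \<Longrightarrow> unit_fun i \<in> funs_on I" by (auto simp: unit_fun_def funs_on_def)

lemma funs_on_add: "x \<in> funs_on I \<Longrightarrow> y \<in> funs_on I \<Longrightarrow> (\<lambda>i. x i + y i) \<in> funs_on I" for x :: "'i \<Rightarrow> 'k::field"
  by (simp add: funs_on_def)

lemma funs_on_scale: "x \<in> funs_on I \<Longrightarrow> (\<lambda>i. c * x i) \<in> funs_on I" for x :: "'i \<Rightarrow> 'k::field"
  by (simp add: funs_on_def)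

lemma funs_on_0: "(\<lambda>i. 0) \<in> funs_on I" by (simp add: funs_on_def)

lemma additive_scale:
  fixes L :: "('i \<Rightarrow> 'p::prime_card mod_ring) \<Rightarrow> 'p mod_ring"
  assumes add: "\<And>x y. x \<in> funs_on I \<Longrightarrow> y \<in> funs_on I \<Longrightarrow> L (\<lambda>i. x i + y i) = L x + L y" and x: "x \<in> funs_on I"
  shows "L (\<lambda>i. c * x i) = c * L x"
proof -
  have "L (\<lambda>i. (c + d) * x i) = L (\<lambda>i. c * x i) + L (\<lambda>i. d * x i)" for c d
    using add[OF funs_on_scale[OF x, of c] funs_on_scale[OF x, of d]] by (simp add: distrib_right)
  from additive_mod_ring[of "\<lambda>c. L (\<lambda>i. c * x i)", OF this] show ?thesis by simp
qed

lemma additive_expand: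
  fixes L :: "('i \<Rightarrow> 'p::prime_card mod_ring) \<Rightarrow> 'p mod_ring"
  assumes fin: "finite I" and add: "\<And>x y. x \<in> funs_on I \<Longrightarrow> y \<in> funs_on I \<Longrightarrow> L (\<lambda>i. x i + y i) = L x + L y"
    and x: "x \<in> funs_on I"
  shows "L x = (\<Sum>i\<in>I. x i * L (unit_fun i))"
proof -
  have "L (\<lambda>k. if k \<in> J then x k else 0) = (\<Sum>i\<in>J. x i * L (unit_fun i))" if "finite J" "J \<subseteq> I" for J
    using that
  proof (induction J rule: finite_induct)
    case empty
    have "L (\<lambda>i. 0) = L (\<lambda>i. 0) + L (\<lambda>i. 0)" using add[OF funs_on_0 funs_on_0] by (simp only: add_0_left)
    hence "L (\<lambda>i. 0) = 0" by (metis add.right_neutral add_left_cancel)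
    thus ?case by simp
  next
    case (insert j J)
    have j: "j \<in> I" using insert.prems by simp
    have "(\<lambda>k. if k \<in> insert j J then x k else 0) = (\<lambda>k. x j * unit_fun j k + (if k \<in> J then x k else 0))"
      using insert.hyps by (auto simp: unit_fun_def fun_eq_iff)
    moreover have "(\<lambda>k. if k \<in> J then x k else 0) \<in> funs_on I" using insert.prems by (auto simp: funs_on_def)
    ultimately have "L (\<lambda>k. if k \<in> insert j J then x k else 0) = L (\<lambda>k. x j * unit_fun j k) + L (\<lambda>k. if k \<in> J then x k else 0)"
      using add[OF funs_on_scale[OF unit_fun_in[OF j]]] by simp
    moreover have "L (\<lambda>k. x j * unit_fun j k) = x j * L (unit_fun j)"
      by (rule additive_scale[where I = I]) (rule add unit_fun_in j | assumption)+
    moreover have "L (\<lambda>k. if k \<in> J then x k else 0) = (\<Sum>i\<in>J. x i * L (unit_fun i))"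
      using insert.IH insert.prems by blast
    ultimately show ?case by (simp only: sum.insert[OF insert.hyps])
  qed
  from this[OF fin order_refl] have "L (\<lambda>k. if k \<in> I then x k else 0) = (\<Sum>i\<in>I. x i * L (unit_fun i))" .
  moreover have "(\<lambda>k. if k \<in> I then x k else 0) = x" using x by (auto simp: funs_on_def)
  ultimately show ?thesis by simp
qed

text \<open>Applied later to commutators, which are additive in each argument but not given as
  matrices.\<close>

lemma biadditive_eq_bil:
  fixes a :: "('i \<Rightarrow> 'p::prime_card mod_ring) \<Rightarrow> ('i \<Rightarrow> 'p mod_ring) \<Rightarrow> 'p mod_ring"
  assumes fin: "finite I"
    and 1: "\<And>x y z. x \<in> funs_on I \<Longrightarrow> y \<in> funs_on I \<Longrightarrow> z \<in> funs_on I \<Longrightarrow> a (\<lambda>i. x i + y i) z = a x z + a y z"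
    and 2: "\<And>x y z. x \<in> funs_on I \<Longrightarrow> y \<in> funs_on I \<Longrightarrow> z \<in> funs_on I \<Longrightarrow> a z (\<lambda>i. x i + y i) = a z x + a z y"
    and xy: "x \<in> funs_on I" "y \<in> funs_on I"
  shows "a x y = bil I (\<lambda>i j. a (unit_fun i) (unit_fun j)) x y"
proof -
  have "a x y = (\<Sum>i\<in>I. x i * a (unit_fun i) y)"
    by (rule additive_expand[OF fin, of "\<lambda>x. a x y"]) (use 1 xy in auto)
  also have "\<dots> = (\<Sum>i\<in>I. x i * (\<Sum>j\<in>I. y j * a (unit_fun i) (unit_fun j)))"
  proof (intro sum.cong refl)
    fix i assume i: "i \<in> I"
    have "a (unit_fun i) y = (\<Sum>j\<in>I. y j * a (unit_fun i) (unit_fun j))"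
      by (rule additive_expand[OF fin]) (use 2 xy unit_fun_in[OF i] in auto)
    thus "x i * a (unit_fun i) y = x i * (\<Sum>j\<in>I. y j * a (unit_fun i) (unit_fun j))" by simp
  qed
  finally show ?thesis by (simp add: bil_def sum_distrib_left mult_ac)
qed

subsection \<open>The torsion of the quasi-cyclic group\<close>

text \<open>The identification of the prime field with the p-torsion of the quasi-cyclic
  group.\<close>

definition tau :: "'p::prime_card mod_ring \<Rightarrow> rat" where
  "tau c = of_int (to_int_mod_ring c) / of_nat CARD('p)"

lemma coc_eq: "coc I A x y = tau (inverse 2 * bil I A x y)"
  by (simp add: coc_def tau_def bil_def)

lemma to_int_bounds: "0 \<le> to_int_mod_ring (c :: 'p::prime_card mod_ring)" "to_int_mod_ring c < int CARD('p)"
  using range_to_int_mod_ring[where 'a = 'p] by (metis atLeastLessThan_iff rangeI)+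

lemma tau_bounds: "0 \<le> tau c" "tau (c :: 'p::prime_card mod_ring) < 1"
proof -
  have "(of_int (to_int_mod_ring c) :: rat) < of_int (int CARD('p))" using to_int_bounds(2)[of c] by (simp only: of_int_less_iff)
  thus "tau c < 1" by (simp add: tau_def)
  show "0 \<le> tau c" using to_int_bounds(1)[of c] by (simp add: tau_def)
qed

lemma tau_0 [simp]: "tau 0 = 0" by (simp add: tau_def)

lemma tau_inj: "tau c = tau d \<Longrightarrow> c = d"
  by (simp add: tau_def)

lemma tau_prufer: "tau (c :: 'p::prime_card mod_ring) \<in> prufer CARD('p)"
  unfolding prufer_def using tau_bounds[of c] by (auto simp: tau_def intro!: exI[of _ 1])

lemma div_int_diff: "(of_int a / of_nat n - of_int (a mod int n) / of_nat n :: rat) \<in> \<int>" if "n > 0"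
proof -
  have "a = int n * (a div int n) + a mod int n" by simp
  hence "(of_int a :: rat) = of_nat n * of_int (a div int n) + of_int (a mod int n)"
    by (metis of_int_add of_int_mult of_int_of_nat_eq)
  hence "(of_int a / of_nat n - of_int (a mod int n) / of_nat n :: rat) = of_int (a div int n)"
    using that by (simp add: field_simps)
  thus ?thesis by simp
qed

text \<open>Identities in the quasi-cyclic group are proved by showing that two rationals differ by
  an integer and applying \<open>frac_cong\<close>.\<close>

lemma tau_add_diff: "tau c + tau d - tau (c + d) \<in> \<int>" for c d :: "'p::prime_card mod_ring"
  using div_int_diff[of "CARD('p)" "to_int_mod_ring c + to_int_mod_ring d"]
  by (simp add: tau_def to_int_mod_ring_add add_divide_distrib)

lemma tau_mult_diff: "of_int (to_int_mod_ring q) * tau c - tau (q * c) \<in> \<int>" for c q :: "'p::prime_card mod_ring"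
  using div_int_diff[of "CARD('p)" "to_int_mod_ring q * to_int_mod_ring c"]
  by (simp add: tau_def to_int_mod_ring_mult)

lemma frac_cong: "x - y \<in> \<int> \<Longrightarrow> frac x = frac (y :: rat)"
  using frac_add_int_right[of "x - y" y] by simp

lemma frac_eq_imp: "frac x = frac y \<Longrightarrow> x - y \<in> \<int>" for x y :: rat
  by (metis frac_diff_zero frac_eq_0_iff frac_diff_eq)

lemma frac_minus_Ints: "frac x - x \<in> \<int>" for x :: rat
  by (simp add: frac_def)

lemma frac_tau: "frac (tau c) = tau c" using tau_bounds[of c] by (simp add: frac_eq)

lemma tau_add: "frac (tau c + tau d) = tau (c + d)"
  using frac_cong[OF tau_add_diff[of c d]] by (simp add: frac_tau)

lemma prufer_frac: "u \<in> prufer p \<Longrightarrow> frac u = u" by (simp add: prufer_def frac_eq)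

lemma prufer_intro: "x * of_nat (p ^ k) \<in> \<int> \<Longrightarrow> frac x \<in> prufer p"
proof -
  assume a: "x * of_nat (p ^ k) \<in> \<int>"
  have "frac x * of_nat (p ^ k) = x * of_nat (p ^ k) - of_int \<lfloor>x\<rfloor> * of_nat (p ^ k)" by (simp add: frac_def algebra_simps)
  hence "frac x * of_nat (p ^ k) \<in> \<int>" using a by (simp only: Ints_diff Ints_mult Ints_of_int Ints_of_nat)
  thus ?thesis by (auto simp: prufer_def frac_lt_1)
qed

lemma prufer_denom: "u \<in> prufer p \<Longrightarrow> \<exists>k. u * of_nat (p ^ k) \<in> \<int>" by (simp add: prufer_def)

lemma denom_mono:
  assumes "(x::rat) * of_nat (p ^ k) \<in> \<int>" "k \<le> l" shows "x * of_nat (p ^ l) \<in> \<int>"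
proof -
  have "p ^ l = p ^ k * p ^ (l - k)" using assms(2) by (simp add: power_add[symmetric])
  hence "x * of_nat (p ^ l) = x * of_nat (p ^ k) * of_nat (p ^ (l - k))" by simp
  thus ?thesis using assms(1) by (simp only: Ints_mult Ints_of_nat)
qed

lemma prufer_add: "u \<in> prufer p \<Longrightarrow> v \<in> prufer p \<Longrightarrow> frac (u + v) \<in> prufer p"
proof -
  assume "u \<in> prufer p" "v \<in> prufer p"
  then obtain k l where kl: "u * of_nat (p ^ k) \<in> \<int>" "v * of_nat (p ^ l) \<in> \<int>" using prufer_denom by meson
  have "u * of_nat (p ^ max k l) \<in> \<int>" "v * of_nat (p ^ max k l) \<in> \<int>"
    using denom_mono[OF kl(1)] denom_mono[OF kl(2)] by simp_all
  hence "(u + v) * of_nat (p ^ max k l) \<in> \<int>" unfolding distrib_right by (rule Ints_add)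
  thus ?thesis by (rule prufer_intro)
qed

lemma prufer_mult: "u \<in> prufer p \<Longrightarrow> frac (of_int n * u) \<in> prufer p"
proof -
  assume "u \<in> prufer p"
  then obtain k where k: "u * of_nat (p ^ k) \<in> \<int>" using prufer_denom by meson
  have "of_int n * u * of_nat (p ^ k) = of_int n * (u * of_nat (p ^ k))" by (simp add: mult.assoc)
  hence "of_int n * u * of_nat (p ^ k) \<in> \<int>" using k by (simp only: Ints_mult Ints_of_int)
  thus ?thesis by (rule prufer_intro)
qed

lemma prufer_minus: "u \<in> prufer p \<Longrightarrow> frac (- u) \<in> prufer p"
  using prufer_mult[of u p "-1"] by simp

lemma prufer_0: "0 \<in> prufer p" by (auto simp: prufer_def intro!: exI[of _ 0])

text \<open>The fraction u / p of the representative in [0,1) again lies in that interval.\<close>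

lemma prufer_divisible:
  assumes "u \<in> prufer p" "p > 0"
  shows "\<exists>v\<in>prufer p. frac (of_nat p * v) = u"
proof -
  obtain k where k: "u * of_nat (p ^ k) \<in> \<int>" using prufer_denom[OF assms(1)] by blast
  have "u / of_nat p * of_nat (p ^ Suc k) = u * of_nat (p ^ k)" using assms(2) by simp
  hence "frac (u / of_nat p) \<in> prufer p" using k prufer_intro[of "u / of_nat p" p "Suc k"] by simp
  moreover have "frac (u / of_nat p) = u / of_nat p"
  proof -
    have "u < 1" "0 \<le> u" using assms(1) by (auto simp: prufer_def)
    moreover have "(1::rat) \<le> of_nat p" using assms(2) by simp
    ultimately have "u < of_nat p" by linarith
    thus ?thesis using assms(2) \<open>0 \<le> u\<close> by (simp add: frac_eq)
  qed
  ultimately show ?thesis using assms prufer_frac[OF assms(1)] by (intro bexI[of _ "u / of_nat p"]) auto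
qed

lemma prufer_torsion:
  assumes u: "u \<in> prufer CARD('p::prime_card)" and 0: "frac (of_nat CARD('p) * u) = 0"
  obtains c :: "'p::prime_card mod_ring" where "u = tau c"
proof -
  have "of_nat CARD('p) * u \<in> \<int>" using 0 by simp
  then obtain n :: int where n: "of_nat CARD('p) * u = of_int n" by (elim Ints_cases)
  have b: "0 \<le> u" "u < 1" using u by (auto simp: prufer_def)
  have n0: "0 \<le> n" using b(1) n by (metis mult_nonneg_nonneg of_int_0_le_iff of_nat_0_le_iff)
  have "of_nat CARD('p) * u < of_nat CARD('p)" using b(2) by simp
  hence "(of_int n :: rat) < of_int (int CARD('p))" unfolding n by simp
  hence n1: "n < int CARD('p)" by (simp only: of_int_less_iff)
  have "u = tau (of_int_mod_ring n :: 'p mod_ring)"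
    using n n0 n1 by (simp add: tau_def field_simps)
  thus ?thesis by (rule that)
qed

subsection \<open>The groups GA\<close>

lemma GA_carrier: "((u1, u2), x) \<in> carrier (GA I A1 (A2 :: 'i \<Rightarrow> 'i \<Rightarrow> 'p::prime_card mod_ring))
   \<longleftrightarrow> u1 \<in> prufer CARD('p) \<and> u2 \<in> prufer CARD('p) \<and> x \<in> funs_on I"
  by (simp add: GA_def funs_on_def)

lemma GA_mult: "((u1, u2), x) \<otimes>\<^bsub>GA I A1 A2\<^esub> ((v1, v2), y)
   = ((frac (u1 + v1 + coc I A1 x y), frac (u2 + v2 + coc I A2 x y)), (\<lambda>i. x i + y i))"
  by (simp add: GA_def)

lemma GA_one: "\<one>\<^bsub>GA I A1 A2\<^esub> = ((0, 0), (\<lambda>i. 0))"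
  by (simp add: GA_def)

lemma bil_add_left: "bil I A (\<lambda>i. x i + y i) z = bil I A x z + bil I A y z"
  by (simp add: bil_def algebra_simps sum.distrib)

lemma bil_add_right: "bil I A z (\<lambda>i. x i + y i) = bil I A z x + bil I A z y"
  by (simp add: bil_def algebra_simps sum.distrib)

lemma bil_0_left: "bil I A (\<lambda>i. 0) z = 0" by (simp add: bil_def)
lemma bil_0_right: "bil I A z (\<lambda>i. 0) = 0" by (simp add: bil_def)

lemma coc_0 [simp]: "coc I A (\<lambda>i. 0) z = 0" "coc I A z (\<lambda>i. 0) = 0"
  by (simp_all add: coc_eq bil_0_left bil_0_right)

lemma coc_prufer: "coc I A x y \<in> prufer CARD('p)" for A :: "'i \<Rightarrow> 'i \<Rightarrow> 'p::prime_card mod_ring"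
  unfolding coc_eq by (rule tau_prufer)

lemma coc_add_left: "coc I A x z + coc I A y z - coc I A (\<lambda>i. x i + y i) z \<in> \<int>"
  unfolding coc_eq bil_add_left distrib_left by (rule tau_add_diff)

lemma coc_add_right: "coc I A z x + coc I A z y - coc I A z (\<lambda>i. x i + y i) \<in> \<int>"
  unfolding coc_eq bil_add_right distrib_left by (rule tau_add_diff)

text \<open>The cocycle condition follows from bilinearity of \<open>coc\<close> modulo
  integers.\<close>

lemma coc_assoc: "frac (frac (u + v + coc I A x y) + w + coc I A (\<lambda>i. x i + y i) z)
   = frac (u + frac (v + w + coc I A y z) + coc I A x (\<lambda>i. y i + z i))"
proof (rule frac_cong)
  let ?l = "u + v + coc I A x y" and ?r = "v + w + coc I A y z"
  have "(frac ?l - ?l) - (frac ?r - ?r)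
      - (coc I A x z + coc I A y z - coc I A (\<lambda>i. x i + y i) z)
      + (coc I A x y + coc I A x z - coc I A x (\<lambda>i. y i + z i)) \<in> \<int>"
    by (intro Ints_add Ints_diff frac_minus_Ints coc_add_left coc_add_right)
  also have "(frac ?l - ?l) - (frac ?r - ?r)
      - (coc I A x z + coc I A y z - coc I A (\<lambda>i. x i + y i) z)
      + (coc I A x y + coc I A x z - coc I A x (\<lambda>i. y i + z i))
    = (frac ?l + w + coc I A (\<lambda>i. x i + y i) z) - (u + frac ?r + coc I A x (\<lambda>i. y i + z i))"
    by (simp add: algebra_simps)
  finally show "(frac ?l + w + coc I A (\<lambda>i. x i + y i) z) - (u + frac ?r + coc I A x (\<lambda>i. y i + z i)) \<in> \<int>" .
qed

lemma group_GA: "group (GA I A1 (A2 :: 'i \<Rightarrow> 'i \<Rightarrow> 'p::prime_card mod_ring))"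
proof (rule groupI)
  let ?G = "GA I A1 A2"
  show "\<one>\<^bsub>?G\<^esub> \<in> carrier ?G" by (simp add: GA_one GA_carrier prufer_0 funs_on_0)
  fix X assume X: "X \<in> carrier ?G"
  obtain u1 u2 x where Xe: "X = ((u1, u2), x)" by (metis surj_pair)
  have Xc: "u1 \<in> prufer CARD('p)" "u2 \<in> prufer CARD('p)" "x \<in> funs_on I" using X by (simp_all add: Xe GA_carrier)
  show "\<one>\<^bsub>?G\<^esub> \<otimes>\<^bsub>?G\<^esub> X = X" using Xc by (simp add: Xe GA_one GA_mult prufer_frac)
  let ?Y = "((frac (- u1 - coc I A1 (\<lambda>i. - x i) x), frac (- u2 - coc I A2 (\<lambda>i. - x i) x)), (\<lambda>i. - x i))"
  have neg: "frac (- u - coc I A (\<lambda>i. - x i) x) \<in> prufer CARD('p)" if "u \<in> prufer CARD('p)" for u and A :: "'i \<Rightarrow> 'i \<Rightarrow> 'p mod_ring"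
  proof -
    have "frac (frac (- u) + frac (- c)) = frac (- u - c)" for c
    proof (rule frac_cong)
      have "(frac (- u) - (- u)) + (frac (- c) - (- c)) \<in> \<int>" by (intro Ints_add frac_minus_Ints)
      thus "frac (- u) + frac (- c) - (- u - c) \<in> \<int>" by (simp add: algebra_simps)
    qed
    thus ?thesis using prufer_add[OF prufer_minus[OF that] prufer_minus[OF coc_prufer[of I A "\<lambda>i. - x i" x]]] by metis
  qed
  have "?Y \<in> carrier ?G" using Xc by (simp add: GA_carrier neg funs_on_def)
  moreover have "?Y \<otimes>\<^bsub>?G\<^esub> X = \<one>\<^bsub>?G\<^esub>" by (simp add: Xe GA_mult GA_one add.assoc)
  ultimately show "\<exists>Y\<in>carrier ?G. Y \<otimes>\<^bsub>?G\<^esub> X = \<one>\<^bsub>?G\<^esub>" by blast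
  fix Y assume Y: "Y \<in> carrier ?G"
  obtain v1 v2 y where Ye: "Y = ((v1, v2), y)" by (metis surj_pair)
  have Yc: "v1 \<in> prufer CARD('p)" "v2 \<in> prufer CARD('p)" "y \<in> funs_on I" using Y by (simp_all add: Ye GA_carrier)
  have "frac (u + v + coc I A x y) \<in> prufer CARD('p)" if "u \<in> prufer CARD('p)" "v \<in> prufer CARD('p)" for u v and A :: "'i \<Rightarrow> 'i \<Rightarrow> 'p mod_ring"
    using prufer_add[OF prufer_add[OF that] coc_prufer[of I A x y]] by simp
  thus "X \<otimes>\<^bsub>?G\<^esub> Y \<in> carrier ?G" using Xc Yc by (simp add: Xe Ye GA_mult GA_carrier funs_on_add)
  fix Z assume Z: "Z \<in> carrier ?G"
  obtain w1 w2 z where Ze: "Z = ((w1, w2), z)" by (metis surj_pair)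
  show "X \<otimes>\<^bsub>?G\<^esub> Y \<otimes>\<^bsub>?G\<^esub> Z = X \<otimes>\<^bsub>?G\<^esub> (Y \<otimes>\<^bsub>?G\<^esub> Z)"
    unfolding Xe Ye Ze GA_mult coc_assoc by (simp add: add.assoc)
qed

text \<open>Old coordinates are M times new ones, so the isomorphism applies M' to the top
  components and leaves the bottom fixed.\<close>

lemma GA_iso_of_congruent:
  fixes A1 A2 :: "'i \<Rightarrow> 'i \<Rightarrow> 'p::prime_card mod_ring" and C1 C2 :: "'j \<Rightarrow> 'j \<Rightarrow> 'p mod_ring"
  assumes congr: "congruent_pairs I A1 A2 J C1 C2" and fin: "finite I" "finite J"
  shows "GA I A1 A2 \<cong> GA J C1 C2"
proof -
  obtain M M' where M: "congruence_matrices I A1 A2 J C1 C2 M M'"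
    using congr unfolding congruent_pairs_def by blast
  define P where "P x = (\<lambda>s. if s \<in> J then \<Sum>i\<in>I. M' s i * x i else 0)" for x
  define R where "R y = (\<lambda>i. if i \<in> I then \<Sum>s\<in>J. M i s * y s else 0)" for y
  have RP: "R (P x) = x" if x: "x \<in> funs_on I" for x
  proof
    fix i
    show "R (P x) i = x i"
    proof (cases "i \<in> I")
      case True
      have "R (P x) i = (\<Sum>s\<in>J. \<Sum>j\<in>I. M i s * M' s j * x j)"
        using True by (simp add: R_def P_def sum_distrib_left mult.assoc)
      also have "\<dots> = (\<Sum>j\<in>I. (\<Sum>s\<in>J. M i s * M' s j) * x j)"
        by (subst sum.swap) (simp add: sum_distrib_right)
      also have "\<dots> = (\<Sum>j\<in>I. if i = j then x j else 0)"
        using True congruence_matricesD(3)[OF M] by (intro sum.cong) auto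
      finally show ?thesis using True fin by simp
    qed (use x in \<open>simp add: R_def funs_on_def\<close>)
  qed
  have PR: "P (R y) = y" if y: "y \<in> funs_on J" for y
  proof
    fix s
    show "P (R y) s = y s"
    proof (cases "s \<in> J")
      case True
      have "P (R y) s = (\<Sum>i\<in>I. \<Sum>t\<in>J. M' s i * M i t * y t)"
        using True by (simp add: R_def P_def sum_distrib_left mult.assoc)
      also have "\<dots> = (\<Sum>t\<in>J. (\<Sum>i\<in>I. M' s i * M i t) * y t)"
        by (subst sum.swap) (simp add: sum_distrib_right)
      also have "\<dots> = (\<Sum>t\<in>J. if s = t then y t else 0)"
        using True congruence_matricesD(4)[OF M] by (intro sum.cong) auto
      finally show ?thesis using True fin by simp
    qed (use y in \<open>simp add: P_def funs_on_def\<close>)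
  qed
  have bilR: "bil J C y z = bil I A (R y) (R z)"
    if C: "\<And>s t. s \<in> J \<Longrightarrow> t \<in> J \<Longrightarrow> (\<Sum>i\<in>I. \<Sum>j\<in>I. M i s * A i j * M j t) = C s t" for A C y z
  proof -
    have "bil I A (R y) (R z) = (\<Sum>i\<in>I. \<Sum>j\<in>I. \<Sum>s\<in>J. \<Sum>t\<in>J. y s * (M i s * A i j * M j t) * z t)"
      unfolding bil_def by (intro sum.cong refl) (simp add: R_def sum_distrib_left sum_distrib_right mult_ac)
    also have "\<dots> = (\<Sum>i\<in>I. \<Sum>s\<in>J. \<Sum>j\<in>I. \<Sum>t\<in>J. y s * (M i s * A i j * M j t) * z t)"
      by (intro sum.cong refl sum.swap)
    also have "\<dots> = (\<Sum>s\<in>J. \<Sum>i\<in>I. \<Sum>j\<in>I. \<Sum>t\<in>J. y s * (M i s * A i j * M j t) * z t)" by (rule sum.swap)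
    also have "\<dots> = (\<Sum>s\<in>J. \<Sum>i\<in>I. \<Sum>t\<in>J. \<Sum>j\<in>I. y s * (M i s * A i j * M j t) * z t)"
      by (intro sum.cong refl sum.swap)
    also have "\<dots> = (\<Sum>s\<in>J. \<Sum>t\<in>J. \<Sum>i\<in>I. \<Sum>j\<in>I. y s * (M i s * A i j * M j t) * z t)"
      by (intro sum.cong refl sum.swap)
    also have "\<dots> = bil J C y z"
      unfolding bil_def by (intro sum.cong refl) (simp add: C[symmetric] sum_distrib_left sum_distrib_right)
    finally show ?thesis by simp
  qed
  have coc: "coc J C1 (P x) (P y) = coc I A1 x y" "coc J C2 (P x) (P y) = coc I A2 x y"
    if "x \<in> funs_on I" "y \<in> funs_on I" for x y
  proof -
    have "bil J C1 (P x) (P y) = bil I A1 (R (P x)) (R (P y))" by (rule bilR) (rule congruence_matricesD(1)[OF M])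
    moreover have "bil J C2 (P x) (P y) = bil I A2 (R (P x)) (R (P y))" by (rule bilR) (rule congruence_matricesD(2)[OF M])
    ultimately show "coc J C1 (P x) (P y) = coc I A1 x y" "coc J C2 (P x) (P y) = coc I A2 x y"
      using that by (simp_all add: coc_eq RP)
  qed
  have PI: "P x \<in> funs_on J" for x by (simp add: P_def funs_on_def)
  have RI: "R x \<in> funs_on I" for x by (simp add: R_def funs_on_def)
  have Padd: "P (\<lambda>i. x i + y i) = (\<lambda>s. P x s + P y s)" for x y
    by (auto simp: P_def fun_eq_iff distrib_left sum.distrib)
  let ?f = "\<lambda>(u :: rat \<times> rat, x). (u, P x)"
  have "?f \<in> iso (GA I A1 A2) (GA J C1 C2)"
    unfolding iso_def
  proof (intro CollectI conjI homI)
    show "bij_betw ?f (carrier (GA I A1 A2)) (carrier (GA J C1 C2))"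
      by (rule bij_betw_byWitness[where f' = "\<lambda>(u, y). (u, R y)"])
         (auto simp: GA_carrier RP PR PI RI)
    fix X Y assume "X \<in> carrier (GA I A1 A2)" "Y \<in> carrier (GA I A1 A2)"
    thus "?f (X \<otimes>\<^bsub>GA I A1 A2\<^esub> Y) = ?f X \<otimes>\<^bsub>GA J C1 C2\<^esub> ?f Y"
      by (cases X; cases Y) (auto simp: GA_carrier GA_mult coc Padd)
  qed (auto simp: GA_carrier PI)
  thus ?thesis by (rule is_isoI)
qed

subsection \<open>Isomorphisms between the groups GA\<close>

lemma coprime_denominators:
  fixes w :: rat and D :: int and n :: nat
  assumes "coprime D (int n)" "of_int D * w \<in> \<int>" "w * of_nat n \<in> \<int>"
  shows "w \<in> \<int>"
proof -
  obtain x y where xy: "x * D + y * int n = 1" using assms(1) by (metis bezout_int coprime_iff_gcd_eq_1)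
  have "w = of_int (x * D + y * int n) * w" unfolding xy by simp
  also have "\<dots> = of_int x * (of_int D * w) + of_int y * (w * of_nat n)" by (simp add: algebra_simps)
  also have "\<dots> \<in> \<int>" by (rule Ints_add[OF Ints_mult[OF Ints_of_int assms(2)] Ints_mult[OF Ints_of_int assms(3)]])
  finally show ?thesis .
qed

lemma of_int_to_int_mod_ring: "of_int (to_int_mod_ring c) = (c :: 'p::prime_card mod_ring)"
  by (simp add: of_int_of_int_mod_ring)

lemma of_nat_card_mod_ring: "of_nat CARD('p) = (0 :: 'p::prime_card mod_ring)"
  unfolding of_nat_of_int_mod_ring o_def by transfer simp

text \<open>The coefficients are lifted to an integer matrix, which acts on M^(2). Its determinant
  is prime to p, so the action is bijective, and on the p-torsion it is the given matrix, which
  combines the two forms.\<close>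

lemma GA_iso_of_lincomb:
  fixes A B :: "'i \<Rightarrow> 'i \<Rightarrow> 'p::prime_card mod_ring"
  assumes det: "\<alpha> * \<delta> - \<beta> * \<gamma> \<noteq> 0"
  shows "GA I A B \<cong> GA I (\<lambda>i j. \<alpha> * A i j + \<beta> * B i j) (\<lambda>i j. \<gamma> * A i j + \<delta> * B i j)"
proof -
  let ?p = "CARD('p)"
  define n where "n c = to_int_mod_ring c" for c :: "'p mod_ring"
  define lin where "lin c d = (\<lambda>(u1 :: rat, u2). frac (of_int (n c) * u1 + of_int (n d) * u2))" for c d :: "'p mod_ring"
  have lin_diff: "lin c d (u1, u2) - (of_int (n c) * u1 + of_int (n d) * u2) \<in> \<int>" for c d u1 u2
    unfolding lin_def prod.case by (rule frac_minus_Ints)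
  have hom: "lin c d (frac (u1 + v1 + coc I A x y), frac (u2 + v2 + coc I B x y))
      = frac (lin c d (u1, u2) + lin c d (v1, v2) + coc I (\<lambda>i j. c * A i j + d * B i j) x y)" for c d u1 u2 v1 v2 x y
  proof -
    let ?X1 = "u1 + v1 + coc I A x y" and ?X2 = "u2 + v2 + coc I B x y"
    let ?s = "inverse 2 * bil I A x y" and ?t = "inverse 2 * bil I B x y"
    have bil: "bil I (\<lambda>i j. c * A i j + d * B i j) x y = c * bil I A x y + d * bil I B x y"
      by (simp add: bil_def sum_distrib_left sum.distrib[symmetric] algebra_simps)
    have e: "inverse 2 * (c * bil I A x y + d * bil I B x y) = c * ?s + d * ?t" by (simp add: algebra_simps)
    have 1: "(of_int (n c) * tau ?s - tau (c * ?s)) + (of_int (n d) * tau ?t - tau (d * ?t))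
        + (tau (c * ?s) + tau (d * ?t) - tau (c * ?s + d * ?t)) \<in> \<int>"
      unfolding n_def by (intro Ints_add tau_mult_diff tau_add_diff)
    have "of_int (n c) * (frac ?X1 - ?X1) + of_int (n d) * (frac ?X2 - ?X2)
        - (lin c d (u1, u2) - (of_int (n c) * u1 + of_int (n d) * u2))
        - (lin c d (v1, v2) - (of_int (n c) * v1 + of_int (n d) * v2))
        + ((of_int (n c) * tau ?s - tau (c * ?s)) + (of_int (n d) * tau ?t - tau (d * ?t))
        + (tau (c * ?s) + tau (d * ?t) - tau (c * ?s + d * ?t))) \<in> \<int>"
      by (intro Ints_add[OF _ 1] Ints_diff Ints_add Ints_mult Ints_of_int frac_minus_Ints lin_diff)
    also have "of_int (n c) * (frac ?X1 - ?X1) + of_int (n d) * (frac ?X2 - ?X2)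
        - (lin c d (u1, u2) - (of_int (n c) * u1 + of_int (n d) * u2))
        - (lin c d (v1, v2) - (of_int (n c) * v1 + of_int (n d) * v2))
        + ((of_int (n c) * tau ?s - tau (c * ?s)) + (of_int (n d) * tau ?t - tau (d * ?t))
        + (tau (c * ?s) + tau (d * ?t) - tau (c * ?s + d * ?t)))
      = of_int (n c) * frac ?X1 + of_int (n d) * frac ?X2
        - (lin c d (u1, u2) + lin c d (v1, v2) + tau (c * ?s + d * ?t))"
      unfolding coc_eq by (simp add: algebra_simps)
    finally have "frac (of_int (n c) * frac ?X1 + of_int (n d) * frac ?X2)
        = frac (lin c d (u1, u2) + lin c d (v1, v2) + tau (c * ?s + d * ?t))"
      by (rule frac_cong)
    thus ?thesis unfolding coc_eq[of I "\<lambda>i j. c * A i j + d * B i j"] bil e by (simp add: lin_def)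
  qed
  \<comment> \<open>Surjectivity is reduced to finite sets: the bottom is exhausted by the finite
    sets of elements killed by p^k, and an injective map that preserves each of them is
    onto.\<close>
  define T where "T k = {u \<in> prufer ?p. u * of_nat (?p ^ k) \<in> \<int>}" for k
  have lin_T: "lin c d (u1, u2) \<in> T k" if "u1 \<in> T k" "u2 \<in> T k" for c d u1 u2 k
  proof -
    let ?X = "of_int (n c) * u1 + of_int (n d) * u2"
    have "of_int (n c) * (u1 * of_nat (?p ^ k)) + of_int (n d) * (u2 * of_nat (?p ^ k)) \<in> \<int>"
      using that by (intro Ints_add Ints_mult[OF Ints_of_int]) (auto simp: T_def)
    hence X: "?X * of_nat (?p ^ k) \<in> \<int>" by (simp only: distrib_right mult.assoc)
    have "(frac ?X - ?X) * of_nat (?p ^ k) + ?X * of_nat (?p ^ k) \<in> \<int>"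
      by (intro Ints_add[OF _ X] Ints_mult frac_minus_Ints) auto
    hence "frac ?X * of_nat (?p ^ k) \<in> \<int>" by (simp only: distrib_right[symmetric] diff_add_cancel)
    thus ?thesis using prufer_intro[OF X] by (simp add: T_def lin_def)
  qed
  have T_mono: "u \<in> T l" if "u \<in> T k" "k \<le> l" for u k l
    using that denom_mono[of u ?p k l] by (auto simp: T_def)
  have prufer_T: "\<exists>k. u \<in> T k" if "u \<in> prufer ?p" for u using prufer_denom[OF that] that by (auto simp: T_def)
  have T_prufer: "T k \<subseteq> prufer ?p" for k by (auto simp: T_def)
  have T_finite: "finite (T k)" for k
  proof (rule finite_subset)
    show "T k \<subseteq> (\<lambda>i. of_int i / of_nat (?p ^ k)) ` {0..int (?p ^ k)}"
    proof
      fix u assume u: "u \<in> T k"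
      then obtain i :: int where i: "u * of_nat (?p ^ k) = of_int i" by (auto simp: T_def elim: Ints_cases)
      have b: "0 \<le> u" "u < 1" using u by (auto simp: T_def prufer_def)
      have q: "(of_nat (?p ^ k) :: rat) > 0" by simp
      have "0 \<le> (of_int i :: rat)" unfolding i[symmetric] using b q by simp
      moreover have "(of_int i :: rat) \<le> of_int (int (?p ^ k))"
        unfolding i[symmetric] using b mult_right_mono[of u 1 "of_nat (?p ^ k)"] by simp
      ultimately have "i \<in> {0..int (?p ^ k)}" unfolding of_int_le_iff of_int_0_le_iff by simp
      moreover have "u = of_int i / of_nat (?p ^ k)" using i q by (simp add: field_simps)
      ultimately show "u \<in> (\<lambda>i. of_int i / of_nat (?p ^ k)) ` {0..int (?p ^ k)}" by blast
    qed
  qed simp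
  define \<Lambda> where "\<Lambda> u = (lin \<alpha> \<beta> u, lin \<gamma> \<delta> u)" for u
  have inj: "u = v" if u: "u \<in> prufer ?p \<times> prufer ?p" and v: "v \<in> prufer ?p \<times> prufer ?p" and e: "\<Lambda> u = \<Lambda> v" for u v
  proof -
    obtain u1 u2 v1 v2 where uv: "u = (u1, u2)" "v = (v1, v2)" by (cases u, cases v) auto
    \<comment> \<open>Multiplication by the adjugate matrix shows that D times each coordinate of u
      - v is an integer. As D is prime to p and the denominators are powers of p, the coordinates
      themselves differ by integers.\<close>
    define D where "D = n \<alpha> * n \<delta> - n \<beta> * n \<gamma>"
    have "(of_int D :: 'p mod_ring) = \<alpha> * \<delta> - \<beta> * \<gamma>" by (simp add: D_def n_def of_int_to_int_mod_ring)
    hence "\<not> int ?p dvd D" using det of_nat_card_mod_ring[where 'p = 'p]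
      by (metis dvdE mult_zero_left of_int_mult of_int_of_nat_eq)
    hence cop: "coprime D (int (?p ^ k))" for k
      using prime_imp_coprime[OF prime_card_int[where 'a = 'p], of D] by (simp add: coprime_commute)
    have "of_int (n \<alpha>) * u1 + of_int (n \<beta>) * u2 - (of_int (n \<alpha>) * v1 + of_int (n \<beta>) * v2) \<in> \<int>"
      "of_int (n \<gamma>) * u1 + of_int (n \<delta>) * u2 - (of_int (n \<gamma>) * v1 + of_int (n \<delta>) * v2) \<in> \<int>"
      using e by (auto simp: \<Lambda>_def lin_def uv intro!: frac_eq_imp)
    moreover define E1 E2 where "E1 = of_int (n \<alpha>) * u1 + of_int (n \<beta>) * u2 - (of_int (n \<alpha>) * v1 + of_int (n \<beta>) * v2)"
      and "E2 = of_int (n \<gamma>) * u1 + of_int (n \<delta>) * u2 - (of_int (n \<gamma>) * v1 + of_int (n \<delta>) * v2)"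
    ultimately have E: "E1 \<in> \<int>" "E2 \<in> \<int>" by simp_all
    have "of_int (n \<delta>) * E1 - of_int (n \<beta>) * E2 \<in> \<int>" "of_int (n \<alpha>) * E2 - of_int (n \<gamma>) * E1 \<in> \<int>"
      using E by (auto intro!: Ints_diff Ints_mult)
    moreover have "of_int (n \<delta>) * E1 - of_int (n \<beta>) * E2 = of_int D * (u1 - v1)"
      "of_int (n \<alpha>) * E2 - of_int (n \<gamma>) * E1 = of_int D * (u2 - v2)"
      by (simp_all add: E1_def E2_def D_def algebra_simps)
    ultimately have Dw: "of_int D * (u1 - v1) \<in> \<int>" "of_int D * (u2 - v2) \<in> \<int>" by simp_all
    have "s = t" if st: "s \<in> prufer ?p" "t \<in> prufer ?p" "of_int D * (s - t) \<in> \<int>" for s t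
    proof -
      obtain k l where "s \<in> T k" "t \<in> T l" using prufer_T st by meson
      hence "s \<in> T (max k l)" "t \<in> T (max k l)" using T_mono by (meson max.cobounded1 max.cobounded2)+
      hence "(s - t) * of_nat (?p ^ max k l) \<in> \<int>" unfolding left_diff_distrib by (intro Ints_diff) (auto simp: T_def)
      hence "s - t \<in> \<int>" using coprime_denominators[OF cop st(3)] by blast
      hence "frac s = frac t" by (rule frac_cong)
      thus ?thesis using prufer_frac st by metis
    qed
    thus ?thesis using u v Dw by (simp add: uv)
  qed
  have \<Lambda>_prufer: "\<Lambda> u \<in> prufer ?p \<times> prufer ?p" if u: "u \<in> prufer ?p \<times> prufer ?p" for u
  proof -
    obtain u1 u2 where u0: "u = (u1, u2)" by (cases u)
    hence "u1 \<in> prufer ?p" "u2 \<in> prufer ?p" using u by auto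
    then obtain k l where uu: "u = (u1, u2)" "u1 \<in> T k" "u2 \<in> T l" using prufer_T u0 by meson
    hence "u1 \<in> T (max k l)" "u2 \<in> T (max k l)" using T_mono by (meson max.cobounded1 max.cobounded2)+
    thus ?thesis using lin_T T_prufer uu(1) unfolding \<Lambda>_def by blast
  qed
  have surj: "\<exists>u\<in>prufer ?p \<times> prufer ?p. \<Lambda> u = v" if v: "v \<in> prufer ?p \<times> prufer ?p" for v
  proof -
    obtain v1 v2 where v0: "v = (v1, v2)" by (cases v)
    hence "v1 \<in> prufer ?p" "v2 \<in> prufer ?p" using v by auto
    then obtain k l where vv: "v = (v1, v2)" "v1 \<in> T k" "v2 \<in> T l" using prufer_T v0 by meson
    hence "v1 \<in> T (max k l)" "v2 \<in> T (max k l)" using T_mono by (meson max.cobounded1 max.cobounded2)+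
    hence vT: "v \<in> T (max k l) \<times> T (max k l)" using v0 by blast
    have "\<Lambda> ` (T (max k l) \<times> T (max k l)) = T (max k l) \<times> T (max k l)"
    proof (rule endo_inj_surj)
      show "finite (T (max k l) \<times> T (max k l))" using T_finite by simp
      show "\<Lambda> ` (T (max k l) \<times> T (max k l)) \<subseteq> T (max k l) \<times> T (max k l)"
        using lin_T by (auto simp: \<Lambda>_def)
      show "inj_on \<Lambda> (T (max k l) \<times> T (max k l))"
      proof (rule inj_onI)
        fix u v assume "u \<in> T (max k l) \<times> T (max k l)" "v \<in> T (max k l) \<times> T (max k l)" "\<Lambda> u = \<Lambda> v"
        moreover have "T (max k l) \<times> T (max k l) \<subseteq> prufer ?p \<times> prufer ?p" using T_prufer by blast
        ultimately show "u = v" using inj by blast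
      qed
    qed
    hence "v \<in> \<Lambda> ` (T (max k l) \<times> T (max k l))" using vT by simp
    then obtain u where "u \<in> T (max k l) \<times> T (max k l)" "\<Lambda> u = v" by (elim imageE) simp
    thus ?thesis using T_prufer by blast
  qed
  let ?G = "GA I A B" and ?H = "GA I (\<lambda>i j. \<alpha> * A i j + \<beta> * B i j) (\<lambda>i j. \<gamma> * A i j + \<delta> * B i j)"
  have carr: "(u, x) \<in> carrier (GA I A' B') \<longleftrightarrow> u \<in> prufer ?p \<times> prufer ?p \<and> x \<in> funs_on I" for u x and A' B' :: "'i \<Rightarrow> 'i \<Rightarrow> 'p mod_ring"
    by (cases u) (auto simp: GA_carrier)
  let ?f = "\<lambda>(u :: rat \<times> rat, x :: 'i \<Rightarrow> 'p mod_ring). (\<Lambda> u, x)"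
  have "?f \<in> iso ?G ?H"
    unfolding iso_def
  proof (intro CollectI conjI homI)
    show "?f X \<in> carrier ?H" if "X \<in> carrier ?G" for X using that \<Lambda>_prufer by (cases X) (auto simp: carr)
    show "bij_betw ?f (carrier ?G) (carrier ?H)"
      unfolding bij_betw_def
    proof
      show "inj_on ?f (carrier ?G)" using inj by (auto simp: inj_on_def carr)
      show "?f ` carrier ?G = carrier ?H"
      proof
        show "?f ` carrier ?G \<subseteq> carrier ?H" using \<Lambda>_prufer by (auto simp: carr)
        show "carrier ?H \<subseteq> ?f ` carrier ?G"
        proof
          fix Y assume "Y \<in> carrier ?H"
          moreover obtain v x where "Y = (v, x)" by (cases Y)
          ultimately have Y: "Y = (v, x)" "v \<in> prufer ?p \<times> prufer ?p" "x \<in> funs_on I" using carr[of v x] by simp_all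
          then obtain u where "u \<in> prufer ?p \<times> prufer ?p" "\<Lambda> u = v" using surj by blast
          thus "Y \<in> ?f ` carrier ?G" using Y by (intro image_eqI[of _ _ "(u, x)"]) (auto simp: carr)
        qed
      qed
    qed
    fix X Y assume "X \<in> carrier ?G" "Y \<in> carrier ?G"
    obtain u1 u2 x v1 v2 y where "X = ((u1, u2), x)" "Y = ((v1, v2), y)" by (metis surj_pair)
    thus "?f (X \<otimes>\<^bsub>?G\<^esub> Y) = ?f X \<otimes>\<^bsub>?H\<^esub> ?f Y" by (simp add: GA_mult \<Lambda>_def hom)
  qed
  thus ?thesis by (rule is_isoI)
qed

lemma GA_iso_of_trans:
  fixes A B :: "'i \<Rightarrow> 'i \<Rightarrow> 'p::prime_card mod_ring"
  assumes "Q \<in> GL2"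
  shows "GA I A B \<cong> GA I (trans1 Q A B) (trans2 Q A B)"
proof (cases Q)
  case (fields q11 q12 q21 q22)
  have "q11 * q22 - (- q21) * (- q12) \<noteq> 0" using assms by (simp add: fields GL2_def mult.commute)
  from GA_iso_of_lincomb[OF this, of I A B] show ?thesis by (simp add: fields add.commute[of "- _"])
qed

lemma bil_self:
  fixes A :: "'i \<Rightarrow> 'i \<Rightarrow> 'k::{field_gcd,finite}"
  assumes "skew_on I A" "(2::'k) \<noteq> 0"
  shows "bil I A x x = 0" "bil I A x y = - bil I A y x"
  using alt_form.alt[OF alt_form_bil[OF assms]] alt_form.skew[OF alt_form_bil[OF assms]] by blast+

lemma bil_scale_left: "bil I A (\<lambda>i. c * x i) y = c * bil I A x y"
  by (simp add: bil_def sum_distrib_left mult.assoc)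

text \<open>The forms are alternating, so the cocycle vanishes on multiples of one vector and powers
  are componentwise.\<close>

lemma GA_pow:
  fixes A B :: "'i \<Rightarrow> 'i \<Rightarrow> 'p::prime_card mod_ring"
  assumes A: "skew_on I A" "skew_on I B" "(2 :: 'p mod_ring) \<noteq> 0"
    and u: "u1 \<in> prufer CARD('p)" "u2 \<in> prufer CARD('p)"
  shows "((u1, u2), x) [^]\<^bsub>GA I A B\<^esub> (n :: nat) = ((frac (of_nat n * u1), frac (of_nat n * u2)), (\<lambda>i. of_nat n * x i))"
proof (induction n)
  case 0
  show ?case by (simp add: GA_one)
next
  case (Suc n)
  have "coc I A (\<lambda>i. of_nat n * x i) x = 0" "coc I B (\<lambda>i. of_nat n * x i) x = 0"
    using bil_self(1)[OF A(1,3)] bil_self(1)[OF A(2,3)] by (simp_all add: coc_eq bil_scale_left)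
  thus ?case by (simp add: Suc GA_mult algebra_simps)
qed

definition bottom_elem :: "'p::prime_card mod_ring \<Rightarrow> 'p mod_ring \<Rightarrow> (rat \<times> rat) \<times> ('i \<Rightarrow> 'p mod_ring)" where
  "bottom_elem c d = ((tau c, tau d), (\<lambda>i. 0))"

lemma bottom_elem_carrier: "bottom_elem c d \<in> carrier (GA I A (B :: 'i \<Rightarrow> 'i \<Rightarrow> 'p::prime_card mod_ring))"
  by (simp add: bottom_elem_def GA_carrier tau_prufer funs_on_0)

lemma bottom_elem_mult: "bottom_elem c d \<otimes>\<^bsub>GA I A B\<^esub> bottom_elem c' d' = bottom_elem (c + c') (d + d')"
  by (simp add: bottom_elem_def GA_mult tau_add)

lemma bottom_elem_inj: "bottom_elem c d = bottom_elem c' d' \<longleftrightarrow> c = c' \<and> d = d'"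
  by (auto simp: bottom_elem_def dest: tau_inj)

text \<open>The cocycle is half of the form in one order and minus half of it in the other, so the
  commutator is the form itself.\<close>

lemma GA_commute:
  fixes A B :: "'i \<Rightarrow> 'i \<Rightarrow> 'p::prime_card mod_ring"
  assumes A: "skew_on I A" "skew_on I B" "(2 :: 'p mod_ring) \<noteq> 0"
  shows "(u, x) \<otimes>\<^bsub>GA I A B\<^esub> (v, y) = bottom_elem (bil I A x y) (bil I B x y) \<otimes>\<^bsub>GA I A B\<^esub> ((v, y) \<otimes>\<^bsub>GA I A B\<^esub> (u, x))"
proof -
  obtain u1 u2 v1 v2 where uv: "u = (u1, u2)" "v = (v1, v2)" by (cases u, cases v) auto
  have *: "frac (s + t + coc I C x y) = frac (tau (bil I C x y) + (t + s + coc I C y x))" if C: "skew_on I C" for s t and C :: "'i \<Rightarrow> 'i \<Rightarrow> 'p mod_ring"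
  proof (rule frac_cong)
    let ?b = "bil I C x y"
    define h where "h = inverse 2 * ?b"
    have "h + h = ?b"
    proof -
      have "h + h = 2 * inverse 2 * ?b" by (simp only: h_def mult_2 distrib_right)
      thus ?thesis using A(3) by simp
    qed
    hence bh: "?b + - h = h" by (metis add.commute add_diff_cancel_left' diff_conv_add_uminus)
    have "- (tau ?b + tau (- h) - tau (?b + - h)) \<in> \<int>" by (intro Ints_minus tau_add_diff)
    hence I: "- (tau ?b + tau (- h) - tau h) \<in> \<int>" unfolding bh .
    have "bil I C y x = - ?b" by (rule bil_self(2)[OF C A(3)])
    hence "inverse 2 * bil I C y x = - h" by (simp only: h_def mult_minus_right)
    hence "coc I C y x = tau (- h)" unfolding coc_eq by (rule arg_cong)
    moreover have "coc I C x y = tau h" unfolding coc_eq h_def ..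
    ultimately show "s + t + coc I C x y - (tau ?b + (t + s + coc I C y x)) \<in> \<int>"
      using I by (simp add: algebra_simps)
  qed
  have **: "frac (s + t + coc I C x y) = frac (tau (bil I C x y) + frac (t + s + coc I C y x) + coc I C (\<lambda>i. 0) (\<lambda>i. y i + x i))"
    if C: "skew_on I C" for s t and C :: "'i \<Rightarrow> 'i \<Rightarrow> 'p mod_ring"
    unfolding *[OF C] by (simp add: add.assoc)
  have "(\<lambda>i. x i + y i) = (\<lambda>i. 0 + (y i + x i))" by (simp only: add_0_left add.commute)
  thus ?thesis unfolding uv bottom_elem_def GA_mult prod.inject using **[OF A(1)] **[OF A(2)] by blast
qed

text \<open>An element of the bottom is a p-th power, and p-th powers have trivial top component
  because the top has exponent p.\<close>

lemma iso_GA_bottom: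
  fixes A B :: "'i \<Rightarrow> 'i \<Rightarrow> 'p::prime_card mod_ring" and C D :: "'j \<Rightarrow> 'j \<Rightarrow> 'p mod_ring"
  assumes A: "skew_on I A" "skew_on I B" "(2 :: 'p mod_ring) \<noteq> 0" and C: "skew_on J C" "skew_on J D"
    and f: "f \<in> iso (GA I A B) (GA J C D)" and u: "((u1, u2), \<lambda>i. 0) \<in> carrier (GA I A B)"
  shows "snd (f ((u1, u2), \<lambda>i. 0)) = (\<lambda>i. 0)"
proof -
  have c: "u1 \<in> prufer CARD('p)" "u2 \<in> prufer CARD('p)" using u by (simp_all add: GA_carrier)
  obtain v1 v2 where v: "v1 \<in> prufer CARD('p)" "frac (of_nat CARD('p) * v1) = u1" "v2 \<in> prufer CARD('p)" "frac (of_nat CARD('p) * v2) = u2"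
    using prufer_divisible[OF c(1)] prufer_divisible[OF c(2)] by auto
  interpret group_hom "GA I A B" "GA J C D" f
    using f group_GA[of I A B] group_GA[of J C D] by (auto simp: group_hom_def group_hom_axioms_def iso_def)
  let ?X = "((v1, v2), \<lambda>i. 0)"
  have X: "?X \<in> carrier (GA I A B)" using v by (simp add: GA_carrier funs_on_0)
  have "?X [^]\<^bsub>GA I A B\<^esub> CARD('p) = ((u1, u2), \<lambda>i. 0)" using v GA_pow[OF A v(1,3), of "\<lambda>i. 0"] by simp
  hence e: "f ((u1, u2), \<lambda>i. 0) = f ?X [^]\<^bsub>GA J C D\<^esub> CARD('p)" using hom_nat_pow[OF X, of "CARD('p)"] by simp
  obtain w1 w2 y where w: "f ?X = ((w1, w2), y)" by (metis surj_pair)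
  have "((w1, w2), y) \<in> carrier (GA J C D)" using hom_closed[OF X] w by simp
  thus ?thesis unfolding e w using GA_pow[OF C A(3), of w1 w2 y] by (simp add: GA_carrier of_nat_card_mod_ring)
qed

text \<open>The isomorphism induces a linear bijection P of the tops and a 2 x 2 matrix on the
  p-torsion of the bottoms. Commutators depend only on the top components and lie in this torsion,
  so comparing them relates the two pairs of forms.\<close>

theorem GA_iso_imp_congruent:
  fixes A B :: "'i \<Rightarrow> 'i \<Rightarrow> 'p::prime_card mod_ring" and C D :: "'j \<Rightarrow> 'j \<Rightarrow> 'p mod_ring"
  assumes A: "skew_on I A" "skew_on I B" and C: "skew_on J C" "skew_on J D" and two: "(2 :: 'p mod_ring) \<noteq> 0"
    and fin: "finite I" "finite J" and iso: "GA I A B \<cong> GA J C D"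
  shows "\<exists>Q\<in>GL2. congruent_pairs I (trans1 Q A B) (trans2 Q A B) J C D"
proof -
  let ?G = "GA I A B" and ?H = "GA J C D"
  obtain f where f: "f \<in> iso ?G ?H" using iso by (auto simp: is_iso_def)
  interpret group_hom ?G ?H f
    using f group_GA[of I A B] group_GA[of J C D] by (auto simp: group_hom_def group_hom_axioms_def iso_def)
  define f' where "f' = inv_into (carrier ?G) f"
  have f': "f' \<in> iso ?H ?G" unfolding f'_def using G.iso_set_sym[OF f] .
  have bij: "bij_betw f (carrier ?G) (carrier ?H)" using f by (simp add: iso_def)
  have f'f: "f' (f X) = X" if "X \<in> carrier ?G" for X
    unfolding f'_def using bij that by (intro inv_into_f_f) (auto simp: bij_betw_def)
  have ff': "f (f' Y) = Y" if "Y \<in> carrier ?H" for Y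
    unfolding f'_def using bij that by (intro f_inv_into_f) (auto simp: bij_betw_def)
  have f'_closed: "f' Y \<in> carrier ?G" if "Y \<in> carrier ?H" for Y using f' that by (auto simp: iso_def hom_def)
  define top where "top x = ((0 :: rat, 0 :: rat), x)" for x :: "'i \<Rightarrow> 'p mod_ring"
  have top: "top x \<in> carrier ?G" if "x \<in> funs_on I" for x using that by (simp add: top_def GA_carrier prufer_0)
  have bot: "snd (f (u, \<lambda>i. 0)) = (\<lambda>i. 0)" if "(u, \<lambda>i. 0) \<in> carrier ?G" for u
    using iso_GA_bottom[OF A two C f] that by (cases u) blast
  have bot': "snd (f' (u, \<lambda>i. 0)) = (\<lambda>i. 0)" if "(u, \<lambda>i. 0) \<in> carrier ?H" for u
    using iso_GA_bottom[OF C two A f'] that by (cases u) blast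
  have snd_mult: "snd (X \<otimes>\<^bsub>?H\<^esub> Y) = (\<lambda>i. snd X i + snd Y i)" for X Y
    by (cases X; cases Y; cases "fst X"; cases "fst Y") (auto simp: GA_mult)
  have decomp: "(u, x) = (u, \<lambda>i. 0) \<otimes>\<^bsub>?G\<^esub> top x" if "(u, x) \<in> carrier ?G" for u x
  proof -
    obtain a b where ab: "u = (a, b)" by (cases u)
    hence "frac a = a" "frac b = b" using that prufer_frac by (auto simp: GA_carrier)
    thus ?thesis by (simp add: ab top_def GA_mult coc_def)
  qed
  have bc: "(u, \<lambda>i. 0) \<in> carrier ?G" if "(u, x) \<in> carrier ?G" for u x
    using that by (cases u) (simp add: GA_carrier funs_on_0)
  define P where "P x = snd (f (top x))" for x
  have P_gen: "snd (f (u, x)) = P x" if "(u, x) \<in> carrier ?G" for u x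
  proof -
    have x: "x \<in> funs_on I" using that by (cases u) (simp add: GA_carrier)
    have "f (u, x) = f (u, \<lambda>i. 0) \<otimes>\<^bsub>?H\<^esub> f (top x)"
      using hom_mult[OF bc[OF that] top[OF x]] decomp[OF that] by simp
    thus ?thesis using bot[OF bc[OF that]] by (simp add: snd_mult P_def)
  qed
  have P_in: "P x \<in> funs_on J" if "x \<in> funs_on I" for x
    using hom_closed[OF top[OF that]] unfolding P_def by (cases "f (top x)"; cases "fst (f (top x))") (simp add: GA_carrier)
  have P_add: "P (\<lambda>i. x i + y i) = (\<lambda>i. P x i + P y i)" if "x \<in> funs_on I" "y \<in> funs_on I" for x y
  proof -
    have m: "top x \<otimes>\<^bsub>?G\<^esub> top y = ((frac (coc I A x y), frac (coc I B x y)), \<lambda>i. x i + y i)" by (simp add: top_def GA_mult)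
    have "snd (f (top x \<otimes>\<^bsub>?G\<^esub> top y)) = P (\<lambda>i. x i + y i)"
      using G.m_closed[OF top[OF that(1)] top[OF that(2)]] unfolding m by (rule P_gen)
    thus ?thesis using hom_mult[OF top[OF that(1)] top[OF that(2)]] by (simp add: snd_mult P_def)
  qed
  have P_ker: "x = (\<lambda>i. 0)" if x: "x \<in> funs_on I" and 0: "P x = (\<lambda>i. 0)" for x
  proof -
    obtain v where v: "f (top x) = (v, \<lambda>i. 0)" using 0 unfolding P_def by (metis prod.collapse)
    have "snd (f' (f (top x))) = (\<lambda>i. 0)" using bot'[of v] hom_closed[OF top[OF x]] unfolding v by simp
    thus ?thesis using f'f[OF top[OF x]] by (simp add: top_def)
  qed
  have P_surj: "\<exists>x\<in>funs_on I. P x = y" if y: "y \<in> funs_on J" for y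
  proof -
    have Y: "((0, 0), y) \<in> carrier ?H" using y by (simp add: GA_carrier prufer_0)
    obtain u x where ux: "f' ((0, 0), y) = (u, x)" by (metis surj_pair)
    have c: "(u, x) \<in> carrier ?G" using f'_closed[OF Y] ux by simp
    have "P x = y" using P_gen[OF c] ff'[OF Y] ux by simp
    moreover have "x \<in> funs_on I" using c by (cases u) (simp add: GA_carrier)
    ultimately show ?thesis by blast
  qed
  have "\<exists>c' d'. f (bottom_elem c d) = bottom_elem c' d'" for c d
  proof -
    have z: "bottom_elem c d \<in> carrier ?G" by (rule bottom_elem_carrier)
    obtain w1 w2 where w: "f (bottom_elem c d) = ((w1, w2), \<lambda>i. 0)"
      using bot[of "(tau c, tau d)"] z unfolding bottom_elem_def by (metis prod.collapse)
    have wc: "w1 \<in> prufer CARD('p)" "w2 \<in> prufer CARD('p)" using hom_closed[OF z] unfolding w by (simp_all add: GA_carrier)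
    have "frac (of_nat CARD('p) * tau e) = 0" for e :: "'p mod_ring" by (simp add: tau_def)
    hence "bottom_elem c d [^]\<^bsub>?G\<^esub> CARD('p) = \<one>\<^bsub>?G\<^esub>"
      unfolding bottom_elem_def GA_pow[OF A two tau_prufer tau_prufer] by (simp add: GA_one)
    hence "f (bottom_elem c d) [^]\<^bsub>?H\<^esub> CARD('p) = \<one>\<^bsub>?H\<^esub>" using hom_nat_pow[OF z, of "CARD('p)"] by simp
    hence "frac (of_nat CARD('p) * w1) = 0" "frac (of_nat CARD('p) * w2) = 0"
      unfolding w GA_pow[OF C two wc] GA_one prod.inject by blast+
    then obtain c' d' :: "'p mod_ring" where "w1 = tau c'" "w2 = tau d'" using prufer_torsion wc by metis
    hence "f (bottom_elem c d) = bottom_elem c' d'" unfolding w unfolding bottom_elem_def by simp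
    thus ?thesis by (intro exI)
  qed
  note ex_t = this
  define t1 where "t1 c d = (SOME c'. \<exists>d'. f (bottom_elem c d) = bottom_elem c' d')" for c d
  define t2 where "t2 c d = (SOME d'. f (bottom_elem c d) = bottom_elem (t1 c d) d')" for c d
  have t: "f (bottom_elem c d) = bottom_elem (t1 c d) (t2 c d)" for c d
    unfolding t2_def by (rule someI_ex, unfold t1_def, rule someI_ex, rule ex_t)
  have t_add: "t1 (c + c') (d + d') = t1 c d + t1 c' d' \<and> t2 (c + c') (d + d') = t2 c d + t2 c' d'" for c c' d d'
  proof -
    have "f (bottom_elem c d \<otimes>\<^bsub>?G\<^esub> bottom_elem c' d') = f (bottom_elem c d) \<otimes>\<^bsub>?H\<^esub> f (bottom_elem c' d')"
      by (rule hom_mult[OF bottom_elem_carrier bottom_elem_carrier])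
    thus ?thesis unfolding bottom_elem_mult t by (simp add: bottom_elem_inj)
  qed
  define \<alpha> \<gamma> \<beta> \<delta> where "\<alpha> = t1 1 0" and "\<gamma> = t2 1 0" and "\<beta> = t1 0 1" and "\<delta> = t2 0 1"
  have lin: "t1 c d = \<alpha> * c + \<beta> * d" "t2 c d = \<gamma> * c + \<delta> * d" for c d
  proof -
    have "t1 c 0 = c * t1 1 0" "t2 c 0 = c * t2 1 0" "t1 0 d = d * t1 0 1" "t2 0 d = d * t2 0 1"
      using additive_mod_ring[of "\<lambda>c. t1 c 0" c] additive_mod_ring[of "\<lambda>c. t2 c 0" c]
        additive_mod_ring[of "\<lambda>d. t1 0 d" d] additive_mod_ring[of "\<lambda>d. t2 0 d" d]
        t_add[of _ _ 0 0] t_add[of 0 0] by simp_all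
    thus "t1 c d = \<alpha> * c + \<beta> * d" "t2 c d = \<gamma> * c + \<delta> * d"
      using t_add[of c 0 0 d] by (simp_all add: \<alpha>_def \<beta>_def \<gamma>_def \<delta>_def mult.commute)
  qed
  have t_inj: "c = 0 \<and> d = 0" if "t1 c d = 0" "t2 c d = 0" for c d
  proof -
    have "f (bottom_elem c d) = f (bottom_elem 0 0)" unfolding t using that lin[of 0 0] by simp
    hence "(bottom_elem c d :: (rat \<times> rat) \<times> ('i \<Rightarrow> 'p mod_ring)) = bottom_elem 0 0"
      using f'f[OF bottom_elem_carrier, of c d] f'f[OF bottom_elem_carrier, of 0 0] by metis
    thus ?thesis by (simp add: bottom_elem_inj)
  qed
  have det: "\<alpha> * \<delta> - \<beta> * \<gamma> \<noteq> 0"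
  proof
    assume 0: "\<alpha> * \<delta> - \<beta> * \<gamma> = 0"
    \<comment> \<open>The vectors (\<beta>, - \<alpha>) and (\<delta>, - \<gamma>) lie in the kernel
      of a singular matrix; injectivity would make the matrix zero.\<close>
    have "\<beta> = 0 \<and> - \<alpha> = 0" using 0 by (intro t_inj) (simp_all add: lin mult.commute)
    moreover have "\<delta> = 0 \<and> - \<gamma> = 0" using 0 by (intro t_inj) (simp_all add: lin mult.commute)
    ultimately have "t1 1 0 = 0" "t2 1 0 = 0" by (simp_all add: \<alpha>_def \<gamma>_def)
    from t_inj[OF this] show False by simp
  qed
  have forms: "bil J C (P x) (P y) = \<alpha> * bil I A x y + \<beta> * bil I B x y"
    "bil J D (P x) (P y) = \<gamma> * bil I A x y + \<delta> * bil I B x y"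
    if x: "x \<in> funs_on I" and y: "y \<in> funs_on I" for x y
  proof -
    let ?X = "f (top x)" and ?Y = "f (top y)" and ?z = "bottom_elem (bil I A x y) (bil I B x y)"
    have c: "?X \<in> carrier ?H" "?Y \<in> carrier ?H" "?Y \<otimes>\<^bsub>?H\<^esub> ?X \<in> carrier ?H" using hom_closed[OF top[OF x]] hom_closed[OF top[OF y]] by simp_all
    have "?X \<otimes>\<^bsub>?H\<^esub> ?Y = f (top x \<otimes>\<^bsub>?G\<^esub> top y)" using top x y by simp
    also have "top x \<otimes>\<^bsub>?G\<^esub> top y = ?z \<otimes>\<^bsub>?G\<^esub> (top y \<otimes>\<^bsub>?G\<^esub> top x)"
      unfolding top_def by (rule GA_commute[OF A two])
    also have "f \<dots> = f ?z \<otimes>\<^bsub>?H\<^esub> (?Y \<otimes>\<^bsub>?H\<^esub> ?X)"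
      using top[OF x] top[OF y] bottom_elem_carrier[of _ _ I A B] by (simp add: hom_mult)
    finally have 1: "?X \<otimes>\<^bsub>?H\<^esub> ?Y = f ?z \<otimes>\<^bsub>?H\<^esub> (?Y \<otimes>\<^bsub>?H\<^esub> ?X)" .
    have "?X \<otimes>\<^bsub>?H\<^esub> ?Y = bottom_elem (bil J C (P x) (P y)) (bil J D (P x) (P y)) \<otimes>\<^bsub>?H\<^esub> (?Y \<otimes>\<^bsub>?H\<^esub> ?X)"
      using GA_commute[OF C two, of "fst ?X" "snd ?X" "fst ?Y" "snd ?Y"] by (simp add: P_def)
    hence "f ?z \<otimes>\<^bsub>?H\<^esub> (?Y \<otimes>\<^bsub>?H\<^esub> ?X) = bottom_elem (bil J C (P x) (P y)) (bil J D (P x) (P y)) \<otimes>\<^bsub>?H\<^esub> (?Y \<otimes>\<^bsub>?H\<^esub> ?X)"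
      using 1 by simp
    hence "f ?z = bottom_elem (bil J C (P x) (P y)) (bil J D (P x) (P y))"
      using H.right_cancel[OF c(3) hom_closed[OF bottom_elem_carrier] bottom_elem_carrier] by blast
    thus "bil J C (P x) (P y) = \<alpha> * bil I A x y + \<beta> * bil I B x y"
      "bil J D (P x) (P y) = \<gamma> * bil I A x y + \<delta> * bil I B x y"
      unfolding t by (simp_all add: bottom_elem_inj lin)
  qed
  \<comment> \<open>The signs and the transposition match the conventions of \<open>trans1\<close>
    and \<open>trans2\<close>.\<close>
  define Q where "Q = (\<alpha>, - \<gamma>, - \<beta>, \<delta>)"
  have Q: "Q \<in> GL2" using det by (simp add: Q_def GL2_def mult.commute)
  have tr: "bil I (trans1 Q A B) x y = \<alpha> * bil I A x y + \<beta> * bil I B x y"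
    "bil I (trans2 Q A B) x y = \<gamma> * bil I A x y + \<delta> * bil I B x y" for x y
    by (simp_all add: Q_def bil_def sum_distrib_left sum.distrib[symmetric] algebra_simps)
  have w_ex: "\<forall>s\<in>J. \<exists>x. x \<in> funs_on I \<and> P x = unit_fun s" using P_surj[OF unit_fun_in] by blast
  \<comment> \<open>Preimages of the unit vectors under P are the new basis, in which the
    transformed forms have the matrices C and D.\<close>
  define w where "w s = (SOME x. x \<in> funs_on I \<and> P x = unit_fun s)" for s
  have "w s \<in> funs_on I \<and> P (w s) = unit_fun s" if "s \<in> J" for s
    using someI_ex[OF bspec[OF w_ex that]] by (simp only: w_def)
  hence w: "\<And>s. s \<in> J \<Longrightarrow> w s \<in> funs_on I" "\<And>s. s \<in> J \<Longrightarrow> P (w s) = unit_fun s" by simp_all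
  have P_diff: "x = y" if "x \<in> funs_on I" "y \<in> funs_on I" "P x = P y" for x y
  proof -
    have m: "(\<lambda>i. - 1 * y i) \<in> funs_on I" using that(2) by (rule funs_on_scale)
    have "P (\<lambda>i. - 1 * y i) j = - 1 * P y j" for j
      by (rule additive_scale[where I = I and L = "\<lambda>x. P x j"]) (simp_all add: P_add that)
    hence "P (\<lambda>i. x i + - 1 * y i) = (\<lambda>j. 0)" using P_add[OF that(1) m] that(3) by simp
    hence "(\<lambda>i. x i + - 1 * y i) = (\<lambda>i. 0)" by (rule P_ker[OF funs_on_add[OF that(1) m]])
    hence "x i + - 1 * y i = 0" for i by (rule fun_cong)
    hence "x i = y i" for i by simp
    thus ?thesis by (rule ext)
  qed
  have comb: "(\<lambda>i. \<Sum>s\<in>K. c s * w s i) \<in> funs_on I \<and> P (\<lambda>i. \<Sum>s\<in>K. c s * w s i) = (\<lambda>j. \<Sum>s\<in>K. c s * unit_fun s j)"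
    if "finite K" "K \<subseteq> J" for K c
    using that
  proof (induction K rule: finite_induct)
    case empty
    have "P (\<lambda>i. 0) j = P (\<lambda>i. 0) j + P (\<lambda>i. 0) j" for j using fun_cong[OF P_add[OF funs_on_0 funs_on_0], of j] by (simp only: add_0_left)
    hence "P (\<lambda>i. 0) j = 0" for j by (metis add.right_neutral add_left_cancel)
    thus ?case by (auto simp: funs_on_0)
  next
    case (insert s K)
    have s: "s \<in> J" using insert.prems by simp
    have cs: "(\<lambda>i. c s * w s i) \<in> funs_on I" using w(1)[OF s] by (rule funs_on_scale)
    have "P (\<lambda>i. c s * w s i) j = c s * P (w s) j" for j
      by (rule additive_scale[where I = I and L = "\<lambda>x. P x j"]) (simp_all add: P_add w(1)[OF s])
    moreover have "(\<lambda>i. \<Sum>s\<in>insert s K. c s * w s i) = (\<lambda>i. c s * w s i + (\<Sum>s\<in>K. c s * w s i))"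
      using insert.hyps by simp
    ultimately show ?case using insert.IH insert.prems P_add[OF cs] funs_on_add[OF cs] insert.hyps w(2)[OF s] by simp
  qed
  have unit_sum: "(\<Sum>s\<in>J. c s * unit_fun s j) = (if j \<in> J then c j else 0)" for c :: "'j \<Rightarrow> 'p mod_ring" and j
  proof -
    have "(\<Sum>s\<in>J. c s * unit_fun s j) = (\<Sum>s\<in>J. if j = s then c s else 0)" by (intro sum.cong) (auto simp: unit_fun_def)
    thus ?thesis using fin by simp
  qed
  have "congruent_pairs I (trans1 Q A B) (trans2 Q A B) J C D"
  proof (rule congruent_pairs_of_basis[where w = w, OF fin])
    have bu: "bil J E (unit_fun s) (unit_fun t) = E s t" if "s \<in> J" "t \<in> J" for s t and E :: "'j \<Rightarrow> 'j \<Rightarrow> 'p mod_ring"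
    proof -
      have "bil J E (unit_fun s) (unit_fun t) = (\<Sum>i\<in>J. if i = s then (\<Sum>j\<in>J. if j = t then E i j else 0) else 0)"
        unfolding bil_def by (intro sum.cong refl) (auto simp: unit_fun_def intro!: sum.cong)
      thus ?thesis using that fin by simp
    qed
    show "\<forall>s\<in>J. \<forall>t\<in>J. bil I (trans1 Q A B) (w s) (w t) = C s t \<and> bil I (trans2 Q A B) (w s) (w t) = D s t"
    proof (intro ballI)
      fix s t assume st: "s \<in> J" "t \<in> J"
      show "bil I (trans1 Q A B) (w s) (w t) = C s t \<and> bil I (trans2 Q A B) (w s) (w t) = D s t"
        unfolding tr using forms[OF w(1)[OF st(1)] w(1)[OF st(2)]] unfolding w(2)[OF st(1)] w(2)[OF st(2)] bu[OF st] by simp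
    qed
    show "\<forall>x\<in>funs_on I. \<exists>c. \<forall>i\<in>I. x i = (\<Sum>s\<in>J. c s * w s i)"
    proof
      fix x :: "'i \<Rightarrow> 'p mod_ring" assume x: "x \<in> funs_on I"
      note cx = comb[OF fin(2) order_refl, of "P x"]
      have "(if j \<in> J then P x j else 0) = P x j" for j using P_in[OF x] by (simp add: funs_on_def)
      hence "P (\<lambda>i. \<Sum>s\<in>J. P x s * w s i) = P x" using conjunct2[OF cx] unfolding unit_sum by simp
      hence e: "(\<lambda>i. \<Sum>s\<in>J. P x s * w s i) = x" by (rule P_diff[OF conjunct1[OF cx] x])
      have "\<forall>i\<in>I. x i = (\<Sum>s\<in>J. P x s * w s i)" using fun_cong[OF e] by simp
      thus "\<exists>c. \<forall>i\<in>I. x i = (\<Sum>s\<in>J. c s * w s i)" by (rule exI[where x = "P x"])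
    qed
    show "\<forall>c. (\<forall>i\<in>I. (\<Sum>s\<in>J. c s * w s i) = 0) \<longrightarrow> (\<forall>s\<in>J. c s = 0)"
    proof (intro allI impI ballI)
      fix c :: "'j \<Rightarrow> 'p mod_ring" and s assume 0: "\<forall>i\<in>I. (\<Sum>s\<in>J. c s * w s i) = 0" and s: "s \<in> J"
      have z: "(\<lambda>i. \<Sum>s\<in>J. c s * w s i) = (\<lambda>i. 0)"
      proof
        fix i show "(\<Sum>s\<in>J. c s * w s i) = 0"
          using 0 conjunct1[OF comb[OF fin(2) order_refl, of c]] by (cases "i \<in> I") (simp_all add: funs_on_def)
      qed
      have "P (\<lambda>i. 0) = (\<lambda>i. 0)" using comb[of "{}" c] by simp
      hence "(\<lambda>j. 0) = (\<lambda>j. \<Sum>t\<in>J. c t * unit_fun t j)"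
        using conjunct2[OF comb[OF fin(2) order_refl, of c]] unfolding z by simp
      hence "(\<Sum>t\<in>J. c t * unit_fun t s) = 0" by (rule fun_cong[symmetric])
      thus "c s = 0" using s unit_sum by simp
    qed
  qed
  thus ?thesis using Q by blast
qed

subsection \<open>Nilpotent extensions of divisible groups\<close>

lemma (in group) commutator_eqI:
  assumes "x \<in> carrier G" "y \<in> carrier G" "n \<in> carrier G" "x \<otimes> y = n \<otimes> (y \<otimes> x)"
  shows "x \<otimes> y \<otimes> inv x \<otimes> inv y = n"
proof -
  have "x \<otimes> y \<otimes> inv x \<otimes> inv y = n \<otimes> (y \<otimes> x) \<otimes> inv x \<otimes> inv y" using assms(4) by simp
  also have "\<dots> = n \<otimes> (y \<otimes> (x \<otimes> inv x) \<otimes> inv y)" using assms(1-3) by (simp only: m_assoc m_closed inv_closed)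
  also have "\<dots> = n" using assms(1-3) by simp
  finally show ?thesis .
qed

lemma (in group) commutator_swap:
  assumes "x \<in> carrier G" "y \<in> carrier G"
  shows "(x \<otimes> y \<otimes> inv x \<otimes> inv y) \<otimes> (y \<otimes> x) = x \<otimes> y"
proof -
  have "(x \<otimes> y \<otimes> inv x \<otimes> inv y) \<otimes> (y \<otimes> x) = x \<otimes> y \<otimes> inv x \<otimes> (inv y \<otimes> y) \<otimes> x"
    using assms by (simp only: m_assoc m_closed inv_closed)
  also have "\<dots> = x \<otimes> y \<otimes> (inv x \<otimes> x)" using assms by (simp add: m_assoc)
  also have "\<dots> = x \<otimes> y" using assms by simp
  finally show ?thesis .
qed

lemma (in group) divisible_normal_central:
  assumes N: "N \<lhd> G" and N_comm: "\<And>a b. a \<in> N \<Longrightarrow> b \<in> N \<Longrightarrow> a \<otimes> b = b \<otimes> a"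
    and div: "\<And>a. a \<in> N \<Longrightarrow> \<exists>b\<in>N. b [^] p = a"
    and pow: "\<And>x. x \<in> carrier G \<Longrightarrow> x [^] (p :: nat) \<in> N"
    and nil: "lower_central G n = {\<one>}" and a: "a \<in> N" and x: "x \<in> carrier G"
  shows "a \<otimes> x = x \<otimes> a"
proof -
  interpret N: normal N G by (rule N)
  have Nc: "a \<in> carrier G" if "a \<in> N" for a using that by (rule N.mem_carrier)
  define \<kappa> where "\<kappa> a = a \<otimes> x \<otimes> inv a \<otimes> inv x" for a
  have \<kappa>_alt: "\<kappa> a = a \<otimes> (x \<otimes> inv a \<otimes> inv x)" if "a \<in> N" for a
    using Nc[OF that] x by (simp add: \<kappa>_def m_assoc)
  have \<kappa>_in: "\<kappa> a \<in> N" if "a \<in> N" for a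
    unfolding \<kappa>_alt[OF that] using that x by (intro N.m_closed N.inv_op_closed2) auto
  have swap: "\<kappa> a \<otimes> (x \<otimes> a) = a \<otimes> x" if "a \<in> N" for a
    unfolding \<kappa>_def by (rule commutator_swap[OF Nc[OF that] x])
  have \<kappa>_eqI: "\<kappa> a = m" if "a \<in> N" "m \<in> N" "a \<otimes> x = m \<otimes> (x \<otimes> a)" for a m
    unfolding \<kappa>_def by (rule commutator_eqI[OF Nc[OF that(1)] x Nc[OF that(2)] that(3)])
  have \<kappa>_mult: "\<kappa> (a \<otimes> b) = \<kappa> a \<otimes> \<kappa> b" if a: "a \<in> N" and b: "b \<in> N" for a b
  proof (rule \<kappa>_eqI)
    note c = Nc[OF a] Nc[OF b] Nc[OF \<kappa>_in[OF a]] Nc[OF \<kappa>_in[OF b]] x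
    have "a \<otimes> b \<otimes> x = a \<otimes> (\<kappa> b \<otimes> (x \<otimes> b))" using c swap[OF b] by (simp add: m_assoc)
    also have "\<dots> = (a \<otimes> \<kappa> b) \<otimes> (x \<otimes> b)" using c by (simp add: m_assoc)
    also have "\<dots> = \<kappa> b \<otimes> (a \<otimes> x) \<otimes> b" using c N_comm[OF a \<kappa>_in[OF b]] by (simp add: m_assoc)
    also have "\<dots> = (\<kappa> b \<otimes> \<kappa> a) \<otimes> (x \<otimes> (a \<otimes> b))" using c swap[OF a, symmetric] by (simp add: m_assoc)
    also have "\<kappa> b \<otimes> \<kappa> a = \<kappa> a \<otimes> \<kappa> b" by (rule N_comm[OF \<kappa>_in[OF b] \<kappa>_in[OF a]])
    finally show "a \<otimes> b \<otimes> x = \<kappa> a \<otimes> \<kappa> b \<otimes> (x \<otimes> (a \<otimes> b))" .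
  qed (use a b \<kappa>_in in auto)
  have it_in: "(\<kappa> ^^ k) a \<in> N" if "a \<in> N" for a k
    using that by (induction k) (auto intro: \<kappa>_in)
  have it_mult: "(\<kappa> ^^ k) (a \<otimes> b) = (\<kappa> ^^ k) a \<otimes> (\<kappa> ^^ k) b" if "a \<in> N" "b \<in> N" for a b k
    using that by (induction k) (auto simp: \<kappa>_mult it_in)
  have it_one: "(\<kappa> ^^ k) \<one> = \<one>" for k
    using x by (induction k) (auto simp: \<kappa>_def)
  have pow_in: "a [^] (k :: nat) \<in> N" if "a \<in> N" for a k
    using that by (induction k) auto
  have it_pow: "(\<kappa> ^^ k) (a [^] (j :: nat)) = (\<kappa> ^^ k) a [^] j" if "a \<in> N" for a k j
    using that by (induction j) (auto simp: it_mult pow_in it_one)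
  have lower: "(\<kappa> ^^ k) a \<in> lower_central G k" if "a \<in> N" for a k
  proof (induction k)
    case 0
    thus ?case using Nc[OF that] by simp
  next
    case (Suc k)
    thus ?case using x by (auto simp: \<kappa>_def intro!: generate.incl)
  qed
  \<comment> \<open>kappa is 1 - sigma for the conjugation sigma by x.  If its square vanishes on b then
    sigma^k b = b - k (kappa b); at k = p, where sigma^p = 1, this gives p (kappa b) = 0.\<close>
  have descent: "\<kappa> a = \<one>" if "\<forall>a\<in>N. (\<kappa> ^^ Suc k) a = \<one>" "a \<in> N" for a k
    using that
  proof (induction k arbitrary: a)
    case 0
    thus ?case by simp
  next
    case (Suc k)
    have "(\<kappa> ^^ Suc k) a = \<one>" if a: "a \<in> N" for a
    proof -
      \<comment> \<open>Divisibility enters here: the argument only shows that the iterate at m has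
        p-th power \<one>, but that power is the iterate at a.\<close>
      obtain m where m: "m \<in> N" "m [^] p = a" using div[OF a] by blast
      define b d where "b = (\<kappa> ^^ k) m" and "d = \<kappa> b"
      have bN: "b \<in> N" and dN: "d \<in> N" unfolding d_def b_def using m it_in \<kappa>_in by auto
      note c = Nc[OF bN] Nc[OF dN] x
      have "\<kappa> d = \<one>" using Suc.prems(1) m(1) by (simp add: b_def d_def)
      hence dx: "x \<otimes> d = d \<otimes> x" using swap[OF dN] c by simp
      have bx: "b \<otimes> x = d \<otimes> (x \<otimes> b)" using swap[OF bN] by (simp add: d_def)
      have "b \<otimes> x [^] j = d [^] j \<otimes> (x [^] j \<otimes> b)" for j :: nat
      proof (induction j)
        case 0
        thus ?case using c by simp
      next
        case (Suc j)
        have "b \<otimes> x [^] Suc j = (b \<otimes> x [^] j) \<otimes> x" using c by (simp add: m_assoc)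
        also have "\<dots> = d [^] j \<otimes> (x [^] j \<otimes> (b \<otimes> x))" using c by (simp add: Suc m_assoc)
        also have "\<dots> = d [^] j \<otimes> ((x [^] j \<otimes> d) \<otimes> (x \<otimes> b))" using c by (simp add: bx m_assoc)
        also have "x [^] j \<otimes> d = d \<otimes> x [^] j" using group_commutes_pow[OF dx] c by simp
        also have "d [^] j \<otimes> (d \<otimes> x [^] j \<otimes> (x \<otimes> b)) = d [^] Suc j \<otimes> (x [^] Suc j \<otimes> b)" using c by (simp add: m_assoc)
        finally show ?case .
      qed
      from this[of p] have "\<one> \<otimes> (b \<otimes> x [^] p) = d [^] p \<otimes> (b \<otimes> x [^] p)"
        using N_comm[OF bN pow[OF x]] c by simp
      hence "d [^] p = \<one>" using c by (metis m_closed nat_pow_closed one_closed right_cancel)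
      thus ?thesis using it_pow[OF m(1), of "Suc k" p] m(2) by (simp add: d_def b_def)
    qed
    thus ?case using Suc.IH Suc.prems(2) by blast
  qed
  have "(\<kappa> ^^ n) a = \<one>" if "a \<in> N" for a using lower[OF that, of n] nil by simp
  hence "\<forall>a\<in>N. (\<kappa> ^^ Suc n) a = \<one>" using it_one[of 1] by simp
  hence "\<kappa> a = \<one>" using descent a by blast
  thus ?thesis using swap[OF a] Nc[OF a] x by simp
qed

section \<open>Groups of class two and Baer's correction\<close>

locale class_two = group G for G (structure) +
  fixes N :: "'a set" and ty :: "'p::prime_card itself"
  assumes N_subgroup: "subgroup N G"
    and central: "\<And>n x. n \<in> N \<Longrightarrow> x \<in> carrier G \<Longrightarrow> x \<otimes> n = n \<otimes> x"
    and commutator_in: "\<And>x y. x \<in> carrier G \<Longrightarrow> y \<in> carrier G \<Longrightarrow> x \<otimes> y \<otimes> inv x \<otimes> inv y \<in> N"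
    and pow_in: "\<And>x. x \<in> carrier G \<Longrightarrow> x [^] CARD('p) \<in> N"
    and odd_p: "odd CARD('p)"
begin

definition c where "c x y = x \<otimes> y \<otimes> inv x \<otimes> inv y"
text \<open>Since the commutators are p-torsion, the power (p+1)/2 is their square root; with the
  correction by h the multiplication becomes commutative (Baer's trick).\<close>

definition h where "h x y = c x y [^] (Suc CARD('p) div 2)"
definition bop where "bop x y = x \<otimes> y \<otimes> h y x"
definition baer where "baer = \<lparr>carrier = carrier G, monoid.mult = bop, one = \<one>\<rparr>"

lemma N_carrier: "n \<in> N \<Longrightarrow> n \<in> carrier G"
  using N_subgroup by (rule subgroup.mem_carrier)

lemma N_closed: "m \<in> N \<Longrightarrow> n \<in> N \<Longrightarrow> m \<otimes> n \<in> N" "\<one> \<in> N"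
  using N_subgroup by (auto intro: subgroup.m_closed subgroup.one_closed)

lemma N_inv: "n \<in> N \<Longrightarrow> inv n \<in> N"
  using N_subgroup by (rule subgroup.m_inv_closed)

lemma N_pow: "n \<in> N \<Longrightarrow> n [^] (k :: nat) \<in> N"
  by (induction k) (auto intro: N_closed)

lemma central_left: "n \<in> N \<Longrightarrow> x \<in> carrier G \<Longrightarrow> y \<in> carrier G \<Longrightarrow> x \<otimes> (n \<otimes> y) = n \<otimes> (x \<otimes> y)"
  using central[of n x] N_carrier[of n] by (simp add: m_assoc[symmetric])

lemma c_in: "x \<in> carrier G \<Longrightarrow> y \<in> carrier G \<Longrightarrow> c x y \<in> N"
  unfolding c_def by (rule commutator_in)

lemma c_swap: "x \<in> carrier G \<Longrightarrow> y \<in> carrier G \<Longrightarrow> c x y \<otimes> (y \<otimes> x) = x \<otimes> y"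
  unfolding c_def by (rule commutator_swap)

lemma c_eqI: "x \<in> carrier G \<Longrightarrow> y \<in> carrier G \<Longrightarrow> n \<in> N \<Longrightarrow> x \<otimes> y = n \<otimes> (y \<otimes> x) \<Longrightarrow> c x y = n"
  unfolding c_def by (rule commutator_eqI) (auto intro: N_carrier)

text \<open>Commutators are central and can be moved to the front, which makes them multiplicative
  in each argument.\<close>

lemma c_mult_left:
  assumes x: "x \<in> carrier G" and y: "y \<in> carrier G" and z: "z \<in> carrier G"
  shows "c (x \<otimes> y) z = c x z \<otimes> c y z"
proof (rule c_eqI)
  note i = c_in[OF x z] c_in[OF y z]
  note m = x y z i[THEN N_carrier]
  have "x \<otimes> y \<otimes> z = x \<otimes> (c y z \<otimes> (z \<otimes> y))" using m c_swap[OF y z] by (simp add: m_assoc)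
  also have "\<dots> = c y z \<otimes> ((x \<otimes> z) \<otimes> y)" using m central_left[OF i(2) x, of "z \<otimes> y"] by (simp add: m_assoc)
  also have "\<dots> = (c y z \<otimes> c x z) \<otimes> (z \<otimes> (x \<otimes> y))" using m c_swap[OF x z, symmetric] by (simp add: m_assoc)
  also have "c y z \<otimes> c x z = c x z \<otimes> c y z" by (rule central[OF i(1) m(5)])
  finally show "x \<otimes> y \<otimes> z = c x z \<otimes> c y z \<otimes> (z \<otimes> (x \<otimes> y))" .
qed (use assms in \<open>auto intro: N_closed c_in\<close>)

lemma c_swap_mult:
  assumes x: "x \<in> carrier G" and y: "y \<in> carrier G"
  shows "c x y \<otimes> c y x = \<one>"
proof -
  note m = x y N_carrier[OF c_in[OF x y]] N_carrier[OF c_in[OF y x]]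
  have "(c x y \<otimes> c y x) \<otimes> (x \<otimes> y) = c x y \<otimes> (c y x \<otimes> (x \<otimes> y))" using m by (simp add: m_assoc)
  also have "\<dots> = \<one> \<otimes> (x \<otimes> y)" using m c_swap[OF y x] c_swap[OF x y] by simp
  finally show ?thesis using m by (metis m_closed one_closed right_cancel)
qed

lemma c_inv: "x \<in> carrier G \<Longrightarrow> y \<in> carrier G \<Longrightarrow> c y x = inv (c x y)"
  using c_swap_mult[of y x] N_carrier[OF c_in[of y x]] N_carrier[OF c_in[of x y]] by (metis inv_equality)

lemma c_mult_right:
  assumes x: "x \<in> carrier G" and y: "y \<in> carrier G" and z: "z \<in> carrier G"
  shows "c z (x \<otimes> y) = c z x \<otimes> c z y"
proof -
  note m = N_carrier[OF c_in[OF x z]] N_carrier[OF c_in[OF y z]]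
  have "c z (x \<otimes> y) = inv (c x z \<otimes> c y z)" using c_inv[of "x \<otimes> y" z] assms by (simp add: c_mult_left)
  also have "\<dots> = inv (c y z \<otimes> c x z)" using central[OF c_in[OF x z] m(2)] by simp
  also have "\<dots> = c z x \<otimes> c z y" using m c_inv[OF x z] c_inv[OF y z] by (simp add: inv_mult_group)
  finally show ?thesis .
qed

lemma c_central: "n \<in> N \<Longrightarrow> x \<in> carrier G \<Longrightarrow> c n x = \<one>" "n \<in> N \<Longrightarrow> x \<in> carrier G \<Longrightarrow> c x n = \<one>"
  by (rule c_eqI; simp add: N_carrier N_closed central)+

lemma c_self: "x \<in> carrier G \<Longrightarrow> c x x = \<one>"
  by (rule c_eqI) (auto intro: N_closed)

lemma c_pow_left: "x \<in> carrier G \<Longrightarrow> y \<in> carrier G \<Longrightarrow> c (x [^] (k :: nat)) y = c x y [^] k"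
  by (induction k) (simp_all add: c_central N_closed c_mult_left)

lemma c_pow_p: "x \<in> carrier G \<Longrightarrow> y \<in> carrier G \<Longrightarrow> c x y [^] CARD('p) = \<one>"
  using c_pow_left[of x y "CARD('p)"] c_central(1)[OF pow_in] by simp

lemma N_pow_mult: "m \<in> N \<Longrightarrow> n \<in> N \<Longrightarrow> (m \<otimes> n) [^] (k :: nat) = m [^] k \<otimes> n [^] k"
  using central[of n m] by (intro pow_mult_distrib) (auto intro: N_carrier)

lemma h_in: "x \<in> carrier G \<Longrightarrow> y \<in> carrier G \<Longrightarrow> h x y \<in> N"
  unfolding h_def by (intro N_pow c_in)

lemma h_square:
  assumes "x \<in> carrier G" "y \<in> carrier G"
  shows "h x y \<otimes> h x y = c x y"
proof -
  have e: "Suc CARD('p) div 2 + Suc CARD('p) div 2 = Suc CARD('p)" using odd_p by presburger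
  note m = N_carrier[OF c_in[OF assms]]
  show ?thesis unfolding h_def nat_pow_mult[OF m] e using m c_pow_p[OF assms] by simp
qed

lemma h_mult:
  assumes "x \<in> carrier G" "y \<in> carrier G" "z \<in> carrier G"
  shows "h (x \<otimes> y) z = h x z \<otimes> h y z" "h z (x \<otimes> y) = h z x \<otimes> h z y"
  using assms by (simp_all add: h_def c_mult_left c_mult_right N_pow_mult c_in)

lemma h_central: "n \<in> N \<Longrightarrow> x \<in> carrier G \<Longrightarrow> h n x = \<one>" "n \<in> N \<Longrightarrow> x \<in> carrier G \<Longrightarrow> h x n = \<one>"
  by (simp_all add: h_def c_central)

lemma h_self: "x \<in> carrier G \<Longrightarrow> h x x = \<one>"
  by (simp add: h_def c_self)

lemma h_swap_mult: "x \<in> carrier G \<Longrightarrow> y \<in> carrier G \<Longrightarrow> h x y \<otimes> h y x = \<one>"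
  using N_pow_mult[OF c_in c_in, of x y y x] c_swap_mult[of x y] by (simp add: h_def)

lemma bop_closed: "x \<in> carrier G \<Longrightarrow> y \<in> carrier G \<Longrightarrow> bop x y \<in> carrier G"
  by (simp add: bop_def N_carrier h_in)

lemma h_bop:
  assumes "x \<in> carrier G" "y \<in> carrier G" "z \<in> carrier G"
  shows "h (bop x y) z = h x z \<otimes> h y z" "h z (bop x y) = h z x \<otimes> h z y"
  using assms h_in[of y x] h_in[of x z] h_in[of y z] h_in[of z x] h_in[of z y]
  by (simp_all add: bop_def h_mult h_central N_carrier)

text \<open>Multiplicativity of h in both arguments is the cocycle condition for the corrected
  product.\<close>

lemma bop_assoc:
  assumes x: "x \<in> carrier G" and y: "y \<in> carrier G" and z: "z \<in> carrier G"
  shows "bop (bop x y) z = bop x (bop y z)"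
proof -
  note i = h_in[OF y x] h_in[OF z x] h_in[OF z y]
  note m = x y z i[THEN N_carrier]
  have "bop (bop x y) z = (x \<otimes> y) \<otimes> (h y x \<otimes> z) \<otimes> (h z x \<otimes> h z y)"
    unfolding bop_def[of "bop x y"] h_bop(2)[OF x y z] unfolding bop_def using m by (simp add: m_assoc)
  also have "\<dots> = x \<otimes> (y \<otimes> (z \<otimes> (h y x \<otimes> h z x \<otimes> h z y)))" using m central[OF i(1) z, symmetric] by (simp add: m_assoc)
  also have "h y x \<otimes> h z x \<otimes> h z y = h z y \<otimes> (h y x \<otimes> h z x)" by (rule central[OF i(3)]) (use m in simp)
  also have "x \<otimes> (y \<otimes> (z \<otimes> (h z y \<otimes> (h y x \<otimes> h z x)))) = bop x (bop y z)"
    using m h_bop(1)[OF y z x] by (simp add: bop_def[of x] bop_def[of y z] m_assoc)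
  finally show ?thesis .
qed

text \<open>The products in the two orders differ by c x y, the square of h x y; the correction
  cancels one of the two factors, and the other one is the correction of the opposite
  product.\<close>

lemma bop_comm:
  assumes x: "x \<in> carrier G" and y: "y \<in> carrier G"
  shows "bop x y = bop y x"
proof -
  note i = h_in[OF x y] h_in[OF y x]
  note m = x y i[THEN N_carrier]
  have "bop x y = h x y \<otimes> h x y \<otimes> (y \<otimes> x) \<otimes> h y x" unfolding bop_def h_square[OF x y] c_swap[OF x y] ..
  also have "\<dots> = h x y \<otimes> (h x y \<otimes> (y \<otimes> x \<otimes> h y x))" using m by (simp add: m_assoc)
  also have "y \<otimes> x \<otimes> h y x = h y x \<otimes> (y \<otimes> x)" using m by (intro central i) simp
  also have "h x y \<otimes> (h x y \<otimes> (h y x \<otimes> (y \<otimes> x))) = h x y \<otimes> ((h x y \<otimes> h y x) \<otimes> (y \<otimes> x))" using m by (simp add: m_assoc)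
  also have "\<dots> = h x y \<otimes> (y \<otimes> x)" using m h_swap_mult[OF x y] by simp
  also have "\<dots> = bop y x" unfolding bop_def using m by (intro central[symmetric] i) simp
  finally show ?thesis .
qed

lemma bop_central: "n \<in> N \<Longrightarrow> x \<in> carrier G \<Longrightarrow> bop n x = n \<otimes> x"
  by (simp add: bop_def h_central N_carrier)

lemma bop_inv: "x \<in> carrier G \<Longrightarrow> bop (inv x) x = \<one>"
  using h_mult(2)[of x "inv x" x] h_central(2)[OF N_closed(2), of x] h_self[of x] N_carrier[OF h_in[of x "inv x"]]
  by (simp add: bop_def)

lemma baer_simps [simp]: "carrier baer = carrier G" "x \<otimes>\<^bsub>baer\<^esub> y = bop x y" "\<one>\<^bsub>baer\<^esub> = \<one>"
  by (simp_all add: baer_def)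

lemma comm_group_baer: "comm_group baer"
proof (rule comm_groupI)
  fix x y z assume "x \<in> carrier baer" "y \<in> carrier baer" "z \<in> carrier baer"
  thus "x \<otimes>\<^bsub>baer\<^esub> y \<otimes>\<^bsub>baer\<^esub> z = x \<otimes>\<^bsub>baer\<^esub> (y \<otimes>\<^bsub>baer\<^esub> z)" by (simp add: bop_assoc)
next
  fix x assume "x \<in> carrier baer"
  thus "\<exists>y\<in>carrier baer. y \<otimes>\<^bsub>baer\<^esub> x = \<one>\<^bsub>baer\<^esub>" using bop_inv by (intro bexI[of _ "inv x"]) auto
next
  fix x y assume "x \<in> carrier baer" "y \<in> carrier baer"
  thus "x \<otimes>\<^bsub>baer\<^esub> y = y \<otimes>\<^bsub>baer\<^esub> x" using bop_comm by simp
qed (auto simp: bop_closed bop_central N_closed)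

text \<open>An element commutes with its powers, so no correction arises there. Hence elements have
  the same order for both operations.\<close>

lemma baer_pow: "x \<in> carrier G \<Longrightarrow> x [^]\<^bsub>baer\<^esub> (k :: nat) = x [^] k"
proof (induction k)
  case (Suc k)
  have "h x (x [^] k) = \<one>" using Suc.prems by (induction k) (simp_all add: h_mult h_self h_central N_closed)
  thus ?case using Suc by (simp add: bop_def)
qed simp

section \<open>Coordinates over the prime field modulo the bottom\<close>

definition scal :: "'a \<Rightarrow> 'p mod_ring \<Rightarrow> 'a" where "scal g a = g [^] nat (to_int_mod_ring a)"

definition torsion :: "'a set" where "torsion = {g \<in> carrier G. g [^] CARD('p) = \<one>}"

text \<open>The product is that of the commutative operation; the elements of J serve as their own
  indices.\<close>

definition lin :: "'a set \<Rightarrow> ('a \<Rightarrow> 'p mod_ring) \<Rightarrow> 'a" where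
  "lin J x = finprod baer (\<lambda>i. scal i (x i)) J"

lemma scal_closed: "g \<in> torsion \<Longrightarrow> scal g a \<in> carrier G"
  by (simp add: scal_def torsion_def)

lemma scal_0: "scal g 0 = \<one>" and scal_1: "g \<in> torsion \<Longrightarrow> scal g 1 = g"
  by (simp_all add: scal_def torsion_def)

lemma scal_add:
  assumes g: "g \<in> torsion"
  shows "scal g (a + b) = bop (scal g a) (scal g b)"
proof -
  interpret H: comm_group baer by (rule comm_group_baer)
  have gc: "g \<in> carrier G" and gp: "g [^] CARD('p) = \<one>" using g by (simp_all add: torsion_def)
  have red: "g [^] (k mod CARD('p)) = g [^] k" for k
  proof -
    have "g [^] k = g [^] (CARD('p) * (k div CARD('p)) + k mod CARD('p))" by simp
    also have "\<dots> = (g [^] CARD('p)) [^] (k div CARD('p)) \<otimes> g [^] (k mod CARD('p))"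
      unfolding nat_pow_pow[OF gc] nat_pow_mult[OF gc] ..
    finally show ?thesis using gp gc by simp
  qed
  let ?a = "to_int_mod_ring a" and ?b = "to_int_mod_ring b"
  have "nat ((?a + ?b) mod int CARD('p)) = (nat ?a + nat ?b) mod CARD('p)"
    using to_int_bounds(1)[of a] to_int_bounds(1)[of b] by (simp add: nat_mod_distrib nat_add_distrib)
  hence "scal g (a + b) = g [^] (nat ?a + nat ?b)" unfolding scal_def to_int_mod_ring_add by (simp only: red)
  also have "\<dots> = bop (g [^] nat ?a) (g [^] nat ?b)"
    using H.nat_pow_mult[of g "nat ?a" "nat ?b"] gc by (simp add: baer_pow)
  finally show ?thesis unfolding scal_def .
qed

lemma lin_closed: "J \<subseteq> torsion \<Longrightarrow> lin J x \<in> carrier G"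
proof -
  interpret H: comm_group baer by (rule comm_group_baer)
  show "J \<subseteq> torsion \<Longrightarrow> lin J x \<in> carrier G"
    unfolding lin_def using H.finprod_closed[of "\<lambda>i. scal i (x i)" J] scal_closed by (auto simp: Pi_def)
qed

lemma lin_add:
  assumes "J \<subseteq> torsion"
  shows "lin J (\<lambda>i. x i + y i) = bop (lin J x) (lin J y)"
proof -
  interpret H: comm_group baer by (rule comm_group_baer)
  have t: "i \<in> torsion" if "i \<in> J" for i using assms that by blast
  have "lin J (\<lambda>i. x i + y i) = finprod baer (\<lambda>i. scal i (x i) \<otimes>\<^bsub>baer\<^esub> scal i (y i)) J"
    unfolding lin_def by (rule H.finprod_cong') (auto simp: scal_add scal_closed bop_closed t)
  also have "\<dots> = bop (lin J x) (lin J y)"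
    unfolding lin_def using H.finprod_multf[of "\<lambda>i. scal i (x i)" J "\<lambda>i. scal i (y i)"] scal_closed t by (simp add: Pi_def)
  finally show ?thesis .
qed

lemma lin_eq_one:
  assumes "\<And>i. i \<in> J \<Longrightarrow> x i = 0"
  shows "lin J x = \<one>"
proof -
  interpret H: comm_group baer by (rule comm_group_baer)
  show ?thesis unfolding lin_def using H.finprod_one_eqI[of J "\<lambda>i. scal i (x i)"] assms by (simp add: scal_0)
qed

lemma lin_insert:
  assumes "finite J" "i \<notin> J" "insert i J \<subseteq> torsion"
  shows "lin (insert i J) x = bop (scal i (x i)) (lin J x)"
proof -
  interpret H: comm_group baer by (rule comm_group_baer)
  have t: "j \<in> torsion" if "j \<in> insert i J" for j using assms(3) that by blast
  show ?thesis unfolding lin_def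
    using H.finprod_insert[OF assms(1,2), of "\<lambda>i. scal i (x i)"] scal_closed t by (simp add: Pi_def)
qed

lemma lin_of_nat:
  assumes "J \<subseteq> torsion"
  shows "lin J (\<lambda>i. of_nat k * x i) = lin J x [^] k"
proof (induction k)
  case 0
  show ?case by (simp add: lin_eq_one)
next
  case (Suc k)
  interpret H: comm_group baer by (rule comm_group_baer)
  note m = lin_closed[OF assms, of x]
  have "lin J (\<lambda>i. of_nat (Suc k) * x i) = lin J (\<lambda>i. of_nat k * x i + x i)"
    by (simp add: distrib_right add.commute)
  also have "\<dots> = bop (lin J x [^] k) (lin J x)" unfolding lin_add[OF assms] Suc ..
  also have "\<dots> = lin J x [^] Suc k" using baer_pow[OF m, of "Suc k"] baer_pow[OF m, of k] by simp
  finally show ?case .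
qed

lemma lin_minus:
  assumes "J \<subseteq> torsion"
  shows "bop (lin J x) (lin J (\<lambda>i. - x i)) = \<one>"
  unfolding lin_add[OF assms, symmetric] by (simp add: lin_eq_one)

definition spanning :: "'a set \<Rightarrow> bool" where
  "spanning J \<longleftrightarrow> finite J \<and> J \<subseteq> torsion \<and> (\<forall>g\<in>carrier G. \<exists>n\<in>N. \<exists>x. g = bop n (lin J x))"

text \<open>Multiplying g by a central p-th root of g^(-p) gives an element of p-torsion in the same
  coset. One such representative for each of the finitely many cosets suffices.\<close>

lemma ex_spanning:
  assumes fin: "finite (rcosets N)" and div: "\<And>a. a \<in> N \<Longrightarrow> \<exists>b\<in>N. b [^] CARD('p) = a"
  shows "\<exists>J. spanning J"
proof -
  interpret H: comm_group baer by (rule comm_group_baer)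
  have rep: "\<exists>r. r \<in> C \<and> r \<in> torsion" if "C \<in> rcosets N" for C
  proof -
    obtain g where g: "g \<in> carrier G" "C = N #> g" using \<open>C \<in> rcosets N\<close> unfolding RCOSETS_def by blast
    obtain b where b: "b \<in> N" "b [^] CARD('p) = inv (g [^] CARD('p))" using div[OF N_inv[OF pow_in[OF g(1)]]] by blast
    have "(b \<otimes> g) [^] CARD('p) = b [^] CARD('p) \<otimes> g [^] CARD('p)"
      using central[OF b(1) g(1)] N_carrier[OF b(1)] g(1) by (intro pow_mult_distrib) auto
    hence "b \<otimes> g \<in> torsion" using b g N_carrier[OF b(1)] by (simp add: torsion_def)
    moreover have "b \<otimes> g \<in> C" unfolding g(2) r_coset_def using b(1) by blast
    ultimately show ?thesis by blast
  qed
  define r where "r C = (SOME r. r \<in> C \<and> r \<in> torsion)" for C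
  have r: "r C \<in> C" "r C \<in> torsion" if "C \<in> rcosets N" for C
    using someI_ex[OF rep[OF that]] by (simp_all add: r_def)
  let ?R = "r ` (rcosets N)"
  have RT: "?R \<subseteq> torsion" using r by blast
  have "\<exists>n\<in>N. \<exists>x. g = bop n (lin ?R x)" if g: "g \<in> carrier G" for g
  proof -
    have C: "N #> g \<in> rcosets N" using g unfolding RCOSETS_def by blast
    let ?r = "r (N #> g)"
    obtain n where n: "n \<in> N" "?r = n \<otimes> g" using r(1)[OF C] unfolding r_coset_def by blast
    let ?x = "\<lambda>i. if i = ?r then 1 else 0 :: 'p mod_ring"
    have rc: "?r \<in> carrier G" using r(2)[OF C] by (simp add: torsion_def)
    have "insert ?r (?R - {?r}) = ?R" using C by blast
    hence "lin ?R ?x = lin (insert ?r (?R - {?r})) ?x" by simp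
    also have "\<dots> = bop (scal ?r 1) (lin (?R - {?r}) ?x)" using fin RT C by (subst lin_insert) auto
    also have "lin (?R - {?r}) ?x = \<one>" by (rule lin_eq_one) auto
    also have "bop (scal ?r 1) \<one> = ?r" using H.r_one[of ?r] rc r(2)[OF C] by (simp add: scal_1)
    finally have "lin ?R ?x = ?r" .
    moreover have "g = inv n \<otimes> ?r" using n g N_carrier[OF n(1)] by (simp add: m_assoc[symmetric])
    ultimately have "g = bop (inv n) (lin ?R ?x)" using bop_central[OF N_inv[OF n(1)] rc] by simp
    thus ?thesis using N_inv[OF n(1)] by blast
  qed
  hence "spanning ?R" unfolding spanning_def using fin RT by blast
  thus ?thesis by blast
qed

text \<open>As in a vector space, a relation modulo N with nonzero coefficient at i expresses i
  through J, up to an element of N.\<close>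

lemma spanning_remove:
  assumes J: "spanning (insert i J)" "i \<notin> J" and x: "lin (insert i J) x \<in> N" "x i \<noteq> 0"
  shows "spanning J"
proof -
  interpret H: comm_group baer by (rule comm_group_baer)
  have fin: "finite J" and T: "insert i J \<subseteq> torsion" and JT: "J \<subseteq> torsion" and iT: "i \<in> torsion"
    and span: "\<And>g. g \<in> carrier G \<Longrightarrow> \<exists>n\<in>N. \<exists>x. g = bop n (lin (insert i J) x)"
    using J(1) by (auto simp: spanning_def)
  have ic: "i \<in> carrier G" using iT by (simp add: torsion_def)
  \<comment> \<open>Scaling makes the coefficient at i equal to 1. In the group it is a power with
    exponent k, and N is closed under powers.\<close>
  define a where "a = inverse (x i)"
  define k where "k = nat (to_int_mod_ring a)"
  have "of_nat k = a"
    using to_int_bounds(1)[of a] by (simp add: k_def of_nat_of_int_mod_ring)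
  define y where "y j = a * x j" for j
  have yi: "y i = 1" using x(2) by (simp add: y_def a_def)
  define n where "n = lin (insert i J) y"
  have "n = lin (insert i J) x [^] k" unfolding n_def lin_of_nat[OF T, symmetric] y_def \<open>of_nat k = a\<close> ..
  hence nN: "n \<in> N" using N_pow[OF x(1)] by simp
  define w where "w = lin J (\<lambda>j. - y j)"
  note mem = ic lin_closed[OF JT] N_carrier[OF nN]
  have wc: "w \<in> carrier G" using mem by (simp add: w_def)
  have n_eq: "n = bop i (lin J y)"
    unfolding n_def lin_insert[OF fin J(2) T] yi scal_1[OF iT] ..
  have i_eq: "i = bop n w"
    using bop_assoc[OF ic mem(2)[of y] wc] lin_minus[OF JT, of y] H.r_one[of i] ic by (simp add: n_eq w_def)
  have "\<exists>m\<in>N. \<exists>x. g = bop m (lin J x)" if g: "g \<in> carrier G" for g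
  proof -
    obtain m z where m: "m \<in> N" and g_eq: "g = bop m (lin (insert i J) z)" using span[OF g] by blast
    define l where "l = nat (to_int_mod_ring (z i))"
    have "scal i (z i) = i [^]\<^bsub>baer\<^esub> l" unfolding scal_def l_def baer_pow[OF ic] ..
    also have "\<dots> = (n \<otimes>\<^bsub>baer\<^esub> w) [^]\<^bsub>baer\<^esub> l" using i_eq by simp
    also have "\<dots> = bop (n [^] l) (w [^] l)"
      using H.nat_pow_distrib[of n w l] mem(3) wc by (simp add: baer_pow)
    also have "w [^] l = lin J (\<lambda>j. of_nat l * - y j)" unfolding w_def lin_of_nat[OF JT] ..
    finally have s: "scal i (z i) = bop (n [^] l) (lin J (\<lambda>j. of_nat l * - y j))" .
    have nl: "n [^] l \<in> N" by (rule N_pow[OF nN])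
    let ?v = "\<lambda>j. of_nat l * - y j"
    have "g = bop m (bop (bop (n [^] l) (lin J ?v)) (lin J z))"
      unfolding g_eq lin_insert[OF fin J(2) T] s ..
    also have "\<dots> = bop (bop m (n [^] l)) (bop (lin J ?v) (lin J z))"
      using H.m_assoc[of "n [^] l" "lin J ?v" "lin J z"] H.m_assoc[of m "n [^] l" "bop (lin J ?v) (lin J z)"]
        N_carrier[OF m] N_carrier[OF nl] mem(2)[of ?v] mem(2)[of z] bop_closed[OF mem(2)[of ?v] mem(2)[of z]]
      by simp
    also have "\<dots> = bop (m \<otimes> n [^] l) (lin J (\<lambda>j. ?v j + z j))"
      unfolding lin_add[OF JT] bop_central[OF m N_carrier[OF nl]] ..
    finally show ?thesis using N_closed(1)[OF m nl] by blast
  qed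
  thus ?thesis unfolding spanning_def using fin JT by blast
qed

text \<open>A spanning set of least cardinality has no relations modulo N, since
  \<open>spanning_remove\<close> would shrink it.\<close>

lemma ex_basis:
  assumes fin: "finite (rcosets N)" and div: "\<And>a. a \<in> N \<Longrightarrow> \<exists>b\<in>N. b [^] CARD('p) = a"
  obtains I where "spanning I" "\<And>x i. lin I x \<in> N \<Longrightarrow> i \<in> I \<Longrightarrow> x i = 0"
proof -
  obtain J where J: "spanning J" using ex_spanning[OF assms] by blast
  obtain I where I: "spanning I" "\<And>K. spanning K \<Longrightarrow> card I \<le> card K"
    using ex_has_least_nat[of spanning J card, OF J] by blast
  have "x i = 0" if "lin I x \<in> N" "i \<in> I" for x i
  proof (rule ccontr)
    assume x: "x i \<noteq> 0"
    have e: "insert i (I - {i}) = I" using that(2) by blast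
    have "spanning (I - {i})"
      by (rule spanning_remove[of i "I - {i}" x, unfolded e, OF I(1) _ that(1) x]) simp
    hence "card I \<le> card (I - {i})" by (rule I(2))
    moreover have "finite I" using I(1) by (simp add: spanning_def)
    hence "card (I - {i}) < card I" using that(2) by (rule card_Diff1_less)
    ultimately show False by simp
  qed
  thus thesis using that I(1) by blast
qed

end

section \<open>Identification with the groups \<open>GA\<close>\<close>

lemma (in group) M2_iso_props:
  assumes N: "subgroup N G" and \<iota>: "\<iota> \<in> iso (M2 p) (G\<lparr>carrier := N\<rparr>)" and p: "p > 0"
  shows "u1 \<in> prufer p \<Longrightarrow> u2 \<in> prufer p \<Longrightarrow> \<iota> (u1, u2) \<in> N"
    and "a \<in> N \<Longrightarrow> \<exists>u1 u2. u1 \<in> prufer p \<and> u2 \<in> prufer p \<and> a = \<iota> (u1, u2)"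
    and "u1 \<in> prufer p \<Longrightarrow> u2 \<in> prufer p \<Longrightarrow> v1 \<in> prufer p \<Longrightarrow> v2 \<in> prufer p \<Longrightarrow> \<iota> (u1, u2) = \<iota> (v1, v2) \<Longrightarrow> u1 = v1 \<and> u2 = v2"
    and "u1 \<in> prufer p \<Longrightarrow> u2 \<in> prufer p \<Longrightarrow> v1 \<in> prufer p \<Longrightarrow> v2 \<in> prufer p \<Longrightarrow> \<iota> (frac (u1 + v1), frac (u2 + v2)) = \<iota> (u1, u2) \<otimes> \<iota> (v1, v2)"
    and "\<iota> (0, 0) = \<one>"
    and "u1 \<in> prufer p \<Longrightarrow> u2 \<in> prufer p \<Longrightarrow> \<iota> (u1, u2) [^] (k :: nat) = \<iota> (frac (of_nat k * u1), frac (of_nat k * u2))"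
    and "a \<in> N \<Longrightarrow> b \<in> N \<Longrightarrow> a \<otimes> b = b \<otimes> a"
    and "a \<in> N \<Longrightarrow> \<exists>b\<in>N. b [^] p = a"
proof -
  have bij: "bij_betw \<iota> (prufer p \<times> prufer p) N" using \<iota> by (simp add: iso_def M2_def)
  show 1: "\<iota> (u1, u2) \<in> N" if "u1 \<in> prufer p" "u2 \<in> prufer p" for u1 u2
    using bij_betwE[OF bij] that by blast
  show 2: "\<exists>u1 u2. u1 \<in> prufer p \<and> u2 \<in> prufer p \<and> a = \<iota> (u1, u2)" if "a \<in> N" for a
    using bij_betw_imp_surj_on[OF bij] that by auto
  show 3: "u1 = v1 \<and> u2 = v2" if "u1 \<in> prufer p" "u2 \<in> prufer p" "v1 \<in> prufer p" "v2 \<in> prufer p" "\<iota> (u1, u2) = \<iota> (v1, v2)" for u1 u2 v1 v2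
    using inj_onD[OF bij_betw_imp_inj_on[OF bij] that(5)] that by simp
  show 4: "\<iota> (frac (u1 + v1), frac (u2 + v2)) = \<iota> (u1, u2) \<otimes> \<iota> (v1, v2)"
    if "u1 \<in> prufer p" "u2 \<in> prufer p" "v1 \<in> prufer p" "v2 \<in> prufer p" for u1 u2 v1 v2
    using hom_mult[of \<iota> "M2 p" "G\<lparr>carrier := N\<rparr>" "(u1, u2)" "(v1, v2)"] \<iota> that by (simp add: M2_def iso_def)
  have Nc: "a \<in> carrier G" if "a \<in> N" for a using N that by (rule subgroup.mem_carrier)
  have i0: "\<iota> (0, 0) \<in> carrier G" by (intro Nc 1 prufer_0)
  have "\<iota> (0, 0) \<otimes> \<iota> (0, 0) = \<iota> (0, 0)" using 4[OF prufer_0 prufer_0 prufer_0 prufer_0] by simp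
  thus 5: "\<iota> (0, 0) = \<one>" using i0 by simp
  show 6: "\<iota> (u1, u2) [^] (k :: nat) = \<iota> (frac (of_nat k * u1), frac (of_nat k * u2))" if u: "u1 \<in> prufer p" "u2 \<in> prufer p" for u1 u2 k
  proof (induction k)
    case 0
    show ?case by (simp add: 5)
  next
    case (Suc k)
    have m: "frac (of_nat k * u1) \<in> prufer p" "frac (of_nat k * u2) \<in> prufer p"
      using prufer_mult[OF u(1), of "int k"] prufer_mult[OF u(2), of "int k"] by simp_all
    show ?case using 4[OF m u] by (simp add: Suc algebra_simps)
  qed
  show "a \<otimes> b = b \<otimes> a" if ab: "a \<in> N" "b \<in> N" for a b
  proof -
    obtain u1 u2 where u: "u1 \<in> prufer p" "u2 \<in> prufer p" "a = \<iota> (u1, u2)" using 2[OF ab(1)] by blast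
    obtain v1 v2 where v: "v1 \<in> prufer p" "v2 \<in> prufer p" "b = \<iota> (v1, v2)" using 2[OF ab(2)] by blast
    show ?thesis unfolding u(3) v(3) 4[OF u(1,2) v(1,2), symmetric] 4[OF v(1,2) u(1,2), symmetric]
      by (simp only: add.commute)
  qed
  show "\<exists>b\<in>N. b [^] p = a" if a: "a \<in> N" for a
  proof -
    obtain u1 u2 where u: "u1 \<in> prufer p" "u2 \<in> prufer p" "a = \<iota> (u1, u2)" using 2[OF a] by blast
    obtain v1 where v1: "v1 \<in> prufer p" "frac (of_nat p * v1) = u1" using prufer_divisible[OF u(1) p] by blast
    obtain v2 where v2: "v2 \<in> prufer p" "frac (of_nat p * v2) = u2" using prufer_divisible[OF u(2) p] by blast
    show ?thesis using 6[OF v1(1) v2(1), of p] 1[OF v1(1) v2(1)] v1 v2 u by (intro bexI[of _ "\<iota> (v1, v2)"]) simp_all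
  qed
qed

text \<open>The basis itself is the index set, and the commutators of basis elements, read in the
  p-torsion of N, are the matrix entries. The original and the corrected product differ by h, which
  becomes the cocycle of \<open>GA\<close>.\<close>

theorem (in class_two) iso_GA:
  assumes \<iota>: "\<iota> \<in> iso (M2 CARD('p)) (G\<lparr>carrier := N\<rparr>)" and fin: "finite (rcosets N)"
  shows "\<exists>(I :: 'a set) (A :: 'a \<Rightarrow> 'a \<Rightarrow> 'p mod_ring) B. finite I \<and> skew_on I A \<and> skew_on I B \<and> GA I A B \<cong> G"
proof -
  interpret H: comm_group baer by (rule comm_group_baer)
  let ?p = "CARD('p)"
  have p0: "?p > 0" by simp
  note \<iota>_props = M2_iso_props[OF N_subgroup \<iota> p0]
  note \<iota>_in = \<iota>_props(1) and \<iota>_ex = \<iota>_props(2) and \<iota>_inj = \<iota>_props(3) and \<iota>_mult = \<iota>_props(4)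
    and \<iota>_0 = \<iota>_props(5) and \<iota>_pow = \<iota>_props(6)
  obtain I where I: "spanning I" and indep: "\<And>x i. lin I x \<in> N \<Longrightarrow> i \<in> I \<Longrightarrow> x i = 0"
    using ex_basis[OF fin \<iota>_props(8)] by blast
  have finI: "finite I" and IT: "I \<subseteq> torsion" using I by (auto simp: spanning_def)
  define t where "t a b = \<iota> (tau a, tau b)" for a b :: "'p mod_ring"
  have t_in: "t a b \<in> N" for a b unfolding t_def by (intro \<iota>_in tau_prufer)
  have t_add: "t (a + a') (b + b') = t a b \<otimes> t a' b'" for a b a' b'
    unfolding t_def tau_add[symmetric] by (intro \<iota>_mult tau_prufer)
  have t_inj: "a = a' \<and> b = b'" if "t a b = t a' b'" for a b a' b'
    using \<iota>_inj[OF tau_prufer tau_prufer tau_prufer tau_prufer that[unfolded t_def]] tau_inj by blast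
  have t_0: "t 0 0 = \<one>" by (simp add: t_def \<iota>_0)
  have t_pow: "t a b [^] k = t (of_nat k * a) (of_nat k * b)" for a b and k :: nat
  proof (induction k)
    case (Suc k)
    have "t (of_nat (Suc k) * a) (of_nat (Suc k) * b) = t (of_nat k * a + a) (of_nat k * b + b)"
      by (simp only: of_nat_Suc distrib_right mult_1_left add.commute)
    thus ?case by (simp add: Suc t_add)
  qed (simp add: t_0)
  have t_ex: "\<exists>a b. n = t a b" if n: "n \<in> N" "n [^] ?p = \<one>" for n
  proof -
    obtain u1 u2 where u: "u1 \<in> prufer ?p" "u2 \<in> prufer ?p" "n = \<iota> (u1, u2)" using \<iota>_ex[OF n(1)] by blast
    have "\<iota> (frac (of_nat ?p * u1), frac (of_nat ?p * u2)) = \<iota> (0, 0)"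
      using n(2) unfolding u(3) \<iota>_pow[OF u(1,2)] \<iota>_0 .
    moreover have "frac (of_nat ?p * u1) \<in> prufer ?p" "frac (of_nat ?p * u2) \<in> prufer ?p"
      using prufer_mult[OF u(1), of "int ?p"] prufer_mult[OF u(2), of "int ?p"] by simp_all
    ultimately have "frac (of_nat ?p * u1) = 0 \<and> frac (of_nat ?p * u2) = 0"
      by (intro \<iota>_inj prufer_0)
    then obtain a b :: "'p mod_ring" where "u1 = tau a" "u2 = tau b" using prufer_torsion u(1,2) by metis
    thus ?thesis unfolding u(3) t_def by blast
  qed
  define a where "a x y = (SOME a. \<exists>b. c (lin I x) (lin I y) = t a b)" for x y
  define b where "b x y = (SOME b. c (lin I x) (lin I y) = t (a x y) b)" for x y
  note lc = lin_closed[OF IT]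
  have c_eq: "c (lin I x) (lin I y) = t (a x y) (b x y)" for x y
  proof -
    have "\<exists>a b. c (lin I x) (lin I y) = t a b" by (rule t_ex[OF c_in[OF lc lc] c_pow_p[OF lc lc]])
    hence "\<exists>b. c (lin I x) (lin I y) = t (a x y) b" unfolding a_def by (rule someI_ex)
    thus ?thesis unfolding b_def by (rule someI_ex)
  qed
  have c_bop: "c (bop x y) z = c x z \<otimes> c y z" "c z (bop x y) = c z x \<otimes> c z y"
    if "x \<in> carrier G" "y \<in> carrier G" "z \<in> carrier G" for x y z
    using that h_in[of y x] N_carrier[OF c_in[of x z]] N_carrier[OF c_in[of y z]] N_carrier[OF c_in[of z x]] N_carrier[OF c_in[of z y]]
    by (simp_all add: bop_def c_mult_left c_mult_right c_central N_carrier)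
  have ab_left: "a (\<lambda>i. x i + y i) z = a x z + a y z \<and> b (\<lambda>i. x i + y i) z = b x z + b y z" for x y z
  proof (rule t_inj)
    show "t (a (\<lambda>i. x i + y i) z) (b (\<lambda>i. x i + y i) z) = t (a x z + a y z) (b x z + b y z)"
      unfolding t_add c_eq[symmetric] lin_add[OF IT] by (rule c_bop(1)[OF lc lc lc])
  qed
  have ab_right: "a z (\<lambda>i. x i + y i) = a z x + a z y \<and> b z (\<lambda>i. x i + y i) = b z x + b z y" for x y z
  proof (rule t_inj)
    show "t (a z (\<lambda>i. x i + y i)) (b z (\<lambda>i. x i + y i)) = t (a z x + a z y) (b z x + b z y)"
      unfolding t_add c_eq[symmetric] lin_add[OF IT] by (rule c_bop(2)[OF lc lc lc])
  qed
  have ab_skew: "a x y + a y x = 0 \<and> b x y + b y x = 0" for x y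
  proof (rule t_inj)
    show "t (a x y + a y x) (b x y + b y x) = t 0 0"
      unfolding t_add c_eq[symmetric] t_0 by (rule c_swap_mult[OF lc lc])
  qed
  define A where "A i j = a (unit_fun i) (unit_fun j)" for i j
  define B where "B i j = b (unit_fun i) (unit_fun j)" for i j
  have skew: "skew_on I A" "skew_on I B"
    unfolding skew_on_def A_def B_def using ab_skew by (auto simp: eq_neg_iff_add_eq_0)
  have a_bil: "a x y = bil I A x y" and b_bil: "b x y = bil I B x y" if "x \<in> funs_on I" "y \<in> funs_on I" for x y
    unfolding A_def B_def using ab_left ab_right by (intro biadditive_eq_bil[OF finI _ _ that]; simp)+
  \<comment> \<open>The exponent (p+1)/2 in h is the 1/2 in the cocycle.\<close>
  have half: "of_nat (Suc ?p div 2) = (inverse 2 :: 'p mod_ring)"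
  proof -
    have "2 * (Suc ?p div 2) = Suc ?p" using odd_p by presburger
    hence "(of_nat (2 * (Suc ?p div 2)) :: 'p mod_ring) = of_nat (Suc ?p)" by (rule arg_cong)
    hence "2 * of_nat (Suc ?p div 2) = (1 :: 'p mod_ring)" by (simp only: of_nat_mult of_nat_numeral of_nat_Suc of_nat_card_mod_ring add_0_right)
    thus ?thesis by (metis inverse_unique)
  qed
  have h_eq: "h (lin I x) (lin I y) = \<iota> (coc I A x y, coc I B x y)" if "x \<in> funs_on I" "y \<in> funs_on I" for x y
    unfolding h_def c_eq t_pow half coc_eq a_bil[OF that] b_bil[OF that] unfolding t_def ..
  have lin_mult: "lin I x \<otimes> lin I y = \<iota> (coc I A x y, coc I B x y) \<otimes> lin I (\<lambda>i. x i + y i)"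
    if x: "x \<in> funs_on I" and y: "y \<in> funs_on I" for x y
  proof -
    let ?x = "lin I x" and ?y = "lin I y"
    note i = h_in[OF lc lc, of x y] h_in[OF lc lc, of y x]
    note m = lc[of x] lc[of y] i[THEN N_carrier]
    have "h ?x ?y \<otimes> bop ?x ?y = h ?x ?y \<otimes> (h ?y ?x \<otimes> (?x \<otimes> ?y))"
      unfolding bop_def using central[OF i(2), of "?x \<otimes> ?y"] m by simp
    also have "\<dots> = ?x \<otimes> ?y" using m h_swap_mult[OF lc lc, of x y] by (simp add: m_assoc[symmetric])
    finally show ?thesis unfolding lin_add[OF IT] h_eq[OF x y] by simp
  qed
  let ?K = "GA I A B"
  define \<Psi> where "\<Psi> X = \<iota> (fst X) \<otimes> lin I (snd X)" for X
  have "\<Psi> \<in> iso ?K G"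
  proof (rule isoI)
    show "\<Psi> \<in> hom ?K G"
    proof (rule homI)
      fix X assume X: "X \<in> carrier ?K"
      obtain u1 u2 x where Xe: "X = ((u1, u2), x)" by (metis surj_pair)
      show "\<Psi> X \<in> carrier G" using X unfolding Xe by (simp add: GA_carrier \<Psi>_def lc N_carrier \<iota>_in)
    next
      fix X Y assume XY: "X \<in> carrier ?K" "Y \<in> carrier ?K"
      obtain u1 u2 x where Xe: "X = ((u1, u2), x)" by (metis surj_pair)
      obtain v1 v2 y where Ye: "Y = ((v1, v2), y)" by (metis surj_pair)
      have u: "u1 \<in> prufer ?p" "u2 \<in> prufer ?p" and x: "x \<in> funs_on I" using XY(1) by (simp_all add: Xe GA_carrier)
      have v: "v1 \<in> prufer ?p" "v2 \<in> prufer ?p" and y: "y \<in> funs_on I" using XY(2) by (simp_all add: Ye GA_carrier)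
      note uv = prufer_add[OF u(1) v(1)] prufer_add[OF u(2) v(2)]
      let ?k = "\<iota> (coc I A x y, coc I B x y)"
      have k: "?k \<in> N" by (intro \<iota>_in coc_prufer)
      note i = \<iota>_in[OF u] \<iota>_in[OF v] k
      note m = i[THEN N_carrier] lc[of x] lc[of y] lc[of "\<lambda>i. x i + y i"]
      have "\<Psi> X \<otimes> \<Psi> Y = \<iota> (u1, u2) \<otimes> ((lin I x \<otimes> \<iota> (v1, v2)) \<otimes> lin I y)"
        unfolding \<Psi>_def Xe Ye fst_conv snd_conv using m by (simp add: m_assoc)
      also have "lin I x \<otimes> \<iota> (v1, v2) = \<iota> (v1, v2) \<otimes> lin I x" by (rule central[OF i(2) lc])
      also have "\<iota> (u1, u2) \<otimes> (\<iota> (v1, v2) \<otimes> lin I x \<otimes> lin I y) = (\<iota> (u1, u2) \<otimes> \<iota> (v1, v2)) \<otimes> (lin I x \<otimes> lin I y)"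
        using m by (simp add: m_assoc)
      also have "\<dots> = \<iota> (frac (u1 + v1), frac (u2 + v2)) \<otimes> ?k \<otimes> lin I (\<lambda>i. x i + y i)"
        unfolding lin_mult[OF x y] \<iota>_mult[OF u v] using m by (simp add: m_assoc)
      also have "\<iota> (frac (u1 + v1), frac (u2 + v2)) \<otimes> ?k = \<iota> (frac (frac (u1 + v1) + coc I A x y), frac (frac (u2 + v2) + coc I B x y))"
        by (rule \<iota>_mult[OF uv coc_prufer coc_prufer, symmetric])
      finally show "\<Psi> (X \<otimes>\<^bsub>?K\<^esub> Y) = \<Psi> X \<otimes> \<Psi> Y" unfolding Xe Ye by (simp add: GA_mult \<Psi>_def)
    qed
    show "bij_betw \<Psi> (carrier ?K) (carrier G)"
    proof (rule bij_betwI')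
      fix X Y assume XY: "X \<in> carrier ?K" "Y \<in> carrier ?K"
      obtain u1 u2 x where Xe: "X = ((u1, u2), x)" by (metis surj_pair)
      obtain v1 v2 y where Ye: "Y = ((v1, v2), y)" by (metis surj_pair)
      have u: "u1 \<in> prufer ?p" "u2 \<in> prufer ?p" and x: "x \<in> funs_on I" using XY(1) by (simp_all add: Xe GA_carrier)
      have v: "v1 \<in> prufer ?p" "v2 \<in> prufer ?p" and y: "y \<in> funs_on I" using XY(2) by (simp_all add: Ye GA_carrier)
      note i = \<iota>_in[OF u] \<iota>_in[OF v]
      note m = i[THEN N_carrier]
      show "(\<Psi> X = \<Psi> Y) = (X = Y)"
      proof
        assume e: "\<Psi> X = \<Psi> Y"
        \<comment> \<open>Equal images put \<open>lin I d\<close> into N, and independence modulo N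
          makes the difference of coordinates vanish.\<close>
        define d where "d = (\<lambda>i. x i + - y i)"
        have xd: "x = (\<lambda>i. d i + y i)" by (simp add: d_def)
        have ly: "lin I x = bop (lin I d) (lin I y)" by (subst xd) (rule lin_add[OF IT])
        have "bop (\<iota> (u1, u2)) (bop (lin I d) (lin I y)) = bop (\<iota> (v1, v2)) (lin I y)"
          using e unfolding \<Psi>_def Xe Ye fst_conv snd_conv ly[symmetric] bop_central[OF i(1) lc] bop_central[OF i(2) lc] .
        hence "bop (bop (\<iota> (u1, u2)) (lin I d)) (lin I y) = bop (\<iota> (v1, v2)) (lin I y)"
          using bop_assoc[OF m(1) lc lc] by simp
        hence "bop (\<iota> (u1, u2)) (lin I d) = \<iota> (v1, v2)"
          using H.right_cancel[of "lin I y" "bop (\<iota> (u1, u2)) (lin I d)" "\<iota> (v1, v2)"] lc m bop_closed by simp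
        hence "\<iota> (u1, u2) \<otimes> lin I d = \<iota> (v1, v2)" using bop_central[OF i(1) lc] by simp
        hence "lin I d = inv \<iota> (u1, u2) \<otimes> \<iota> (v1, v2)" using m lc inv_solve_left by metis
        hence "lin I d \<in> N" using N_closed(1)[OF N_inv[OF i(1)] i(2)] by simp
        hence d0: "d j = 0" if "j \<in> I" for j using indep that by blast
        have "x j = y j" for j
        proof (cases "j \<in> I")
          case True
          thus ?thesis using d0[OF True] by (simp add: d_def)
        next
          case False
          thus ?thesis using x y by (simp add: funs_on_def)
        qed
        hence xy: "x = y" by (rule ext)
        have "\<iota> (u1, u2) = \<iota> (v1, v2)"
          using e m lc right_cancel unfolding \<Psi>_def Xe Ye fst_conv snd_conv xy by metis
        thus "X = Y" using \<iota>_inj[OF u v] xy by (simp add: Xe Ye)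
      qed simp
    next
      fix X assume X: "X \<in> carrier ?K"
      obtain u1 u2 x where Xe: "X = ((u1, u2), x)" by (metis surj_pair)
      show "\<Psi> X \<in> carrier G" using X unfolding Xe by (simp add: GA_carrier \<Psi>_def lc N_carrier \<iota>_in)
    next
      fix g assume "g \<in> carrier G"
      then obtain n x where n: "n \<in> N" "g = bop n (lin I x)" using I unfolding spanning_def by blast
      obtain u1 u2 where u: "u1 \<in> prufer ?p" "u2 \<in> prufer ?p" "n = \<iota> (u1, u2)" using \<iota>_ex[OF n(1)] by blast
      define y where "y i = (if i \<in> I then x i else 0)" for i
      have "lin I x = lin I y" unfolding lin_def
        by (rule H.finprod_cong') (use IT in \<open>auto simp: y_def intro!: scal_closed\<close>)
      hence "g = \<Psi> ((u1, u2), y)" using n(2) bop_central[OF n(1) lc] by (simp add: \<Psi>_def u(3))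
      moreover have "((u1, u2), y) \<in> carrier ?K" using u by (simp add: GA_carrier y_def funs_on_def)
      ultimately show "\<exists>X\<in>carrier ?K. g = \<Psi> X" by blast
    qed
  qed
  thus ?thesis using finI skew unfolding is_iso_def by blast
qed

text \<open>Nilpotency enters through \<open>divisible_normal_central\<close>, which makes the
  bottom central. The top being elementary abelian supplies commutators and p-th powers in the
  bottom.\<close>

theorem chernikov_iso_GA:
  fixes G :: "('g, 'z) monoid_scheme"
  assumes odd: "odd CARD('p::prime_card)" and nil: "nilpotent_group G" and ch: "chernikov_M2_elem_top G CARD('p)"
  shows "\<exists>(I :: 'g set) (A :: 'g \<Rightarrow> 'g \<Rightarrow> 'p mod_ring) B. finite I \<and> skew_on I A \<and> skew_on I B \<and> GA I A B \<cong> G"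
proof -
  let ?p = "CARD('p)"
  obtain N where N: "N \<lhd> G" and M: "G\<lparr>carrier := N\<rparr> \<cong> M2 ?p" and fin: "finite (carrier (G Mod N))"
    and ab: "comm_group (G Mod N)" and ex: "\<And>X. X \<in> carrier (G Mod N) \<Longrightarrow> X [^]\<^bsub>G Mod N\<^esub> ?p = \<one>\<^bsub>G Mod N\<^esub>"
    using ch unfolding chernikov_M2_elem_top_def by blast
  obtain n where n: "lower_central G n = {\<one>\<^bsub>G\<^esub>}" using nil unfolding nilpotent_group_def by blast
  interpret N: normal N G by (rule N)
  interpret Q: comm_group "G Mod N" by (rule ab)
  have sub: "subgroup N G" by (rule N.subgroup_axioms)
  interpret NG: group "G\<lparr>carrier := N\<rparr>" by (rule subgroup.subgroup_is_group[OF sub N.is_group])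
  obtain \<phi> where "\<phi> \<in> iso (G\<lparr>carrier := N\<rparr>) (M2 ?p)" using M unfolding is_iso_def by blast
  hence \<iota>: "inv_into N \<phi> \<in> iso (M2 ?p) (G\<lparr>carrier := N\<rparr>)" using NG.iso_set_sym by fastforce
  have p0: "?p > 0" by simp
  note props = N.M2_iso_props[OF sub \<iota> p0]
  interpret \<pi>: group_hom G "G Mod N" "\<lambda>a. N #>\<^bsub>G\<^esub> a"
    using N.r_coset_hom_Mod N.is_group Q.is_group by (simp add: group_hom_def group_hom_axioms_def)
  have in_N: "x \<otimes>\<^bsub>G\<^esub> inv\<^bsub>G\<^esub> y \<in> N" if "x \<in> carrier G" "y \<in> carrier G" "N #>\<^bsub>G\<^esub> x = N #>\<^bsub>G\<^esub> y" for x y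
    using N.rcos_module[OF N.is_group that(2,1)] N.rcos_self[OF that(1) sub] that(3) by simp
  have com: "x \<otimes>\<^bsub>G\<^esub> y \<otimes>\<^bsub>G\<^esub> inv\<^bsub>G\<^esub> x \<otimes>\<^bsub>G\<^esub> inv\<^bsub>G\<^esub> y \<in> N" if xy: "x \<in> carrier G" "y \<in> carrier G" for x y
  proof -
    have "N #>\<^bsub>G\<^esub> (x \<otimes>\<^bsub>G\<^esub> y) = N #>\<^bsub>G\<^esub> (y \<otimes>\<^bsub>G\<^esub> x)"
      using \<pi>.hom_mult[OF xy] \<pi>.hom_mult[OF xy(2,1)] Q.m_comm[OF \<pi>.hom_closed[OF xy(1)] \<pi>.hom_closed[OF xy(2)]] by simp
    hence "x \<otimes>\<^bsub>G\<^esub> y \<otimes>\<^bsub>G\<^esub> inv\<^bsub>G\<^esub> (y \<otimes>\<^bsub>G\<^esub> x) \<in> N" using xy by (intro in_N) auto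
    thus ?thesis using xy by (simp add: N.inv_mult_group N.m_assoc)
  qed
  have pow: "x [^]\<^bsub>G\<^esub> ?p \<in> N" if x: "x \<in> carrier G" for x
  proof -
    have "N #>\<^bsub>G\<^esub> (x [^]\<^bsub>G\<^esub> ?p) = N #>\<^bsub>G\<^esub> \<one>\<^bsub>G\<^esub>"
      using \<pi>.hom_nat_pow[OF x, of ?p] ex[OF \<pi>.hom_closed[OF x]] \<pi>.hom_one by simp
    from in_N[OF _ _ this] show ?thesis using x by simp
  qed
  interpret C: class_two G N "TYPE('p)"
  proof unfold_locales
    fix a x assume ax: "a \<in> N" "x \<in> carrier G"
    have "a \<otimes>\<^bsub>G\<^esub> x = x \<otimes>\<^bsub>G\<^esub> a"
      using N.divisible_normal_central[OF N props(7,8) pow n] ax by blast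
    thus "x \<otimes>\<^bsub>G\<^esub> a = a \<otimes>\<^bsub>G\<^esub> x" by (rule sym)
  qed (use sub com pow odd in auto)
  have "finite (rcosets\<^bsub>G\<^esub> N)" using fin by (simp add: FactGroup_def)
  thus ?thesis by (rule C.iso_GA[OF \<iota>])
qed

subsection \<open>Classification\<close>

lemma skew_on_Arho: "skew_on (Arho_index \<rho>) (Arho k \<rho>)"
proof -
  have "plus_mat r B i j = - plus_mat r B j i" for r i j and B :: "nat \<Rightarrow> nat \<Rightarrow> 'k::field"
    by (simp add: plus_mat_def)
  thus ?thesis unfolding skew_on_def Arho_def Rmat_def by (auto split: prod.splits)
qed

lemma skew_on_trans:
  assumes A: "skew_on I A" and B: "skew_on I B"
  shows "skew_on I (trans1 Q A B)" "skew_on I (trans2 Q A B)"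
proof -
  obtain a b c d where Q: "Q = (a, b, c, d)" by (cases Q)
  have "A i j = - A j i" "B i j = - B j i" if "i \<in> I" "j \<in> I" for i j
    using A B that unfolding skew_on_def by blast+
  note e = this
  have "trans1 Q A B i j = - trans1 Q A B j i \<and> trans2 Q A B i j = - trans2 Q A B j i" if ij: "i \<in> I" "j \<in> I" for i j
    using e(1)[OF ij] e(2)[OF ij] by (simp add: Q)
  thus "skew_on I (trans1 Q A B)" "skew_on I (trans2 Q A B)" unfolding skew_on_def by blast+
qed

theorem theorem3p6:
  fixes \<R> :: "('p::prime_card mod_ring bform option \<Rightarrow> nat \<Rightarrow> nat) set"
    and G :: "('g, 'z) monoid_scheme"
  assumes "odd CARD('p)"
    and "\<R> \<subseteq> Ftilde"
    and "\<forall>\<rho> \<in> Ftilde. \<exists>!\<sigma>. \<sigma> \<in> \<R> \<and> same_orbit \<rho> \<sigma>"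
    and "nilpotent_group G"
    and "chernikov_M2_elem_top G CARD('p)"
  shows "\<exists>!\<rho>. \<rho> \<in> \<R> \<and> G \<cong> Grho \<rho>"
proof -
  have two: "(2 :: 'p mod_ring) \<noteq> 0"
  proof
    assume "(2 :: 'p mod_ring) = 0"
    obtain k where k: "CARD('p) = 2 * k + 1" using assms(1) by (rule oddE)
    have "(of_nat CARD('p) :: 'p mod_ring) = 2 * of_nat k + 1" unfolding k by simp
    thus False using \<open>2 = 0\<close> by (simp add: of_nat_card_mod_ring)
  qed
  have G: "group G" using assms(4) by (simp add: nilpotent_group_def)
  have grp: "group (Grho \<rho>)" for \<rho> :: "'p mod_ring bform option \<Rightarrow> nat \<Rightarrow> nat"
    unfolding Grho_def by (rule group_GA)
  obtain I :: "'g set" and A B :: "'g \<Rightarrow> 'g \<Rightarrow> 'p mod_ring"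
    where I: "finite I" "skew_on I A" "skew_on I B" and GA: "GA I A B \<cong> G"
    using chernikov_iso_GA[OF assms(1,4,5)] by blast
  obtain \<rho> :: "'p mod_ring bform option \<Rightarrow> nat \<Rightarrow> nat" where \<rho>: "\<rho> \<in> Ftilde"
    and "congruent_pairs I A B (Arho_index \<rho>) (Arho 1 \<rho>) (Arho 2 \<rho>)"
    using pair_classification[OF I two] by blast
  hence "GA I A B \<cong> Grho \<rho>" unfolding Grho_def by (intro GA_iso_of_congruent I(1) finite_Arho_index)
  hence G\<rho>: "G \<cong> Grho \<rho>" using group.iso_sym[OF group_GA GA] iso_trans by blast
  \<comment> \<open>The pair of \<sigma> transformed by Q has some canonical form \<upsilon>. The
    counts give \<sigma> = act_F \<upsilon> Q, so injectivity of the action identifies \<upsilon>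
    with \<tau>.\<close>
  have orbit_iso: "Grho \<tau> \<cong> Grho \<sigma>" if F: "\<tau> \<in> Ftilde" "\<sigma> \<in> Ftilde" and so: "same_orbit \<tau> \<sigma>"
    for \<tau> \<sigma> :: "'p mod_ring bform option \<Rightarrow> nat \<Rightarrow> nat"
  proof -
    obtain Q where Q: "Q \<in> GL2" "\<sigma> = act_F \<tau> Q" using so unfolding same_orbit_def by blast
    let ?A = "trans1 Q (Arho 1 \<sigma>) (Arho 2 \<sigma>)" and ?B = "trans2 Q (Arho 1 \<sigma>) (Arho 2 \<sigma>)"
    note fin = finite_Arho_index[OF F(2)]
    obtain \<upsilon> where \<upsilon>: "\<upsilon> \<in> Ftilde"
      and congr: "congruent_pairs (Arho_index \<sigma>) ?A ?B (Arho_index \<upsilon>) (Arho 1 \<upsilon>) (Arho 2 \<upsilon>)"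
      using pair_classification[OF fin skew_on_trans[OF skew_on_Arho skew_on_Arho] two, of Q 1 2] by blast
    have s: "\<sigma> = act_F \<upsilon> Q" by (rule congruent_Arho_imp_act_F[OF F(2) \<upsilon> Q(1) congr])
    have e: "\<upsilon> = \<tau>" by (rule act_F_inj[OF Q(1) \<upsilon> F(1) trans[OF s[symmetric] Q(2)]])
    have "Grho \<sigma> \<cong> GA (Arho_index \<sigma>) ?A ?B" unfolding Grho_def by (rule GA_iso_of_trans[OF Q(1)])
    also have "\<dots> \<cong> Grho \<upsilon>" unfolding Grho_def by (rule GA_iso_of_congruent[OF congr fin finite_Arho_index[OF \<upsilon>]])
    finally show ?thesis unfolding e by (rule group.iso_sym[OF grp])
  qed
  have iso_orbit: "same_orbit \<tau> \<sigma>" if F: "\<sigma> \<in> Ftilde" "\<tau> \<in> Ftilde" and iso: "Grho \<sigma> \<cong> Grho \<tau>"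
    for \<tau> \<sigma> :: "'p mod_ring bform option \<Rightarrow> nat \<Rightarrow> nat"
  proof -
    obtain Q where Q: "Q \<in> GL2" and congr: "congruent_pairs (Arho_index \<sigma>) (trans1 Q (Arho 1 \<sigma>) (Arho 2 \<sigma>))
        (trans2 Q (Arho 1 \<sigma>) (Arho 2 \<sigma>)) (Arho_index \<tau>) (Arho 1 \<tau>) (Arho 2 \<tau>)"
      using GA_iso_imp_congruent[OF skew_on_Arho skew_on_Arho skew_on_Arho skew_on_Arho two
          finite_Arho_index[OF F(1)] finite_Arho_index[OF F(2)] iso[unfolded Grho_def]] by blast
    have "\<sigma> = act_F \<tau> Q" by (rule congruent_Arho_imp_act_F[OF F Q congr])
    thus ?thesis using Q unfolding same_orbit_def by blast
  qed
  have orbit_refl: "same_orbit \<sigma> \<sigma>" if "\<sigma> \<in> Ftilde" for \<sigma> :: "'p mod_ring bform option \<Rightarrow> nat \<Rightarrow> nat"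
    unfolding same_orbit_def using act_F_id[OF that] by (intro bexI[of _ "(1, 0, 0, 1)"]) (auto simp: GL2_def)
  obtain \<sigma> where \<sigma>: "\<sigma> \<in> \<R>" "same_orbit \<rho> \<sigma>" using assms(3) \<rho> by blast
  show ?thesis
  proof (rule ex1I[of _ \<sigma>])
    have "Grho \<rho> \<cong> Grho \<sigma>" using orbit_iso[OF \<rho> _ \<sigma>(2)] \<sigma>(1) assms(2) by blast
    thus G\<sigma>: "\<sigma> \<in> \<R> \<and> G \<cong> Grho \<sigma>" using \<sigma>(1) iso_trans[OF G\<rho>] by blast
    fix \<tau> assume \<tau>: "\<tau> \<in> \<R> \<and> G \<cong> Grho \<tau>"
    have F: "\<sigma> \<in> Ftilde" "\<tau> \<in> Ftilde" using \<sigma>(1) \<tau> assms(2) by blast+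
    have "Grho \<sigma> \<cong> G" using G\<sigma> group.iso_sym[OF G] by blast
    hence "Grho \<sigma> \<cong> Grho \<tau>" using \<tau> iso_trans by blast
    hence "same_orbit \<tau> \<sigma>" by (rule iso_orbit[OF F])
    moreover have "same_orbit \<tau> \<tau>" by (rule orbit_refl[OF F(2)])
    \<comment> \<open>The orbit of \<tau> contains both \<tau> and \<sigma>, and it meets \<R> only
      once.\<close>
    ultimately show "\<tau> = \<sigma>" using assms(3) F(2) \<sigma>(1) \<tau> by blast
  qed
qed

end
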